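(* Let $1<p\le 2\le q<\infty$, and let $m:\Omega\to\mathbb{C}$ be a bounded measurable function satisfying $$\sup_{\alpha>0}\ \alpha\left(\int_{\{a\in\Omega:\,|m(a)|>\alpha\}}d\mu(a)\right)^{\frac1p-\frac1q}<\infty.$$ Then the Fourier multiplier operator $T_m$, defined on $\mathcal{S}(\mathbb{H}^n)$ by $\mathcal{F}(T_mf)(a,w)=m(a)\,\mathcal{F}(f)(a,w)$, extends to a bounded operator from $L^p(\mathbb{H}^n)$ to $L^q(\mathbb{H}^n)$.
   Context: Let $n\ge 1$. The Heisenberg group $\mathbb{H}^n=\mathbb{C}^n\times\mathbb{R}$ has group law $(z,t)(w,s)=(z+w,\,t+s+\tfrac12\operatorname{Im}(z\cdot\overline{w}))$ (so $(z,t)^{-1}=(-z,-t)$) and Haar measure $dz\,dt$ (Lebesgue measure); $L^p(\mathbb{H}^n)$ is taken with respect to it, and $\mathcal{S}(\mathbb{H}^n)$ is the Schwartz space of $\mathbb{C}^n\times\mathbb{R}\cong\mathbb{R}^{2n+1}$. Write $\mathbb{R}^*=\mathbb{R}\setminus\{0\}$. Laguerre functions: for $\lambda\in\mathbb{R}^*$ and $k\in\{0,1,2,\dots\}$, $\varphi^{n-1}_{k,\lambda}(z)=L^{n-1}_k\big(\tfrac12|\lambda||z|^2\big)e^{-\frac14|\lambda||z|^2}$, where $L_k^{\delta}(t)=\frac{t^{-\delta}e^t}{k!}\big(\frac{d}{dt}\big)^k(e^{-t}t^{k+\delta})$ is the Laguerre polynomial of type $\delta$ and degree $k$. Heisenberg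 fan: $\Omega=\bigcup_{k\ge 0}R_k\cup R_\infty\subset\mathbb{R}^2$, where $R_k=\{(\lambda,(2k+n)|\lambda|):\lambda\in\mathbb{R}^*\}$ and $R_\infty=\{(0,\tau):\tau\ge 0\}$. For $a=(\lambda,(2k+n)|\lambda|)\in R_k$ put $e_a(z,t)=e^{i\lambda t}\varphi^{n-1}_{k,\lambda}(z)$ and $c_{n,k}=\frac{k!\,(n-1)!}{(k+n-1)!}$. Normalized Strichartz Fourier transform: for $f\in L^1\cap L^2(\mathbb{H}^n)$, $a\in R_k$, $w\in\mathbb{C}^n$, $$\mathcal{F}(f)(a,w)=c_{n,k}\int_{\mathbb{H}^n}f(z,t)\,e_a\big((z,t)^{-1}(w,0)\big)\,dz\,dt.$$ (Values on $R_\infty$ are irrelevant here, since $R_\infty$ is a null set for the measures below.) The measures $\nu_2$ and $\mu$ on $\Omega$ are $$\int_\Omega\phi\,d\nu_2=(2\pi)^{-2n-1}\int_{-\infty}^\infty\Big(\sum_{k=0}^\infty c_{n,k}^{-2}\,\phi(\lambda,(2k+n)|\lambda|)\Big)|\lambda|^{2n}\,d\lambda,\qquad d\mu(a)=|\lambda|^{-n}\,d\nu_2(a).$$ The Plancherel identity $\|f\|_{L^2(\mathbb{H}^n)}^2=\int_\Omega\int_{\mathbb{C}^n}|\mathcal{F}(f)(a,w)|^2\,dw\,d\nu_2(a)$ holds, and $\mathcal{F}$ extends to an isometry from $L^2(\mathbb{H}^n)$ into $L^2(\Omega\times\mathbb{C}^n,d\nu_2\,dw)$ whose range is stable under multiplication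 by bounded measurable functions of $a$ alone; so $T_mf$ is the unique element of $L^2(\mathbb{H}^n)$ with $\mathcal{F}(T_mf)=m\,\mathcal{F}(f)$ (almost everywhere). *)

theory Defs
  imports "HOL-Analysis.Analysis" "HOL-Computational_Algebra.Polynomial"
begin

section \<open>Lebesgue spaces and Schwartz functions\<close>

text \<open>
  Powers of extended nonnegative reals with exponent \<open>s \<ge> 0\<close>. At \<open>s = 0\<close> the conventions are
  \<open>\<infinity>^0 = 1\<close> and, as for real \<open>powr\<close>, \<open>0^0 = 0\<close>.
\<close>

definition enn_powr :: "ennreal \<Rightarrow> real \<Rightarrow> ennreal" where
  "enn_powr x s =
     (if x = \<infinity> then (if s = 0 then 1 else \<infinity>) else ennreal (enn2real x powr s))"

text \<open>The norm takes the value \<open>\<infinity>\<close> on functions that are not \<open>p\<close>-integrable.\<close>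

definition Lp_norm :: "real \<Rightarrow> 'a measure \<Rightarrow> ('a \<Rightarrow> complex) \<Rightarrow> ennreal" where
  "Lp_norm p M f = enn_powr (\<integral>\<^sup>+x. ennreal (norm (f x) powr p) \<partial>M) (1 / p)"

definition Lp :: "real \<Rightarrow> 'a measure \<Rightarrow> ('a \<Rightarrow> complex) set" where
  "Lp p M = {f \<in> borel_measurable M. Lp_norm p M f < \<infinity>}"

text \<open>
  Elements of \<open>Lp\<close> are functions rather than classes, so linearity is required almost everywhere.
  Together with the norm bound it implies that \<open>T\<close> respects almost everywhere equality.
\<close>

definition bounded_Lp_operator ::
  "real \<Rightarrow> 'a measure \<Rightarrow> real \<Rightarrow> 'b measure \<Rightarrow> (('a \<Rightarrow> complex) \<Rightarrow> ('b \<Rightarrow> complex)) \<Rightarrow> bool" where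
  "bounded_Lp_operator p M q N T \<longleftrightarrow>
     (\<forall>f\<in>Lp p M. T f \<in> Lp q N) \<and>
     (\<forall>f\<in>Lp p M. \<forall>g\<in>Lp p M. AE x in N. T (\<lambda>y. f y + g y) x = T f x + T g x) \<and>
     (\<forall>c. \<forall>f\<in>Lp p M. AE x in N. T (\<lambda>y. c * f y) x = c * T f x) \<and>
     (\<exists>C::real. \<forall>f\<in>Lp p M. Lp_norm q N (T f) \<le> ennreal C * Lp_norm p M f)"

primrec iter_partial ::
  "'a::euclidean_space list \<Rightarrow> ('a \<Rightarrow> 'b::real_normed_vector) \<Rightarrow> 'a \<Rightarrow> 'b" where
  "iter_partial [] f = f"
| "iter_partial (b # bs) f = (\<lambda>x. frechet_derivative (iter_partial bs f) (at x) b)"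

definition schwartz :: "('a::euclidean_space \<Rightarrow> complex) set" where
  "schwartz = {f. \<forall>bs. set bs \<subseteq> Basis \<longrightarrow>
     (\<forall>x. iter_partial bs f differentiable (at x)) \<and>
     (\<forall>N::nat. bounded (range (\<lambda>x. norm x ^ N *\<^sub>R iter_partial bs f x)))}"

section \<open>Heisenberg group and Laguerre functions\<close>

type_synonym 'n heis = "(complex ^ 'n) \<times> real"

definition heis_mult :: "'n::finite heis \<Rightarrow> 'n heis \<Rightarrow> 'n heis" where
  "heis_mult = (\<lambda>(z, t) (w, s). (z + w, t + s + 1/2 * Im (\<Sum>i\<in>UNIV. z $ i * cnj (w $ i))))"

definition heis_inv :: "'n::finite heis \<Rightarrow> 'n heis" where
  "heis_inv = (\<lambda>(z, t). (- z, - t))"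

lemma heis_mult_inv: "heis_mult x (heis_inv x) = (0, 0)"
proof -
  have "Im (\<Sum>i\<in>UNIV. z $ i * cnj (- z $ i)) = 0" for z :: "complex ^ 'a"
    by (simp add: mult.commute)
  then show ?thesis
    by (cases x) (simp add: heis_mult_def heis_inv_def)
qed

text \<open>
  The Rodrigues formula has a removable singularity at \<open>t = 0\<close>, so it is imposed for \<open>t > 0\<close>, which
  determines the polynomial; \<open>laguerre_rodrigues\<close> below shows that it exists.
\<close>

definition laguerre :: "nat \<Rightarrow> nat \<Rightarrow> real poly" where
  "laguerre k d = (THE P. \<forall>t>0. poly P t =
     exp t / (fact k * t ^ d) * (deriv ^^ k) (\<lambda>s. exp (- s) * s ^ (k + d)) t)"

lemma funpow_deriv_exp_poly:
  fixes Q :: "real poly"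
  shows "(deriv ^^ k) (\<lambda>s. exp (- s) * poly Q s) =
    (\<lambda>s. exp (- s) * poly (((\<lambda>P. pderiv P - P) ^^ k) Q) s)"
proof (induction k)
  case (Suc k)
  have "deriv (\<lambda>s. exp (- s) * poly P s) = (\<lambda>s. exp (- s) * poly (pderiv P - P) s)"
    for P :: "real poly"
    by (rule ext, rule DERIV_imp_deriv) (auto intro!: derivative_eq_intros simp: algebra_simps)
  then show ?case
    by (simp add: Suc)
qed simp

lemma monom_dvd_pderiv_diff:
  fixes Q :: "real poly"
  shows "monom 1 (k + d) dvd Q \<Longrightarrow> monom 1 d dvd ((\<lambda>P. pderiv P - P) ^^ k) Q"
proof (induction k arbitrary: Q)
  case (Suc k)
  then obtain R where R: "Q = monom 1 (Suc (k + d)) * R"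
    by (auto elim: dvdE)
  have "monom 1 (Suc (k + d)) = monom 1 (k + d) * monom (1::real) 1"
    by (simp add: mult_monom)
  moreover have "pderiv (monom (1::real) (Suc (k + d))) = monom 1 (k + d) * monom (of_nat (Suc (k + d))) 0"
    by (simp add: pderiv_monom mult_monom)
  ultimately have "monom 1 (k + d) dvd pderiv Q - Q"
    unfolding R pderiv_mult
    by (metis dvd_add dvd_diff dvd_mult dvd_mult2 dvd_triv_left)
  from Suc.IH[OF this] show ?case
    by (simp only: funpow_Suc_right o_apply)
qed simp

lemma laguerre_rodrigues:
  assumes "t > 0"
  shows "poly (laguerre k d) t =
    exp t / (fact k * t ^ d) * (deriv ^^ k) (\<lambda>s. exp (- s) * s ^ (k + d)) t"
proof -
  let ?R = "\<lambda>t::real. exp t / (fact k * t ^ d) * (deriv ^^ k) (\<lambda>s. exp (- s) * s ^ (k + d)) t"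
  have "monom 1 d dvd ((\<lambda>P. pderiv P - P) ^^ k) (monom (1::real) (k + d))"
    by (rule monom_dvd_pderiv_diff) simp
  then obtain S where S: "((\<lambda>P. pderiv P - P) ^^ k) (monom (1::real) (k + d)) = monom 1 d * S"
    by (auto elim: dvdE)
  have "poly (smult (1 / fact k) S) t = ?R t" if "t > 0" for t
    using that funpow_deriv_exp_poly[of k "monom 1 (k + d)"] S
    by (simp add: poly_monom exp_minus field_simps)
  moreover have "P = P'" if "\<forall>t>0. poly P t = ?R t" "\<forall>t>0. poly P' t = ?R t" for P P'
  proof (rule ccontr)
    assume "P \<noteq> P'"
    then have "finite {t. poly (P - P') t = 0}"
      by (intro poly_roots_finite) simp
    moreover have "{0<..} \<subseteq> {t. poly (P - P') t = 0}"
      using that by auto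
    ultimately show False
      using infinite_Ioi finite_subset by blast
  qed
  ultimately have "\<exists>!P. \<forall>t>0. poly P t = ?R t"
    by blast
  from theI'[OF this] assms show ?thesis
    unfolding laguerre_def by blast
qed

definition laguerre_fun :: "nat \<Rightarrow> real \<Rightarrow> complex ^ 'n::finite \<Rightarrow> real" where
  "laguerre_fun k l z =
     poly (laguerre k (CARD('n) - 1)) (1/2 * \<bar>l\<bar> * (norm z)\<^sup>2) * exp (- 1/4 * \<bar>l\<bar> * (norm z)\<^sup>2)"

section \<open>The Heisenberg fan and its measures\<close>

definition fan_ray :: "nat \<Rightarrow> nat \<Rightarrow> (real \<times> real) set" where
  "fan_ray n k = {(l, (2 * real k + real n) * \<bar>l\<bar>) |l. l \<noteq> 0}"

definition fan :: "nat \<Rightarrow> (real \<times> real) set" where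
  "fan n = (\<Union>k. fan_ray n k) \<union> {(0, t) |t. t \<ge> 0}"

definition fan_const :: "nat \<Rightarrow> nat \<Rightarrow> real" where
  "fan_const n k = fact k * fact (n - 1) / fact (k + n - 1)"

definition fan_index :: "nat \<Rightarrow> real \<times> real \<Rightarrow> nat" where
  "fan_index n a = (THE k. a \<in> fan_ray n k)"

lemma fan_index_eq: "a \<in> fan_ray n k \<Longrightarrow> fan_index n a = k"
  unfolding fan_index_def by (rule the_equality) (auto simp: fan_ray_def)

text \<open>
  As an image measure under \<open>(l, k) \<mapsto> (l, (2k + n)\<bar>l\<bar>)\<close>; \<open>nn_integral_nu2\<close> is the integral formula.
  The points with \<open>l = 0\<close> are null.
\<close>

definition nu2 :: "nat \<Rightarrow> (real \<times> real) measure" where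
  "nu2 n = distr
     (density (lborel \<Otimes>\<^sub>M count_space UNIV)
        (\<lambda>(l, k). ennreal (1 / (2 * pi) ^ (2 * n + 1) * (1 / (fan_const n k)\<^sup>2) * \<bar>l\<bar> ^ (2 * n))))
     (restrict_space borel (fan n))
     (\<lambda>(l, k). (l, (2 * real k + real n) * \<bar>l\<bar>))"

definition mu :: "nat \<Rightarrow> (real \<times> real) measure" where
  "mu n = density (nu2 n) (\<lambda>(l, \<tau>). ennreal (1 / \<bar>l\<bar> ^ n))"

lemma space_nu2 [simp]: "space (nu2 n) = fan n"
  by (simp add: nu2_def space_restrict_space)

lemma sets_nu2 [simp, measurable_cong]: "sets (nu2 n) = sets (restrict_space borel (fan n))"
  by (simp add: nu2_def)

lemma space_mu [simp]: "space (mu n) = fan n"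
  by (simp add: mu_def)

lemma nn_integral_nu2:
  assumes \<phi>: "\<phi> \<in> borel_measurable (nu2 n)"
  shows "(\<integral>\<^sup>+a. \<phi> a \<partial>nu2 n) = ennreal (1 / (2 * pi) ^ (2 * n + 1)) *
    (\<integral>\<^sup>+l. (\<Sum>k. ennreal (1 / (fan_const n k)\<^sup>2) * \<phi> (l, (2 * real k + real n) * \<bar>l\<bar>))
       * ennreal (\<bar>l\<bar> ^ (2 * n)) \<partial>lborel)"
proof -
  let ?M = "lborel \<Otimes>\<^sub>M (count_space UNIV :: nat measure)"
  let ?h = "\<lambda>(l::real, k::nat). (l, (2 * real k + real n) * \<bar>l\<bar>)"
  let ?c = "1 / (2 * pi) ^ (2 * n + 1)"
  let ?w = "\<lambda>(l, k). ennreal (?c * (1 / (fan_const n k)\<^sup>2) * \<bar>l\<bar> ^ (2 * n))"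
  interpret C: sigma_finite_measure "count_space (UNIV :: nat set)"
    by (rule sigma_finite_measure_count_space)
  have [measurable]: "(\<lambda>x. real (snd x)) \<in> borel_measurable ?M"
       "(\<lambda>x. fan_const n (snd x)) \<in> borel_measurable ?M"
    by measurable
  have "?h \<in> ?M \<rightarrow>\<^sub>M borel \<Otimes>\<^sub>M borel"
    unfolding split_beta' by measurable
  then have "?h \<in> ?M \<rightarrow>\<^sub>M borel"
    by (simp only: borel_prod)
  moreover have "?h x \<in> fan n" for x
    by (cases x; cases "fst x = 0") (auto simp: fan_def fan_ray_def)
  ultimately have h [measurable]: "?h \<in> ?M \<rightarrow>\<^sub>M restrict_space borel (fan n)"
    by (intro measurable_restrict_space2) auto
  have w [measurable]: "?w \<in> borel_measurable ?M"
    unfolding split_beta' by measurable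
  have \<phi>' [measurable]: "\<phi> \<in> borel_measurable (restrict_space borel (fan n))"
    using \<phi> by simp
  have \<phi>h [measurable]: "(\<lambda>x. \<phi> (?h x)) \<in> borel_measurable ?M"
    by (rule measurable_compose[OF h \<phi>'])
  have \<phi>l [measurable]: "(\<lambda>l. \<phi> (l, (2 * real k + real n) * \<bar>l\<bar>)) \<in> borel_measurable lborel" for k
    using measurable_compose[OF measurable_Pair2'[of k "count_space UNIV" lborel] \<phi>h]
    by simp
  have "(\<integral>\<^sup>+a. \<phi> a \<partial>nu2 n) = (\<integral>\<^sup>+x. ?w x * \<phi> (?h x) \<partial>?M)"
    unfolding nu2_def by (simp add: nn_integral_distr nn_integral_density)
  also have "\<dots> = (\<integral>\<^sup>+l. \<integral>\<^sup>+k. ?w (l, k) * \<phi> (?h (l, k)) \<partial>count_space UNIV \<partial>lborel)"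
    by (rule C.nn_integral_fst[symmetric]) measurable
  also have "\<dots> = (\<integral>\<^sup>+l. ennreal ?c * ((\<Sum>k. ennreal (1 / (fan_const n k)\<^sup>2) *
      \<phi> (l, (2 * real k + real n) * \<bar>l\<bar>)) * ennreal (\<bar>l\<bar> ^ (2 * n))) \<partial>lborel)"
  proof (rule nn_integral_cong)
    fix l :: real
    define A B where "A = ennreal ?c" and "B = ennreal (\<bar>l\<bar> ^ (2 * n))"
    define D \<Phi> where "D = (\<lambda>k. ennreal (1 / (fan_const n k)\<^sup>2))"
      and "\<Phi> = (\<lambda>k. \<phi> (l, (2 * real k + real n) * \<bar>l\<bar>))"
    have w_eq: "?w (l, k) * \<phi> (?h (l, k)) = A * B * (D k * \<Phi> k)" for k
    proof -
      have "?w (l, k) = A * D k * B"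
        unfolding A_def B_def D_def prod.case
        by (subst ennreal_mult', simp)+ (rule refl)
      then show ?thesis
        by (simp only: prod.case \<Phi>_def mult_ac)
    qed
    have "(\<integral>\<^sup>+k. ?w (l, k) * \<phi> (?h (l, k)) \<partial>count_space UNIV) = (\<Sum>k. A * B * (D k * \<Phi> k))"
      unfolding w_eq by (rule nn_integral_count_space_nat)
    also have "\<dots> = A * B * (\<Sum>k. D k * \<Phi> k)"
      by (rule ennreal_suminf_cmult)
    also have "\<dots> = A * ((\<Sum>k. D k * \<Phi> k) * B)"
      by (simp only: mult_ac)
    finally show "(\<integral>\<^sup>+k. ?w (l, k) * \<phi> (?h (l, k)) \<partial>count_space UNIV) =
        ennreal ?c * ((\<Sum>k. ennreal (1 / (fan_const n k)\<^sup>2) *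
          \<phi> (l, (2 * real k + real n) * \<bar>l\<bar>)) * ennreal (\<bar>l\<bar> ^ (2 * n)))"
      unfolding A_def B_def D_def \<Phi>_def .
  qed
  also have "\<dots> = ennreal ?c * (\<integral>\<^sup>+l. (\<Sum>k. ennreal (1 / (fan_const n k)\<^sup>2) *
      \<phi> (l, (2 * real k + real n) * \<bar>l\<bar>)) * ennreal (\<bar>l\<bar> ^ (2 * n)) \<partial>lborel)"
    by (rule nn_integral_cmult) measurable
  finally show ?thesis .
qed

section \<open>Strichartz Fourier transform and multipliers\<close>

definition fan_fun :: "real \<times> real \<Rightarrow> 'n::finite heis \<Rightarrow> complex" where
  "fan_fun a = (\<lambda>(z, t).
     exp (\<i> * of_real (fst a * t)) * of_real (laguerre_fun (fan_index CARD('n) a) (fst a) z))"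

text \<open>The value \<open>0\<close> at \<open>fst a = 0\<close> is a dummy on a null set.\<close>

definition strichartz ::
  "('n::finite heis \<Rightarrow> complex) \<Rightarrow> (real \<times> real) \<times> (complex ^ 'n) \<Rightarrow> complex" where
  "strichartz f = (\<lambda>(a, w). if fst a = 0 then 0 else
     of_real (fan_const CARD('n) (fan_index CARD('n) a)) *
     (LINT x|lborel. f x * fan_fun a (heis_mult (heis_inv x) (w, 0))))"

text \<open>
  The extension of \<open>strichartz\<close> to \<open>L\<^sup>2\<close> by continuity, as a relation: \<open>G\<close> is a representative of the
  transform of \<open>f\<close>.
\<close>

definition strichartz_L2 ::
  "('n::finite heis \<Rightarrow> complex) \<Rightarrow> ((real \<times> real) \<times> (complex ^ 'n) \<Rightarrow> complex) \<Rightarrow> bool" where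
  "strichartz_L2 f G \<longleftrightarrow>
     f \<in> Lp 2 lborel \<and> G \<in> Lp 2 (nu2 CARD('n) \<Otimes>\<^sub>M lborel) \<and>
     (\<exists>F. (\<forall>j::nat. F j \<in> Lp 1 lborel \<inter> Lp 2 lborel) \<and>
        (\<lambda>j. Lp_norm 2 lborel (\<lambda>x. F j x - f x)) \<longlonglongrightarrow> 0 \<and>
        (\<lambda>j. Lp_norm 2 (nu2 CARD('n) \<Otimes>\<^sub>M lborel) (\<lambda>y. strichartz (F j) y - G y)) \<longlonglongrightarrow> 0)"

text \<open>\<open>g\<close> is a representative of \<open>T\<^sub>m f\<close>, for \<open>f\<close> in \<open>L\<^sup>1 \<inter> L\<^sup>2\<close>.\<close>

definition is_multiplier_image ::
  "(real \<times> real \<Rightarrow> complex) \<Rightarrow> ('n::finite heis \<Rightarrow> complex) \<Rightarrow> ('n heis \<Rightarrow> complex) \<Rightarrow> bool" where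
  "is_multiplier_image m f g \<longleftrightarrow>
     (\<exists>G. strichartz_L2 g G \<and>
        (AE (a, w) in nu2 CARD('n) \<Otimes>\<^sub>M lborel. G (a, w) = m a * strichartz f (a, w)))"

end

theory Submission
  imports Defs "HOL-Probability.Probability"
begin

text \<open>
  On \<open>L\<^sup>1 \<inter> L\<^sup>2\<close> the transform satisfies the Plancherel identity: in \<open>t\<close> this is the Plancherel
  identity on the line, and for fixed \<open>\<lambda>\<close> it says that the \<open>\<lambda>\<close>-twisted convolutions with
  the Laguerre functions are orthogonal projections (up to a factor) which sum to the identity; both
  facts are read off the generating function, a Gaussian that turns into an approximate identity.

  Multiplication by a bounded measurable symbol preserves the closure of the range. The symbols
  with this property form an algebra closed under bounded limits, so by a \<open>\<sigma>\<close>-algebra argument it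
  suffices to produce enough of them. Translation in \<open>t\<close> gives \<open>e\<^bsup>i\<lambda>u\<^esup>\<close>, and convolution with a
  Gaussian in \<open>z\<close> gives functions from which the second coordinate of the fan is recovered in the
  limit.

  Paley's inequality bounds the \<open>L\<^sup>2\<close> norm of \<open>m \<F>(f)\<close> by the \<open>L\<^sup>p\<close> norm of \<open>f\<close> when \<open>m\<close> is in weak
  \<open>L\<^bsup>2p/(2-p)\<^esup>(\<mu>)\<close>: at each height of \<open>m\<close> split \<open>f\<close> by size and use Plancherel on the small part and
  an \<open>L\<^sup>1\<close> bound on the large part. For the theorem write \<open>\<bar>m\<bar> = \<bar>m\<bar>\<^bsup>\<theta>\<^esup> \<bar>m\<bar>\<^bsup>1-\<theta>\<^esup>\<close> and pair \<open>T\<^sub>m f\<close> with \<open>h\<close>.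
  By Cauchy-Schwarz the pairing is at most the product of the \<open>L\<^sup>2\<close> norms of \<open>\<bar>m\<bar>\<^bsup>\<theta>\<^esup> \<F>(f)\<close> and
  \<open>\<bar>m\<bar>\<^bsup>1-\<theta>\<^esup> \<F>(h)\<close>, to which Paley's inequality applies with exponents \<open>p\<close> and \<open>q' = q/(q-1)\<close>.
\<close>

definition L2sq :: "'a measure \<Rightarrow> ('a \<Rightarrow> complex) \<Rightarrow> ennreal" where
  "L2sq M f = (\<integral>\<^sup>+x. ennreal ((norm (f x))\<^sup>2) \<partial>M)"

subsection \<open>Gaussian integrals\<close>

lemma measurable_cis [measurable]: "cis \<in> borel_measurable borel"
  by (intro borel_measurable_continuous_onI continuous_intros)

lemma measurable_cnj [measurable]: "cnj \<in> borel_measurable borel"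
  by (intro borel_measurable_continuous_onI continuous_intros)

lemma integrable_prod_mult:
  fixes f :: "'a::euclidean_space \<Rightarrow> 'b::{real_normed_field, banach, second_countable_topology}"
    and g :: "'c::euclidean_space \<Rightarrow> 'b"
  assumes f: "integrable lborel f" and g: "integrable lborel g"
  shows "integrable (lborel \<Otimes>\<^sub>M lborel) (\<lambda>(x, y). f x * g y)"
  using f g by (intro lborel_pair.Fubini_integrable) (auto simp: norm_mult intro!: integrable_mult_left)

lemma integral_prod_mult:
  fixes f :: "'a::euclidean_space \<Rightarrow> 'b::{real_normed_field, banach, second_countable_topology}"
    and g :: "'c::euclidean_space \<Rightarrow> 'b"
  assumes f: "integrable lborel f" and g: "integrable lborel g"
  shows "(LINT p|(lborel \<Otimes>\<^sub>M lborel). f (fst p) * g (snd p)) = (LINT x|lborel. f x) * (LINT y|lborel. g y)"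
  using lborel_pair.integral_fst'[OF integrable_prod_mult[OF f g]] by (simp add: split_beta')

lemma measurable_fst_borel [measurable]:
    "fst \<in> borel_measurable (borel :: ('a::euclidean_space \<times> 'b::euclidean_space) measure)"
  and measurable_snd_borel [measurable]:
    "snd \<in> borel_measurable (borel :: ('a \<times> 'b) measure)"
  by (intro borel_measurable_continuous_onI continuous_intros)+

lemma integrable_continuous_bounded_support:
  fixes f :: "'a::euclidean_space \<Rightarrow> 'b::{banach, second_countable_topology}"
  assumes "continuous_on UNIV f" "\<And>x. norm x > R \<Longrightarrow> f x = 0"
  shows "integrable lborel f"
proof -
  have "integrable lborel (\<lambda>x. indicator (cball 0 R) x *\<^sub>R f x)"
    by (intro borel_integrable_compact continuous_on_subset[OF assms(1)]) auto
  moreover have "(\<lambda>x. indicator (cball 0 R) x *\<^sub>R f x) = f"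
    using assms(2) by (auto simp: fun_eq_iff indicator_def)
  ultimately show ?thesis by simp
qed

lemma lborel_integral_affine_euclidean:
  fixes f :: "'a::euclidean_space \<Rightarrow> 'b::{banach, second_countable_topology}"
  assumes [measurable]: "f \<in> borel_measurable borel" and c: "c \<noteq> 0"
  shows "(LINT x|lborel. f x) = \<bar>c\<bar> ^ DIM('a) *\<^sub>R (LINT x|lborel. f (t + c *\<^sub>R x))"
proof -
  have "(LINT x|lborel. f x) =
      (LINT x|density (distr lborel borel (\<lambda>x. t + c *\<^sub>R x)) (\<lambda>_. ennreal (\<bar>c\<bar> ^ DIM('a))). f x)"
    using lborel_affine[OF c, of t] c by (simp add: ennreal_power)
  also have "\<dots> = \<bar>c\<bar> ^ DIM('a) *\<^sub>R (LINT x|lborel. f (t + c *\<^sub>R x))"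
    by (subst integral_density) (auto simp: integral_distr)
  finally show ?thesis .
qed

lemma lborel_nn_integral_affine_euclidean:
  fixes f :: "'a::euclidean_space \<Rightarrow> ennreal"
  assumes [measurable]: "f \<in> borel_measurable borel" and c: "c \<noteq> 0"
  shows "(\<integral>\<^sup>+x. f x \<partial>lborel) = ennreal (\<bar>c\<bar> ^ DIM('a)) * (\<integral>\<^sup>+x. f (t + c *\<^sub>R x) \<partial>lborel)"
proof -
  have "(\<integral>\<^sup>+x. f x \<partial>lborel) =
      (\<integral>\<^sup>+x. f x \<partial>density (distr lborel borel (\<lambda>x. t + c *\<^sub>R x)) (\<lambda>_. ennreal (\<bar>c\<bar> ^ DIM('a))))"
    using lborel_affine[OF c, of t] c by (simp add: ennreal_power)
  also have "\<dots> = ennreal (\<bar>c\<bar> ^ DIM('a)) * (\<integral>\<^sup>+x. f (t + c *\<^sub>R x) \<partial>lborel)"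
    by (subst nn_integral_density) (auto simp: nn_integral_distr nn_integral_cmult)
  finally show ?thesis .
qed

lemma lborel_integral_translate:
  fixes f :: "'a::euclidean_space \<Rightarrow> 'b::{banach, second_countable_topology}"
  assumes "f \<in> borel_measurable borel"
  shows "(LINT x|lborel. f (x + a)) = (LINT x|lborel. f x)"
  using lborel_integral_affine_euclidean[OF assms, of 1 a] by (simp add: add.commute)

lemma lborel_nn_integral_translate:
  fixes f :: "'a::euclidean_space \<Rightarrow> ennreal"
  assumes "f \<in> borel_measurable borel"
  shows "(\<integral>\<^sup>+x. f (x + a) \<partial>lborel) = (\<integral>\<^sup>+x. f x \<partial>lborel)"
  using lborel_nn_integral_affine_euclidean[OF assms, of 1 a] by (simp add: add.commute)

lemma lborel_nn_integral_reflect: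
  fixes f :: "'a::euclidean_space \<Rightarrow> ennreal"
  assumes "f \<in> borel_measurable borel"
  shows "(\<integral>\<^sup>+x. f (a - x) \<partial>lborel) = (\<integral>\<^sup>+x. f x \<partial>lborel)"
  using lborel_nn_integral_affine_euclidean[OF assms, of "-1" a] by simp

lemma lborel_integrable_translate_iff:
  fixes f :: "'a::euclidean_space \<Rightarrow> 'b::{banach, second_countable_topology}"
  assumes [measurable]: "f \<in> borel_measurable borel"
  shows "integrable lborel (\<lambda>x. f (x + a)) \<longleftrightarrow> integrable lborel f"
  using lborel_nn_integral_translate[of "\<lambda>x. ennreal (norm (f x))" a]
  by (simp add: integrable_iff_bounded)

lemma lborel_integrable_reflect_iff:
  fixes f :: "'a::euclidean_space \<Rightarrow> 'b::{banach, second_countable_topology}"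
  assumes [measurable]: "f \<in> borel_measurable borel"
  shows "integrable lborel (\<lambda>x. f (a - x)) \<longleftrightarrow> integrable lborel f"
  using lborel_nn_integral_reflect[of "\<lambda>x. ennreal (norm (f x))" a]
  by (simp add: integrable_iff_bounded)

lemma gauss_fourier_real:
  fixes g v :: real
  assumes g: "g > 0"
  shows "integrable lborel (\<lambda>x. of_real (exp (- g * x\<^sup>2)) * cis (x * v))" (is ?A)
    and "(LINT x|lborel. of_real (exp (- g * x\<^sup>2)) * cis (x * v)) =
      of_real (sqrt (pi / g) * exp (- v\<^sup>2 / (4 * g)))" (is ?B)
proof -
  let ?f = "\<lambda>x::real. of_real (exp (- g * x\<^sup>2)) * cis (x * v)"
  define c where "c = 1 / sqrt (2 * g)"
  have c: "c > 0" "c\<^sup>2 = 1 / (2 * g)" using g by (auto simp: c_def power_divide)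
  have "integrable lborel (\<lambda>x. std_normal_density x)"
    by (simp add: integrable_normal_density)
  then have "integrable lborel (\<lambda>x. sqrt (2 * pi) * std_normal_density x)" by simp
  then have "integrable lborel (\<lambda>x::real. exp (- x\<^sup>2 / 2))"
    by (simp add: std_normal_density_def)
  from lborel_integrable_real_affine[OF this, of "1 / c" 0]
  have "integrable lborel (\<lambda>x. exp (- g * x\<^sup>2))"
    using c g by (simp add: power_divide mult.commute)
  then show ?A
    by (rule Bochner_Integration.integrable_bound) (auto simp: norm_mult)
  have eq: "?f (c * x) = sqrt (2 * pi) *\<^sub>R (std_normal_density x *\<^sub>R iexp (c * v * x))" for x
    using c g by (simp add: std_normal_density_def power_mult_distrib cis_conv_exp scaleR_conv_of_real mult_ac)
  have "(LINT x|lborel. ?f x) = c *\<^sub>R (LINT x|lborel. ?f (c * x))"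
    using lborel_integral_real_affine[of c ?f 0] c by simp
  also have "\<dots> = c *\<^sub>R sqrt (2 * pi) *\<^sub>R char std_normal_distribution (c * v)"
    unfolding eq char_def by (subst integral_density) (auto simp: mult_ac simp flip: integral_scaleR_right)
  also have "\<dots> = of_real (sqrt (pi / g) * exp (- v\<^sup>2 / (4 * g)))"
    unfolding char_std_normal_distribution using c g
    by (simp add: scaleR_conv_of_real power_mult_distrib c_def real_sqrt_mult real_sqrt_divide field_simps)
  finally show ?B .
qed

lemma gauss_fourier:
  fixes v :: "'a::euclidean_space"
  assumes g: "g > 0"
  shows "integrable lborel (\<lambda>x::'a. of_real (exp (- g * (norm x)\<^sup>2)) * cis (x \<bullet> v))" (is ?A)
    and "(LINT x|lborel. of_real (exp (- g * (norm x)\<^sup>2)) * cis (x \<bullet> v)) =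
      of_real (sqrt (pi / g) ^ DIM('a) * exp (- (norm v)\<^sup>2 / (4 * g)))" (is ?B)
proof -
  interpret product_sigma_finite "\<lambda>_::'a. lborel :: real measure" ..
  let ?h = "\<lambda>b x. of_real (exp (- g * x\<^sup>2)) * cis (x * (v \<bullet> b)) :: complex"
  let ?S = "\<lambda>f. \<Sum>b\<in>(Basis::'a set). f b *\<^sub>R b"
  have cis_sum: "cis (\<Sum>b\<in>A. u b) = (\<Prod>b\<in>A. cis (u b))" if "finite A" for A and u :: "'a \<Rightarrow> real"
    using that by (induction A rule: finite_induct) (auto simp: cis_mult[symmetric])
  have eq: "of_real (exp (- g * (norm (?S f))\<^sup>2)) * cis (?S f \<bullet> v) = (\<Prod>b\<in>Basis. ?h b (f b))" for f
  proof -
    have "(norm (?S f))\<^sup>2 = (\<Sum>b\<in>Basis. (f b)\<^sup>2)"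
      unfolding power2_norm_eq_inner
      by (subst euclidean_inner) (simp add: power2_eq_square)
    moreover have "?S f \<bullet> v = (\<Sum>b\<in>Basis. f b * (v \<bullet> b))"
      by (simp add: inner_sum_left inner_commute[of v])
    ultimately show ?thesis
      by (simp add: cis_sum exp_sum sum_distrib_left sum_negf[symmetric] prod.distrib)
  qed
  have S [measurable]: "?S \<in> (\<Pi>\<^sub>M b\<in>Basis. lborel) \<rightarrow>\<^sub>M borel"
    by measurable
  have "integrable (\<Pi>\<^sub>M b\<in>(Basis::'a set). lborel) (\<lambda>f. \<Prod>b\<in>Basis. ?h b (f b))"
    by (rule product_integrable_prod) (use gauss_fourier_real[OF g] in auto)
  then show ?A
    by (subst lborel_eq, subst integrable_distr_eq[OF S]) (simp_all only: eq, measurable)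
  have "(LINT x|lborel. of_real (exp (- g * (norm x)\<^sup>2)) * cis (x \<bullet> v)) =
     (LINT f|(\<Pi>\<^sub>M b\<in>(Basis::'a set). lborel). (\<Prod>b\<in>Basis. ?h b (f b)))"
    by (subst lborel_eq, subst integral_distr[OF S]) (simp_all only: eq, measurable)
  also have "\<dots> = (\<Prod>b\<in>(Basis::'a set). LINT x|lborel. ?h b x)"
    by (rule product_integral_prod) (use gauss_fourier_real[OF g] in auto)
  also have "\<dots> = (\<Prod>b\<in>(Basis::'a set). of_real (sqrt (pi / g) * exp (- (v \<bullet> b)\<^sup>2 / (4 * g))))"
    by (intro prod.cong refl gauss_fourier_real[OF g])
  also have "\<dots> = of_real (sqrt (pi / g) ^ DIM('a) * exp (- (norm v)\<^sup>2 / (4 * g)))"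
  proof -
    have "(norm v)\<^sup>2 = (\<Sum>b\<in>Basis. (v \<bullet> b)\<^sup>2)"
      unfolding power2_norm_eq_inner
      by (subst euclidean_inner) (simp add: power2_eq_square)
    then show ?thesis
      by (simp add: prod.distrib exp_sum sum_divide_distrib sum_negf[symmetric])
  qed
  finally show ?B .
qed

lemma gauss_integrable:
  assumes g: "g > 0"
  shows "integrable lborel (\<lambda>x::'a::euclidean_space. exp (- g * (norm x)\<^sup>2))" (is ?A)
    and "(LINT x|lborel. exp (- g * (norm (x::'a))\<^sup>2)) = sqrt (pi / g) ^ DIM('a)" (is ?B)
    and "(\<integral>\<^sup>+x. ennreal (exp (- g * (norm (x::'a))\<^sup>2)) \<partial>lborel) = ennreal (sqrt (pi / g) ^ DIM('a))" (is ?C)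
proof -
  have 1: "integrable lborel (\<lambda>x::'a. of_real (exp (- g * (norm x)\<^sup>2)) :: complex)"
    using gauss_fourier(1)[OF g, of "0::'a"] by simp
  from integrable_norm[OF this] show A: ?A by simp
  have "complex_of_real (LINT x|lborel. exp (- g * (norm (x::'a))\<^sup>2)) = of_real (sqrt (pi / g) ^ DIM('a))"
    using gauss_fourier(2)[OF g, of "0::'a"] unfolding integral_complex_of_real[symmetric] by simp
  then show B: ?B by (simp only: of_real_eq_iff)
  show ?C using nn_integral_eq_integral[OF A] B by simp
qed

lemma gauss_fourier_tilted:
  fixes u v :: "'a::euclidean_space"
  assumes g: "g > 0" and uv: "u \<bullet> v = 0"
  shows "(LINT x|lborel. of_real (exp (- g * (norm x)\<^sup>2 + x \<bullet> u)) * cis (x \<bullet> v)) =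
      of_real (sqrt (pi / g) ^ DIM('a) * exp (((norm u)\<^sup>2 - (norm v)\<^sup>2) / (4 * g)))"
proof -
  let ?f = "\<lambda>x::'a. of_real (exp (- g * (norm x)\<^sup>2 + x \<bullet> u)) * cis (x \<bullet> v)"
  let ?a = "(1 / (2 * g)) *\<^sub>R u"
  have "?f (x + ?a) = of_real (exp ((norm u)\<^sup>2 / (4 * g))) * (of_real (exp (- g * (norm x)\<^sup>2)) * cis (x \<bullet> v))" for x
  proof -
    have "- g * (norm (x + ?a))\<^sup>2 + (x + ?a) \<bullet> u = (norm u)\<^sup>2 / (4 * g) + - g * (norm x)\<^sup>2"
      unfolding power2_norm_eq_inner inner_add_left inner_add_right inner_scaleR_left inner_scaleR_right
      using g by (simp add: field_simps inner_commute)
    moreover have "(x + ?a) \<bullet> v = x \<bullet> v" using uv by (simp add: inner_add_left)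
    ultimately show ?thesis by (simp only: exp_add of_real_mult mult.assoc)
  qed
  then have "(LINT x|lborel. ?f x) = (LINT x|lborel. of_real (exp ((norm u)\<^sup>2 / (4 * g))) * (of_real (exp (- g * (norm x)\<^sup>2)) * cis (x \<bullet> v)))"
    using lborel_integral_translate[of ?f ?a] by simp
  also have "\<dots> = of_real (exp ((norm u)\<^sup>2 / (4 * g))) * of_real (sqrt (pi / g) ^ DIM('a) * exp (- (norm v)\<^sup>2 / (4 * g)))"
    by (subst gauss_fourier(2)[OF g, symmetric]) (rule integral_mult_right_zero)
  also have "\<dots> = of_real (sqrt (pi / g) ^ DIM('a) * exp (((norm u)\<^sup>2 - (norm v)\<^sup>2) / (4 * g)))"
    by (simp add: diff_divide_distrib exp_diff exp_minus field_simps)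
  finally show ?thesis .
qed

subsection \<open>Approximation of the identity\<close>

lemma gauss_convolution_bound:
  fixes f :: "'a::euclidean_space \<Rightarrow> complex"
  assumes g: "g > 0" and [measurable]: "f \<in> borel_measurable borel"
  shows "(\<integral>\<^sup>+x. \<integral>\<^sup>+y. ennreal (norm (f x) * norm (f y) * exp (- g * (norm (x - y))\<^sup>2)) \<partial>lborel \<partial>lborel)
    \<le> ennreal (sqrt (pi / g) ^ DIM('a)) * L2sq lborel f"
proof -
  let ?e = "\<lambda>x y::'a. ennreal (exp (- g * (norm (x - y))\<^sup>2))"
  let ?n = "\<lambda>x. ennreal ((norm (f x))\<^sup>2)"
  define c where "c = ennreal (sqrt (pi / g) ^ DIM('a))"
  have e: "(\<integral>\<^sup>+y. ?e x y \<partial>lborel) = c" for x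
    unfolding c_def gauss_integrable(3)[OF g, symmetric]
    by (subst lborel_nn_integral_reflect[of "\<lambda>y. ennreal (exp (- g * (norm y)\<^sup>2))" x]) auto
  have "(\<integral>\<^sup>+x. \<integral>\<^sup>+y. ennreal (norm (f x) * norm (f y) * exp (- g * (norm (x - y))\<^sup>2)) \<partial>lborel \<partial>lborel)
    \<le> (\<integral>\<^sup>+x. \<integral>\<^sup>+y. ennreal (1/2) * (?n x * ?e x y) + ennreal (1/2) * (?n y * ?e x y) \<partial>lborel \<partial>lborel)"
  proof (intro nn_integral_mono)
    fix x y
    have "norm (f x) * norm (f y) * exp (- g * (norm (x - y))\<^sup>2) \<le> (1/2 * (norm (f x))\<^sup>2 + 1/2 * (norm (f y))\<^sup>2) * exp (- g * (norm (x - y))\<^sup>2)"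
      using sum_squares_bound[of "norm (f x)" "norm (f y)"] by (intro mult_right_mono) auto
    then show "ennreal (norm (f x) * norm (f y) * exp (- g * (norm (x - y))\<^sup>2)) \<le>
       ennreal (1/2) * (?n x * ?e x y) + ennreal (1/2) * (?n y * ?e x y)"
      by (simp add: ennreal_mult'[symmetric] algebra_simps flip: ennreal_plus del: ennreal_half)
  qed
  also have "\<dots> = ennreal (1/2) * (\<integral>\<^sup>+x. \<integral>\<^sup>+y. ?n x * ?e x y \<partial>lborel \<partial>lborel) + ennreal (1/2) * (\<integral>\<^sup>+x. \<integral>\<^sup>+y. ?n y * ?e x y \<partial>lborel \<partial>lborel)"
    by (simp add: nn_integral_add nn_integral_cmult)
  also have "(\<integral>\<^sup>+x. \<integral>\<^sup>+y. ?n y * ?e x y \<partial>lborel \<partial>lborel) = (\<integral>\<^sup>+y. \<integral>\<^sup>+x. ?n y * ?e y x \<partial>lborel \<partial>lborel)"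
    by (subst lborel_pair.Fubini') (simp_all add: norm_minus_commute)
  also have "(\<integral>\<^sup>+x. \<integral>\<^sup>+y. ?n x * ?e x y \<partial>lborel \<partial>lborel) = c * L2sq lborel f"
    by (simp add: nn_integral_cmult e[simplified] nn_integral_multc L2sq_def mult.commute)
  also have "ennreal (1/2) * (c * L2sq lborel f) + ennreal (1/2) * (c * L2sq lborel f) = (ennreal (1/2) + ennreal (1/2)) * (c * L2sq lborel f)"
    by (rule distrib_right[symmetric])
  also have "ennreal (1/2) + ennreal (1/2) = 1"
    by (subst ennreal_plus[symmetric]) auto
  finally show ?thesis unfolding c_def by simp
qed

lemma gauss_approx_identity:
  fixes f :: "'a::euclidean_space \<Rightarrow> complex" and \<theta> :: "'a \<Rightarrow> 'a \<Rightarrow> complex"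
  assumes f: "continuous_on UNIV f" and R: "\<And>x. norm x > R \<Longrightarrow> f x = 0"
    and \<theta>: "continuous_on UNIV (\<lambda>(x, y). \<theta> x y)" "\<And>x y. norm (\<theta> x y) \<le> 1" "\<And>x. \<theta> x x = 1"
    and g: "filterlim g at_top sequentially"
  shows "(\<lambda>j. (LINT x|lborel. LINT y|lborel. f x * cnj (f y) * \<theta> x y * of_real (exp (- g j * (norm (x - y))\<^sup>2)))
        * of_real (sqrt (g j / pi) ^ DIM('a))) \<longlonglongrightarrow> of_real (LINT x|lborel. (norm (f x))\<^sup>2)"
proof -
  let ?g = "\<lambda>u::'a. exp (- 1 * (norm u)\<^sup>2)"
  have fm [measurable]: "f \<in> borel_measurable borel"
    using f by (rule borel_measurable_continuous_onI)
  have tm [measurable]: "(\<lambda>p. \<theta> (fst p) (snd p)) \<in> borel_measurable (borel \<Otimes>\<^sub>M borel)"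
    unfolding borel_prod using \<theta>(1) by (intro borel_measurable_continuous_onI) (simp add: split_beta')
  have [measurable]: "(\<lambda>x. \<theta> (u x) (v x)) \<in> borel_measurable M"
    if "u \<in> borel_measurable M" "v \<in> borel_measurable M" for u v and M :: "'c measure"
    using measurable_compose[OF measurable_Pair[OF that] tm] by simp
  obtain B where B: "\<And>x. norm (f x) \<le> B"
  proof -
    have "compact (f ` cball 0 R)"
      by (intro compact_continuous_image continuous_on_subset[OF f]) auto
    then obtain B where "\<And>y. y \<in> f ` cball 0 R \<Longrightarrow> norm y \<le> B"
      using compact_imp_bounded bounded_iff by metis
    then have "norm (f x) \<le> max B 0" for x
      using R[of x] by (cases "norm x > R") (force simp: le_max_iff_disj)+
    then show ?thesis using that by blast
  qed
  have B0: "B \<ge> 0" using B[of 0] norm_ge_zero order_trans by blast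
  define h where "h c = (\<lambda>(x, u). f x * cnj (f (x + c *\<^sub>R u)) * \<theta> x (x + c *\<^sub>R u) * of_real (?g u))" for c :: real
  have h_meas [measurable]: "h c \<in> borel_measurable (lborel \<Otimes>\<^sub>M lborel)" for c
    unfolding h_def split_beta' by measurable
  define W where "W = (\<lambda>(x::'a, u). (B\<^sup>2 * indicator (cball 0 R) x) * ?g u)"
  have W: "integrable (lborel \<Otimes>\<^sub>M lborel) W"
  proof -
    have "integrable lborel (\<lambda>x::'a. B\<^sup>2 * indicator (cball 0 R) x :: real)"
      using emeasure_bounded_finite[OF bounded_cball[of "0::'a" R]]
      by (intro integrable_mult_right integrable_real_indicator) auto
    from lborel_pair.integrable_fst'[of "undefined"] this gauss_integrable(1)[of 1, where 'a='a] show ?thesis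
      unfolding W_def by (intro lborel_pair.Fubini_integrable) (auto simp: abs_mult intro!: integrable_mult_left)
  qed
  have hW: "norm (h c p) \<le> W p" for c p
  proof -
    obtain x u where p: "p = (x, u)" by fastforce
    show ?thesis
    proof (cases "x \<in> cball 0 R")
      case True
      have "norm (f x * cnj (f (x + c *\<^sub>R u)) * \<theta> x (x + c *\<^sub>R u)) \<le> B * B * 1"
        unfolding norm_mult using B B0 \<theta>(2) by (intro mult_mono) auto
      then show ?thesis using True unfolding p h_def W_def
        by (auto simp: norm_mult power2_eq_square intro!: mult_right_mono)
    next
      case False
      then have "f x = 0" using R by auto
      then show ?thesis unfolding p h_def W_def by auto
    qed
  qed
  have h_int: "integrable (lborel \<Otimes>\<^sub>M lborel) (h c)" for c
    by (rule Bochner_Integration.integrable_bound[OF W]) (auto intro!: AE_I2 order_trans[OF hW abs_ge_self] simp del: split_paired_All)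
  have lim: "((\<lambda>c. h c p) \<longlongrightarrow> (\<lambda>(x, u). of_real ((norm (f x))\<^sup>2) * of_real (?g u)) p) (at 0)" for p
  proof -
    obtain x u where p: "p = (x, u)" by fastforce
    have 1: "((\<lambda>c. x + c *\<^sub>R u) \<longlongrightarrow> x + 0 *\<^sub>R u) (at 0)" by (intro tendsto_intros)
    have 2: "((\<lambda>c. f (x + c *\<^sub>R u)) \<longlongrightarrow> f x) (at 0)"
      using f 1 by (auto simp: continuous_on_eq_continuous_at intro!: isCont_tendsto_compose[of _ f])
    have 3: "((\<lambda>c. \<theta> x (x + c *\<^sub>R u)) \<longlongrightarrow> \<theta> x x) (at 0)"
      using \<theta>(1) tendsto_Pair[OF tendsto_const[of x] 1]
      by (auto simp: continuous_on_eq_continuous_at dest!: spec[of _ x] isCont_tendsto_compose[of "(x, x)" "\<lambda>(x, y). \<theta> x y"])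
    have "((\<lambda>c. f x * cnj (f (x + c *\<^sub>R u)) * \<theta> x (x + c *\<^sub>R u) * of_real (?g u)) \<longlongrightarrow> f x * cnj (f x) * \<theta> x x * of_real (?g u)) (at 0)"
      by (intro tendsto_intros 2 3)
    then show ?thesis unfolding p h_def prod.case \<theta>(3) complex_norm_square by simp
  qed
  define c where "c j = 1 / sqrt (g j)" for j
  have gpos: "eventually (\<lambda>j. g j > 0) sequentially"
    using g filterlim_at_top_dense by blast
  have c0: "filterlim c (at 0) sequentially"
  proof -
    have "c \<longlonglongrightarrow> 0" unfolding c_def
      by (intro tendsto_divide_0[OF tendsto_const] filterlim_at_top_imp_at_infinity filterlim_compose[OF sqrt_at_top g])
    then show ?thesis unfolding filterlim_at using gpos by (auto simp: c_def elim: eventually_mono)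
  qed
  have "(\<lambda>j. (LINT p|(lborel \<Otimes>\<^sub>M lborel). h (c j) p)) \<longlonglongrightarrow> (LINT p|(lborel \<Otimes>\<^sub>M lborel). (\<lambda>(x, u). of_real ((norm (f x))\<^sup>2) * of_real (?g u)) p)"
    by (rule integral_dominated_convergence[OF _ _ W])
       (use hW filterlim_compose[OF lim c0] in \<open>auto simp: split_beta' simp del: split_paired_All\<close>)
  also have "(LINT p|(lborel \<Otimes>\<^sub>M lborel). (\<lambda>(x, u). of_real ((norm (f x))\<^sup>2) * of_real (?g u) :: complex) p)
     = (LINT p|(lborel \<Otimes>\<^sub>M lborel). h 0 p)"
    by (intro Bochner_Integration.integral_cong) (auto simp: h_def \<theta>(3) simp flip: complex_norm_square)
  also have "\<dots> = (LINT x|lborel. LINT u|lborel. h 0 (x, u))"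
    by (rule lborel_pair.integral_fst'[OF h_int, symmetric])
  also have "\<dots> = (LINT x|lborel. of_real ((norm (f x))\<^sup>2) * (LINT u|lborel. of_real (?g u)))"
    by (simp add: h_def \<theta>(3) flip: complex_norm_square)
  also have "\<dots> = of_real ((LINT x|lborel. (norm (f x))\<^sup>2) * sqrt pi ^ DIM('a))"
    using gauss_integrable(2)[of 1, where 'a='a] by (simp flip: of_real_mult of_real_power)
  finally have *: "(\<lambda>j. (LINT p|(lborel \<Otimes>\<^sub>M lborel). h (c j) p)) \<longlonglongrightarrow> of_real ((LINT x|lborel. (norm (f x))\<^sup>2) * sqrt pi ^ DIM('a))" .
  have "(LINT x|lborel. LINT y|lborel. f x * cnj (f y) * \<theta> x y * of_real (exp (- g j * (norm (x - y))\<^sup>2)))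
        * of_real (sqrt (g j / pi) ^ DIM('a)) = (LINT p|(lborel \<Otimes>\<^sub>M lborel). h (c j) p) * of_real ((1 / sqrt pi) ^ DIM('a))"
    if gj: "g j > 0" for j
  proof -
    have cj: "c j > 0" "(c j)\<^sup>2 = 1 / g j" using gj by (auto simp: c_def power_divide)
    have inner: "(LINT y|lborel. f x * cnj (f y) * \<theta> x y * of_real (exp (- g j * (norm (x - y))\<^sup>2)))
       = of_real (c j ^ DIM('a)) * (LINT u|lborel. h (c j) (x, u))" for x
      by (subst lborel_integral_affine_euclidean[of _ "c j" x])
         (use cj gj in \<open>auto simp: h_def power_mult_distrib scaleR_conv_of_real\<close>)
    have "(LINT x|lborel. LINT y|lborel. f x * cnj (f y) * \<theta> x y * of_real (exp (- g j * (norm (x - y))\<^sup>2)))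
       = of_real (c j ^ DIM('a)) * (LINT p|(lborel \<Otimes>\<^sub>M lborel). h (c j) p)"
      unfolding inner using lborel_pair.integral_fst'[OF h_int] by simp
    moreover have "c j ^ DIM('a) * sqrt (g j / pi) ^ DIM('a) = (1 / sqrt pi) ^ DIM('a)"
      using gj by (simp add: c_def power_mult_distrib[symmetric] real_sqrt_divide)
    ultimately show ?thesis
      by (simp add: mult_ac del: of_real_mult of_real_power add: of_real_mult[symmetric] of_real_power[symmetric])
  qed
  then have ev: "eventually (\<lambda>j. (LINT p|(lborel \<Otimes>\<^sub>M lborel). h (c j) p) * of_real ((1 / sqrt pi) ^ DIM('a)) = (LINT x|lborel. LINT y|lborel. f x * cnj (f y) * \<theta> x y * of_real (exp (- g j * (norm (x - y))\<^sup>2)))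
        * of_real (sqrt (g j / pi) ^ DIM('a))) sequentially"
    using gpos by (auto elim!: eventually_mono)
  have "(\<lambda>j. (LINT p|(lborel \<Otimes>\<^sub>M lborel). h (c j) p) * of_real ((1 / sqrt pi) ^ DIM('a))) \<longlonglongrightarrow> of_real ((LINT x|lborel. (norm (f x))\<^sup>2) * sqrt pi ^ DIM('a)) * of_real ((1 / sqrt pi) ^ DIM('a))"
    by (intro tendsto_intros *)
  from Lim_transform_eventually[OF this ev] show ?thesis
    by (simp add: power_divide)
qed

lemma L2_approx_continuous:
  fixes f :: "'a::euclidean_space \<Rightarrow> complex"
  assumes fm [measurable]: "f \<in> borel_measurable borel" and fin: "L2sq lborel f < \<infinity>" and e: "e > 0"
  obtains g r where "continuous_on UNIV g" "\<And>x. norm x > r \<Longrightarrow> g x = 0" "L2sq lborel (\<lambda>x. f x - g x) < e"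
proof -
  have "f measurable_on UNIV"
    by (intro lebesgue_measurable_imp_measurable_on measurable_completion) auto
  then obtain N g where N: "negligible N" and g: "\<And>n. continuous_on UNIV (g n)"
    and lim: "\<And>x. x \<notin> N \<Longrightarrow> (\<lambda>n. g n x) \<longlonglongrightarrow> f x"
    unfolding measurable_on_def by auto
  have gm [measurable]: "g n \<in> borel_measurable borel" for n
    using g by (rule borel_measurable_continuous_onI)
  have AEN: "AE x in lborel. x \<notin> N"
    using N AE_not_in[of N lebesgue] by (simp add: negligible_iff_null_sets AE_completion_iff)
  define cl where "cl r z = z /\<^sub>R max 1 (norm z / r)" for r and z :: complex
  define ch where "ch r x = max 0 (min 1 (r + 1 - norm x))" for r and x :: 'a
  have cl_cont: "continuous_on UNIV (cl r)" for r
    unfolding cl_def divide_inverse by (intro continuous_intros) (auto simp: max_def)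
  have ch_cont: "continuous_on UNIV (ch r)" for r
    unfolding ch_def by (intro continuous_intros)
  have [measurable]: "cl r \<in> borel_measurable borel" "ch r \<in> borel_measurable borel" for r
    using cl_cont ch_cont by (auto intro: borel_measurable_continuous_onI)
  have cl_r: "norm (cl r z) \<le> r" if "r > 0" for r z
    using that by (auto simp: cl_def max_def divide_simps)
  have cl_le: "norm (cl r z) \<le> norm z" for r z
  proof -
    have "norm z / max 1 (norm z / r) \<le> norm z / 1" by (intro divide_left_mono) auto
    then show ?thesis by (simp add: cl_def divide_inverse mult.commute)
  qed
  have ch01: "0 \<le> ch r x" "ch r x \<le> 1" for r x by (auto simp: ch_def)
  define F where "F r x = ch r x *\<^sub>R cl r (f x)" for r x
  define G where "G r n x = ch r x *\<^sub>R cl r (g n x)" for r n x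
  have [measurable]: "F r \<in> borel_measurable borel" "G r n \<in> borel_measurable borel" for r n
    unfolding F_def G_def by measurable
  have F_le: "norm (F r x) \<le> norm (f x)" for r x
    unfolding F_def using mult_mono[OF ch01(2) cl_le[of r "f x"], of r x] ch01(1)[of r x] by simp
  have "(\<lambda>j. L2sq lborel (\<lambda>x. f x - F (real j) x)) \<longlonglongrightarrow> (\<integral>\<^sup>+(x::'a). 0 \<partial>lborel)"
    unfolding L2sq_def
  proof (rule nn_integral_dominated_convergence[where w = "\<lambda>x. ennreal 4 * ennreal ((norm (f x))\<^sup>2)"])
    show "(\<integral>\<^sup>+x. ennreal 4 * ennreal ((norm (f x))\<^sup>2) \<partial>lborel) < \<infinity>"
      using fin by (simp add: nn_integral_cmult L2sq_def ennreal_mult_less_top)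
    show "AE x in lborel. ennreal ((norm (f x - F (real j) x))\<^sup>2) \<le> ennreal 4 * ennreal ((norm (f x))\<^sup>2)" for j
    proof (intro AE_I2)
      fix x
      have "norm (f x - F (real j) x) \<le> 2 * norm (f x)"
        using norm_triangle_ineq4[of "f x" "F (real j) x"] F_le[of "real j" x] by linarith
      then have "(norm (f x - F (real j) x))\<^sup>2 \<le> (2 * norm (f x))\<^sup>2" by (intro power_mono) auto
      then show "ennreal ((norm (f x - F (real j) x))\<^sup>2) \<le> ennreal 4 * ennreal ((norm (f x))\<^sup>2)"
        using ennreal_leI by (fastforce simp: power_mult_distrib ennreal_mult'[symmetric] simp del: ennreal_numeral)
    qed
    show "AE x in lborel. (\<lambda>j. ennreal ((norm (f x - F (real j) x))\<^sup>2)) \<longlonglongrightarrow> 0"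
    proof (intro AE_I2)
      fix x
      obtain n where n: "norm x + norm (f x) + 1 < real n" using reals_Archimedean2 by blast
      have "F (real j) x = f x" if "j \<ge> n" for j
      proof -
        have j: "norm x + norm (f x) + 1 < real j" using n that by linarith
        then have "norm (f x) \<le> real j" "norm x \<le> real j" "real j > 0"
          using norm_ge_zero[of x] norm_ge_zero[of "f x"] by linarith+
        then show ?thesis by (simp add: F_def ch_def cl_def max_def)
      qed
      then have "eventually (\<lambda>j. ennreal ((norm (f x - F (real j) x))\<^sup>2) = 0) sequentially"
        unfolding eventually_sequentially by (intro exI[of _ n]) auto
      then show "(\<lambda>j. ennreal ((norm (f x - F (real j) x))\<^sup>2)) \<longlonglongrightarrow> 0"
        by (rule tendsto_eventually)
    qed
  qed auto
  moreover obtain d where d: "d > 0" "ennreal (4 * d) \<le> e"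
  proof (cases e)
    case (real r)
    then show ?thesis using e by (intro that[of "r / 4"]) auto
  next
    case top
    then show ?thesis by (intro that[of 1]) auto
  qed
  ultimately have "eventually (\<lambda>j. L2sq lborel (\<lambda>x. f x - F (real j) x) < ennreal d) sequentially"
    by (intro order_tendstoD(2)) auto
  from eventually_happens[OF eventually_conj[OF this eventually_gt_at_top[of 0]]]
  obtain j where j: "j > 0" "L2sq lborel (\<lambda>x. f x - F (real j) x) < ennreal d"
    by auto
  define r where "r = real j"
  have r: "r > 0" using j by (simp add: r_def)
  have [measurable]: "cball 0 (r + 1) \<in> sets (borel :: 'a measure)" by (rule borel_closed) simp
  have "(\<lambda>n. L2sq lborel (\<lambda>x. F r x - G r n x)) \<longlonglongrightarrow> (\<integral>\<^sup>+(x::'a). 0 \<partial>lborel)"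
    unfolding L2sq_def
  proof (rule nn_integral_dominated_convergence[where w = "\<lambda>x. ennreal ((2 * r)\<^sup>2) * indicator (cball 0 (r + 1)) x"])
    show "(\<integral>\<^sup>+x. ennreal ((2 * r)\<^sup>2) * indicator (cball 0 (r + 1)) x \<partial>(lborel :: 'a measure)) < \<infinity>"
      using emeasure_bounded_finite[OF bounded_cball[of "0::'a" "r + 1"]]
      by (simp add: nn_integral_cmult_indicator ennreal_mult_less_top)
    show "AE x in lborel. ennreal ((norm (F r x - G r n x))\<^sup>2) \<le> ennreal ((2 * r)\<^sup>2) * indicator (cball 0 (r + 1)) x" for n
    proof (intro AE_I2)
      fix x :: 'a
      show "ennreal ((norm (F r x - G r n x))\<^sup>2) \<le> ennreal ((2 * r)\<^sup>2) * indicator (cball 0 (r + 1)) x"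
      proof (cases "x \<in> cball 0 (r + 1)")
        case True
        have "norm (F r x) \<le> 1 * r" "norm (G r n x) \<le> 1 * r"
          unfolding F_def G_def using mult_mono[OF ch01(2) cl_r[OF r]] ch01(1)[of r x] by auto
        then have "norm (F r x - G r n x) \<le> 2 * r"
          using norm_triangle_ineq4[of "F r x" "G r n x"] by linarith
        from power_mono[OF this, of 2] show ?thesis using True by (auto intro!: ennreal_leI)
      next
        case False
        then have "ch r x = 0" by (auto simp: ch_def)
        then show ?thesis by (simp add: F_def G_def)
      qed
    qed
    show "AE x in lborel. (\<lambda>n. ennreal ((norm (F r x - G r n x))\<^sup>2)) \<longlonglongrightarrow> 0"
      using AEN
    proof eventually_elim
      case (elim x)
      have "(\<lambda>n. cl r (g n x)) \<longlonglongrightarrow> cl r (f x)"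
        using cl_cont[of r] lim[OF elim] by (auto simp: continuous_on_eq_continuous_at intro: isCont_tendsto_compose)
      then have "(\<lambda>n. (norm (F r x - G r n x))\<^sup>2) \<longlonglongrightarrow> (norm (F r x - F r x))\<^sup>2"
        unfolding G_def F_def by (intro tendsto_intros)
      from tendsto_ennrealI[OF this] show ?case by simp
    qed
  qed auto
  then have "eventually (\<lambda>n. L2sq lborel (\<lambda>x. F r x - G r n x) < ennreal d) sequentially"
    using d by (intro order_tendstoD(2)) auto
  from eventually_happens[OF this]
  obtain n where n: "L2sq lborel (\<lambda>x. F r x - G r n x) < ennreal d"
    by auto
  have "L2sq lborel (\<lambda>x. f x - G r n x) \<le> 2 * L2sq lborel (\<lambda>x. f x - F r x) + 2 * L2sq lborel (\<lambda>x. F r x - G r n x)"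
  proof -
    have "(norm (f x - G r n x))\<^sup>2 \<le> 2 * (norm (f x - F r x))\<^sup>2 + 2 * (norm (F r x - G r n x))\<^sup>2" for x
    proof -
      have "norm (f x - G r n x) \<le> norm (f x - F r x) + norm (F r x - G r n x)"
        using norm_triangle_ineq[of "f x - F r x" "F r x - G r n x"] by simp
      then have "(norm (f x - G r n x))\<^sup>2 \<le> (norm (f x - F r x) + norm (F r x - G r n x))\<^sup>2" by (intro power_mono) auto
      also have "\<dots> \<le> 2 * (norm (f x - F r x))\<^sup>2 + 2 * (norm (F r x - G r n x))\<^sup>2"
        using sum_squares_bound[of "norm (f x - F r x)" "norm (F r x - G r n x)"] by (simp add: power2_sum)
      finally show ?thesis .
    qed
    then have "ennreal ((norm (f x - G r n x))\<^sup>2) \<le> 2 * ennreal ((norm (f x - F r x))\<^sup>2) + 2 * ennreal ((norm (F r x - G r n x))\<^sup>2)" for x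
      by (simp add: ennreal_leI ennreal_mult'[symmetric] flip: ennreal_plus ennreal_numeral)
    then have "L2sq lborel (\<lambda>x. f x - G r n x) \<le> (\<integral>\<^sup>+x. 2 * ennreal ((norm (f x - F r x))\<^sup>2) + 2 * ennreal ((norm (F r x - G r n x))\<^sup>2) \<partial>lborel)"
      unfolding L2sq_def by (intro nn_integral_mono)
    also have "\<dots> = 2 * L2sq lborel (\<lambda>x. f x - F r x) + 2 * L2sq lborel (\<lambda>x. F r x - G r n x)"
      unfolding L2sq_def by (simp add: nn_integral_add nn_integral_cmult)
    finally show ?thesis .
  qed
  also have "\<dots> < 2 * ennreal d + 2 * ennreal d"
    using j(2) n unfolding r_def by (intro add_strict_mono ennreal_mult_strict_left_mono) auto
  also have "\<dots> = ennreal (4 * d)"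
    using d(1) by (simp flip: ennreal_numeral ennreal_mult' ennreal_plus)
  also have "\<dots> \<le> e" by (rule d(2))
  finally have "L2sq lborel (\<lambda>x. f x - G r n x) < e" .
  moreover have "continuous_on UNIV (G r n)"
    unfolding G_def using continuous_on_compose2[OF cl_cont[of r] g[of n]] by (intro continuous_intros ch_cont) auto
  moreover have "G r n x = 0" if "norm x > r + 1" for x
    using that by (auto simp: G_def ch_def)
  ultimately show ?thesis using that by blast
qed

subsection \<open>Laguerre functions\<close>

lemma coeff_funpow_pderiv_diff:
  fixes N :: nat
  shows "coeff (((\<lambda>P. pderiv P - P) ^^ j) (monom (1::real) N)) m =
    (if m \<le> N then (-1) ^ (j + (N - m)) * real (j choose (N - m)) * fact N / fact m else 0)"
proof (induction j arbitrary: m)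
  case 0
  then show ?case by auto
next
  case (Suc j)
  show ?case
  proof (cases "m < N")
    case True
    then obtain i where i: "N - m = Suc i" "N - Suc m = i" by (metis Suc_diff_Suc)
    have "coeff (((\<lambda>P. pderiv P - P) ^^ Suc j) (monom (1::real) N)) m =
       real (Suc m) * ((-1) ^ (j + i) * real (j choose i) * fact N / fact (Suc m))
        - (-1) ^ (j + Suc i) * real (j choose Suc i) * fact N / fact m"
      using Suc[of m] Suc[of "Suc m"] True i by (simp add: coeff_pderiv)
    also have "real (Suc m) * ((-1) ^ (j + i) * real (j choose i) * fact N / fact (Suc m)) = (-1) ^ (j + i) * real (j choose i) * fact N / fact m"
      by (simp add: fact_Suc del: of_nat_Suc)
    also have "\<dots> - (-1) ^ (j + Suc i) * real (j choose Suc i) * fact N / fact m = (-1) ^ (Suc j + Suc i) * real (Suc j choose Suc i) * fact N / fact m"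
      by (simp add: algebra_simps add_divide_distrib)
    finally show ?thesis using True i by simp
  next
    case False
    then show ?thesis using Suc[of m] Suc[of "Suc m"] by (cases "m = N") (auto simp: coeff_pderiv)
  qed
qed

lemma poly_eqI_pos:
  fixes P Q :: "real poly"
  assumes "\<And>t. t > 0 \<Longrightarrow> poly P t = poly Q t"
  shows "P = Q"
proof (rule ccontr)
  assume "P \<noteq> Q"
  then have "finite {t. poly (P - Q) t = 0}" by (intro poly_roots_finite) simp
  moreover have "{0<..} \<subseteq> {t. poly (P - Q) t = 0}" using assms by auto
  ultimately show False using infinite_Ioi finite_subset by blast
qed

lemma coeff_laguerre:
  "coeff (laguerre k d) i = (if i \<le> k then (-1) ^ i / fact i * real ((k + d) choose (k - i)) else 0)"
proof -
  define Q where "Q = ((\<lambda>P. pderiv P - P) ^^ k) (monom (1::real) (k + d))"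
  have "poly (smult (fact k) (monom 1 d * laguerre k d)) t = poly Q t" if "t > 0" for t
    using laguerre_rodrigues[OF that, of k d] that funpow_deriv_exp_poly[of k "monom 1 (k + d)"]
    by (simp add: poly_monom Q_def exp_minus field_simps)
  then have "smult (fact k) (monom 1 d * laguerre k d) = Q" by (rule poly_eqI_pos)
  from arg_cong[OF this, of "\<lambda>p. coeff p (d + i)"]
  have *: "fact k * coeff (laguerre k d) i = coeff Q (d + i)" by (simp add: coeff_monom_mult)
  show ?thesis
  proof (cases "i \<le> k")
    case True
    then obtain j where k: "k = i + j" using le_Suc_ex by blast
    have "coeff Q (d + i) = (-1) ^ i * real (k choose j) * fact (k + d) / fact (d + i)"
      unfolding Q_def coeff_funpow_pderiv_diff by (simp add: k power_add power_mult_distrib[symmetric])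
    also have "real (k choose j) = fact k / (fact j * fact i)"
      by (simp add: k binomial_fact)
    finally have "coeff (laguerre k d) i = (-1) ^ i / fact i * (fact (k + d) / (fact j * fact (d + i)))"
      using * by (simp add: eq_divide_eq[of "coeff (laguerre k d) i" "coeff Q (d + i)" "fact k", THEN iffD2] mult.commute)
    also have "fact (k + d) / (fact j * fact (d + i)) = real ((k + d) choose j)"
      by (simp add: k binomial_fact add.commute add.left_commute)
    finally show ?thesis using True by (simp add: k)
  next
    case False
    then show ?thesis using * unfolding Q_def coeff_funpow_pderiv_diff by simp
  qed
qed

lemma poly_laguerre:
  "poly (laguerre k d) x = (\<Sum>i\<le>k. (- x) ^ i / fact i * real ((k + d) choose (k - i)))"
proof -
  have "degree (laguerre k d) \<le> k" by (rule degree_le) (simp add: coeff_laguerre)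
  then have "poly (laguerre k d) x = (\<Sum>i\<le>k. coeff (laguerre k d) i * x ^ i)"
    unfolding poly_altdef by (intro sum.mono_neutral_left) (auto simp: coeff_eq_0)
  also have "\<dots> = (\<Sum>i\<le>k. (- x) ^ i / fact i * real ((k + d) choose (k - i)))"
    by (intro sum.cong refl) (simp add: coeff_laguerre power_minus[of x])
  finally show ?thesis .
qed

lemma binomial_series:
  fixes r :: real
  assumes "\<bar>r\<bar> < 1"
  shows "(\<lambda>j. real ((N + j) choose j) * r ^ j) sums (1 / (1 - r) ^ (N + 1))"
proof -
  have "(\<lambda>j. ((- (real N + 1)) gchoose j) * (- r) ^ j) sums (1 + - r) powr (- (real N + 1))"
    using assms by (intro gen_binomial_real) auto
  moreover have "((- (real N + 1)) gchoose j) * (- r) ^ j = real ((N + j) choose j) * r ^ j" for j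
  proof -
    have "real N + 1 + real j - 1 = real (N + j)" by simp
    then have "((- (real N + 1)) gchoose j) * (- r) ^ j = ((-1) ^ j * (- r) ^ j) * real ((N + j) choose j)"
      unfolding gbinomial_minus by (simp only: binomial_gbinomial mult_ac)
    also have "(-1) ^ j * (- r) ^ j = r ^ j" by (simp flip: power_mult_distrib)
    finally show ?thesis by (simp only: mult.commute)
  qed
  moreover have "(1 + - r) powr (- (real N + 1)) = 1 / (1 - r) ^ (N + 1)"
  proof -
    have "- (real N + 1) = - real (N + 1)" by simp
    then have "(1 + - r) powr (- (real N + 1)) = 1 / (1 - r) powr real (N + 1)"
      by (simp only: powr_minus_divide) simp
    also have "(1 - r) powr real (N + 1) = (1 - r) ^ (N + 1)" using assms by (intro powr_realpow) auto
    finally show ?thesis .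
  qed
  ultimately show ?thesis by simp
qed

lemma laguerre_generating_function:
  fixes r x :: real
  assumes r: "\<bar>r\<bar> < 1"
  shows "(\<lambda>k. r ^ k * poly (laguerre k d) x) sums (exp (- x * r / (1 - r)) / (1 - r) ^ (d + 1))"
proof -
  define f where "f x r = (\<lambda>(i, j). (- x) ^ i / fact i * real ((i + j + d) choose j) * r ^ (i + j))" for x r :: real
  have inner: "(\<lambda>j. f x r (i, j)) sums ((- x * r / (1 - r)) ^ i / fact i / (1 - r) ^ (d + 1))"
    if "\<bar>r\<bar> < 1" for i x r
  proof -
    have "(\<lambda>j. (- x * r) ^ i / fact i * (real ((i + d + j) choose j) * r ^ j)) sums ((- x * r) ^ i / fact i * (1 / (1 - r) ^ (i + d + 1)))"
      by (intro sums_mult binomial_series that)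
    moreover have "(- x * r) ^ i / fact i * (real ((i + d + j) choose j) * r ^ j) = f x r (i, j)" for j
      unfolding f_def prod.case power_add power_mult_distrib by (simp add: add_ac)
    moreover have "y ^ i / fact i * (1 / (1 - r) ^ (i + d + 1)) = (y / (1 - r)) ^ i / fact i / (1 - r) ^ (d + 1)" for y
      by (simp add: power_divide power_add)
    ultimately show ?thesis by simp
  qed
  have outer: "(\<lambda>i. y ^ i / fact i / c) sums (exp y / c)" for y c :: real
    using sums_divide[OF exp_converges[of y], of c] by (simp add: divide_inverse mult.commute)
  have nf: "norm (f x r p) = f (- \<bar>x\<bar>) \<bar>r\<bar> p" for p
    by (cases p) (simp add: f_def abs_mult power_abs)
  have pos: "f (- \<bar>x\<bar>) \<bar>r\<bar> p \<ge> 0" for p by (cases p) (simp add: f_def)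
  have inner_abs: "((\<lambda>j. f (- \<bar>x\<bar>) \<bar>r\<bar> (i, j)) has_sum ((\<bar>x\<bar> * \<bar>r\<bar> / (1 - \<bar>r\<bar>)) ^ i / fact i / (1 - \<bar>r\<bar>) ^ (d + 1))) UNIV" for i
    using inner[of "\<bar>r\<bar>" "- \<bar>x\<bar>" i] r pos by (intro sums_nonneg_imp_has_sum) auto
  have inner_has: "((\<lambda>j. f x r (i, j)) has_sum ((- x * r / (1 - r)) ^ i / fact i / (1 - r) ^ (d + 1))) UNIV" for i
  proof -
    have "summable (\<lambda>j. norm (f x r (i, j)))"
      unfolding nf using inner[of "\<bar>r\<bar>" "- \<bar>x\<bar>" i] r by (simp add: sums_iff)
    then show ?thesis by (rule norm_summable_imp_has_sum[OF _ inner[OF r]])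
  qed
  have outer_abs: "((\<lambda>i. (\<bar>x\<bar> * \<bar>r\<bar> / (1 - \<bar>r\<bar>)) ^ i / fact i / (1 - \<bar>r\<bar>) ^ (d + 1)) has_sum (exp (\<bar>x\<bar> * \<bar>r\<bar> / (1 - \<bar>r\<bar>)) / (1 - \<bar>r\<bar>) ^ (d + 1))) UNIV"
    using outer r by (intro sums_nonneg_imp_has_sum) auto
  have outer_has: "((\<lambda>i. (- x * r / (1 - r)) ^ i / fact i / (1 - r) ^ (d + 1)) has_sum (exp (- x * r / (1 - r)) / (1 - r) ^ (d + 1))) UNIV"
  proof -
    have "summable (\<lambda>i. norm ((- x * r / (1 - r)) ^ i / fact i))"
      using summable_norm_exp[of "- x * r / (1 - r)"] by (simp add: divide_inverse mult.commute)
    then have "summable (\<lambda>i. norm ((- x * r / (1 - r)) ^ i / fact i) / \<bar>1 - r\<bar> ^ (d + 1))"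
      by (rule summable_divide)
    then have "summable (\<lambda>i. norm ((- x * r / (1 - r)) ^ i / fact i / (1 - r) ^ (d + 1)))"
      by (simp add: abs_mult power_abs)
    then show ?thesis by (rule norm_summable_imp_has_sum[OF _ outer])
  qed
  have "(\<lambda>p. norm (f x r p)) summable_on (UNIV \<times> UNIV)"
    unfolding Infinite_Sum.abs_summable_on_Sigma_iff unfolding nf
  proof (intro conjI ballI)
    show "(\<lambda>j. f (- \<bar>x\<bar>) \<bar>r\<bar> (i, j)) summable_on UNIV" for i
      using inner_abs[of i] by (auto simp: summable_on_def)
    show "(\<lambda>i. norm (infsum (\<lambda>j. f (- \<bar>x\<bar>) \<bar>r\<bar> (i, j)) UNIV)) summable_on UNIV"
      unfolding infsumI[OF inner_abs] using outer_abs r by (auto simp: summable_on_def)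
  qed
  then have "f x r summable_on (UNIV \<times> UNIV)" by (rule Infinite_Sum.abs_summable_summable)
  from has_sum_SigmaI[OF _ outer_has this] inner_has
  have tot: "(f x r has_sum (exp (- x * r / (1 - r)) / (1 - r) ^ (d + 1))) (UNIV \<times> UNIV)" by auto
  have bij: "bij_betw (\<lambda>(k, i). (i, k - i)) (SIGMA k:UNIV. {..k}) (UNIV \<times> (UNIV :: nat set))"
    by (rule bij_betwI[where g = "\<lambda>(i, j). (i + j, i)"]) auto
  have "((\<lambda>(k, i). f x r (i, k - i)) has_sum (exp (- x * r / (1 - r)) / (1 - r) ^ (d + 1))) (SIGMA k:UNIV. {..k})"
    using has_sum_reindex_bij_betw[OF bij, of "f x r"] tot by (simp add: split_beta')
  then have "((\<lambda>k. \<Sum>i\<le>k. f x r (i, k - i)) has_sum (exp (- x * r / (1 - r)) / (1 - r) ^ (d + 1))) UNIV"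
    by (rule has_sum_SigmaD) (auto intro!: has_sum_finite)
  then have "(\<lambda>k. \<Sum>i\<le>k. f x r (i, k - i)) sums (exp (- x * r / (1 - r)) / (1 - r) ^ (d + 1))"
    by (rule has_sum_imp_sums)
  moreover have "(\<Sum>i\<le>k. f x r (i, k - i)) = r ^ k * poly (laguerre k d) x" for k
    unfolding poly_laguerre sum_distrib_left by (intro sum.cong) (auto simp: f_def)
  ultimately show ?thesis by simp
qed

lemma abs_poly_laguerre_le: "\<bar>poly (laguerre k d) x\<bar> \<le> poly (laguerre k d) (- \<bar>x\<bar>)"
  unfolding poly_laguerre by (rule order_trans[OF sum_abs]) (simp add: abs_mult power_abs)

lemma power_series_unique:
  fixes a b :: "nat \<Rightarrow> complex"
  assumes e: "e > 0"
    and a: "\<And>r::real. \<bar>r\<bar> < e \<Longrightarrow> (\<lambda>k. of_real (r ^ k) * a k) sums S r"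
    and b: "\<And>r::real. \<bar>r\<bar> < e \<Longrightarrow> (\<lambda>k. of_real (r ^ k) * b k) sums S r"
  shows "a = b"
proof -
  have key: "c = (\<lambda>_. 0)" if c: "\<And>r::real. \<bar>r\<bar> < e \<Longrightarrow> (\<lambda>k. c k * r ^ k) sums 0" for c :: "nat \<Rightarrow> real"
  proof
    fix k show "c k = 0"
    proof (induction k rule: less_induct)
      case (less k)
      have "(\<lambda>j. c (j + k) * r ^ j) sums 0" if r: "r \<noteq> 0" "norm r < e" for r
      proof -
        have "(\<lambda>j. c (j + k) * r ^ (j + k)) sums (0 - (\<Sum>i<k. c i * r ^ i))"
          using sums_split_initial_segment[OF c[of r], of k] r by simp
        then have "(\<lambda>j. c (j + k) * r ^ (j + k) / r ^ k) sums (0 / r ^ k)"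
          using less by (intro sums_divide) simp
        then show ?thesis using r by (simp add: power_add)
      qed
      then have "((\<lambda>_. 0) \<longlongrightarrow> c (0 + k)) (at (0::real))"
        using powser_limit_0_strong[of e "\<lambda>j. c (j + k)" "\<lambda>_. 0"] e by simp
      then show ?case using LIM_unique[of "\<lambda>_. 0::real" "c k" 0 0] by simp
    qed
  qed
  have d: "(\<lambda>k. of_real (r ^ k) * (a k - b k)) sums 0" if "\<bar>r\<bar> < e" for r
    using sums_diff[OF a[OF that] b[OF that]] by (simp add: algebra_simps)
  have "(\<lambda>k. Re (a k - b k)) = (\<lambda>_. 0)"
    by (rule key) (use sums_Re[OF d] in \<open>simp add: mult.commute\<close>)
  moreover have "(\<lambda>k. Im (a k - b k)) = (\<lambda>_. 0)"
    by (rule key) (use sums_Im[OF d] in \<open>simp add: mult.commute\<close>)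
  ultimately show ?thesis by (auto simp: fun_eq_iff complex_eq_iff)
qed

text \<open>The generating function \<open>\<Sum>\<^sub>k r\<^sup>k \<phi>\<^sub>k\<close> of the Laguerre functions.\<close>

definition lag_gauss :: "real \<Rightarrow> real \<Rightarrow> complex ^ 'n::finite \<Rightarrow> real" where
  "lag_gauss r l z = exp (- (\<bar>l\<bar> / 4 * ((1 + r) / (1 - r))) * (norm z)\<^sup>2) / (1 - r) ^ CARD('n)"

lemma laguerre_fun_generating:
  fixes z :: "complex ^ 'n::finite"
  assumes r: "\<bar>r\<bar> < 1"
  shows "(\<lambda>k. r ^ k * laguerre_fun k l z) sums lag_gauss r l z"
proof -
  let ?y = "\<bar>l\<bar> / 4 * (norm z)\<^sup>2"
  have n: "CARD('n) - 1 + 1 = CARD('n)" using zero_less_card_finite[where 'a='n] by linarith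
  have "(\<lambda>k. r ^ k * poly (laguerre k (CARD('n) - 1)) (2 * ?y) * exp (- ?y)) sums
     (exp (- (2 * ?y) * r / (1 - r)) / (1 - r) ^ CARD('n) * exp (- ?y))"
    using sums_mult2[OF laguerre_generating_function[OF r, of "CARD('n) - 1" "2 * ?y"]] unfolding n .
  moreover have "exp (- (2 * ?y) * r / (1 - r)) * exp (- ?y) = exp (- (\<bar>l\<bar> / 4 * ((1 + r) / (1 - r))) * (norm z)\<^sup>2)"
    unfolding exp_add[symmetric] using r by (intro arg_cong[of _ _ exp]) (simp add: field_simps)
  ultimately show ?thesis
    by (simp add: laguerre_fun_def lag_gauss_def mult_ac)
qed

lemma laguerre_fun_minus [simp]: "laguerre_fun k l (- z) = laguerre_fun k l z"
  and lag_gauss_minus [simp]: "lag_gauss r l (- z) = lag_gauss r l z"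
  by (simp_all add: laguerre_fun_def lag_gauss_def)

lemma laguerre_fun_minus_commute: "laguerre_fun k l (w - z) = laguerre_fun k l (z - w)"
  by (metis laguerre_fun_minus minus_diff_eq)

lemma laguerre_fun_partial_sum_bound:
  fixes z :: "complex ^ 'n::finite"
  assumes r: "\<bar>r\<bar> \<le> 1 / 4"
  shows "(\<Sum>k<N. \<bar>r\<bar> ^ k * \<bar>laguerre_fun k l z\<bar>) \<le> (4 / 3) ^ CARD('n) * exp (- (\<bar>l\<bar> / 12) * (norm z)\<^sup>2)"
proof -
  let ?y = "\<bar>l\<bar> / 4 * (norm z)\<^sup>2" and ?d = "CARD('n) - 1"
  have n: "CARD('n) - 1 + 1 = CARD('n)" using zero_less_card_finite[where 'a='n] by linarith
  have y: "?y \<ge> 0" by simp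
  have s: "(\<lambda>k. (1/4) ^ k * poly (laguerre k ?d) (- (2 * ?y))) sums
     (exp (2 * ?y * (1 / 4) / (1 - 1 / 4)) / (1 - 1 / 4) ^ CARD('n))"
    using laguerre_generating_function[of "1/4" ?d "- (2 * ?y)"] unfolding n by simp
  have nonneg: "poly (laguerre k ?d) (- (2 * ?y)) \<ge> 0" for k
    using abs_poly_laguerre_le[of k ?d "2 * ?y"] abs_ge_zero[of "poly (laguerre k ?d) (2 * ?y)"] by simp
  have "(\<Sum>k<N. \<bar>r\<bar> ^ k * \<bar>laguerre_fun k l z\<bar>) \<le> (\<Sum>k<N. (1/4) ^ k * poly (laguerre k ?d) (- (2 * ?y))) * exp (- ?y)"
    unfolding sum_distrib_right
  proof (intro sum_mono)
    fix k
    have "\<bar>laguerre_fun k l z\<bar> \<le> poly (laguerre k ?d) (- (2 * ?y)) * exp (- ?y)"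
      using abs_poly_laguerre_le[of k ?d "2 * ?y"] by (simp add: laguerre_fun_def abs_mult)
    then show "\<bar>r\<bar> ^ k * \<bar>laguerre_fun k l z\<bar> \<le> (1/4) ^ k * poly (laguerre k ?d) (- (2 * ?y)) * exp (- ?y)"
      unfolding mult.assoc using r nonneg by (intro mult_mono power_mono) auto
  qed
  also have "\<dots> \<le> (exp (2 * ?y * (1 / 4) / (1 - 1 / 4)) / (1 - 1 / 4) ^ CARD('n)) * exp (- ?y)"
    using nonneg by (intro mult_right_mono sum_le_suminf[OF sums_summable[OF s], unfolded sums_unique[OF s, symmetric]]) auto
  also have "\<dots> = (4 / 3) ^ CARD('n) * (exp (2 * ?y * (1 / 4) / (1 - 1 / 4)) * exp (- ?y))"
    by (simp add: power_divide)
  also have "exp (2 * ?y * (1 / 4) / (1 - 1 / 4)) * exp (- ?y) = exp (- (\<bar>l\<bar> / 12) * (norm z)\<^sup>2)"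
    unfolding exp_add[symmetric] by (intro arg_cong[of _ _ exp]) (simp add: field_simps)
  finally show ?thesis .
qed

lemma laguerre_fun_gauss_bound:
  fixes z :: "complex ^ 'n::finite"
  shows "\<bar>laguerre_fun k l z\<bar> \<le> 4 ^ k * (4 / 3) ^ CARD('n) * exp (- (\<bar>l\<bar> / 12) * (norm z)\<^sup>2)"
proof -
  have "(1/4) ^ k * \<bar>laguerre_fun k l z\<bar> \<le> (\<Sum>k<Suc k. \<bar>1/4\<bar> ^ k * \<bar>laguerre_fun k l z\<bar>)"
    by (simp add: sum_nonneg)
  also have "\<dots> \<le> (4 / 3) ^ CARD('n) * exp (- (\<bar>l\<bar> / 12) * (norm z)\<^sup>2)"
    by (rule laguerre_fun_partial_sum_bound) simp
  finally show ?thesis by (simp add: power_divide field_simps)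
qed

lemma continuous_laguerre_fun: "continuous_on UNIV (\<lambda>(l, z). laguerre_fun k l z)"
  unfolding laguerre_fun_def split_beta' by (intro continuous_intros)

lemma measurable_laguerre_fun [measurable (raw)]:
  fixes g :: "'a \<Rightarrow> complex ^ 'n::finite"
  assumes "f \<in> borel_measurable M" "g \<in> borel_measurable M"
  shows "(\<lambda>x. laguerre_fun k (f x) (g x)) \<in> borel_measurable M"
  by (rule borel_measurable_continuous_Pair[OF assms continuous_laguerre_fun[unfolded split_beta']])

lemma measurable_lag_gauss [measurable]: "lag_gauss r l \<in> borel_measurable borel"
  unfolding lag_gauss_def by measurable

subsection \<open>Twisted convolution with Laguerre functions\<close>

definition rot :: "complex ^ 'n::finite \<Rightarrow> complex ^ 'n" where
  "rot w = (\<chi> i. \<i> * w $ i)"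

lemma Im_sum_cnj_eq_inner_rot:
  fixes z w :: "complex ^ 'n::finite"
  shows "Im (\<Sum>i\<in>UNIV. z $ i * cnj (w $ i)) = z \<bullet> rot w"
  by (simp add: inner_vec_def inner_complex_def rot_def algebra_simps)

lemma rot_add: "rot (a + b) = rot a + rot b"
  and rot_diff: "rot (a - b) = rot a - rot b"
  and rot_scaleR: "rot (c *\<^sub>R a) = c *\<^sub>R rot a"
  by (simp_all add: rot_def vec_eq_iff algebra_simps)

lemma norm_rot [simp]: "norm (rot w) = norm w"
  by (simp add: norm_vec_def rot_def norm_mult)

lemma inner_rot_commute: "z \<bullet> rot w = - (w \<bullet> rot z)"
  by (simp add: inner_vec_def inner_complex_def rot_def algebra_simps flip: sum_negf)

lemma inner_rot_self [simp]: "w \<bullet> rot w = 0"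
  using inner_rot_commute[of w w] by simp

lemma continuous_rot [continuous_intros]: "continuous_on S f \<Longrightarrow> continuous_on S (\<lambda>x. rot (f x))"
  by (rule continuous_on_compose2[OF linear_continuous_on[of rot UNIV]])
     (auto simp: linear_conv_bounded_linear[symmetric] linear_iff rot_add rot_scaleR)

lemma measurable_rot [measurable]: "rot \<in> borel_measurable borel"
  by (intro borel_measurable_continuous_onI continuous_intros)

lemma DIM_complex_vec: "DIM(complex ^ 'n::finite) = 2 * CARD('n)"
  by simp

lemma lag_gauss_twist:
  fixes w :: "complex ^ 'n::finite"
  assumes l: "l \<noteq> 0" and r: "\<bar>r\<bar> < 1" and s: "\<bar>s\<bar> < 1"
  shows "(LINT z|lborel. (of_real (lag_gauss s l z) * cis (- (l / 2) * (z \<bullet> rot w))) * of_real (lag_gauss r l (w - z)))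
    = of_real ((2 * pi / \<bar>l\<bar>) ^ CARD('n) * lag_gauss (r * s) l w)"
proof -
  let ?n = "CARD('n)"
  define A where "A = \<bar>l\<bar>"
  have A: "A > 0" "l\<^sup>2 = A\<^sup>2" using l by (auto simp: A_def)
  have rs: "r < 1" "s < 1" "- 1 < r" "- 1 < s" using r s by auto
  have rs1: "r * s < 1" using abs_mult_less[OF r s] by (simp add: abs_less_iff flip: abs_mult)
  define a where "a = A / 4 * ((1 + s) / (1 - s))"
  define b where "b = A / 4 * ((1 + r) / (1 - r))"
  have ab: "a > 0" "b > 0" using A rs by (auto simp: a_def b_def)
  let ?u = "(2 * b) *\<^sub>R w" and ?v = "(- (l / 2)) *\<^sub>R rot w"
  have uv: "?u \<bullet> ?v = 0" by simp
  define K where "K = exp (- b * (norm w)\<^sup>2) / ((1 - s) ^ ?n * (1 - r) ^ ?n)"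
  have "(of_real (lag_gauss s l z) * cis (- (l / 2) * (z \<bullet> rot w))) * of_real (lag_gauss r l (w - z))
     = of_real K * (of_real (exp (- (a + b) * (norm z)\<^sup>2 + z \<bullet> ?u)) * cis (z \<bullet> ?v))" for z
  proof -
    have "lag_gauss s l z * lag_gauss r l (w - z) = (exp (- a * (norm z)\<^sup>2) * exp (- b * (norm (w - z))\<^sup>2)) / ((1 - s) ^ ?n * (1 - r) ^ ?n)"
      by (simp add: lag_gauss_def a_def b_def A_def)
    also have "exp (- a * (norm z)\<^sup>2) * exp (- b * (norm (w - z))\<^sup>2) = exp (- b * (norm w)\<^sup>2) * exp (- (a + b) * (norm z)\<^sup>2 + z \<bullet> ?u)"
      unfolding exp_add[symmetric] power2_norm_eq_inner inner_diff_left inner_diff_right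
      by (intro arg_cong[of _ _ exp]) (simp add: algebra_simps inner_commute)
    finally have "lag_gauss s l z * lag_gauss r l (w - z) = K * exp (- (a + b) * (norm z)\<^sup>2 + z \<bullet> ?u)"
      by (simp add: K_def)
    then have 1: "complex_of_real (lag_gauss s l z) * of_real (lag_gauss r l (w - z)) = of_real K * of_real (exp (- (a + b) * (norm z)\<^sup>2 + z \<bullet> ?u))"
      by (simp only: of_real_mult[symmetric])
    have 2: "- (l / 2) * (z \<bullet> rot w) = z \<bullet> ?v" by simp
    have "(of_real (lag_gauss s l z) * cis (- (l / 2) * (z \<bullet> rot w))) * of_real (lag_gauss r l (w - z))
      = (complex_of_real (lag_gauss s l z) * of_real (lag_gauss r l (w - z))) * cis (- (l / 2) * (z \<bullet> rot w))"
      by (simp only: mult_ac)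
    then show ?thesis unfolding 1 2 by (simp only: mult.assoc)
  qed
  then have "(LINT z|lborel. (of_real (lag_gauss s l z) * cis (- (l / 2) * (z \<bullet> rot w))) * of_real (lag_gauss r l (w - z)))
     = of_real K * (LINT z|lborel. of_real (exp (- (a + b) * (norm z)\<^sup>2 + z \<bullet> ?u)) * cis (z \<bullet> ?v))"
    by (simp only: integral_mult_right_zero)
  also have "\<dots> = of_real (K * (sqrt (pi / (a + b)) ^ DIM(complex ^ 'n) * exp (((norm ?u)\<^sup>2 - (norm ?v)\<^sup>2) / (4 * (a + b)))))"
    using gauss_fourier_tilted[of "a + b", OF _ uv] ab by simp
  also have "K * (sqrt (pi / (a + b)) ^ DIM(complex ^ 'n) * exp (((norm ?u)\<^sup>2 - (norm ?v)\<^sup>2) / (4 * (a + b))))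
     = (2 * pi / A) ^ ?n * lag_gauss (r * s) l w"
  proof -
    have a1: "a * (1 - s) = A / 4 * (1 + s)" and b1: "b * (1 - r) = A / 4 * (1 + r)"
    proof -
      have "A / 4 * ((1 + x) / (1 - x)) * (1 - x) = A / 4 * (1 + x)" if "x < 1" for x
        using that by (simp add: divide_simps)
      then show "a * (1 - s) = A / 4 * (1 + s)" "b * (1 - r) = A / 4 * (1 + r)"
        unfolding a_def b_def using rs by blast+
    qed
    have "(a + b) * ((1 - s) * (1 - r)) = (a * (1 - s)) * (1 - r) + (b * (1 - r)) * (1 - s)"
      by (simp add: algebra_simps)
    then have s1: "(a + b) * ((1 - s) * (1 - r)) = A * (1 - r * s) / 2"
      unfolding a1 b1 by (simp add: field_simps)
    have s2: "a * b + A\<^sup>2 / 16 = A / 4 * ((1 + r * s) / (1 - r * s)) * (a + b)"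
    proof -
      have "(a * b + A\<^sup>2 / 16) * ((1 - s) * (1 - r)) = A\<^sup>2 / 8 * (1 + r * s)"
      proof -
        have "(a * b + A\<^sup>2 / 16) * ((1 - s) * (1 - r)) = (a * (1 - s)) * (b * (1 - r)) + A\<^sup>2 / 16 * ((1 - s) * (1 - r))"
          by (simp add: algebra_simps)
        then show ?thesis unfolding a1 b1 by (simp add: field_simps power2_eq_square)
      qed
      also have "\<dots> = A / 4 * ((1 + r * s) / (1 - r * s)) * (A * (1 - r * s) / 2)"
      proof -
        have "A / 4 * ((1 + x) / (1 - x)) * (A * (1 - x) / 2) = A\<^sup>2 / 8 * (1 + x)" if "x < 1" for x
          using that by (simp add: divide_simps power2_eq_square)
        then show ?thesis using rs1 by simp
      qed
      also have "\<dots> = A / 4 * ((1 + r * s) / (1 - r * s)) * (a + b) * ((1 - s) * (1 - r))"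
        unfolding s1[symmetric] by simp
      finally have "(a * b + A\<^sup>2 / 16) * ((1 - s) * (1 - r)) = A / 4 * ((1 + r * s) / (1 - r * s)) * (a + b) * ((1 - s) * (1 - r))" .
      moreover have "(1 - s) * (1 - r) \<noteq> 0" using rs by simp
      ultimately show ?thesis by (rule mult_right_cancel[THEN iffD1, rotated])
    qed
    have e1: "sqrt (pi / (a + b)) ^ DIM(complex ^ 'n) = (pi / (a + b)) ^ ?n"
      unfolding DIM_complex_vec power_mult using ab by simp
    have e2: "((norm ?u)\<^sup>2 - (norm ?v)\<^sup>2) / (4 * (a + b)) = (b\<^sup>2 - A\<^sup>2 / 16) / (a + b) * (norm w)\<^sup>2"
      using ab A by (simp add: power_mult_distrib power_divide field_simps)
    have e3: "exp (- b * (norm w)\<^sup>2) * exp ((b\<^sup>2 - A\<^sup>2 / 16) / (a + b) * (norm w)\<^sup>2) = exp (- (A / 4 * ((1 + r * s) / (1 - r * s))) * (norm w)\<^sup>2)"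
    proof -
      have "- b + (b\<^sup>2 - A\<^sup>2 / 16) / (a + b) = - ((a * b + A\<^sup>2 / 16) / (a + b))"
        using ab by (simp add: field_simps power2_eq_square)
      also have "(a * b + A\<^sup>2 / 16) / (a + b) = A / 4 * ((1 + r * s) / (1 - r * s))"
        unfolding s2 using ab by simp
      finally show ?thesis unfolding exp_add[symmetric] distrib_right[symmetric] by simp
    qed
    have e4: "(pi / (a + b)) ^ ?n / ((1 - s) ^ ?n * (1 - r) ^ ?n) = (2 * pi / A) ^ ?n / (1 - r * s) ^ ?n"
    proof -
      have "pi / (a + b) / ((1 - s) * (1 - r)) = 2 * pi / A / (1 - r * s)"
        unfolding divide_divide_eq_left s1 by simp
      then show ?thesis by (simp flip: power_mult_distrib power_divide)
    qed
    have "X / M * (P * Y) = P / M * (X * Y)" for X M P Y :: real by simp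
    then show ?thesis
      unfolding K_def e1 e2 e3 e4 lag_gauss_def A_def[symmetric] by (simp only: e3 e4) simp
  qed
  finally show ?thesis by (simp add: A_def)
qed

lemma laguerre_fun_le_const:
  fixes z :: "complex ^ 'n::finite"
  shows "\<bar>laguerre_fun k l z\<bar> \<le> 4 ^ k * (4 / 3) ^ CARD('n)"
proof -
  have "4 ^ k * (4 / 3) ^ CARD('n) * exp (- (\<bar>l\<bar> / 12) * (norm z)\<^sup>2) \<le> 4 ^ k * (4 / 3) ^ CARD('n) * (1::real)"
    by (intro mult_left_mono) auto
  with laguerre_fun_gauss_bound[of k l z] show ?thesis by linarith
qed

lemma integrable_mult_laguerre_fun:
  fixes h :: "complex ^ 'n::finite \<Rightarrow> complex"
  assumes [measurable]: "h \<in> borel_measurable borel" and h: "\<And>z. norm (h z) \<le> B" and l: "l \<noteq> 0"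
  shows "integrable lborel (\<lambda>z. h z * of_real (laguerre_fun k l (w - z)))"
proof -
  let ?c = "B * (4 ^ k * (4 / 3) ^ CARD('n))"
  have "integrable lborel (\<lambda>z::complex ^ 'n. exp (- (\<bar>l\<bar> / 12) * (norm z)\<^sup>2))"
    using l by (intro gauss_integrable) auto
  then have "integrable lborel (\<lambda>z::complex ^ 'n. exp (- (\<bar>l\<bar> / 12) * (norm (w - z))\<^sup>2))"
    by (subst lborel_integrable_reflect_iff[of "\<lambda>z. exp (- (\<bar>l\<bar> / 12) * (norm z)\<^sup>2)" w]) auto
  then have "integrable lborel (\<lambda>z::complex ^ 'n. ?c * exp (- (\<bar>l\<bar> / 12) * (norm (w - z))\<^sup>2))"
    by (rule integrable_mult_right)
  then show ?thesis
  proof (rule Bochner_Integration.integrable_bound)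
    have "norm (h z * of_real (laguerre_fun k l (w - z))) \<le> ?c * exp (- (\<bar>l\<bar> / 12) * (norm (w - z))\<^sup>2)" for z
      unfolding norm_mult mult.assoc[of B] norm_of_real using order_trans[OF norm_ge_zero h[of z]]
      by (intro mult_mono laguerre_fun_gauss_bound h) auto
    then show "AE z in lborel. norm (h z * of_real (laguerre_fun k l (w - z))) \<le> norm (?c * exp (- (\<bar>l\<bar> / 12) * (norm (w - z))\<^sup>2))"
      by (auto intro!: AE_I2 order_trans[OF _ abs_ge_self])
  qed measurable
qed

lemma laguerre_fun_generating_integral:
  fixes h :: "complex ^ 'n::finite \<Rightarrow> complex"
  assumes hm [measurable]: "h \<in> borel_measurable borel" and h: "\<And>z. norm (h z) \<le> B" and l: "l \<noteq> 0" and r: "\<bar>r\<bar> \<le> 1 / 4"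
  shows "(\<lambda>k. of_real (r ^ k) * (LINT z|lborel. h z * of_real (laguerre_fun k l (w - z)))) sums
    (LINT z|lborel. h z * of_real (lag_gauss r l (w - z)))"
proof -
  let ?c = "B * (4 / 3) ^ CARD('n)"
  let ?P = "\<lambda>N z. h z * of_real (\<Sum>k<N. r ^ k * laguerre_fun k l (w - z))"
  have B: "B \<ge> 0" using h[of 0] norm_ge_zero order_trans by blast
  have "integrable lborel (\<lambda>z::complex ^ 'n. exp (- (\<bar>l\<bar> / 12) * (norm z)\<^sup>2))"
    using l by (intro gauss_integrable) auto
  then have "integrable lborel (\<lambda>z::complex ^ 'n. exp (- (\<bar>l\<bar> / 12) * (norm (w - z))\<^sup>2))"
    by (subst lborel_integrable_reflect_iff[of "\<lambda>z. exp (- (\<bar>l\<bar> / 12) * (norm z)\<^sup>2)" w]) auto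
  then have int: "integrable lborel (\<lambda>z::complex ^ 'n. ?c * exp (- (\<bar>l\<bar> / 12) * (norm (w - z))\<^sup>2))"
    by (rule integrable_mult_right)
  have "(\<lambda>N. LINT z|lborel. ?P N z) \<longlonglongrightarrow> (LINT z|lborel. h z * of_real (lag_gauss r l (w - z)))"
  proof (rule integral_dominated_convergence[OF _ _ int])
    have "(\<lambda>N. \<Sum>k<N. r ^ k * laguerre_fun k l (w - z)) \<longlonglongrightarrow> lag_gauss r l (w - z)" for z
      using laguerre_fun_generating[of r l "w - z"] r unfolding sums_def by simp
    then show "AE z in lborel. (\<lambda>N. ?P N z) \<longlonglongrightarrow> h z * of_real (lag_gauss r l (w - z))"
      by (intro AE_I2 tendsto_mult tendsto_const tendsto_of_real)
    have "norm (?P N z) \<le> ?c * exp (- (\<bar>l\<bar> / 12) * (norm (w - z))\<^sup>2)" for N z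
    proof -
      have "\<bar>\<Sum>k<N. r ^ k * laguerre_fun k l (w - z)\<bar> \<le> (\<Sum>k<N. \<bar>r\<bar> ^ k * \<bar>laguerre_fun k l (w - z)\<bar>)"
        by (rule order_trans[OF sum_abs]) (simp add: abs_mult power_abs)
      also have "\<dots> \<le> (4 / 3) ^ CARD('n) * exp (- (\<bar>l\<bar> / 12) * (norm (w - z))\<^sup>2)"
        by (rule laguerre_fun_partial_sum_bound[OF r])
      finally show ?thesis
        unfolding norm_mult mult.assoc norm_of_real using B by (intro mult_mono h) auto
    qed
    then show "AE z in lborel. norm (?P N z) \<le> ?c * exp (- (\<bar>l\<bar> / 12) * (norm (w - z))\<^sup>2)" for N
      by (intro AE_I2)
  qed measurable
  moreover have "(LINT z|lborel. ?P N z) = (\<Sum>k<N. of_real (r ^ k) * (LINT z|lborel. h z * of_real (laguerre_fun k l (w - z))))" for N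
  proof -
    have "(LINT z|lborel. ?P N z) = (LINT z|lborel. (\<Sum>k<N. of_real (r ^ k) * (h z * of_real (laguerre_fun k l (w - z)))))"
      by (intro Bochner_Integration.integral_cong refl) (simp add: sum_distrib_left mult_ac)
    also have "\<dots> = (\<Sum>k<N. LINT z|lborel. of_real (r ^ k) * (h z * of_real (laguerre_fun k l (w - z))))"
      by (intro Bochner_Integration.integral_sum integrable_mult_right integrable_mult_laguerre_fun[OF hm h l])
    finally show ?thesis by simp
  qed
  ultimately show ?thesis unfolding sums_def by simp
qed

lemma lag_gauss_bound:
  fixes z :: "complex ^ 'n::finite"
  assumes "\<bar>r\<bar> < 1"
  shows "0 \<le> lag_gauss r l z" "lag_gauss r l z \<le> 1 / (1 - r) ^ CARD('n)"
proof -
  have "r < 1" "- 1 < r" using assms by auto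
  then show "0 \<le> lag_gauss r l z" "lag_gauss r l z \<le> 1 / (1 - r) ^ CARD('n)"
    by (auto simp: lag_gauss_def intro!: divide_right_mono)
qed

lemma lag_gauss_twist_laguerre:
  fixes w :: "complex ^ 'n::finite"
  assumes l: "l \<noteq> 0" and s: "\<bar>s\<bar> < 1"
  shows "(LINT z|lborel. (of_real (lag_gauss s l z) * cis (- (l / 2) * (z \<bullet> rot w))) * of_real (laguerre_fun k l (w - z)))
    = of_real ((2 * pi / \<bar>l\<bar>) ^ CARD('n) * s ^ k * laguerre_fun k l w)"
proof -
  let ?h = "\<lambda>z. of_real (lag_gauss s l z) * cis (- (l / 2) * (z \<bullet> rot w))"
  let ?C = "(2 * pi / \<bar>l\<bar>) ^ CARD('n)"
  have "(\<lambda>k. LINT z|lborel. ?h z * of_real (laguerre_fun k l (w - z))) = (\<lambda>k. of_real (?C * s ^ k * laguerre_fun k l w))"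
  proof (rule power_series_unique[of "1 / 4" _ "\<lambda>r. of_real (?C * lag_gauss (r * s) l w)"])
    fix r :: real assume r: "\<bar>r\<bar> < 1 / 4"
    have "norm (?h z) \<le> 1 / (1 - s) ^ CARD('n)" for z
      using lag_gauss_bound[OF s, of l z] by (simp add: norm_mult)
    from laguerre_fun_generating_integral[where h = ?h, OF _ this l, where r = r and w = w]
    show "(\<lambda>k. of_real (r ^ k) * (LINT z|lborel. ?h z * of_real (laguerre_fun k l (w - z)))) sums of_real (?C * lag_gauss (r * s) l w)"
      using r lag_gauss_twist[OF l _ s, of r w] by simp
    have "\<bar>r * s\<bar> < 1" using r abs_mult_less[of r 1 s 1] s by (simp add: abs_mult)
    from sums_of_real[where 'a = complex, OF sums_mult[OF laguerre_fun_generating[OF this, of l w], of ?C]]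
    show "(\<lambda>k. of_real (r ^ k) * of_real (?C * s ^ k * laguerre_fun k l w)) sums (of_real (?C * lag_gauss (r * s) l w) :: complex)"
      by (simp add: power_mult_distrib mult_ac)
  qed simp
  then show ?thesis by meson
qed

lemma laguerre_twist:
  fixes w :: "complex ^ 'n::finite"
  assumes l: "l \<noteq> 0"
  shows "(LINT z|lborel. (of_real (laguerre_fun k l z) * cis (- (l / 2) * (z \<bullet> rot w))) * of_real (laguerre_fun k l (w - z)))
    = of_real ((2 * pi / \<bar>l\<bar>) ^ CARD('n) * laguerre_fun k l w)"
proof -
  let ?C = "(2 * pi / \<bar>l\<bar>) ^ CARD('n)"
  let ?h = "\<lambda>z. cis (- (l / 2) * (z \<bullet> rot w)) * of_real (laguerre_fun k l (w - z))"
  let ?c = "\<lambda>j. if j = k then complex_of_real (?C * laguerre_fun k l w) else 0"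
  have "(\<lambda>j. LINT z|lborel. ?h z * of_real (laguerre_fun j l (0 - z))) = ?c"
  proof (rule power_series_unique[of "1 / 4" _ "\<lambda>r. of_real (?C * r ^ k * laguerre_fun k l w)"])
    fix r :: real assume r: "\<bar>r\<bar> < 1 / 4"
    have "norm (?h z) \<le> 4 ^ k * (4 / 3) ^ CARD('n)" for z
      using laguerre_fun_le_const[of k l "w - z"] by (simp add: norm_mult)
    from laguerre_fun_generating_integral[where h = ?h, OF _ this l, where r = r and w = 0]
    show "(\<lambda>j. of_real (r ^ j) * (LINT z|lborel. ?h z * of_real (laguerre_fun j l (0 - z)))) sums of_real (?C * r ^ k * laguerre_fun k l w)"
      using r lag_gauss_twist_laguerre[OF l, of r w k] by (simp add: mult_ac)
    have "(\<lambda>j. of_real (r ^ j) * ?c j) = (\<lambda>j. if j = k then of_real (?C * r ^ k * laguerre_fun k l w) else 0)"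
      by auto
    then show "(\<lambda>j. of_real (r ^ j) * ?c j) sums (of_real (?C * r ^ k * laguerre_fun k l w))"
      using sums_single[of k "\<lambda>_. complex_of_real (?C * r ^ k * laguerre_fun k l w)"] by simp
  qed simp
  then have "(LINT z|lborel. ?h z * of_real (laguerre_fun k l (0 - z))) = of_real (?C * laguerre_fun k l w)"
    by (simp only: fun_eq_iff if_True simp_thms)
  then show ?thesis by (simp add: mult_ac)
qed

lemma fan_const_pos: "fan_const n k > 0"
  by (simp add: fan_const_def)

lemma fan_const_le_1:
  assumes "n > 0"
  shows "fan_const n k \<le> 1"
proof -
  obtain d where d: "n = Suc d" using assms gr0_conv_Suc by blast
  have "0 < (k + d) choose k" by simp
  then have "1 \<le> real ((k + d) choose k)" by linarith
  then show ?thesis by (simp add: d fan_const_def binomial_fact le_divide_eq divide_le_eq)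
qed

lemma laguerre_fun_0: "laguerre_fun k l (0 :: complex ^ 'n::finite) = 1 / fan_const CARD('n) k"
proof -
  obtain d where d: "CARD('n) = Suc d" using zero_less_card_finite[where 'a='n] gr0_conv_Suc by blast
  have "poly (laguerre k d) 0 = real ((k + d) choose k)"
    unfolding poly_0_coeff_0 coeff_laguerre by simp
  then show ?thesis by (simp add: laguerre_fun_def d fan_const_def binomial_fact)
qed

lemma laguerre_fun_sq_integral:
  assumes l: "l \<noteq> 0"
  shows "integrable lborel (\<lambda>z::complex ^ 'n::finite. (laguerre_fun k l z)\<^sup>2)"
    and "(LINT z|lborel. (laguerre_fun k l (z::complex ^ 'n))\<^sup>2) = (2 * pi / \<bar>l\<bar>) ^ CARD('n) / fan_const CARD('n) k"
proof -
  have "norm (complex_of_real (laguerre_fun k l z)) \<le> 4 ^ k * (4 / 3) ^ CARD('n)" for z :: "complex ^ 'n"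
    using laguerre_fun_le_const[of k l z] by simp
  from integrable_mult_laguerre_fun[where h = "\<lambda>z. complex_of_real (laguerre_fun k l z)", OF _ this l, where k = k and w = 0]
  have 1: "integrable lborel (\<lambda>z::complex ^ 'n. complex_of_real ((laguerre_fun k l z)\<^sup>2))"
    by (simp add: power2_eq_square)
  show "integrable lborel (\<lambda>z::complex ^ 'n. (laguerre_fun k l z)\<^sup>2)"
    using integrable_norm[OF 1] by (simp add: norm_power)
  have "complex_of_real (LINT z|lborel. (laguerre_fun k l (z::complex ^ 'n))\<^sup>2) = of_real ((2 * pi / \<bar>l\<bar>) ^ CARD('n) * (1 / fan_const CARD('n) k))"
    unfolding integral_complex_of_real[symmetric]
    using laguerre_twist[OF l, of k "0 :: complex ^ 'n"] by (simp add: laguerre_fun_0 power2_eq_square rot_def zero_vec_def[symmetric])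
  then show "(LINT z|lborel. (laguerre_fun k l (z::complex ^ 'n))\<^sup>2) = (2 * pi / \<bar>l\<bar>) ^ CARD('n) / fan_const CARD('n) k"
    by (simp only: of_real_eq_iff) simp
qed

subsection \<open>Plancherel theorem for Laguerre expansions\<close>

lemma laguerre_fun_correlation:
  fixes a b :: "complex ^ 'n::finite"
  assumes l: "l \<noteq> 0"
  shows "integrable lborel (\<lambda>w. \<bar>laguerre_fun k l (w - a)\<bar> * \<bar>laguerre_fun k l (w - b)\<bar>)" (is ?A)
    and "(LINT w|lborel. \<bar>laguerre_fun k l (w - a)\<bar> * \<bar>laguerre_fun k l (w - b)\<bar>) \<le> (2 * pi / \<bar>l\<bar>) ^ CARD('n) / fan_const CARD('n) k" (is ?B)
proof -
  let ?p = "\<lambda>a w. laguerre_fun k l (w - a)"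
  have int: "integrable lborel (\<lambda>w. (?p a w)\<^sup>2)" for a :: "complex ^ 'n"
    using lborel_integrable_translate_iff[of "\<lambda>w::complex ^ 'n. (laguerre_fun k l w)\<^sup>2" "- a"] laguerre_fun_sq_integral(1)[OF l] by simp
  have val: "(LINT w|lborel. (?p a w)\<^sup>2) = (2 * pi / \<bar>l\<bar>) ^ CARD('n) / fan_const CARD('n) k" for a :: "complex ^ 'n"
    using lborel_integral_translate[of "\<lambda>w::complex ^ 'n. (laguerre_fun k l w)\<^sup>2" "- a"] laguerre_fun_sq_integral(2)[OF l, where 'n = 'n] by simp
  have le: "\<bar>?p a w\<bar> * \<bar>?p b w\<bar> \<le> 1/2 * (?p a w)\<^sup>2 + 1/2 * (?p b w)\<^sup>2" for w
    using sum_squares_bound[of "\<bar>?p a w\<bar>" "\<bar>?p b w\<bar>"] by simp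
  have int2: "integrable lborel (\<lambda>w. 1/2 * (?p a w)\<^sup>2 + 1/2 * (?p b w)\<^sup>2)"
    by (intro Bochner_Integration.integrable_add integrable_mult_right int)
  show ?A
    by (rule Bochner_Integration.integrable_bound[OF int2])
       (use le in \<open>auto intro!: AE_I2 order_trans[OF _ abs_ge_self]\<close>)
  then have "(LINT w|lborel. \<bar>?p a w\<bar> * \<bar>?p b w\<bar>) \<le> (LINT w|lborel. 1/2 * (?p a w)\<^sup>2 + 1/2 * (?p b w)\<^sup>2)"
    by (rule integral_mono[OF _ int2 le])
  also have "\<dots> = 1/2 * (LINT w|lborel. (?p a w)\<^sup>2) + 1/2 * (LINT w|lborel. (?p b w)\<^sup>2)"
    using Bochner_Integration.integral_add[OF integrable_mult_right[OF int[of a], of "1/2"] integrable_mult_right[OF int[of b], of "1/2"]] by simp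
  also have "\<dots> = (2 * pi / \<bar>l\<bar>) ^ CARD('n) / fan_const CARD('n) k"
    unfolding val by simp
  finally show ?B .
qed

lemma laguerre_fun_le:
  fixes w :: "complex ^ 'n::finite"
  assumes l: "l \<noteq> 0"
  shows "\<bar>laguerre_fun k l w\<bar> \<le> 1 / fan_const CARD('n) k"
proof -
  let ?C = "(2 * pi / \<bar>l\<bar>) ^ CARD('n)"
  have C: "?C > 0" using l by simp
  have "?C * \<bar>laguerre_fun k l w\<bar> = norm (of_real (?C * laguerre_fun k l w) :: complex)"
    using C by (simp only: norm_of_real abs_mult)
  also have "\<dots> \<le> (LINT z|lborel. norm ((of_real (laguerre_fun k l z) * cis (- (l / 2) * (z \<bullet> rot w))) * of_real (laguerre_fun k l (w - z))))"
    unfolding laguerre_twist[OF l, symmetric] by (rule integral_norm_bound)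
  also have "\<dots> = (LINT z|lborel. \<bar>laguerre_fun k l (z - 0)\<bar> * \<bar>laguerre_fun k l (z - w)\<bar>)"
    by (intro Bochner_Integration.integral_cong refl) (simp add: norm_mult laguerre_fun_minus_commute[of k l w])
  also have "\<dots> \<le> ?C * (1 / fan_const CARD('n) k)"
    using laguerre_fun_correlation(2)[OF l, of k 0 w] by simp
  finally show ?thesis using C by (simp only: mult_le_cancel_left_pos)
qed

definition tw_conv :: "(complex ^ 'n::finite \<Rightarrow> complex) \<Rightarrow> nat \<Rightarrow> real \<Rightarrow> complex ^ 'n \<Rightarrow> complex" where
  "tw_conv f k l w = (LINT z|lborel. f z * cis (- (l / 2) * (z \<bullet> rot w)) * of_real (laguerre_fun k l (w - z)))"

definition tw_form :: "(complex ^ 'n::finite \<Rightarrow> complex) \<Rightarrow> (complex ^ 'n \<Rightarrow> real) \<Rightarrow> real \<Rightarrow> complex" where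
  "tw_form f h l = (LINT x|lborel. LINT y|lborel. f x * cnj (f y) * cis (- (l / 2) * (x \<bullet> rot y)) * of_real (h (x - y)))"

lemma tw_form_integrable:
  fixes f :: "complex ^ 'n::finite \<Rightarrow> complex"
  assumes f: "integrable lborel f" and [measurable]: "h \<in> borel_measurable borel" and h: "\<And>z. \<bar>h z\<bar> \<le> B"
  shows "integrable (lborel \<Otimes>\<^sub>M lborel) (\<lambda>(x, y). f x * cnj (f y) * cis (- (l / 2) * (x \<bullet> rot y)) * of_real (h (x - y)))"
proof -
  have [measurable]: "f \<in> borel_measurable borel" using f by auto
  have "integrable (lborel \<Otimes>\<^sub>M lborel) (\<lambda>(x, y). norm (f x) * (B * norm (f y)))"
    by (intro integrable_prod_mult integrable_mult_right integrable_norm f)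
  then show ?thesis
  proof (rule Bochner_Integration.integrable_bound)
    have "norm (f x * cnj (f y) * cis (- (l / 2) * (x \<bullet> rot y)) * of_real (h (x - y))) \<le> \<bar>norm (f x) * (B * norm (f y))\<bar>" for x y
      using mult_left_mono[OF h[of "x - y"], of "norm (f x) * norm (f y)"]
      by (intro order_trans[OF _ abs_ge_self]) (simp add: norm_mult mult_ac)
    then show "AE p in lborel \<Otimes>\<^sub>M lborel. norm (case p of (x, y) \<Rightarrow> f x * cnj (f y) * cis (- (l / 2) * (x \<bullet> rot y)) * of_real (h (x - y)))
      \<le> norm (case p of (x, y) \<Rightarrow> norm (f x) * (B * norm (f y)))"
      by (intro AE_I2) (simp add: split_beta')
  qed measurable
qed

lemma tw_conv_energy:
  fixes f :: "complex ^ 'n::finite \<Rightarrow> complex"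
  assumes f: "integrable lborel f" and l: "l \<noteq> 0"
  shows "integrable lborel (\<lambda>w. (norm (tw_conv f k l w))\<^sup>2)"
    and "of_real (LINT w|lborel. (norm (tw_conv f k l w))\<^sup>2) = of_real ((2 * pi / \<bar>l\<bar>) ^ CARD('n)) * tw_form f (laguerre_fun k l) l"
proof -
  let ?C = "(2 * pi / \<bar>l\<bar>) ^ CARD('n)"
  let ?p = "laguerre_fun k l :: complex ^ 'n \<Rightarrow> real"
  let ?e = "\<lambda>z w. cis (- (l / 2) * (z \<bullet> rot w))"
  define H where "H p w = f (fst p) * cnj (f (snd p)) * (?e (fst p) w * cnj (?e (snd p) w)) * of_real (?p (w - fst p) * ?p (w - snd p))" for p w
  have fm [measurable]: "f \<in> borel_measurable borel" using f by auto
  have [measurable]: "?p \<in> borel_measurable borel" by measurable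
  have Hm [measurable]: "case_prod H \<in> borel_measurable (lborel \<Otimes>\<^sub>M lborel)"
    unfolding H_def split_beta' by measurable
  have nH: "norm (H p w) = norm (f (fst p)) * norm (f (snd p)) * (\<bar>?p (w - fst p)\<bar> * \<bar>?p (w - snd p)\<bar>)" for p w
    by (simp add: H_def norm_mult abs_mult)
  have Hint: "integrable (lborel \<Otimes>\<^sub>M lborel) (case_prod H)"
  proof (rule lborel_pair.Fubini_integrable[OF Hm])
    have "integrable (lborel \<Otimes>\<^sub>M lborel) (\<lambda>(x, y). norm (f x) * (?C / fan_const CARD('n) k * norm (f y)))"
      by (intro integrable_prod_mult integrable_mult_right integrable_norm f)
    then have b: "integrable lborel (\<lambda>p. norm (f (fst p)) * (?C / fan_const CARD('n) k * norm (f (snd p))))"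
      by (simp add: lborel_prod split_beta')
    show "integrable lborel (\<lambda>p. LINT w|lborel. norm (case (p, w) of (p, w) \<Rightarrow> H p w))"
    proof (rule Bochner_Integration.integrable_bound[OF b])
      show "AE p in lborel. norm (LINT w|lborel. norm (case (p, w) of (p, w) \<Rightarrow> H p w)) \<le> norm (norm (f (fst p)) * (?C / fan_const CARD('n) k * norm (f (snd p))))"
      proof (intro AE_I2)
        fix p :: "(complex ^ 'n) \<times> (complex ^ 'n)"
        have "(LINT w|lborel. norm (H p w)) \<le> norm (f (fst p)) * norm (f (snd p)) * (?C / fan_const CARD('n) k)"
          unfolding nH by (simp del: times_divide_eq_right times_divide_eq_left) (intro mult_left_mono laguerre_fun_correlation(2)[OF l], simp)
        then show "norm (LINT w|lborel. norm (case (p, w) of (p, w) \<Rightarrow> H p w)) \<le> norm (norm (f (fst p)) * (?C / fan_const CARD('n) k * norm (f (snd p))))"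
          using fan_const_pos[of "CARD('n)" k] by (simp add: mult_ac integral_nonneg_AE)
      qed
    qed measurable
    show "AE p in lborel. integrable lborel (\<lambda>w. case (p, w) of (p, w) \<Rightarrow> H p w)"
    proof (intro AE_I2)
      fix p :: "(complex ^ 'n) \<times> (complex ^ 'n)"
      have "integrable lborel (\<lambda>w. norm (f (fst p)) * norm (f (snd p)) * (\<bar>?p (w - fst p)\<bar> * \<bar>?p (w - snd p)\<bar>))"
        by (intro integrable_mult_right laguerre_fun_correlation(1)[OF l])
      then show "integrable lborel (\<lambda>w. case (p, w) of (p, w) \<Rightarrow> H p w)"
      proof (rule Bochner_Integration.integrable_bound)
        show "(\<lambda>w. case (p, w) of (p, w) \<Rightarrow> H p w) \<in> borel_measurable lborel"
          unfolding H_def prod.case by measurable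
      qed (auto simp: nH intro!: AE_I2)
    qed
  qed
  have sq: "of_real ((norm (tw_conv f k l w))\<^sup>2) = (LINT p|lborel. H p w)" for w
  proof -
    have F: "integrable lborel (\<lambda>z. f z * ?e z w * of_real (?p (w - z)))"
    proof (rule Bochner_Integration.integrable_bound[OF integrable_mult_right[OF integrable_norm[OF f], of "1 / fan_const CARD('n) k"]])
      show "AE z in lborel. norm (f z * ?e z w * of_real (?p (w - z))) \<le> norm (1 / fan_const CARD('n) k * norm (f z))"
        using fan_const_pos[of "CARD('n)" k] laguerre_fun_le[OF l]
        by (intro AE_I2) (auto simp: norm_mult mult.commute[of "norm (f _)"] intro!: mult_right_mono simp del: times_divide_eq_left)
    qed measurable
    have F': "integrable lborel (\<lambda>z. cnj (f z * ?e z w * of_real (?p (w - z))))"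
      using F by (rule integrable_cnj)
    have "of_real ((norm (tw_conv f k l w))\<^sup>2) = tw_conv f k l w * cnj (tw_conv f k l w)"
      by (rule complex_norm_square)
    also have "\<dots> = (LINT p|(lborel \<Otimes>\<^sub>M lborel). (f (fst p) * ?e (fst p) w * of_real (?p (w - fst p))) * cnj (f (snd p) * ?e (snd p) w * of_real (?p (w - snd p))))"
      unfolding integral_prod_mult[OF F F'] tw_conv_def Bochner_Integration.integral_cnj ..
    also have "\<dots> = (LINT p|lborel. H p w)"
      unfolding lborel_prod by (intro Bochner_Integration.integral_cong refl) (simp add: H_def mult_ac)
    finally show ?thesis .
  qed
  have "integrable lborel (\<lambda>w. LINT p|lborel. H p w)"
    using lborel_pair.integrable_snd[OF Hint] .
  then have i: "integrable lborel (\<lambda>w. complex_of_real ((norm (tw_conv f k l w))\<^sup>2))"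
    unfolding sq .
  from integrable_norm[OF this] show "integrable lborel (\<lambda>w. (norm (tw_conv f k l w))\<^sup>2)"
    by (simp add: norm_power)
  have inner: "(LINT w|lborel. H (x, y) w) = of_real ?C * (f x * cnj (f y) * ?e x y * of_real (?p (x - y)))" for x y
  proof -
    define u where "u = x - y"
    have "(LINT w|lborel. H (x, y) w) = (LINT v|lborel. H (x, y) (v + y))"
      by (rule lborel_integral_translate[symmetric]) (simp add: H_def)
    also have "\<dots> = (LINT v|lborel. (f x * cnj (f y) * ?e x y) * cnj ((of_real (?p v) * ?e v u) * of_real (?p (u - v))))"
    proof (intro Bochner_Integration.integral_cong refl)
      fix v
      have "?e x (v + y) * cnj (?e y (v + y)) = cis (- (l / 2) * (u \<bullet> rot (v + y)))"
        by (simp add: u_def cis_cnj cis_mult inner_diff_left algebra_simps)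
      also have "u \<bullet> rot (v + y) = x \<bullet> rot y - v \<bullet> rot u"
        unfolding rot_add inner_add_right inner_rot_commute[of u v] by (simp add: u_def inner_diff_left)
      also have "cis (- (l / 2) * (x \<bullet> rot y - v \<bullet> rot u)) = ?e x y * cnj (?e v u)"
        by (simp add: cis_cnj cis_mult algebra_simps)
      finally have e: "?e x (v + y) * cnj (?e y (v + y)) = ?e x y * cnj (?e v u)" .
      have "?p (v + y - x) = ?p (u - v)"
        using laguerre_fun_minus[of k l "u - v"] by (simp add: u_def algebra_simps)
      then show "H (x, y) (v + y) = (f x * cnj (f y) * ?e x y) * cnj ((of_real (?p v) * ?e v u) * of_real (?p (u - v)))"
        unfolding H_def fst_conv snd_conv e by (simp add: mult_ac)
    qed
    also have "\<dots> = (f x * cnj (f y) * ?e x y) * cnj (of_real (?C * ?p u))"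
      unfolding integral_mult_right_zero Bochner_Integration.integral_cnj laguerre_twist[OF l] ..
    finally show ?thesis by (simp add: u_def mult_ac)
  qed
  have "of_real (LINT w|lborel. (norm (tw_conv f k l w))\<^sup>2) = (LINT w|lborel. LINT p|lborel. H p w)"
    unfolding sq[symmetric] by (rule integral_complex_of_real[symmetric])
  also have "\<dots> = (LINT p|lborel. LINT w|lborel. H p w)"
    by (rule lborel_pair.Fubini_integral[OF Hint])
  also have "\<dots> = (LINT p|(lborel \<Otimes>\<^sub>M lborel). (\<lambda>(x, y). of_real ?C * (f x * cnj (f y) * ?e x y * of_real (?p (x - y)))) p)"
    unfolding lborel_prod by (intro Bochner_Integration.integral_cong refl) (auto simp: inner split: prod.splits)
  also have "\<dots> = of_real ?C * (LINT p|(lborel \<Otimes>\<^sub>M lborel). (\<lambda>(x, y). f x * cnj (f y) * ?e x y * of_real (?p (x - y))) p)"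
    unfolding split_beta' by (rule integral_mult_right_zero)
  also have "(LINT p|(lborel \<Otimes>\<^sub>M lborel). (\<lambda>(x, y). f x * cnj (f y) * ?e x y * of_real (?p (x - y))) p) = tw_form f ?p l"
  proof -
    have "integrable (lborel \<Otimes>\<^sub>M lborel) (\<lambda>(x, y). f x * cnj (f y) * ?e x y * of_real (?p (x - y)))"
      by (rule tw_form_integrable[OF f _ laguerre_fun_le[OF l]]) measurable
    from lborel_pair.integral_fst'[OF this] show ?thesis by (simp add: tw_form_def)
  qed
  finally show "of_real (LINT w|lborel. (norm (tw_conv f k l w))\<^sup>2) = of_real ?C * tw_form f ?p l" .
qed

lemma tw_form_series:
  fixes f :: "complex ^ 'n::finite \<Rightarrow> complex"
  assumes f: "integrable lborel f" and l: "l \<noteq> 0" and r: "0 \<le> r" "r < 1"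
  shows "(\<lambda>k. of_real (r ^ k) * tw_form f (laguerre_fun k l) l) sums tw_form f (lag_gauss r l) l"
proof -
  define g where "g = (\<lambda>(x, y). f x * cnj (f y) * cis (- (l / 2) * (x \<bullet> rot y)))"
  have fm [measurable]: "f \<in> borel_measurable borel" using f by auto
  have gm [measurable]: "g \<in> borel_measurable (lborel \<Otimes>\<^sub>M lborel)" unfolding g_def by measurable
  have form: "tw_form f h l = (LINT p|(lborel \<Otimes>\<^sub>M lborel). g p * of_real (h (fst p - snd p)))"
    "integrable (lborel \<Otimes>\<^sub>M lborel) (\<lambda>p. g p * of_real (h (fst p - snd p)))"
    if "h \<in> borel_measurable borel" "\<And>z. \<bar>h z\<bar> \<le> B" for h B
    using lborel_pair.integral_fst'[OF tw_form_integrable[OF f that, of l]] tw_form_integrable[OF f that, of l]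
    by (simp_all add: tw_form_def g_def split_beta')
  have formL: "tw_form f (laguerre_fun k l) l = (LINT p|(lborel \<Otimes>\<^sub>M lborel). g p * of_real (laguerre_fun k l (fst p - snd p)))"
    "integrable (lborel \<Otimes>\<^sub>M lborel) (\<lambda>p. g p * of_real (laguerre_fun k l (fst p - snd p)))" for k
    by (rule form[OF _ laguerre_fun_le[OF l]]; measurable)+
  have r1: "\<bar>r\<bar> < 1" using r by simp
  let ?P = "\<lambda>N p. g p * of_real (\<Sum>k<N. r ^ k * laguerre_fun k l (fst p - snd p))"
  let ?c = "1 / (1 - r) ^ CARD('n)"
  have c: "(\<Sum>k<N. r ^ k * laguerre_fun k l (0 :: complex ^ 'n)) \<le> ?c" for N
  proof -
    have "(\<Sum>k<N. r ^ k * laguerre_fun k l (0 :: complex ^ 'n)) \<le> lag_gauss r l (0 :: complex ^ 'n)"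
      unfolding sums_unique[OF laguerre_fun_generating[OF r1, of l "0 :: complex ^ 'n"]]
      using sums_summable[OF laguerre_fun_generating[OF r1, of l "0 :: complex ^ 'n"]] r fan_const_pos
      by (intro sum_le_suminf) (auto simp: laguerre_fun_0 less_imp_le)
    then show ?thesis using lag_gauss_bound(2)[OF r1, of l "0 :: complex ^ 'n"] by linarith
  qed
  have ng: "norm (g p) = norm (f (fst p)) * norm (f (snd p))" for p
    by (simp add: g_def split_beta' norm_mult)
  have W: "integrable (lborel \<Otimes>\<^sub>M lborel) (\<lambda>p. norm (f (fst p)) * (norm (f (snd p)) * ?c))"
    using integrable_prod_mult[OF integrable_norm[OF f] integrable_mult_left[OF integrable_norm[OF f], of ?c]] by (simp add: split_beta')
  have "(\<lambda>N. LINT p|(lborel \<Otimes>\<^sub>M lborel). ?P N p) \<longlonglongrightarrow> (LINT p|(lborel \<Otimes>\<^sub>M lborel). g p * of_real (lag_gauss r l (fst p - snd p)))"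
  proof (rule integral_dominated_convergence[OF _ _ W])
    have "(\<lambda>N. \<Sum>k<N. r ^ k * laguerre_fun k l z) \<longlonglongrightarrow> lag_gauss r l z" for z :: "complex ^ 'n"
      using laguerre_fun_generating[OF r1, of l z] unfolding sums_def by simp
    then show "AE p in lborel \<Otimes>\<^sub>M lborel. (\<lambda>N. ?P N p) \<longlonglongrightarrow> g p * of_real (lag_gauss r l (fst p - snd p))"
      by (intro AE_I2 tendsto_mult tendsto_const tendsto_of_real)
    have "norm (?P N p) \<le> norm (f (fst p)) * (norm (f (snd p)) * ?c)" for N p
    proof -
      have "\<bar>\<Sum>k<N. r ^ k * laguerre_fun k l (fst p - snd p)\<bar> \<le> (\<Sum>k<N. r ^ k * laguerre_fun k l (0 :: complex ^ 'n))"
        using laguerre_fun_le[OF l] r by (intro order_trans[OF sum_abs] sum_mono) (auto simp: abs_mult laguerre_fun_0 simp del: times_divide_eq_right intro!: mult_left_mono)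
      from mult_left_mono[OF order_trans[OF this c], of "norm (g p)"] show ?thesis
        unfolding norm_mult norm_of_real by (simp add: ng mult.assoc)
    qed
    then show "AE p in lborel \<Otimes>\<^sub>M lborel. norm (?P N p) \<le> norm (f (fst p)) * (norm (f (snd p)) * ?c)" for N
      by (intro AE_I2)
  qed measurable
  moreover have "(LINT p|(lborel \<Otimes>\<^sub>M lborel). ?P N p) = (\<Sum>k<N. of_real (r ^ k) * tw_form f (laguerre_fun k l) l)" for N
  proof -
    have "(LINT p|(lborel \<Otimes>\<^sub>M lborel). ?P N p) = (LINT p|(lborel \<Otimes>\<^sub>M lborel). (\<Sum>k<N. of_real (r ^ k) * (g p * of_real (laguerre_fun k l (fst p - snd p)))))"
      by (intro Bochner_Integration.integral_cong refl) (simp add: sum_distrib_left mult_ac)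
    also have "\<dots> = (\<Sum>k<N. LINT p|(lborel \<Otimes>\<^sub>M lborel). of_real (r ^ k) * (g p * of_real (laguerre_fun k l (fst p - snd p))))"
      by (intro Bochner_Integration.integral_sum integrable_mult_right formL)
    finally show ?thesis unfolding formL by simp
  qed
  moreover have "tw_form f (lag_gauss r l) l = (LINT p|(lborel \<Otimes>\<^sub>M lborel). g p * of_real (lag_gauss r l (fst p - snd p)))"
  proof (rule form(1)[where B = ?c])
    show "\<bar>lag_gauss r l z\<bar> \<le> ?c" for z :: "complex ^ 'n"
      using lag_gauss_bound[OF r1, of l z] by simp
  qed measurable
  ultimately show ?thesis unfolding sums_def by simp
qed

lemma filterlim_real_add_at_top: "filterlim (\<lambda>j. real j + c) at_top sequentially"
  unfolding add.commute[of _ c]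
  by (rule filterlim_tendsto_add_at_top[OF tendsto_const filterlim_real_sequentially])

lemma inverse_real_add_tendsto_0: "(\<lambda>j. 1 / (real j + c)) \<longlonglongrightarrow> 0"
  by (rule tendsto_divide_0[OF tendsto_const filterlim_at_top_imp_at_infinity[OF filterlim_real_add_at_top]])

lemma lag_gauss_eq:
  fixes z :: "complex ^ 'n::finite"
  assumes "\<bar>r\<bar> < 1"
  shows "lag_gauss r l z = 1 / (1 - r) ^ CARD('n) * exp (- (\<bar>l\<bar> / 4 * ((1 + r) / (1 - r))) * (norm z)\<^sup>2)"
  by (simp add: lag_gauss_def)

lemma lag_gauss_mass:
  assumes l: "l \<noteq> 0" and r: "0 \<le> r" "r < 1"
  shows "1 / (1 - r) ^ n * sqrt (pi / (\<bar>l\<bar> / 4 * ((1 + r) / (1 - r)))) ^ (2 * n) = (2 * pi / \<bar>l\<bar>) ^ n * (2 / (1 + r)) ^ n"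
proof -
  define X where "X = pi / (\<bar>l\<bar> / 4 * ((1 + r) / (1 - r)))"
  have X: "X = (1 - r) * (2 * pi / \<bar>l\<bar> * (2 / (1 + r)))"
    using r l by (simp add: X_def divide_simps)
  have "X \<ge> 0" unfolding X using r by simp
  then have "sqrt X ^ (2 * n) = X ^ n" by (simp add: power_mult)
  also have "X ^ n = (1 - r) ^ n * ((2 * pi / \<bar>l\<bar>) ^ n * (2 / (1 + r)) ^ n)"
    unfolding X by (simp only: power_mult_distrib)
  finally show ?thesis unfolding X_def[symmetric] using r by simp
qed

lemma tw_conv_bessel:
  fixes f :: "complex ^ 'n::finite \<Rightarrow> complex"
  assumes f: "integrable lborel f" and l: "l \<noteq> 0"
  shows "(\<Sum>k. L2sq lborel (tw_conv f k l)) \<le> ennreal ((2 * pi / \<bar>l\<bar>) ^ (2 * CARD('n))) * L2sq lborel f"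
proof -
  let ?n = "CARD('n)"
  define C where "C = (2 * pi / \<bar>l\<bar>) ^ ?n"
  have C: "C > 0" "(2 * pi / \<bar>l\<bar>) ^ (2 * ?n) = C * C"
    using l by (simp add: C_def) (simp only: C_def mult_2 power_add)
  have fm [measurable]: "f \<in> borel_measurable borel" using f by auto
  define e where "e k = (LINT w|lborel. (norm (tw_conv f k l w))\<^sup>2)" for k
  have e0: "e k \<ge> 0" for k by (simp add: e_def)
  have Le: "L2sq lborel (tw_conv f k l) = ennreal (e k)" for k
    unfolding L2sq_def e_def by (rule nn_integral_eq_integral[OF tw_conv_energy(1)[OF f l]]) simp
  have ser: "(\<lambda>k. r ^ k * e k) sums Re (of_real C * tw_form f (lag_gauss r l) l)" if r: "0 \<le> r" "r < 1" for r
  proof -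
    have "(\<lambda>k. of_real C * (of_real (r ^ k) * tw_form f (laguerre_fun k l) l)) sums (of_real C * tw_form f (lag_gauss r l) l)"
      by (intro sums_mult tw_form_series f l r)
    moreover have "of_real C * (of_real (r ^ k) * tw_form f (laguerre_fun k l) l) = complex_of_real (r ^ k * e k)" for k
      using tw_conv_energy(2)[OF f l, of k] by (simp add: C_def e_def mult_ac)
    ultimately have "(\<lambda>k. complex_of_real (r ^ k * e k)) sums (of_real C * tw_form f (lag_gauss r l) l)" by (simp only:)
    from sums_Re[OF this] show ?thesis by simp
  qed
  have bound: "ennreal (Re (of_real C * tw_form f (lag_gauss r l) l)) \<le> ennreal (C * C * (2 / (1 + r)) ^ ?n) * L2sq lborel f"
    if r: "0 \<le> r" "r < 1" for r
  proof -
    have r1: "\<bar>r\<bar> < 1" using r by simp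
    define g where "g = \<bar>l\<bar> / 4 * ((1 + r) / (1 - r))"
    have g: "g > 0" using l r by (simp add: g_def)
    let ?c = "1 / (1 - r) ^ ?n"
    have int: "integrable (lborel \<Otimes>\<^sub>M lborel) (\<lambda>(x, y). f x * cnj (f y) * cis (- (l / 2) * (x \<bullet> rot y)) * of_real (lag_gauss r l (x - y)))"
    proof (rule tw_form_integrable[OF f, of _ "?c"])
      show "\<bar>lag_gauss r l z\<bar> \<le> ?c" for z :: "complex ^ 'n" using lag_gauss_bound[OF r1, of l z] by simp
    qed measurable
    have "Re (of_real C * tw_form f (lag_gauss r l) l) \<le> C * norm (tw_form f (lag_gauss r l) l)"
      using complex_Re_le_cmod[of "of_real C * tw_form f (lag_gauss r l) l"] C by (simp add: norm_mult)
    then have A: "ennreal (Re (of_real C * tw_form f (lag_gauss r l) l)) \<le> ennreal C * ennreal (norm (tw_form f (lag_gauss r l) l))"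
      using C by (simp add: ennreal_mult'[symmetric] ennreal_leI)
    have "tw_form f (lag_gauss r l) l = (LINT p|(lborel \<Otimes>\<^sub>M lborel). (\<lambda>(x, y). f x * cnj (f y) * cis (- (l / 2) * (x \<bullet> rot y)) * of_real (lag_gauss r l (x - y))) p)"
      using lborel_pair.integral_fst'[OF int] by (simp add: tw_form_def)
    also have "ennreal (norm \<dots>) \<le> (\<integral>\<^sup>+p. norm ((\<lambda>(x, y). f x * cnj (f y) * cis (- (l / 2) * (x \<bullet> rot y)) * of_real (lag_gauss r l (x - y))) p) \<partial>(lborel \<Otimes>\<^sub>M lborel))"
      by (rule integral_norm_bound_ennreal[OF int])
    also have "\<dots> = (\<integral>\<^sup>+x. \<integral>\<^sup>+y. ennreal (norm (f x * cnj (f y) * cis (- (l / 2) * (x \<bullet> rot y)) * of_real (lag_gauss r l (x - y)))) \<partial>lborel \<partial>lborel)"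
      by (subst lborel.nn_integral_fst[symmetric]) simp_all
    also have "\<dots> = (\<integral>\<^sup>+x. \<integral>\<^sup>+y. ennreal ?c * ennreal (norm (f x) * norm (f y) * exp (- g * (norm (x - y))\<^sup>2)) \<partial>lborel \<partial>lborel)"
    proof (intro nn_integral_cong)
      fix x y
      have "norm (f x * cnj (f y) * cis (- (l / 2) * (x \<bullet> rot y)) * of_real (lag_gauss r l (x - y))) = norm (f x) * norm (f y) * lag_gauss r l (x - y)"
        by (simp add: norm_mult abs_of_nonneg lag_gauss_bound[OF r1])
      also have "\<dots> = ?c * (norm (f x) * norm (f y) * exp (- g * (norm (x - y))\<^sup>2))"
        unfolding lag_gauss_eq[OF r1] g_def[symmetric] by (simp only: mult_ac)
      finally have eq: "norm (f x * cnj (f y) * cis (- (l / 2) * (x \<bullet> rot y)) * of_real (lag_gauss r l (x - y))) = ?c * (norm (f x) * norm (f y) * exp (- g * (norm (x - y))\<^sup>2))" .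
      show "ennreal (norm (f x * cnj (f y) * cis (- (l / 2) * (x \<bullet> rot y)) * of_real (lag_gauss r l (x - y)))) = ennreal ?c * ennreal (norm (f x) * norm (f y) * exp (- g * (norm (x - y))\<^sup>2))"
        unfolding eq using r by (intro ennreal_mult') simp
    qed
    also have "\<dots> = ennreal ?c * (\<integral>\<^sup>+x. \<integral>\<^sup>+y. ennreal (norm (f x) * norm (f y) * exp (- g * (norm (x - y))\<^sup>2)) \<partial>lborel \<partial>lborel)"
      by (simp add: nn_integral_cmult)
    also have "\<dots> \<le> ennreal ?c * (ennreal (sqrt (pi / g) ^ DIM(complex ^ 'n)) * L2sq lborel f)"
      by (intro mult_left_mono gauss_convolution_bound[OF g]) auto
    also have "\<dots> = ennreal (?c * sqrt (pi / g) ^ (2 * ?n)) * L2sq lborel f"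
      using r g unfolding DIM_complex_vec by (simp add: ennreal_mult' mult.assoc del: times_divide_eq_left)
    also have "?c * sqrt (pi / g) ^ (2 * ?n) = C * (2 / (1 + r)) ^ ?n"
      unfolding g_def C_def by (rule lag_gauss_mass[OF l r])
    finally have "ennreal (norm (tw_form f (lag_gauss r l) l)) \<le> ennreal (C * (2 / (1 + r)) ^ ?n) * L2sq lborel f" .
    from order_trans[OF A mult_left_mono[OF this]]
    have "ennreal (Re (of_real C * tw_form f (lag_gauss r l) l)) \<le> ennreal C * (ennreal (C * (2 / (1 + r)) ^ ?n) * L2sq lborel f)"
      by simp
    then show ?thesis using C r by (simp add: ennreal_mult' mult.assoc)
  qed
  show ?thesis
  proof (cases "L2sq lborel f")
    case top
    then show ?thesis using C unfolding C(2) by (simp add: ennreal_mult_top)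
  next
    case (real L)
    have "sum e {..<N} \<le> C * C * L" for N
    proof -
      have *: "(\<Sum>k<N. r ^ k * e k) \<le> C * C * (2 / (1 + r)) ^ ?n * L" if r: "0 \<le> r" "r < 1" for r
      proof -
        have "(\<Sum>k<N. r ^ k * e k) \<le> Re (of_real C * tw_form f (lag_gauss r l) l)"
          unfolding sums_unique[OF ser[OF r]] using sums_summable[OF ser[OF r]] r e0
          by (intro sum_le_suminf) auto
        moreover have "ennreal (Re (of_real C * tw_form f (lag_gauss r l) l)) \<le> ennreal (C * C * (2 / (1 + r)) ^ ?n * L)"
          using bound[OF r] real C r by (simp add: ennreal_mult'')
        then have "Re (of_real C * tw_form f (lag_gauss r l) l) \<le> C * C * (2 / (1 + r)) ^ ?n * L"
          using real C r by (simp add: ennreal_le_iff)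
        ultimately show ?thesis by linarith
      qed
      have "((\<lambda>r. \<Sum>k<N. r ^ k * e k) \<longlongrightarrow> (\<Sum>k<N. 1 ^ k * e k)) (at_left (1::real))"
        by (intro tendsto_intros)
      moreover have "((\<lambda>r. C * C * (2 / (1 + r)) ^ ?n * L) \<longlongrightarrow> C * C * (2 / (1 + 1)) ^ ?n * L) (at_left (1::real))"
        by (intro tendsto_intros) auto
      moreover have "eventually (\<lambda>r. (\<Sum>k<N. r ^ k * e k) \<le> C * C * (2 / (1 + r)) ^ ?n * L) (at_left 1)"
        using eventually_at_left_real[OF zero_less_one] by eventually_elim (auto intro!: *)
      ultimately show ?thesis
        using tendsto_le[OF trivial_limit_at_left_real, of "\<lambda>r. C * C * (2 / (1 + r)) ^ ?n * L" _ 1 "\<lambda>r. \<Sum>k<N. r ^ k * e k"] by simp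
    qed
    then have "(\<Sum>k<N. L2sq lborel (tw_conv f k l)) \<le> ennreal (C * C) * L2sq lborel f" for N
      unfolding Le real using real e0 C by (simp add: sum_nonneg ennreal_leI flip: ennreal_mult)
    then show ?thesis unfolding C(2) by (intro suminf_le_const) auto
  qed
qed

lemma continuous_bounded_support_sq:
  fixes f :: "'a::euclidean_space \<Rightarrow> complex"
  assumes "continuous_on UNIV f" "\<And>x. norm x > R \<Longrightarrow> f x = 0"
  shows "L2sq lborel f = ennreal (LINT x|lborel. (norm (f x))\<^sup>2)"
  unfolding L2sq_def
  by (rule nn_integral_eq_integral[OF integrable_continuous_bounded_support[of _ R]])
     (use assms in \<open>auto intro!: continuous_intros\<close>)

lemma tw_conv_lower:
  fixes f :: "complex ^ 'n::finite \<Rightarrow> complex"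
  assumes f: "continuous_on UNIV f" "\<And>x. norm x > R \<Longrightarrow> f x = 0" and l: "l \<noteq> 0"
  shows "ennreal ((2 * pi / \<bar>l\<bar>) ^ (2 * CARD('n))) * L2sq lborel f \<le> (\<Sum>k. L2sq lborel (tw_conv f k l))"
proof -
  let ?n = "CARD('n)"
  define C where "C = (2 * pi / \<bar>l\<bar>) ^ ?n"
  have C: "C > 0" "(2 * pi / \<bar>l\<bar>) ^ (2 * ?n) = C * C"
    using l by (simp add: C_def) (simp only: C_def mult_2 power_add)
  have fi: "integrable lborel f" by (rule integrable_continuous_bounded_support[OF f])
  define e where "e k = (LINT w|lborel. (norm (tw_conv f k l w))\<^sup>2)" for k
  have e0: "e k \<ge> 0" for k by (simp add: e_def)
  have Le: "L2sq lborel (tw_conv f k l) = ennreal (e k)" for k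
    unfolding L2sq_def e_def by (rule nn_integral_eq_integral[OF tw_conv_energy(1)[OF fi l]]) simp
  define I where "I = (LINT x|lborel. (norm (f x))\<^sup>2)"
  define T where "T = (\<Sum>k. L2sq lborel (tw_conv f k l))"
  define r :: "nat \<Rightarrow> real" where "r j = 1 - 1 / (real j + 2)" for j
  have r: "0 \<le> r j" "r j < 1" for j by (auto simp: r_def field_simps)
  have r1: "\<bar>r j\<bar> < 1" for j using r[of j] by simp
  have rlim: "r \<longlonglongrightarrow> 1" unfolding r_def using tendsto_diff[OF tendsto_const inverse_real_add_tendsto_0[of 2], of 1] by simp
  define g where "g j = \<bar>l\<bar> / 4 * ((1 + r j) / (1 - r j))" for j
  have glim: "filterlim g at_top sequentially"
  proof -
    have "g = (\<lambda>j. \<bar>l\<bar> / 2 * (real j + 3 / 2))"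
      by (simp add: g_def r_def fun_eq_iff field_simps)
    then show ?thesis
      using filterlim_tendsto_pos_mult_at_top[OF tendsto_const _ filterlim_real_add_at_top[of "3 / 2"], of "\<bar>l\<bar> / 2"] l by simp
  qed
  have gpos: "g j > 0" for j using l r[of j] by (simp add: g_def)
  define A where "A j = (LINT x|lborel. LINT y|lborel. f x * cnj (f y) * cis (- (l / 2) * (x \<bullet> rot y)) * of_real (exp (- g j * (norm (x - y))\<^sup>2)))" for j
  have Alim: "(\<lambda>j. A j * of_real (sqrt (g j / pi) ^ DIM(complex ^ 'n))) \<longlonglongrightarrow> of_real I"
    unfolding A_def I_def
    by (rule gauss_approx_identity[OF f _ _ _ glim, where \<theta> = "\<lambda>x y. cis (- (l / 2) * (x \<bullet> rot y))"])
       (auto simp: split_beta' intro!: continuous_intros)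
  define X where "X j = Re (of_real C * tw_form f (lag_gauss (r j) l) l)" for j
  have Xeq: "X j = C * C * (2 / (1 + r j)) ^ ?n * Re (A j * of_real (sqrt (g j / pi) ^ DIM(complex ^ 'n)))" for j
  proof -
    have "tw_form f (lag_gauss (r j) l) l = (LINT x|lborel. LINT y|lborel. of_real (1 / (1 - r j) ^ ?n) * (f x * cnj (f y) * cis (- (l / 2) * (x \<bullet> rot y)) * of_real (exp (- g j * (norm (x - y))\<^sup>2))))"
      unfolding tw_form_def lag_gauss_eq[OF r1] g_def
      by (intro Bochner_Integration.integral_cong refl) (simp add: mult_ac)
    also have "\<dots> = of_real (1 / (1 - r j) ^ ?n) * A j"
      unfolding A_def integral_mult_right_zero ..
    also have "\<dots> = of_real (1 / (1 - r j) ^ ?n * (sqrt (pi / g j) ^ (2 * ?n) * sqrt (g j / pi) ^ (2 * ?n))) * A j"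
      using gpos[of j] by (simp add: real_sqrt_mult[symmetric] flip: power_mult_distrib)
    also have "\<dots> = of_real (C * (2 / (1 + r j)) ^ ?n) * (A j * of_real (sqrt (g j / pi) ^ (2 * ?n)))"
      unfolding mult.assoc[symmetric] g_def lag_gauss_mass[OF l r] C_def by (simp add: mult_ac)
    finally have "X j = Re (of_real (C * (C * (2 / (1 + r j)) ^ ?n)) * (A j * of_real (sqrt (g j / pi) ^ (2 * ?n))))"
      unfolding X_def of_real_mult by (simp only: mult_ac)
    also have "\<dots> = C * (C * (2 / (1 + r j)) ^ ?n) * Re (A j * of_real (sqrt (g j / pi) ^ (2 * ?n)))"
      by (simp only: times_complex.sel Re_complex_of_real Im_complex_of_real)
    finally show ?thesis unfolding DIM_complex_vec by (simp only: mult.assoc)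
  qed
  have "X \<longlonglongrightarrow> C * C * (2 / (1 + 1)) ^ ?n * Re (of_real I)"
    unfolding Xeq by (intro tendsto_intros Alim rlim) auto
  then have "(\<lambda>j. ennreal (X j)) \<longlonglongrightarrow> ennreal (C * C * I)"
    by (intro tendsto_ennrealI) simp
  moreover have "ennreal (X j) \<le> T" for j
  proof -
    have "(\<lambda>k. r j ^ k * e k) sums X j"
    proof -
      have "(\<lambda>k. of_real C * (of_real (r j ^ k) * tw_form f (laguerre_fun k l) l)) sums (of_real C * tw_form f (lag_gauss (r j) l) l)"
        by (intro sums_mult tw_form_series fi l r)
      moreover have "of_real C * (of_real (r j ^ k) * tw_form f (laguerre_fun k l) l) = complex_of_real (r j ^ k * e k)" for k
        using tw_conv_energy(2)[OF fi l, of k] by (simp add: C_def e_def mult_ac)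
      ultimately have "(\<lambda>k. complex_of_real (r j ^ k * e k)) sums (of_real C * tw_form f (lag_gauss (r j) l) l)" by (simp only:)
      from sums_Re[OF this] show ?thesis by (simp add: X_def)
    qed
    then have "ennreal (X j) = (\<Sum>k. ennreal (r j ^ k * e k))"
      using r e0 by (simp add: sums_iff suminf_ennreal2)
    also have "\<dots> \<le> T"
      unfolding T_def Le using r[of j] e0
      by (intro suminf_le ennreal_leI) (auto intro!: mult_left_le_one_le power_le_one)
    finally show ?thesis .
  qed
  ultimately have "ennreal (C * C * I) \<le> T"
    by (intro LIMSEQ_le_const2) auto
  moreover have "L2sq lborel f = ennreal I"
    using continuous_bounded_support_sq[of f R] f by (simp add: I_def)
  ultimately show ?thesis
    unfolding C(2) T_def[symmetric] using C(1) by (simp add: ennreal_mult'[symmetric])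
qed

subsection \<open>Plancherel theorem on the real line\<close>

definition ft :: "(real \<Rightarrow> complex) \<Rightarrow> real \<Rightarrow> complex" where
  "ft f l = (LINT t|lborel. f t * cis (- (l * t)))"

lemma ft_energy:
  assumes f: "integrable lborel f" and e: "e > 0"
  shows "integrable lborel (\<lambda>l. (norm (ft f l))\<^sup>2 * exp (- e * l\<^sup>2))"
    and "of_real (LINT l|lborel. (norm (ft f l))\<^sup>2 * exp (- e * l\<^sup>2)) =
      of_real (sqrt (pi / e)) * (LINT t|lborel. LINT s|lborel. f t * cnj (f s) * of_real (exp (- (1 / (4 * e)) * (norm (t - s))\<^sup>2)))"
    and "integrable (lborel \<Otimes>\<^sub>M lborel) (\<lambda>(t, s). f t * cnj (f s) * of_real (exp (- (1 / (4 * e)) * (norm (t - s))\<^sup>2)))"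
proof -
  define H where "H p l = f (fst p) * cnj (f (snd p)) * (of_real (exp (- e * l\<^sup>2)) * cis (l * (snd p - fst p)))" for p l
  have fm [measurable]: "f \<in> borel_measurable borel" using f by auto
  have ff: "integrable (lborel \<Otimes>\<^sub>M lborel) (\<lambda>(t, s). f t * cnj (f s))"
    by (intro integrable_prod_mult f integrable_cnj)
  have Hm [measurable]: "case_prod H \<in> borel_measurable (lborel \<Otimes>\<^sub>M lborel)"
    unfolding H_def split_beta' by measurable
  have Hint: "integrable (lborel \<Otimes>\<^sub>M lborel) (case_prod H)"
  proof (rule Bochner_Integration.integrable_bound)
    have "integrable lborel (\<lambda>p. f (fst p) * cnj (f (snd p)))"
      using ff by (simp add: lborel_prod split_beta')
    then show "integrable (lborel \<Otimes>\<^sub>M lborel) (\<lambda>(p, l). norm (f (fst p) * cnj (f (snd p))) * exp (- e * l\<^sup>2))"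
      using gauss_integrable(1)[OF e, where 'a = real] by (intro integrable_prod_mult integrable_norm) (auto simp: power2_eq_square)
  qed (auto simp: H_def norm_mult intro!: AE_I2)
  have sq: "complex_of_real ((norm (ft f l))\<^sup>2 * exp (- e * l\<^sup>2)) = (LINT p|lborel. H p l)" for l
  proof -
    have F: "integrable lborel (\<lambda>t. f t * cis (- (l * t)))"
      by (rule Bochner_Integration.integrable_bound[OF f]) (auto simp: norm_mult intro!: AE_I2)
    have F': "integrable lborel (\<lambda>t. cnj (f t * cis (- (l * t))))"
      using F by (rule integrable_cnj)
    have "complex_of_real ((norm (ft f l))\<^sup>2) = ft f l * cnj (ft f l)"
      by (rule complex_norm_square)
    also have "\<dots> = (LINT p|(lborel \<Otimes>\<^sub>M lborel). (f (fst p) * cis (- (l * fst p))) * cnj (f (snd p) * cis (- (l * snd p))))"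
      unfolding integral_prod_mult[OF F F'] ft_def Bochner_Integration.integral_cnj ..
    finally have "complex_of_real ((norm (ft f l))\<^sup>2 * exp (- e * l\<^sup>2)) = (LINT p|(lborel \<Otimes>\<^sub>M lborel). (f (fst p) * cis (- (l * fst p))) * cnj (f (snd p) * cis (- (l * snd p)))) * of_real (exp (- e * l\<^sup>2))"
      by simp
    also have "\<dots> = (LINT p|(lborel \<Otimes>\<^sub>M lborel). (f (fst p) * cis (- (l * fst p))) * cnj (f (snd p) * cis (- (l * snd p))) * of_real (exp (- e * l\<^sup>2)))"
      by (rule integral_mult_left_zero[symmetric])
    also have "\<dots> = (LINT p|lborel. H p l)"
      unfolding lborel_prod
    proof (intro Bochner_Integration.integral_cong refl)
      fix p :: "real \<times> real"
      have "cis (- (l * fst p)) * cnj (cis (- (l * snd p))) = cis (l * (snd p - fst p))"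
        by (simp add: cis_cnj cis_mult algebra_simps)
      then show "(f (fst p) * cis (- (l * fst p))) * cnj (f (snd p) * cis (- (l * snd p))) * of_real (exp (- e * l\<^sup>2)) = H p l"
        unfolding H_def by (simp add: mult_ac)
    qed
    finally show ?thesis .
  qed
  have "integrable lborel (\<lambda>l. LINT p|lborel. H p l)"
    using lborel_pair.integrable_snd[OF Hint] .
  then have i: "integrable lborel (\<lambda>l. complex_of_real ((norm (ft f l))\<^sup>2 * exp (- e * l\<^sup>2)))"
    unfolding sq .
  from integrable_norm[OF this] show "integrable lborel (\<lambda>l. (norm (ft f l))\<^sup>2 * exp (- e * l\<^sup>2))"
    by (simp add: norm_mult norm_power)
  have inner: "(LINT l|lborel. H p l) = of_real (sqrt (pi / e)) * (f (fst p) * cnj (f (snd p)) * of_real (exp (- (1 / (4 * e)) * (norm (fst p - snd p))\<^sup>2)))" for p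
    unfolding H_def integral_mult_right_zero gauss_fourier_real(2)[OF e] using e by (simp add: power2_commute)
  show int: "integrable (lborel \<Otimes>\<^sub>M lborel) (\<lambda>(t, s). f t * cnj (f s) * of_real (exp (- (1 / (4 * e)) * (norm (t - s))\<^sup>2)))"
    by (rule Bochner_Integration.integrable_bound[OF ff]) (use e in \<open>auto simp: norm_mult split_beta' intro!: AE_I2 mult_left_le\<close>)
  have "complex_of_real (LINT l|lborel. (norm (ft f l))\<^sup>2 * exp (- e * l\<^sup>2)) = (LINT l|lborel. LINT p|lborel. H p l)"
    unfolding sq[symmetric] by (rule integral_complex_of_real[symmetric])
  also have "\<dots> = (LINT p|lborel. LINT l|lborel. H p l)"
    by (rule lborel_pair.Fubini_integral[OF Hint])
  also have "\<dots> = of_real (sqrt (pi / e)) * (LINT p|lborel. f (fst p) * cnj (f (snd p)) * of_real (exp (- (1 / (4 * e)) * (norm (fst p - snd p))\<^sup>2)))"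
    unfolding inner by (rule integral_mult_right_zero)
  also have "(LINT p|lborel. f (fst p) * cnj (f (snd p)) * of_real (exp (- (1 / (4 * e)) * (norm (fst p - snd p))\<^sup>2)))
      = (LINT t|lborel. LINT s|lborel. f t * cnj (f s) * of_real (exp (- (1 / (4 * e)) * (norm (t - s))\<^sup>2)))"
    using lborel_pair.integral_fst'[OF int] by (simp add: lborel_prod split_beta')
  finally show "complex_of_real (LINT l|lborel. (norm (ft f l))\<^sup>2 * exp (- e * l\<^sup>2)) =
      of_real (sqrt (pi / e)) * (LINT t|lborel. LINT s|lborel. f t * cnj (f s) * of_real (exp (- (1 / (4 * e)) * (norm (t - s))\<^sup>2)))" .
qed

lemma measurable_ft [measurable]:
  assumes [measurable]: "f \<in> borel_measurable borel"
  shows "ft f \<in> borel_measurable borel"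
  unfolding ft_def by measurable

lemma ft_bessel:
  assumes fm [measurable]: "f \<in> borel_measurable borel"
  shows "L2sq lborel (ft f) \<le> ennreal (2 * pi) * L2sq lborel f"
proof (cases "integrable lborel f")
  case False
  have "ft f l = 0" for l
  proof -
    have "\<not> integrable lborel (\<lambda>t. f t * cis (- (l * t)))"
    proof
      assume "integrable lborel (\<lambda>t. f t * cis (- (l * t)))"
      then have "integrable lborel f"
        by (rule Bochner_Integration.integrable_bound) (auto simp: norm_mult intro!: AE_I2)
      with False show False by simp
    qed
    then show ?thesis unfolding ft_def by (rule not_integrable_integral_eq)
  qed
  then show ?thesis by (simp add: L2sq_def)
next
  case f: True
  define e :: "nat \<Rightarrow> real" where "e j = 1 / (real j + 1)" for j
  have e: "e j > 0" for j by (simp add: e_def)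
  have elim: "e \<longlonglongrightarrow> 0" unfolding e_def by (rule inverse_real_add_tendsto_0)
  have b: "(\<integral>\<^sup>+l. ennreal ((norm (ft f l))\<^sup>2 * exp (- e j * l\<^sup>2)) \<partial>lborel) \<le> ennreal (2 * pi) * L2sq lborel f" for j
  proof -
    let ?g = "1 / (4 * e j)"
    have g: "?g > 0" using e[of j] by simp
    have "(\<integral>\<^sup>+l. ennreal ((norm (ft f l))\<^sup>2 * exp (- e j * l\<^sup>2)) \<partial>lborel) = ennreal (LINT l|lborel. (norm (ft f l))\<^sup>2 * exp (- e j * l\<^sup>2))"
      by (rule nn_integral_eq_integral[OF ft_energy(1)[OF f e]]) simp
    also have "(LINT l|lborel. (norm (ft f l))\<^sup>2 * exp (- e j * l\<^sup>2)) \<le> norm (complex_of_real (LINT l|lborel. (norm (ft f l))\<^sup>2 * exp (- e j * l\<^sup>2)))"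
      by simp
    also have "\<dots> = sqrt (pi / e j) * norm (LINT t|lborel. LINT s|lborel. f t * cnj (f s) * of_real (exp (- ?g * (norm (t - s))\<^sup>2)))"
      unfolding ft_energy(2)[OF f e] norm_mult norm_of_real using e[of j] by simp
    also have "ennreal \<dots> = ennreal (sqrt (pi / e j)) * ennreal (norm (LINT t|lborel. LINT s|lborel. f t * cnj (f s) * of_real (exp (- ?g * (norm (t - s))\<^sup>2))))"
      using e[of j] by (intro ennreal_mult) auto
    also have "(LINT t|lborel. LINT s|lborel. f t * cnj (f s) * of_real (exp (- ?g * (norm (t - s))\<^sup>2))) = (LINT p|(lborel \<Otimes>\<^sub>M lborel). (\<lambda>(t, s). f t * cnj (f s) * of_real (exp (- ?g * (norm (t - s))\<^sup>2))) p)"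
      using lborel_pair.integral_fst'[OF ft_energy(3)[OF f e[of j]]] by simp
    also have "ennreal (norm \<dots>) \<le> (\<integral>\<^sup>+p. norm ((\<lambda>(t, s). f t * cnj (f s) * of_real (exp (- ?g * (norm (t - s))\<^sup>2))) p) \<partial>(lborel \<Otimes>\<^sub>M lborel))"
      by (rule integral_norm_bound_ennreal[OF ft_energy(3)[OF f e]])
    also have "\<dots> = (\<integral>\<^sup>+t. \<integral>\<^sup>+s. ennreal (norm (f t) * norm (f s) * exp (- ?g * (norm (t - s))\<^sup>2)) \<partial>lborel \<partial>lborel)"
      by (subst lborel.nn_integral_fst[symmetric]) (simp_all add: norm_mult)
    also have "\<dots> \<le> ennreal (sqrt (pi / ?g) ^ DIM(real)) * L2sq lborel f"
      by (rule gauss_convolution_bound[OF g fm])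
    finally have "(\<integral>\<^sup>+l. ennreal ((norm (ft f l))\<^sup>2 * exp (- e j * l\<^sup>2)) \<partial>lborel) \<le> ennreal (sqrt (pi / e j)) * (ennreal (sqrt (pi / ?g) ^ DIM(real)) * L2sq lborel f)"
      by (simp add: ennreal_leI mult_left_mono)
    also have "\<dots> = ennreal (sqrt (pi / e j) * sqrt (pi / ?g)) * L2sq lborel f"
      using e[of j] by (simp add: ennreal_mult mult.assoc)
    also have "sqrt (pi / e j) * sqrt (pi / ?g) = 2 * pi"
    proof -
      have "sqrt (pi / e j) * sqrt (pi / ?g) = sqrt ((2 * pi)\<^sup>2)"
        unfolding real_sqrt_mult[symmetric] using e[of j] by (simp add: power2_eq_square)
      also have "\<dots> = 2 * pi" unfolding real_sqrt_abs by simp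
      finally show ?thesis .
    qed
    finally show ?thesis .
  qed
  have "L2sq lborel (ft f) = (\<integral>\<^sup>+l. liminf (\<lambda>j. ennreal ((norm (ft f l))\<^sup>2 * exp (- e j * l\<^sup>2))) \<partial>lborel)"
    unfolding L2sq_def
  proof (intro nn_integral_cong)
    fix l
    have "(\<lambda>j. (norm (ft f l))\<^sup>2 * exp (- e j * l\<^sup>2)) \<longlonglongrightarrow> (norm (ft f l))\<^sup>2 * exp (- 0 * l\<^sup>2)"
      by (intro tendsto_intros elim)
    from tendsto_ennrealI[OF this]
    have "(\<lambda>j. ennreal ((norm (ft f l))\<^sup>2 * exp (- e j * l\<^sup>2))) \<longlonglongrightarrow> ennreal ((norm (ft f l))\<^sup>2)" by simp
    then show "ennreal ((norm (ft f l))\<^sup>2) = liminf (\<lambda>j. ennreal ((norm (ft f l))\<^sup>2 * exp (- e j * l\<^sup>2)))"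
      using lim_imp_Liminf[OF trivial_limit_sequentially] by metis
  qed
  also have "\<dots> \<le> liminf (\<lambda>j. \<integral>\<^sup>+l. ennreal ((norm (ft f l))\<^sup>2 * exp (- e j * l\<^sup>2)) \<partial>lborel)"
    by (rule nn_integral_liminf) simp
  also have "\<dots> \<le> ennreal (2 * pi) * L2sq lborel f"
    by (rule order_trans[OF Liminf_le_Limsup Limsup_bounded]) (use b in \<open>auto intro!: always_eventually\<close>)
  finally show ?thesis .
qed

lemma ft_lower:
  assumes f: "continuous_on UNIV f" "\<And>x. norm x > R \<Longrightarrow> f x = 0"
  shows "ennreal (2 * pi) * L2sq lborel f \<le> L2sq lborel (ft f)"
proof -
  have fi: "integrable lborel f" by (rule integrable_continuous_bounded_support[OF f])
  define I where "I = (LINT x|lborel. (norm (f x))\<^sup>2)"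
  define g :: "nat \<Rightarrow> real" where "g j = real j + 1" for j
  define e where "e j = 1 / (4 * g j)" for j
  have g: "g j > 0" and e: "e j > 0" and ge: "1 / (4 * e j) = g j" for j by (simp_all add: e_def g_def)
  have glim: "filterlim g at_top sequentially" unfolding g_def by (rule filterlim_real_add_at_top)
  define A where "A j = (LINT x|lborel. LINT y|lborel. f x * cnj (f y) * 1 * of_real (exp (- g j * (norm (x - y))\<^sup>2)))" for j
  have Alim: "(\<lambda>j. A j * of_real (sqrt (g j / pi) ^ DIM(real))) \<longlonglongrightarrow> of_real I"
    unfolding A_def I_def by (rule gauss_approx_identity[OF f _ _ _ glim, where \<theta> = "\<lambda>_ _. 1"]) auto
  define X where "X j = (LINT l|lborel. (norm (ft f l))\<^sup>2 * exp (- e j * l\<^sup>2))" for j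
  have Xeq: "X j = 2 * pi * Re (A j * of_real (sqrt (g j / pi) ^ DIM(real)))" for j
  proof -
    have "complex_of_real (X j) = of_real (sqrt (pi / e j)) * A j"
      unfolding X_def A_def ft_energy(2)[OF fi e] ge by simp
    also have "sqrt (pi / e j) = 2 * pi * sqrt (g j / pi)"
    proof -
      have "sqrt (pi / e j) = sqrt ((2 * pi)\<^sup>2 * (g j / pi))"
        using g[of j] by (simp add: e_def power2_eq_square)
      then show ?thesis unfolding real_sqrt_mult real_sqrt_abs by simp
    qed
    finally have "complex_of_real (X j) = of_real (2 * pi) * (A j * of_real (sqrt (g j / pi)))"
      by (simp only: of_real_mult mult_ac)
    then have "Re (complex_of_real (X j)) = Re (of_real (2 * pi) * (A j * of_real (sqrt (g j / pi))))" by (rule arg_cong)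
    then show ?thesis by (simp del: of_real_mult)
  qed
  have "X = (\<lambda>j. 2 * pi * Re (A j * of_real (sqrt (g j / pi) ^ DIM(real))))"
    by (rule ext) (rule Xeq)
  then have "X \<longlonglongrightarrow> 2 * pi * Re (of_real I)"
    using tendsto_mult[OF tendsto_const tendsto_Re[OF Alim], of "2 * pi"] by simp
  then have "(\<lambda>j. ennreal (X j)) \<longlonglongrightarrow> ennreal (2 * pi * I)"
    by (intro tendsto_ennrealI) simp
  moreover have "ennreal (X j) \<le> L2sq lborel (ft f)" for j
  proof -
    have "ennreal (X j) = (\<integral>\<^sup>+l. ennreal ((norm (ft f l))\<^sup>2 * exp (- e j * l\<^sup>2)) \<partial>lborel)"
      unfolding X_def by (rule nn_integral_eq_integral[OF ft_energy(1)[OF fi e], symmetric]) simp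
    also have "\<dots> \<le> L2sq lborel (ft f)"
      unfolding L2sq_def using e[of j] by (intro nn_integral_mono ennreal_leI mult_left_le) auto
    finally show ?thesis .
  qed
  ultimately have "ennreal (2 * pi * I) \<le> L2sq lborel (ft f)"
    by (intro LIMSEQ_le_const2) auto
  moreover have "L2sq lborel f = ennreal I"
    using continuous_bounded_support_sq[of f R] f by (simp add: I_def)
  ultimately show ?thesis by (simp add: ennreal_mult'[symmetric])
qed

subsection \<open>The Strichartz Fourier transform\<close>

lemma L2sq_add_le:
  assumes [measurable]: "f \<in> borel_measurable M" "g \<in> borel_measurable M" and d: "d > 0"
  shows "L2sq M (\<lambda>x. f x + g x) \<le> ennreal (1 + d) * L2sq M f + ennreal (1 + 1 / d) * L2sq M g"
proof -
  have "(norm (f x + g x))\<^sup>2 \<le> (1 + d) * (norm (f x))\<^sup>2 + (1 + 1 / d) * (norm (g x))\<^sup>2" for x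
  proof -
    let ?a = "norm (f x)" and ?b = "norm (g x)"
    have "(norm (f x + g x))\<^sup>2 \<le> (?a + ?b)\<^sup>2" by (intro power_mono norm_triangle_ineq) auto
    also have "\<dots> \<le> (1 + d) * ?a\<^sup>2 + (1 + 1 / d) * ?b\<^sup>2"
    proof -
      have "0 \<le> (d * ?a - ?b)\<^sup>2 / d" using d by simp
      also have "\<dots> = d * ?a\<^sup>2 + 1 / d * ?b\<^sup>2 - 2 * ?a * ?b"
        using d by (simp add: power2_eq_square field_simps)
      finally show ?thesis by (simp add: power2_sum algebra_simps)
    qed
    finally show ?thesis .
  qed
  then have "L2sq M (\<lambda>x. f x + g x) \<le> (\<integral>\<^sup>+x. ennreal (1 + d) * ennreal ((norm (f x))\<^sup>2) + ennreal (1 + 1 / d) * ennreal ((norm (g x))\<^sup>2) \<partial>M)"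
    unfolding L2sq_def using d by (intro nn_integral_mono) (simp add: ennreal_leI flip: ennreal_mult' ennreal_plus)
  also have "\<dots> = ennreal (1 + d) * L2sq M f + ennreal (1 + 1 / d) * L2sq M g"
    by (simp add: nn_integral_add nn_integral_cmult L2sq_def)
  finally show ?thesis .
qed

lemma L2sq_cmult:
  assumes [measurable]: "f \<in> borel_measurable M"
  shows "L2sq M (\<lambda>x. c * f x) = ennreal ((norm c)\<^sup>2) * L2sq M f"
  by (simp add: L2sq_def norm_mult power_mult_distrib ennreal_mult' nn_integral_cmult)

lemma L2sq_minus_commute: "L2sq M (\<lambda>x. f x - g x) = L2sq M (\<lambda>x. g x - f x)"
  by (simp add: L2sq_def norm_minus_commute)

lemma measurable_fst_nu2 [measurable]: "fst \<in> borel_measurable (nu2 n)"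
  and measurable_snd_nu2 [measurable]: "snd \<in> borel_measurable (nu2 n)"
  by (simp_all cong: measurable_cong_sets add: measurable_restrict_space1 measurable_fst_borel measurable_snd_borel)

lemma measurable_fan_index [measurable]: "fan_index n \<in> measurable (nu2 n) (count_space UNIV)"
  if n: "n > 0"
proof -
  define k0 where "k0 = fan_index n (0, 0)"
  have zero: "fan_index n a = k0" if "fst a = 0" for a
    using that by (cases a) (simp add: k0_def fan_index_def fan_ray_def)
  have "fan_index n -` {k} \<inter> space (nu2 n) =
     {a \<in> space (nu2 n). fst a \<noteq> 0 \<and> snd a = (2 * real k + real n) * \<bar>fst a\<bar>} \<union> {a \<in> space (nu2 n). fst a = 0 \<and> k0 = k}" for k
  proof -
    have "fan_index n a = k \<longleftrightarrow> snd a = (2 * real k + real n) * \<bar>fst a\<bar>" if a: "a \<in> fan n" "fst a \<noteq> 0" for a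
    proof -
      obtain j where j: "a \<in> fan_ray n j" using a by (auto simp: fan_def)
      then have "fan_index n a = j" "snd a = (2 * real j + real n) * \<bar>fst a\<bar>"
        by (auto simp: fan_index_eq) (auto simp: fan_ray_def)
      then show ?thesis using a(2) by auto
    qed
    then show ?thesis using zero by auto
  qed
  moreover have "{a \<in> space (nu2 n). fst a \<noteq> 0 \<and> snd a = (2 * real k + real n) * \<bar>fst a\<bar>} \<in> sets (nu2 n)"
    and "{a \<in> space (nu2 n). fst a = 0 \<and> k0 = k} \<in> sets (nu2 n)" for k
    by measurable
  ultimately show ?thesis
    by (subst measurable_count_space_eq2_countable) (auto simp del: space_nu2 sets_nu2)
qed

lemma heis_mult_heis_inv: "heis_mult (heis_inv (z, t)) (w, 0) = (w - z, - t - 1/2 * (z \<bullet> rot w))"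
  unfolding heis_mult_def heis_inv_def prod.case Im_sum_cnj_eq_inner_rot by simp

lemma fan_fun_heis:
  fixes z w :: "complex ^ 'n::finite"
  shows "fan_fun a (heis_mult (heis_inv (z, t)) (w, 0)) =
    cis (- (fst a * t)) * (cis (- (fst a / 2) * (z \<bullet> rot w)) * of_real (laguerre_fun (fan_index CARD('n) a) (fst a) (w - z)))"
proof -
  have "fst a * (- t - 1/2 * (z \<bullet> rot w)) = - (fst a * t) + - (fst a / 2) * (z \<bullet> rot w)"
    by (simp add: algebra_simps)
  then show ?thesis
    unfolding heis_mult_heis_inv fan_fun_def prod.case cis_conv_exp[symmetric] by (simp only: cis_mult[symmetric] mult.assoc)
qed

lemma strichartz_integrable:
  fixes f :: "'n::finite heis \<Rightarrow> complex"
  assumes f: "integrable lborel f" and a: "fst a \<noteq> 0"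
  shows "integrable lborel (\<lambda>x. f x * fan_fun a (heis_mult (heis_inv x) (w, 0)))"
proof -
  let ?c = "1 / fan_const CARD('n) (fan_index CARD('n) a)"
  have c: "?c > 0" by (simp add: fan_const_pos)
  have fm [measurable]: "f \<in> borel_measurable borel" using f by auto
  have eq: "fan_fun a (heis_mult (heis_inv x) (w, 0)) = cis (- (fst a * snd x)) * (cis (- (fst a / 2) * (fst x \<bullet> rot w)) * of_real (laguerre_fun (fan_index CARD('n) a) (fst a) (w - fst x)))" for x :: "'n heis"
    using fan_fun_heis[of a "fst x" "snd x" w] by simp
  show ?thesis
  proof (rule Bochner_Integration.integrable_bound[OF integrable_mult_right[OF f, of "of_real ?c"]])
    show "(\<lambda>x. f x * fan_fun a (heis_mult (heis_inv x) (w, 0))) \<in> borel_measurable lborel"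
      unfolding eq by measurable
    have "norm (f x * fan_fun a (heis_mult (heis_inv x) (w, 0))) \<le> norm (of_real ?c * f x)" for x
    proof -
      have "\<bar>laguerre_fun (fan_index CARD('n) a) (fst a) (w - fst x)\<bar> \<le> ?c" by (rule laguerre_fun_le[OF a])
      from mult_left_mono[OF this, of "norm (f x)"] c show ?thesis
        unfolding eq norm_mult norm_of_real norm_cis abs_of_pos[OF c] by (simp add: mult.commute)
    qed
    then show "AE x in lborel. norm (f x * fan_fun a (heis_mult (heis_inv x) (w, 0))) \<le> norm (of_real ?c * f x)"
      by (intro AE_I2)
  qed
qed

lemma strichartz_add:
  fixes f g :: "'n::finite heis \<Rightarrow> complex"
  assumes "integrable lborel f" "integrable lborel g"
  shows "strichartz (\<lambda>x. f x + g x) y = strichartz f y + strichartz g y"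
  using Bochner_Integration.integral_add[OF strichartz_integrable[OF assms(1), of "fst y" "snd y"] strichartz_integrable[OF assms(2), of "fst y" "snd y"]]
  by (cases y) (auto simp: strichartz_def distrib_left distrib_right)

lemma strichartz_cmult:
  fixes f :: "'n::finite heis \<Rightarrow> complex"
  shows "strichartz (\<lambda>x. c * f x) y = c * strichartz f y"
  by (cases y) (simp add: strichartz_def mult.assoc)

lemma strichartz_diff:
  fixes f g :: "'n::finite heis \<Rightarrow> complex"
  assumes "integrable lborel f" "integrable lborel g"
  shows "strichartz (\<lambda>x. f x - g x) y = strichartz f y - strichartz g y"
  using strichartz_add[OF assms(1) integrable_mult_right[OF assms(2), of "-1"], of y] strichartz_cmult[of "-1" g y] by simp

definition tslice :: "('n::finite heis \<Rightarrow> complex) \<Rightarrow> real \<Rightarrow> complex ^ 'n \<Rightarrow> complex" where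
  "tslice f l z = ft (\<lambda>t. f (z, t)) l"

lemma tslice_integrable:
  fixes f :: "'n::finite heis \<Rightarrow> complex"
  assumes f: "integrable lborel f"
  shows "integrable lborel (tslice f l)"
    and "(LINT z|lborel. norm (tslice f l z)) \<le> (LINT x|lborel. norm (f x))"
proof -
  have fm [measurable]: "f \<in> borel_measurable borel" using f by auto
  have "integrable lborel (\<lambda>x. f x * cis (- (l * snd x)))"
    by (rule Bochner_Integration.integrable_bound[OF f]) (auto simp: norm_mult intro!: AE_I2)
  then have "integrable (lborel \<Otimes>\<^sub>M lborel) (\<lambda>x. f x * cis (- (l * snd x)))"
    by (simp add: lborel_prod)
  from lborel_pair.integrable_fst'[OF this]
  show i: "integrable lborel (tslice f l)"
    by (simp add: tslice_def[abs_def] ft_def)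
  have n: "integrable (lborel \<Otimes>\<^sub>M lborel) (\<lambda>x. norm (f x))"
    using integrable_norm[OF f] by (simp add: lborel_prod)
  have "(LINT z|lborel. norm (tslice f l z)) \<le> (LINT z|lborel. LINT t|lborel. norm (f (z, t)))"
  proof (rule integral_mono[OF integrable_norm[OF i] lborel_pair.integrable_fst'[OF n]])
    fix z
    have "norm (tslice f l z) \<le> (LINT t|lborel. norm (f (z, t) * cis (- (l * t))))"
      unfolding tslice_def ft_def by (rule integral_norm_bound)
    then show "norm (tslice f l z) \<le> (LINT t|lborel. norm (f (z, t)))" by (simp add: norm_mult)
  qed
  also have "\<dots> = (LINT x|lborel. norm (f x))"
    using lborel_pair.integral_fst'[OF n] by (simp add: lborel_prod)
  finally show "(LINT z|lborel. norm (tslice f l z)) \<le> (LINT x|lborel. norm (f x))" .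
qed

lemma strichartz_eq:
  fixes f :: "'n::finite heis \<Rightarrow> complex"
  assumes f: "integrable lborel f" and l: "l \<noteq> 0"
  shows "strichartz f ((l, (2 * real k + real CARD('n)) * \<bar>l\<bar>), w) =
    of_real (fan_const CARD('n) k) * tw_conv (tslice f l) k l w"
proof -
  let ?a = "(l, (2 * real k + real CARD('n)) * \<bar>l\<bar>)"
  have k: "fan_index CARD('n) ?a = k"
    by (rule fan_index_eq) (use l in \<open>auto simp: fan_ray_def\<close>)
  have int: "integrable (lborel \<Otimes>\<^sub>M lborel) (\<lambda>x. f x * fan_fun ?a (heis_mult (heis_inv x) (w, 0)))"
    using strichartz_integrable[OF f, of ?a w] l by (simp add: lborel_prod)
  have "(LINT x|lborel. f x * fan_fun ?a (heis_mult (heis_inv x) (w, 0))) =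
     (LINT z|lborel. LINT t|lborel. f (z, t) * fan_fun ?a (heis_mult (heis_inv (z, t)) (w, 0)))"
    using lborel_pair.integral_fst'[OF int] by (simp add: lborel_prod)
  also have "\<dots> = (LINT z|lborel. LINT t|lborel. (f (z, t) * cis (- (l * t))) * (cis (- (l / 2) * (z \<bullet> rot w)) * of_real (laguerre_fun k l (w - z))))"
    unfolding fan_fun_heis k by (simp add: mult.assoc)
  also have "\<dots> = tw_conv (tslice f l) k l w"
    unfolding integral_mult_left_zero tw_conv_def tslice_def ft_def by (simp add: mult.assoc)
  finally show ?thesis using l k by (simp add: strichartz_def)
qed

lemma measurable_strichartz [measurable]:
  fixes f :: "'n::finite heis \<Rightarrow> complex"
  assumes [measurable]: "f \<in> borel_measurable borel"
  shows "strichartz f \<in> borel_measurable (nu2 CARD('n) \<Otimes>\<^sub>M lborel)"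
proof -
  define G where "G k = (\<lambda>(a :: real \<times> real, w :: complex ^ 'n). if fst a = 0 then 0 else of_real (fan_const CARD('n) k) *
     (LINT x|lborel. f x * (cis (- (fst a * snd x)) * (cis (- (fst a / 2) * (fst x \<bullet> rot w)) * of_real (laguerre_fun k (fst a) (w - fst x))))))"
    for k :: nat
  have eq: "strichartz f y = G (fan_index CARD('n) (fst y)) y" for y
  proof -
    obtain a w where y: "y = (a, w)" by fastforce
    have "fan_fun a (heis_mult (heis_inv x) (w, 0)) = cis (- (fst a * snd x)) * (cis (- (fst a / 2) * (fst x \<bullet> rot w)) * of_real (laguerre_fun (fan_index CARD('n) a) (fst a) (w - fst x)))" for x :: "'n heis"
      using fan_fun_heis[of a "fst x" "snd x" w] by simp
    then show ?thesis by (simp add: y G_def strichartz_def)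
  qed
  have [measurable]: "G k \<in> borel_measurable (nu2 CARD('n) \<Otimes>\<^sub>M lborel)" for k
    unfolding G_def split_beta' by measurable
  have [measurable]: "(\<lambda>y. fan_index CARD('n) (fst y)) \<in> measurable (nu2 CARD('n) \<Otimes>\<^sub>M lborel) (count_space UNIV)"
    by (rule measurable_compose[OF measurable_fst measurable_fan_index]) simp
  have "(\<lambda>y. G (fan_index CARD('n) (fst y)) y) \<in> borel_measurable (nu2 CARD('n) \<Otimes>\<^sub>M lborel)"
    by (rule measurable_compose_countable) measurable
  then show ?thesis unfolding eq[symmetric] by simp
qed

lemma tslice_measurable [measurable (raw)]:
  fixes f :: "'n::finite heis \<Rightarrow> complex"
  assumes [measurable]: "f \<in> borel_measurable borel" and uv: "u \<in> borel_measurable M" "v \<in> borel_measurable M"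
  shows "(\<lambda>p. tslice f (u p) (v p)) \<in> borel_measurable M"
proof -
  have "(\<lambda>p. tslice f (fst p) (snd p)) \<in> borel_measurable (borel \<Otimes>\<^sub>M borel)"
    unfolding tslice_def ft_def by measurable
  from measurable_compose[OF measurable_Pair[OF uv] this] show ?thesis by simp
qed

lemma L2sq_strichartz_eq:
  fixes f :: "'n::finite heis \<Rightarrow> complex"
  assumes f: "integrable lborel f"
  shows "L2sq (nu2 CARD('n) \<Otimes>\<^sub>M lborel) (strichartz f) = ennreal (1 / (2 * pi) ^ (2 * CARD('n) + 1)) *
     (\<integral>\<^sup>+l. (\<Sum>k. L2sq lborel (tw_conv (tslice f l) k l)) * ennreal (\<bar>l\<bar> ^ (2 * CARD('n))) \<partial>lborel)"
proof -
  let ?n = "CARD('n)"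
  have fm [measurable]: "f \<in> borel_measurable borel" using f by auto
  have "L2sq (nu2 ?n \<Otimes>\<^sub>M lborel) (strichartz f) = (\<integral>\<^sup>+a. \<integral>\<^sup>+w. ennreal ((norm (strichartz f (a, w)))\<^sup>2) \<partial>lborel \<partial>nu2 ?n)"
    unfolding L2sq_def by (rule lborel.nn_integral_fst[symmetric]) measurable
  also have "\<dots> = ennreal (1 / (2 * pi) ^ (2 * ?n + 1)) * (\<integral>\<^sup>+l. (\<Sum>k. ennreal (1 / (fan_const ?n k)\<^sup>2) *
      (\<integral>\<^sup>+w. ennreal ((norm (strichartz f ((l, (2 * real k + real ?n) * \<bar>l\<bar>), w)))\<^sup>2) \<partial>lborel)) * ennreal (\<bar>l\<bar> ^ (2 * ?n)) \<partial>lborel)"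
    by (rule nn_integral_nu2) measurable
  also have "(\<integral>\<^sup>+l. (\<Sum>k. ennreal (1 / (fan_const ?n k)\<^sup>2) *
      (\<integral>\<^sup>+w. ennreal ((norm (strichartz f ((l, (2 * real k + real ?n) * \<bar>l\<bar>), w)))\<^sup>2) \<partial>lborel)) * ennreal (\<bar>l\<bar> ^ (2 * ?n)) \<partial>lborel)
      = (\<integral>\<^sup>+l. (\<Sum>k. L2sq lborel (tw_conv (tslice f l) k l)) * ennreal (\<bar>l\<bar> ^ (2 * ?n)) \<partial>lborel)"
  proof (rule nn_integral_cong_AE, use AE_lborel_singleton[of "0::real"] in eventually_elim)
    case (elim l)
    have [measurable]: "tslice f l \<in> borel_measurable borel"
      using tslice_integrable(1)[OF f, of l] by auto
    have tm [measurable]: "tw_conv (tslice f l) k l \<in> borel_measurable borel" for k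
      unfolding tw_conv_def by measurable
    have "ennreal (1 / (fan_const ?n k)\<^sup>2) * (\<integral>\<^sup>+w. ennreal ((norm (strichartz f ((l, (2 * real k + real ?n) * \<bar>l\<bar>), w)))\<^sup>2) \<partial>lborel)
      = L2sq lborel (tw_conv (tslice f l) k l)" for k
    proof -
      have "(\<integral>\<^sup>+w. ennreal ((norm (strichartz f ((l, (2 * real k + real ?n) * \<bar>l\<bar>), w)))\<^sup>2) \<partial>lborel) = ennreal ((fan_const ?n k)\<^sup>2) * L2sq lborel (tw_conv (tslice f l) k l)"
        unfolding strichartz_eq[OF f elim] using L2sq_cmult[of "tw_conv (tslice f l) k l" lborel "of_real (fan_const ?n k)"]
        by (simp add: L2sq_def)
      then show ?thesis using fan_const_pos[of ?n k]
        by (simp add: mult.assoc[symmetric] ennreal_mult'[symmetric])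
    qed
    then show ?case by simp
  qed
  finally show ?thesis .
qed

lemma L2sq_tslice:
  fixes f :: "'n::finite heis \<Rightarrow> complex"
  assumes [measurable]: "f \<in> borel_measurable borel"
  shows "(\<integral>\<^sup>+l. L2sq lborel (tslice f l) \<partial>lborel) = (\<integral>\<^sup>+z. L2sq lborel (ft (\<lambda>t. f (z, t))) \<partial>lborel)"
  unfolding L2sq_def tslice_def[symmetric] by (rule lborel_pair.Fubini') (simp add: split_beta')

lemma L2sq_slices:
  fixes f :: "'n::finite heis \<Rightarrow> complex"
  assumes [measurable]: "f \<in> borel_measurable borel"
  shows "(\<integral>\<^sup>+z. L2sq lborel (\<lambda>t. f (z, t)) \<partial>lborel) = L2sq lborel f"
proof -
  have "(\<integral>\<^sup>+z. L2sq lborel (\<lambda>t. f (z, t)) \<partial>lborel) = (\<integral>\<^sup>+x. ennreal ((norm (f x))\<^sup>2) \<partial>(lborel \<Otimes>\<^sub>M lborel))"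
    unfolding L2sq_def by (rule lborel.nn_integral_fst) (simp add: lborel_prod)
  then show ?thesis by (simp add: L2sq_def lborel_prod)
qed

lemma plancherel_constants:
  assumes l: "l \<noteq> 0"
  shows "ennreal ((2 * pi / \<bar>l\<bar>) ^ (2 * n)) * x * ennreal (\<bar>l\<bar> ^ (2 * n)) = ennreal ((2 * pi) ^ (2 * n)) * x"
proof -
  have "ennreal ((2 * pi / \<bar>l\<bar>) ^ (2 * n)) * x * ennreal (\<bar>l\<bar> ^ (2 * n)) = ennreal ((2 * pi / \<bar>l\<bar>) ^ (2 * n) * \<bar>l\<bar> ^ (2 * n)) * x"
    by (simp add: ennreal_mult' mult_ac)
  also have "(2 * pi / \<bar>l\<bar>) ^ (2 * n) * \<bar>l\<bar> ^ (2 * n) = (2 * pi) ^ (2 * n)"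
    unfolding power_mult_distrib[symmetric] using l by simp
  finally show ?thesis .
qed

lemma plancherel_constants2:
  "ennreal (1 / (2 * pi) ^ (2 * n + 1)) * (ennreal ((2 * pi) ^ (2 * n)) * (ennreal (2 * pi) * x)) = x"
proof -
  have "ennreal A * (ennreal B * (ennreal D * x)) = ennreal (A * (B * D)) * x" if "A \<ge> 0" "B \<ge> 0" "D \<ge> 0" for A B D
    using that by (simp add: ennreal_mult' mult.assoc)
  moreover have "1 / (2 * pi) ^ (2 * n + 1) * ((2 * pi) ^ (2 * n) * (2 * pi)) = 1"
    by simp
  ultimately show ?thesis by simp
qed

lemma strichartz_bessel:
  fixes f :: "'n::finite heis \<Rightarrow> complex"
  assumes f: "integrable lborel f"
  shows "L2sq (nu2 CARD('n) \<Otimes>\<^sub>M lborel) (strichartz f) \<le> L2sq lborel f"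
proof -
  let ?n = "CARD('n)"
  have fm [measurable]: "f \<in> borel_measurable borel" using f by auto
  have [measurable]: "(\<lambda>l. L2sq lborel (tslice f l)) \<in> borel_measurable lborel"
    unfolding L2sq_def by measurable
  have "(\<integral>\<^sup>+l. (\<Sum>k. L2sq lborel (tw_conv (tslice f l) k l)) * ennreal (\<bar>l\<bar> ^ (2 * ?n)) \<partial>lborel)
    \<le> (\<integral>\<^sup>+l. ennreal ((2 * pi) ^ (2 * ?n)) * L2sq lborel (tslice f l) \<partial>lborel)"
  proof (rule nn_integral_mono_AE, use AE_lborel_singleton[of "0::real"] in eventually_elim)
    case (elim l)
    show ?case
      using mult_right_mono[OF tw_conv_bessel[OF tslice_integrable(1)[OF f] elim], of "ennreal (\<bar>l\<bar> ^ (2 * ?n))" l]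
      unfolding plancherel_constants[OF elim] by simp
  qed
  also have "\<dots> = ennreal ((2 * pi) ^ (2 * ?n)) * (\<integral>\<^sup>+z. L2sq lborel (ft (\<lambda>t. f (z, t))) \<partial>lborel)"
    by (simp add: nn_integral_cmult L2sq_tslice)
  also have "\<dots> \<le> ennreal ((2 * pi) ^ (2 * ?n)) * (\<integral>\<^sup>+z. ennreal (2 * pi) * L2sq lborel (\<lambda>t. f (z, t)) \<partial>lborel)"
    by (intro mult_left_mono nn_integral_mono ft_bessel) auto
  also have "(\<integral>\<^sup>+z. ennreal (2 * pi) * L2sq lborel (\<lambda>t. f (z, t)) \<partial>lborel) = ennreal (2 * pi) * L2sq lborel f"
    unfolding L2sq_slices[OF fm, symmetric] by (rule nn_integral_cmult) (simp add: L2sq_def)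
  finally have "(\<integral>\<^sup>+l. (\<Sum>k. L2sq lborel (tw_conv (tslice f l) k l)) * ennreal (\<bar>l\<bar> ^ (2 * ?n)) \<partial>lborel)
    \<le> ennreal ((2 * pi) ^ (2 * ?n)) * (ennreal (2 * pi) * L2sq lborel f)" .
  from mult_left_mono[OF this, of "ennreal (1 / (2 * pi) ^ (2 * ?n + 1))"] show ?thesis
    unfolding L2sq_strichartz_eq[OF f] plancherel_constants2 by simp
qed

lemma continuous_bounded_support_bounded:
  fixes f :: "'a::euclidean_space \<Rightarrow> 'b::real_normed_vector"
  assumes f: "continuous_on UNIV f" "\<And>x. norm x > R \<Longrightarrow> f x = 0"
  obtains B where "\<And>x. norm (f x) \<le> B"
proof -
  have "compact (f ` cball 0 R)"
    by (intro compact_continuous_image continuous_on_subset[OF f(1)]) auto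
  then obtain B where "\<And>y. y \<in> f ` cball 0 R \<Longrightarrow> norm y \<le> B"
    using compact_imp_bounded bounded_iff by metis
  then have "norm (f x) \<le> max B 0" for x
    using f(2)[of x] by (cases "norm x > R") (force simp: le_max_iff_disj)+
  then show ?thesis using that by blast
qed

lemma tslice_continuous:
  fixes f :: "'n::finite heis \<Rightarrow> complex"
  assumes f: "continuous_on UNIV f" "\<And>x. norm x > R \<Longrightarrow> f x = 0"
  shows "continuous_on UNIV (tslice f l)"
proof -
  have [measurable]: "f \<in> borel_measurable borel" using f(1) by (rule borel_measurable_continuous_onI)
  obtain B where B: "\<And>x. norm (f x) \<le> B" using continuous_bounded_support_bounded[OF f] by blast
  have "isCont (tslice f l) z" for z
  proof (rule continuous_at_sequentiallyI)
    fix u assume u: "u \<longlonglongrightarrow> z"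
    have W: "integrable lborel (\<lambda>t. B * indicator {- R..R} t :: real)"
      by (intro integrable_mult_right integrable_real_indicator) (auto simp: emeasure_lborel_Icc_eq)
    show "(\<lambda>n. tslice f l (u n)) \<longlonglongrightarrow> tslice f l z"
      unfolding tslice_def ft_def
    proof (rule integral_dominated_convergence[OF _ _ W])
      have "(\<lambda>n. f (u n, t)) \<longlonglongrightarrow> f (z, t)" for t
        using f(1) tendsto_Pair[OF u tendsto_const[of t]] by (auto simp: continuous_on_eq_continuous_at intro: isCont_tendsto_compose)
      then show "AE t in lborel. (\<lambda>n. f (u n, t) * cis (- (l * t))) \<longlonglongrightarrow> f (z, t) * cis (- (l * t))"
        by (intro AE_I2 tendsto_mult tendsto_const)
      have "norm (f (u n, t) * cis (- (l * t))) \<le> B * indicator {- R..R} t" for n t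
      proof (cases "t \<in> {- R..R}")
        case True
        then show ?thesis using B by (simp add: norm_mult)
      next
        case False
        then have "norm (u n, t) > R" using norm_snd_le[of t "u n"] by auto
        with False show ?thesis using f(2) by (simp del: atLeastAtMost_iff)
      qed
      then show "AE t in lborel. norm (f (u n, t) * cis (- (l * t))) \<le> B * indicator {- R..R} t" for n
        by (intro AE_I2)
    qed measurable
  qed
  then show ?thesis by (simp add: continuous_on_eq_continuous_at)
qed

lemma strichartz_lower:
  fixes f :: "'n::finite heis \<Rightarrow> complex"
  assumes f: "continuous_on UNIV f" "\<And>x. norm x > R \<Longrightarrow> f x = 0"
  shows "L2sq lborel f \<le> L2sq (nu2 CARD('n) \<Otimes>\<^sub>M lborel) (strichartz f)"
proof -
  let ?n = "CARD('n)"
  have fi: "integrable lborel f" by (rule integrable_continuous_bounded_support[OF f])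
  have fm [measurable]: "f \<in> borel_measurable borel" using fi by auto
  have [measurable]: "(\<lambda>l. L2sq lborel (tslice f l)) \<in> borel_measurable lborel"
    unfolding L2sq_def by measurable
  have z: "tslice f l z = 0" if "norm z > R" for l z
  proof -
    have "f (z, t) = 0" for t using norm_fst_le[of z t] that by (intro f(2)) simp
    then show ?thesis by (simp add: tslice_def ft_def)
  qed
  have "ennreal (2 * pi) * L2sq lborel f = (\<integral>\<^sup>+z. ennreal (2 * pi) * L2sq lborel (\<lambda>t. f (z, t)) \<partial>lborel)"
    unfolding L2sq_slices[OF fm, symmetric] by (rule nn_integral_cmult[symmetric]) (simp add: L2sq_def)
  also have "\<dots> \<le> (\<integral>\<^sup>+z. L2sq lborel (ft (\<lambda>t. f (z, t))) \<partial>lborel)"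
  proof (intro nn_integral_mono ft_lower[where R = R])
    fix z t
    show "continuous_on UNIV (\<lambda>t. f (z, t))"
      by (intro continuous_on_compose2[OF f(1)] continuous_intros) auto
    show "f (z, t) = 0" if "norm t > R"
      using norm_snd_le[of t z] that by (intro f(2)) simp
  qed
  finally have "ennreal ((2 * pi) ^ (2 * ?n)) * (ennreal (2 * pi) * L2sq lborel f) \<le> ennreal ((2 * pi) ^ (2 * ?n)) * (\<integral>\<^sup>+z. L2sq lborel (ft (\<lambda>t. f (z, t))) \<partial>lborel)"
    by (rule mult_left_mono) simp
  also have "\<dots> = (\<integral>\<^sup>+l. ennreal ((2 * pi) ^ (2 * ?n)) * L2sq lborel (tslice f l) \<partial>lborel)"
    by (simp add: nn_integral_cmult L2sq_tslice)
  also have "\<dots> \<le> (\<integral>\<^sup>+l. (\<Sum>k. L2sq lborel (tw_conv (tslice f l) k l)) * ennreal (\<bar>l\<bar> ^ (2 * ?n)) \<partial>lborel)"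
  proof (rule nn_integral_mono_AE, use AE_lborel_singleton[of "0::real"] in eventually_elim)
    case (elim l)
    have "ennreal ((2 * pi / \<bar>l\<bar>) ^ (2 * ?n)) * L2sq lborel (tslice f l) \<le> (\<Sum>k. L2sq lborel (tw_conv (tslice f l) k l))"
      by (rule tw_conv_lower[OF tslice_continuous[OF f] z elim])
    from mult_right_mono[OF this, of "ennreal (\<bar>l\<bar> ^ (2 * ?n))"] show ?case
      unfolding plancherel_constants[OF elim] by simp
  qed
  finally have "ennreal ((2 * pi) ^ (2 * ?n)) * (ennreal (2 * pi) * L2sq lborel f)
    \<le> (\<integral>\<^sup>+l. (\<Sum>k. L2sq lborel (tw_conv (tslice f l) k l)) * ennreal (\<bar>l\<bar> ^ (2 * ?n)) \<partial>lborel)" .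
  from mult_left_mono[OF this, of "ennreal (1 / (2 * pi) ^ (2 * ?n + 1))"] show ?thesis
    unfolding L2sq_strichartz_eq[OF fi] plancherel_constants2 by simp
qed

theorem strichartz_plancherel:
  fixes f :: "'n::finite heis \<Rightarrow> complex"
  assumes f: "integrable lborel f" and f2: "L2sq lborel f < \<infinity>"
  shows "L2sq (nu2 CARD('n) \<Otimes>\<^sub>M lborel) (strichartz f) = L2sq lborel f"
proof (rule antisym[OF strichartz_bessel[OF f]])
  let ?K = "nu2 CARD('n) \<Otimes>\<^sub>M (lborel :: (complex ^ 'n) measure)"
  have fm [measurable]: "f \<in> borel_measurable borel" using f by auto
  obtain x where x: "L2sq lborel f = ennreal x" "x \<ge> 0" using f2 by (cases "L2sq lborel f") auto
  have "L2sq ?K (strichartz f) < \<infinity>" using strichartz_bessel[OF f] f2 by (rule le_less_trans)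
  then obtain y where y: "L2sq ?K (strichartz f) = ennreal y" "y \<ge> 0" by (cases "L2sq ?K (strichartz f)") auto
  have le: "x \<le> (1 + d) * ((1 + d) * y + (1 + 1 / d) * e) + (1 + 1 / d) * e" if d: "d > 0" and e: "e > 0" for d e
  proof -
    obtain g r where g: "continuous_on UNIV g" "\<And>x. norm x > r \<Longrightarrow> g x = 0" and fg: "L2sq lborel (\<lambda>x. f x - g x) < ennreal e"
      using L2_approx_continuous[OF fm f2, of "ennreal e"] e by auto
    have gi: "integrable lborel g" by (rule integrable_continuous_bounded_support[OF g])
    have gm [measurable]: "g \<in> borel_measurable borel" using gi by auto
    have "L2sq lborel f \<le> ennreal (1 + d) * L2sq lborel g + ennreal (1 + 1 / d) * L2sq lborel (\<lambda>x. f x - g x)"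
      using L2sq_add_le[of g lborel "\<lambda>x. f x - g x" d] d by simp
    also have "L2sq lborel g \<le> L2sq ?K (strichartz g)" by (rule strichartz_lower[OF g])
    also have "L2sq ?K (strichartz g) \<le> ennreal (1 + d) * L2sq ?K (strichartz f) + ennreal (1 + 1 / d) * L2sq ?K (strichartz (\<lambda>x. g x - f x))"
      using L2sq_add_le[of "strichartz f" ?K "strichartz (\<lambda>x. g x - f x)" d] d
      by (simp add: strichartz_diff[OF gi f])
    also have "L2sq ?K (strichartz (\<lambda>x. g x - f x)) \<le> L2sq lborel (\<lambda>x. g x - f x)"
      by (intro strichartz_bessel Bochner_Integration.integrable_diff gi f)
    also have "L2sq lborel (\<lambda>x. g x - f x) = L2sq lborel (\<lambda>x. f x - g x)" by (rule L2sq_minus_commute)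
    finally have "L2sq lborel f \<le> ennreal (1 + d) * (ennreal (1 + d) * L2sq ?K (strichartz f) + ennreal (1 + 1 / d) * L2sq lborel (\<lambda>x. f x - g x)) + ennreal (1 + 1 / d) * L2sq lborel (\<lambda>x. f x - g x)"
      by (simp add: add_mono mult_left_mono)
    also have "\<dots> \<le> ennreal (1 + d) * (ennreal (1 + d) * L2sq ?K (strichartz f) + ennreal (1 + 1 / d) * ennreal e) + ennreal (1 + 1 / d) * ennreal e"
      using fg by (intro add_mono mult_left_mono) auto
    also have "\<dots> = ennreal ((1 + d) * ((1 + d) * y + (1 + 1 / d) * e) + (1 + 1 / d) * e)"
      using d e y by (simp flip: ennreal_mult ennreal_plus)
    finally have *: "L2sq lborel f \<le> ennreal ((1 + d) * ((1 + d) * y + (1 + 1 / d) * e) + (1 + 1 / d) * e)" .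
    have "0 \<le> (1 + d) * ((1 + d) * y + (1 + 1 / d) * e) + (1 + 1 / d) * e"
      using d e y by (intro add_nonneg_nonneg mult_nonneg_nonneg) auto
    from *[unfolded x(1) ennreal_le_iff[OF this]] show ?thesis .
  qed
  have le2: "x \<le> (1 + d) * ((1 + d) * y + (1 + 1 / d) * 0) + (1 + 1 / d) * 0" if d: "d > 0" for d
  proof (rule tendsto_lowerbound[where F = "at_right 0"])
    show "((\<lambda>e. (1 + d) * ((1 + d) * y + (1 + 1 / d) * e) + (1 + 1 / d) * e) \<longlongrightarrow> (1 + d) * ((1 + d) * y + (1 + 1 / d) * 0) + (1 + 1 / d) * 0) (at_right 0)"
      by (intro tendsto_intros)
    show "\<forall>\<^sub>F e in at_right 0. x \<le> (1 + d) * ((1 + d) * y + (1 + 1 / d) * e) + (1 + 1 / d) * e"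
      using eventually_at_right_less[of "0::real"] by eventually_elim (rule le[OF d])
  qed simp
  have "x \<le> (1 + 0) * ((1 + 0) * y)"
  proof (rule tendsto_lowerbound[where F = "at_right 0"])
    show "((\<lambda>d. (1 + d) * ((1 + d) * y)) \<longlongrightarrow> (1 + 0) * ((1 + 0) * y)) (at_right (0::real))"
      by (intro tendsto_intros)
    show "\<forall>\<^sub>F d in at_right 0. x \<le> (1 + d) * ((1 + d) * y)"
      using eventually_at_right_less[of "0::real"] by eventually_elim (use le2 in simp)
  qed simp
  then show "L2sq lborel f \<le> L2sq ?K (strichartz f)"
    unfolding x y by (simp add: ennreal_leI)
qed

lemma strichartz_L1_bound:
  fixes f :: "'n::finite heis \<Rightarrow> complex"
  assumes f: "integrable lborel f" and l: "l \<noteq> 0"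
  shows "(\<integral>\<^sup>+w. ennreal ((norm (strichartz f ((l, (2 * real k + real CARD('n)) * \<bar>l\<bar>), w)))\<^sup>2) \<partial>lborel)
    \<le> ennreal (fan_const CARD('n) k * (2 * pi / \<bar>l\<bar>) ^ CARD('n) * (LINT x|lborel. norm (f x))\<^sup>2)"
proof -
  let ?n = "CARD('n)" and ?g = "tslice f l"
  define c where "c = fan_const ?n k"
  have c: "c > 0" by (simp add: c_def fan_const_pos)
  define C where "C = (2 * pi / \<bar>l\<bar>) ^ ?n"
  have C: "C > 0" using l by (simp add: C_def)
  have g: "integrable lborel ?g" by (rule tslice_integrable(1)[OF f])
  have [measurable]: "?g \<in> borel_measurable borel" using g by auto
  have int: "integrable (lborel \<Otimes>\<^sub>M lborel) (\<lambda>(x, y). ?g x * cnj (?g y) * cis (- (l / 2) * (x \<bullet> rot y)) * of_real (laguerre_fun k l (x - y)))"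
    by (rule tw_form_integrable[OF g _ laguerre_fun_le[OF l]]) measurable
  have W: "integrable (lborel \<Otimes>\<^sub>M lborel) (\<lambda>p. norm (?g (fst p)) * (1 / c * norm (?g (snd p))))"
    using integrable_prod_mult[OF integrable_norm[OF g] integrable_mult_right[OF integrable_norm[OF g], of "1 / c"]] by (simp add: split_beta')
  have "(LINT w|lborel. (norm (tw_conv ?g k l w))\<^sup>2) = norm (complex_of_real (LINT w|lborel. (norm (tw_conv ?g k l w))\<^sup>2))"
    by simp
  also have "\<dots> = C * norm (tw_form ?g (laguerre_fun k l) l)"
    unfolding tw_conv_energy(2)[OF g l] norm_mult norm_of_real using C by (simp add: C_def)
  also have "tw_form ?g (laguerre_fun k l) l = (LINT p|(lborel \<Otimes>\<^sub>M lborel). (\<lambda>(x, y). ?g x * cnj (?g y) * cis (- (l / 2) * (x \<bullet> rot y)) * of_real (laguerre_fun k l (x - y))) p)"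
    using lborel_pair.integral_fst'[OF int] by (simp add: tw_form_def)
  also have "norm \<dots> \<le> (LINT p|(lborel \<Otimes>\<^sub>M lborel). norm ((\<lambda>(x, y). ?g x * cnj (?g y) * cis (- (l / 2) * (x \<bullet> rot y)) * of_real (laguerre_fun k l (x - y))) p))"
    by (rule integral_norm_bound)
  also have "\<dots> \<le> (LINT p|(lborel \<Otimes>\<^sub>M lborel). norm (?g (fst p)) * (1 / c * norm (?g (snd p))))"
  proof (rule integral_mono[OF integrable_norm[OF int] W])
    fix p :: "(complex ^ 'n) \<times> (complex ^ 'n)"
    have "\<bar>laguerre_fun k l (fst p - snd p)\<bar> \<le> 1 / c" unfolding c_def by (rule laguerre_fun_le[OF l])
    from mult_left_mono[OF this, of "norm (?g (fst p)) * norm (?g (snd p))"]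
    show "norm ((\<lambda>(x, y). ?g x * cnj (?g y) * cis (- (l / 2) * (x \<bullet> rot y)) * of_real (laguerre_fun k l (x - y))) p) \<le> norm (?g (fst p)) * (1 / c * norm (?g (snd p)))"
      by (simp add: split_beta' norm_mult)
  qed
  also have "\<dots> = (LINT x|lborel. norm (?g x)) * (1 / c * (LINT x|lborel. norm (?g x)))"
    using integral_prod_mult[OF integrable_norm[OF g] integrable_mult_right[OF integrable_norm[OF g], of "1 / c"]] by simp
  also have "\<dots> \<le> (LINT x|lborel. norm (f x)) * (1 / c * (LINT x|lborel. norm (f x)))"
    using c tslice_integrable(2)[OF f, of l] by (intro mult_mono) auto
  finally have e: "(LINT w|lborel. (norm (tw_conv ?g k l w))\<^sup>2) \<le> C * ((LINT x|lborel. norm (f x)) * (1 / c * (LINT x|lborel. norm (f x))))"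
    using C by simp
  have "(\<integral>\<^sup>+w. ennreal ((norm (strichartz f ((l, (2 * real k + real ?n) * \<bar>l\<bar>), w)))\<^sup>2) \<partial>lborel) = (\<integral>\<^sup>+w. ennreal (c\<^sup>2 * (norm (tw_conv ?g k l w))\<^sup>2) \<partial>lborel)"
    unfolding strichartz_eq[OF f l] c_def[symmetric] using c by (simp add: norm_mult power_mult_distrib)
  also have "\<dots> = ennreal (c\<^sup>2 * (LINT w|lborel. (norm (tw_conv ?g k l w))\<^sup>2))"
    using nn_integral_eq_integral[OF integrable_mult_right[OF tw_conv_energy(1)[OF g l], of "c\<^sup>2" k]] by simp
  also have "\<dots> \<le> ennreal (c\<^sup>2 * (C * ((LINT x|lborel. norm (f x)) * (1 / c * (LINT x|lborel. norm (f x))))))"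
    by (intro ennreal_leI mult_left_mono e) auto
  also have "c\<^sup>2 * (C * ((LINT x|lborel. norm (f x)) * (1 / c * (LINT x|lborel. norm (f x))))) = c * C * (LINT x|lborel. norm (f x))\<^sup>2"
    using c by (simp add: power2_eq_square)
  finally show ?thesis unfolding c_def C_def .
qed

subsection \<open>Multipliers preserving the range of the transform\<close>

definition L12 :: "('n::finite heis \<Rightarrow> complex) set" where
  "L12 = {f. integrable lborel f \<and> L2sq lborel f < \<infinity>}"

definition strichartz_range :: "((real \<times> real) \<times> (complex ^ 'n::finite) \<Rightarrow> complex) set" where
  "strichartz_range = {G \<in> borel_measurable (nu2 CARD('n) \<Otimes>\<^sub>M lborel).
     \<forall>e>0. \<exists>f\<in>L12. L2sq (nu2 CARD('n) \<Otimes>\<^sub>M lborel) (\<lambda>y. strichartz f y - G y) < ennreal e}"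

definition fan_mult :: "'n::finite itself \<Rightarrow> (real \<times> real \<Rightarrow> complex) set" where
  "fan_mult _ = {m \<in> borel_measurable (nu2 CARD('n)). bounded (m ` fan CARD('n)) \<and>
     (\<forall>f::'n heis \<Rightarrow> complex. f \<in> L12 \<longrightarrow> (\<lambda>y. m (fst y) * strichartz f y) \<in> strichartz_range)}"

lemma L12_measurable: "f \<in> L12 \<Longrightarrow> f \<in> borel_measurable borel"
  by (auto simp: L12_def)

lemma L12_strichartz_measurable:
  fixes f :: "'n::finite heis \<Rightarrow> complex"
  shows "f \<in> L12 \<Longrightarrow> strichartz f \<in> borel_measurable (nu2 CARD('n) \<Otimes>\<^sub>M lborel)"
  by (intro measurable_strichartz L12_measurable)

lemma L2sq_add_le2:
  assumes "f \<in> borel_measurable M" "g \<in> borel_measurable M"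
  shows "L2sq M (\<lambda>x. f x + g x) \<le> 2 * L2sq M f + 2 * L2sq M g"
  using L2sq_add_le[OF assms, of 1] by (simp add: ennreal_numeral)

lemma L2sq_add_small:
  assumes "f \<in> borel_measurable M" "g \<in> borel_measurable M"
    and "L2sq M f < ennreal (e / 4)" "L2sq M g < ennreal (e / 4)"
  shows "L2sq M (\<lambda>x. f x + g x) < ennreal e"
proof -
  have "e > 0" using assms(3) by (cases "e > 0") (auto simp: ennreal_neg)
  have "2 * L2sq M f + 2 * L2sq M g < 2 * ennreal (e / 4) + 2 * ennreal (e / 4)"
    using assms by (intro add_strict_mono ennreal_mult_strict_left_mono) auto
  also have "\<dots> = ennreal e"
    using \<open>e > 0\<close> by (simp flip: ennreal_numeral ennreal_mult' ennreal_plus)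
  finally show ?thesis using L2sq_add_le2[OF assms(1,2)] by (rule le_less_trans[rotated])
qed

lemma L12_add: "f \<in> L12 \<Longrightarrow> g \<in> L12 \<Longrightarrow> (\<lambda>x. f x + g x) \<in> L12"
proof -
  assume f: "f \<in> L12" and g: "g \<in> L12"
  have "L2sq lborel (\<lambda>x. f x + g x) \<le> 2 * L2sq lborel f + 2 * L2sq lborel g"
    using f g by (intro L2sq_add_le2) (auto simp: L12_def)
  also have "\<dots> < \<infinity>"
    using f g by (auto simp: L12_def ennreal_mult_less_top)
  finally show ?thesis using f g by (auto simp: L12_def)
qed

lemma L12_cmult: "f \<in> L12 \<Longrightarrow> (\<lambda>x. c * f x) \<in> L12"
  using L2sq_cmult[of f lborel c] by (auto simp: L12_def ennreal_mult_less_top)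

lemma strichartz_range_measurable:
  fixes G :: "(real \<times> real) \<times> (complex ^ 'n::finite) \<Rightarrow> complex"
  shows "G \<in> strichartz_range \<Longrightarrow> G \<in> borel_measurable (nu2 CARD('n) \<Otimes>\<^sub>M lborel)"
  by (simp add: strichartz_range_def)

lemma strichartz_in_range: "f \<in> L12 \<Longrightarrow> strichartz f \<in> strichartz_range"
  by (auto simp: strichartz_range_def L2sq_def intro!: bexI[of _ f] L12_strichartz_measurable)

lemma strichartz_range_closed:
  fixes G :: "(real \<times> real) \<times> (complex ^ 'n::finite) \<Rightarrow> complex"
  assumes G: "G \<in> borel_measurable (nu2 CARD('n) \<Otimes>\<^sub>M lborel)"
    and approx: "\<And>e. e > 0 \<Longrightarrow> \<exists>H\<in>strichartz_range. L2sq (nu2 CARD('n) \<Otimes>\<^sub>M lborel) (\<lambda>y. H y - G y) < ennreal e"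
  shows "G \<in> strichartz_range"
  unfolding strichartz_range_def
proof (intro CollectI conjI G allI impI)
  fix e :: real assume e: "e > 0"
  let ?K = "nu2 CARD('n) \<Otimes>\<^sub>M (lborel :: (complex ^ 'n) measure)"
  obtain H where H: "H \<in> strichartz_range" "L2sq ?K (\<lambda>y. H y - G y) < ennreal (e / 4)"
    using approx[of "e / 4"] e by auto
  then obtain f where f: "f \<in> L12" "L2sq ?K (\<lambda>y. strichartz f y - H y) < ennreal (e / 4)"
    using e unfolding strichartz_range_def by (auto dest: spec[of _ "e / 4"])
  note [measurable] = G strichartz_range_measurable[OF H(1)] L12_strichartz_measurable[OF f(1)]
  have "L2sq ?K (\<lambda>y. (strichartz f y - H y) + (H y - G y)) < ennreal e"
    using f(2) H(2) by (intro L2sq_add_small) simp_all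
  then show "\<exists>f\<in>L12. L2sq ?K (\<lambda>y. strichartz f y - G y) < ennreal e"
    using f by auto
qed

lemma strichartz_range_add:
  fixes G H :: "(real \<times> real) \<times> (complex ^ 'n::finite) \<Rightarrow> complex"
  assumes G: "G \<in> strichartz_range" and H: "H \<in> strichartz_range"
  shows "(\<lambda>y. G y + H y) \<in> strichartz_range"
  unfolding strichartz_range_def
proof (intro CollectI conjI allI impI)
  let ?K = "nu2 CARD('n) \<Otimes>\<^sub>M (lborel :: (complex ^ 'n) measure)"
  have m: "G \<in> borel_measurable ?K" "H \<in> borel_measurable ?K" using G H by (auto intro: strichartz_range_measurable)
  then show "(\<lambda>y. G y + H y) \<in> borel_measurable ?K" by simp
  fix e :: real assume e: "e > 0"
  obtain f where f: "f \<in> L12" "L2sq ?K (\<lambda>y. strichartz f y - G y) < ennreal (e / 4)"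
    using G e unfolding strichartz_range_def by (auto dest: spec[of _ "e / 4"])
  obtain g where g: "g \<in> L12" "L2sq ?K (\<lambda>y. strichartz g y - H y) < ennreal (e / 4)"
    using H e unfolding strichartz_range_def by (auto dest: spec[of _ "e / 4"])
  note [measurable] = m L12_strichartz_measurable[OF f(1)] L12_strichartz_measurable[OF g(1)]
  have "L2sq ?K (\<lambda>y. (strichartz f y - G y) + (strichartz g y - H y)) < ennreal e"
    using f(2) g(2) by (intro L2sq_add_small) simp_all
  moreover have "strichartz (\<lambda>x. f x + g x) y = strichartz f y + strichartz g y" for y
    using f g by (intro strichartz_add) (auto simp: L12_def)
  ultimately have "L2sq ?K (\<lambda>y. strichartz (\<lambda>x. f x + g x) y - (G y + H y)) < ennreal e"
    by (simp add: algebra_simps)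
  then show "\<exists>f\<in>L12. L2sq ?K (\<lambda>y. strichartz f y - (G y + H y)) < ennreal e"
    by (rule bexI[of _ "\<lambda>x. f x + g x"]) (rule L12_add[OF f(1) g(1)])
qed

lemma L2sq_mult_le:
  assumes [measurable]: "G \<in> borel_measurable M" and m: "\<And>y. y \<in> space M \<Longrightarrow> norm (m y) \<le> B"
  shows "L2sq M (\<lambda>y. m y * G y) \<le> ennreal (B\<^sup>2) * L2sq M G"
proof -
  have "L2sq M (\<lambda>y. m y * G y) \<le> (\<integral>\<^sup>+y. ennreal (B\<^sup>2) * ennreal ((norm (G y))\<^sup>2) \<partial>M)"
    unfolding L2sq_def
  proof (rule nn_integral_mono)
    fix y assume "y \<in> space M"
    then have "(norm (m y))\<^sup>2 \<le> B\<^sup>2" using m by (intro power_mono) auto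
    then show "ennreal ((norm (m y * G y))\<^sup>2) \<le> ennreal (B\<^sup>2) * ennreal ((norm (G y))\<^sup>2)"
      by (simp add: norm_mult power_mult_distrib ennreal_mult'[symmetric] ennreal_leI mult_right_mono)
  qed
  then show ?thesis by (simp add: nn_integral_cmult L2sq_def)
qed

lemma measurable_fst_mult:
  assumes "m \<in> borel_measurable N"
  shows "(\<lambda>y. m (fst y)) \<in> borel_measurable (N \<Otimes>\<^sub>M L)"
  by (rule measurable_compose[OF measurable_fst assms])

lemma fan_mult_range:
  fixes G :: "(real \<times> real) \<times> (complex ^ 'n::finite) \<Rightarrow> complex"
  assumes m: "m \<in> fan_mult TYPE('n)" and G: "G \<in> strichartz_range"
  shows "(\<lambda>y. m (fst y) * G y) \<in> strichartz_range"
proof (rule strichartz_range_closed)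
  let ?K = "nu2 CARD('n) \<Otimes>\<^sub>M (lborel :: (complex ^ 'n) measure)"
  have mm: "(\<lambda>y. m (fst y)) \<in> borel_measurable ?K"
    using m by (intro measurable_fst_mult) (simp add: fan_mult_def)
  have Gm: "G \<in> borel_measurable ?K" by (rule strichartz_range_measurable[OF G])
  show "(\<lambda>y. m (fst y) * G y) \<in> borel_measurable ?K" using mm Gm by simp
  fix e :: real assume e: "e > 0"
  obtain B0 where "\<And>a. a \<in> fan CARD('n) \<Longrightarrow> norm (m a) \<le> B0"
    using m unfolding fan_mult_def bounded_iff by auto
  then have B: "\<And>a. a \<in> fan CARD('n) \<Longrightarrow> norm (m a) \<le> max B0 1" by (auto simp: le_max_iff_disj)
  define B where "B = max B0 1"
  have B1: "B > 0" by (simp add: B_def)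
  obtain f where f: "f \<in> L12" "L2sq ?K (\<lambda>y. strichartz f y - G y) < ennreal (e / B\<^sup>2)"
    using G e B1 unfolding strichartz_range_def by (auto dest: spec[of _ "e / B\<^sup>2"])
  have fm: "f \<in> borel_measurable borel" using f(1) by (rule L12_measurable)
  have "L2sq ?K (\<lambda>y. m (fst y) * (strichartz f y - G y)) \<le> ennreal (B\<^sup>2) * L2sq ?K (\<lambda>y. strichartz f y - G y)"
    using B Gm measurable_strichartz[OF fm] by (intro L2sq_mult_le) (auto simp: space_pair_measure B_def)
  also have "\<dots> < ennreal (B\<^sup>2) * ennreal (e / B\<^sup>2)"
    using f(2) B1 by (intro ennreal_mult_strict_left_mono) auto
  also have "\<dots> = ennreal e" using B1 e by (simp add: ennreal_mult'[symmetric])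
  finally have "L2sq ?K (\<lambda>y. m (fst y) * strichartz f y - m (fst y) * G y) < ennreal e"
    by (simp add: algebra_simps)
  moreover have "(\<lambda>y. m (fst y) * strichartz f y) \<in> strichartz_range"
    using m f(1) by (simp add: fan_mult_def)
  ultimately show "\<exists>H\<in>strichartz_range. L2sq ?K (\<lambda>y. H y - m (fst y) * G y) < ennreal e"
    by (rule bexI[of _ "\<lambda>y. m (fst y) * strichartz f y"])
qed

lemma fan_mult_add:
  assumes "m1 \<in> fan_mult TYPE('n::finite)" "m2 \<in> fan_mult TYPE('n)"
  shows "(\<lambda>a. m1 a + m2 a) \<in> fan_mult TYPE('n)"
  using assms unfolding fan_mult_def
  by (auto simp: distrib_right intro!: strichartz_range_add bounded_plus_comp)

lemma fan_mult_const: "(\<lambda>_. c) \<in> fan_mult TYPE('n::finite)"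
proof -
  have "(\<lambda>y. c * strichartz f y) \<in> strichartz_range" if "f \<in> L12" for f :: "'n heis \<Rightarrow> complex"
    using strichartz_in_range[OF L12_cmult[OF that, of c]] unfolding strichartz_cmult by simp
  then show ?thesis by (auto simp: fan_mult_def bounded_iff)
qed

lemma fan_mult_mult:
  assumes m1: "m1 \<in> fan_mult TYPE('n::finite)" and m2: "m2 \<in> fan_mult TYPE('n)"
  shows "(\<lambda>a. m1 a * m2 a) \<in> fan_mult TYPE('n)"
proof -
  obtain B1 B2 where B: "\<forall>a\<in>fan CARD('n). norm (m1 a) \<le> B1" "\<forall>a\<in>fan CARD('n). norm (m2 a) \<le> B2"
    using m1 m2 unfolding fan_mult_def bounded_iff by auto
  have "norm (m1 a * m2 a) \<le> B1 * B2" if "a \<in> fan CARD('n)" for a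
    unfolding norm_mult using B that by (intro mult_mono) (auto intro: order_trans[OF norm_ge_zero])
  then have "bounded ((\<lambda>a. m1 a * m2 a) ` fan CARD('n))"
    unfolding bounded_iff by (intro exI[of _ "B1 * B2"]) blast
  moreover have "(\<lambda>y. m1 (fst y) * (m2 (fst y) * strichartz f y)) \<in> strichartz_range" if "f \<in> L12" for f :: "'n heis \<Rightarrow> complex"
    using fan_mult_range[OF m1, of "\<lambda>y. m2 (fst y) * strichartz f y"] m2 that by (simp add: fan_mult_def)
  ultimately show ?thesis using m1 m2 by (auto simp: fan_mult_def mult.assoc)
qed

lemma L12_strichartz_finite:
  fixes f :: "'n::finite heis \<Rightarrow> complex"
  assumes "f \<in> L12"
  shows "L2sq (nu2 CARD('n) \<Otimes>\<^sub>M lborel) (strichartz f) < \<infinity>"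
  using assms strichartz_plancherel[of f] by (auto simp: L12_def)

lemma fan_mult_limit:
  assumes mj: "\<And>j. mj j \<in> fan_mult TYPE('n::finite)" and B: "\<And>j a. a \<in> fan CARD('n) \<Longrightarrow> norm (mj j a) \<le> B"
    and lim: "\<And>a. a \<in> fan CARD('n) \<Longrightarrow> (\<lambda>j. mj j a) \<longlonglongrightarrow> m a"
  shows "m \<in> fan_mult TYPE('n)"
  unfolding fan_mult_def
proof (intro CollectI conjI allI impI)
  let ?K = "nu2 CARD('n) \<Otimes>\<^sub>M (lborel :: (complex ^ 'n) measure)"
  have mjm: "mj j \<in> borel_measurable (nu2 CARD('n))" for j using mj by (simp add: fan_mult_def)
  show mm: "m \<in> borel_measurable (nu2 CARD('n))"
    by (rule borel_measurable_LIMSEQ_metric[OF mjm]) (use lim in simp)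
  have mB: "norm (m a) \<le> B" if "a \<in> fan CARD('n)" for a
    by (rule LIMSEQ_le_const2[OF tendsto_norm[OF lim[OF that]]]) (use B that in auto)
  then show "bounded (m ` fan CARD('n))"
    unfolding bounded_iff by (intro exI[of _ B]) blast
  fix f :: "'n heis \<Rightarrow> complex" assume f: "f \<in> L12"
  have Sm [measurable]: "strichartz f \<in> borel_measurable ?K" by (intro measurable_strichartz L12_measurable f)
  have [measurable]: "(\<lambda>y. mj j (fst y)) \<in> borel_measurable ?K" "(\<lambda>y. m (fst y)) \<in> borel_measurable ?K" for j
    using mjm mm by (auto intro: measurable_fst_mult)
  show "(\<lambda>y. m (fst y) * strichartz f y) \<in> strichartz_range"
  proof (rule strichartz_range_closed)
    fix e :: real assume e: "e > 0"
    have sp: "fst y \<in> fan CARD('n)" if "y \<in> space ?K" for y using that by (auto simp: space_pair_measure)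
    have "(\<lambda>j. L2sq ?K (\<lambda>y. mj j (fst y) * strichartz f y - m (fst y) * strichartz f y)) \<longlonglongrightarrow> (\<integral>\<^sup>+y. 0 \<partial>?K)"
      unfolding L2sq_def
    proof (rule nn_integral_dominated_convergence[where w = "\<lambda>y. ennreal ((2 * B)\<^sup>2) * ennreal ((norm (strichartz f y))\<^sup>2)"])
      show "(\<integral>\<^sup>+y. ennreal ((2 * B)\<^sup>2) * ennreal ((norm (strichartz f y))\<^sup>2) \<partial>?K) < \<infinity>"
        using L12_strichartz_finite[OF f] by (simp add: nn_integral_cmult ennreal_mult_less_top L2sq_def)
      show "AE y in ?K. ennreal ((norm (mj j (fst y) * strichartz f y - m (fst y) * strichartz f y))\<^sup>2) \<le> ennreal ((2 * B)\<^sup>2) * ennreal ((norm (strichartz f y))\<^sup>2)" for j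
      proof (rule AE_I2)
        fix y assume y: "y \<in> space ?K"
        have "norm (mj j (fst y) - m (fst y)) \<le> 2 * B"
          using norm_triangle_ineq4[of "mj j (fst y)" "m (fst y)"] B[OF sp[OF y], of j] mB[OF sp[OF y]] by linarith
        then have "norm (mj j (fst y) * strichartz f y - m (fst y) * strichartz f y) \<le> 2 * B * norm (strichartz f y)"
          unfolding left_diff_distrib[symmetric] norm_mult by (rule mult_right_mono) simp
        from power_mono[OF this, of 2]
        show "ennreal ((norm (mj j (fst y) * strichartz f y - m (fst y) * strichartz f y))\<^sup>2) \<le> ennreal ((2 * B)\<^sup>2) * ennreal ((norm (strichartz f y))\<^sup>2)"
          by (subst ennreal_mult'[symmetric]) (auto simp: power_mult_distrib intro!: ennreal_leI)
      qed
      show "AE y in ?K. (\<lambda>j. ennreal ((norm (mj j (fst y) * strichartz f y - m (fst y) * strichartz f y))\<^sup>2)) \<longlonglongrightarrow> 0"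
      proof (rule AE_I2)
        fix y assume y: "y \<in> space ?K"
        have "(\<lambda>j. (norm (mj j (fst y) * strichartz f y - m (fst y) * strichartz f y))\<^sup>2) \<longlonglongrightarrow> (norm (m (fst y) * strichartz f y - m (fst y) * strichartz f y))\<^sup>2"
          by (intro tendsto_intros lim sp y)
        from tendsto_ennrealI[OF this]
        show "(\<lambda>j. ennreal ((norm (mj j (fst y) * strichartz f y - m (fst y) * strichartz f y))\<^sup>2)) \<longlonglongrightarrow> 0" by simp
      qed
    qed measurable
    then have "eventually (\<lambda>j. L2sq ?K (\<lambda>y. mj j (fst y) * strichartz f y - m (fst y) * strichartz f y) < ennreal e) sequentially"
      using e by (intro order_tendstoD(2)) auto
    from eventually_happens[OF this] obtain j where "L2sq ?K (\<lambda>y. mj j (fst y) * strichartz f y - m (fst y) * strichartz f y) < ennreal e"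
      by auto
    moreover have "(\<lambda>y. mj j (fst y) * strichartz f y) \<in> strichartz_range" using mj f by (simp add: fan_mult_def)
    ultimately show "\<exists>H\<in>strichartz_range. L2sq ?K (\<lambda>y. H y - m (fst y) * strichartz f y) < ennreal e"
      by (rule bexI[of _ "\<lambda>y. mj j (fst y) * strichartz f y"])
  qed measurable
qed

lemma fan_mult_cong:
  assumes m: "m \<in> fan_mult TYPE('n::finite)" and m': "m' \<in> borel_measurable (nu2 CARD('n))" "bounded (m' ` fan CARD('n))"
    and eq: "\<And>a. a \<in> fan CARD('n) \<Longrightarrow> fst a \<noteq> 0 \<Longrightarrow> m' a = m a"
  shows "m' \<in> fan_mult TYPE('n)"
  unfolding fan_mult_def
proof (intro CollectI conjI allI impI m')
  let ?K = "nu2 CARD('n) \<Otimes>\<^sub>M (lborel :: (complex ^ 'n) measure)"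
  fix f :: "'n heis \<Rightarrow> complex" assume f: "f \<in> L12"
  have V: "(\<lambda>y. m (fst y) * strichartz f y) \<in> strichartz_range" using m f by (simp add: fan_mult_def)
  show "(\<lambda>y. m' (fst y) * strichartz f y) \<in> strichartz_range"
  proof (rule strichartz_range_closed)
    show "(\<lambda>y. m' (fst y) * strichartz f y) \<in> borel_measurable ?K"
      by (intro borel_measurable_times measurable_fst_mult m' measurable_strichartz L12_measurable f)
    fix e :: real assume e: "e > 0"
    have "L2sq ?K (\<lambda>y. m (fst y) * strichartz f y - m' (fst y) * strichartz f y) = (\<integral>\<^sup>+y. 0 \<partial>?K)"
      unfolding L2sq_def
    proof (rule nn_integral_cong)
      fix y assume "y \<in> space ?K"
      then have "fst y \<in> fan CARD('n)" by (auto simp: space_pair_measure)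
      then have "m (fst y) * strichartz f y = m' (fst y) * strichartz f y"
        using eq[of "fst y"] by (cases "fst (fst y) = 0") (auto simp: strichartz_def split_beta')
      then show "ennreal ((norm (m (fst y) * strichartz f y - m' (fst y) * strichartz f y))\<^sup>2) = 0" by simp
    qed
    then show "\<exists>H\<in>strichartz_range. L2sq ?K (\<lambda>y. H y - m' (fst y) * strichartz f y) < ennreal e"
      using V e by (intro bexI[of _ "\<lambda>y. m (fst y) * strichartz f y"]) auto
  qed
qed

lemma strichartz_translate:
  fixes f :: "'n::finite heis \<Rightarrow> complex"
  assumes fm [measurable]: "f \<in> borel_measurable borel"
  shows "strichartz (\<lambda>x. f (x + (0, u))) y = cis (fst (fst y) * u) * strichartz f y"
proof -
  obtain a w where y: "y = (a, w)" by fastforce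
  define P where "P x = cis (- (fst a * snd x)) * (cis (- (fst a / 2) * (fst x \<bullet> rot w)) * of_real (laguerre_fun (fan_index CARD('n) a) (fst a) (w - fst x)))" for x :: "'n heis"
  have [measurable]: "P \<in> borel_measurable borel" unfolding P_def by measurable
  have P: "fan_fun a (heis_mult (heis_inv x) (w, 0)) = P x" for x :: "'n heis"
    using fan_fun_heis[of a "fst x" "snd x" w] by (simp add: P_def)
  have Pu: "P x = cis (fst a * u) * P (x + (0, u))" for x
  proof -
    have "cis (- (fst a * snd x)) = cis (fst a * u) * cis (- (fst a * (snd x + u)))"
      by (simp add: cis_mult algebra_simps)
    then show ?thesis by (simp add: P_def)
  qed
  have "(LINT x|lborel. f (x + (0, u)) * P x) = (LINT x|lborel. cis (fst a * u) * (f (x + (0, u)) * P (x + (0, u))))"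
    by (intro Bochner_Integration.integral_cong refl, subst Pu) (simp only: mult_ac)
  also have "\<dots> = cis (fst a * u) * (LINT x|lborel. f x * P x)"
    using lborel_integral_translate[of "\<lambda>x. f x * P x" "(0, u)"] by simp
  finally show ?thesis by (simp add: y strichartz_def P)
qed

lemma fan_mult_cis: "(\<lambda>a. cis (fst a * u)) \<in> fan_mult TYPE('n::finite)"
  unfolding fan_mult_def
proof (intro CollectI conjI allI impI)
  show "(\<lambda>a. cis (fst a * u)) \<in> borel_measurable (nu2 CARD('n))" by measurable
  show "bounded ((\<lambda>a. cis (fst a * u)) ` fan CARD('n))" by (auto simp: bounded_iff)
  fix f :: "'n heis \<Rightarrow> complex" assume f: "f \<in> L12"
  have fm [measurable]: "f \<in> borel_measurable borel" by (rule L12_measurable[OF f])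
  have "(\<lambda>x. f (x + (0, u))) \<in> L12"
    using f lborel_integrable_translate_iff[OF fm, of "(0, u)"] lborel_nn_integral_translate[of "\<lambda>x. ennreal ((norm (f x))\<^sup>2)" "(0, u)"]
    by (simp add: L12_def L2sq_def)
  from strichartz_in_range[OF this] show "(\<lambda>y. cis (fst (fst y) * u) * strichartz f y) \<in> strichartz_range"
    unfolding strichartz_translate[OF fm] .
qed

lemma fan_mult_sin: "(\<lambda>a. of_real (sin (fst a * u))) \<in> fan_mult TYPE('n::finite)"
proof -
  have "(\<lambda>a. 1 / (2 * \<i>) * (cis (fst a * u) + (-1) * cis (fst a * (- u)))) \<in> fan_mult TYPE('n)"
    by (intro fan_mult_mult fan_mult_add fan_mult_const fan_mult_cis)
  moreover have "1 / (2 * \<i>) * (cis (fst a * u) + (-1) * cis (fst a * (- u))) = of_real (sin (fst a * u))" for a :: "real \<times> real"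
    by (simp add: complex_eq_iff cis.ctr Complex_eq)
  ultimately show ?thesis by simp
qed

text \<open>Convolution on the group with the measure \<open>exp (- b \<bar>z\<bar>\<^sup>2) dz \<otimes> \<delta>\<^sub>0\<close>.\<close>

definition gconv :: "real \<Rightarrow> ('n::finite heis \<Rightarrow> complex) \<Rightarrow> 'n heis \<Rightarrow> complex" where
  "gconv b f x = (LINT z|lborel. f (z, snd x - 1/2 * (z \<bullet> rot (fst x))) * of_real (exp (- b * (norm (fst x - z))\<^sup>2)))"

lemma gconv_measurable [measurable]:
  fixes f :: "'n::finite heis \<Rightarrow> complex"
  assumes [measurable]: "f \<in> borel_measurable borel"
  shows "gconv b f \<in> borel_measurable borel"
  unfolding gconv_def by measurable

lemma norm_integral_le_nn_integral:
  fixes f :: "'a \<Rightarrow> 'b::{banach, second_countable_topology}"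
  shows "ennreal (norm (LINT x|M. f x)) \<le> (\<integral>\<^sup>+x. ennreal (norm (f x)) \<partial>M)"
  by (cases "integrable M f") (auto simp: integral_norm_bound_ennreal not_integrable_integral_eq)

lemma gauss_nn_integral_shift:
  assumes b: "b > 0"
  shows "(\<integral>\<^sup>+w. ennreal (exp (- b * (norm (w - z))\<^sup>2)) \<partial>lborel) = ennreal (sqrt (pi / b) ^ DIM('a::euclidean_space))"
    and "(\<integral>\<^sup>+w. ennreal (exp (- b * (norm (z - w :: 'a))\<^sup>2)) \<partial>lborel) = ennreal (sqrt (pi / b) ^ DIM('a))"
proof -
  show 1: "(\<integral>\<^sup>+w. ennreal (exp (- b * (norm (w - z))\<^sup>2)) \<partial>lborel) = ennreal (sqrt (pi / b) ^ DIM('a))"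
    using lborel_nn_integral_translate[of "\<lambda>w::'a. ennreal (exp (- b * (norm w)\<^sup>2))" "- z"] gauss_integrable(3)[OF b, where 'a = 'a] by simp
  then show "(\<integral>\<^sup>+w. ennreal (exp (- b * (norm (z - w :: 'a))\<^sup>2)) \<partial>lborel) = ennreal (sqrt (pi / b) ^ DIM('a))"
    by (simp add: norm_minus_commute)
qed

lemma gauss_nn_integral_cmult:
  fixes z :: "'a::euclidean_space"
  assumes b: "b > 0"
  shows "(\<integral>\<^sup>+w. c * ennreal (exp (- b * (norm (w - z))\<^sup>2)) \<partial>lborel) = c * ennreal (sqrt (pi / b) ^ DIM('a))"
  unfolding gauss_nn_integral_shift(1)[OF b, of z, symmetric] by (rule nn_integral_cmult) measurable

lemma gconv_nn_integral:
  fixes h :: "'n::finite heis \<Rightarrow> ennreal"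
  assumes [measurable]: "h \<in> borel_measurable borel" and b: "b > 0"
  shows "(\<integral>\<^sup>+x. (\<integral>\<^sup>+z. h (z, snd x - 1/2 * (z \<bullet> rot (fst x))) * ennreal (exp (- b * (norm (fst x - z))\<^sup>2)) \<partial>lborel) \<partial>lborel)
    = ennreal (sqrt (pi / b) ^ DIM(complex ^ 'n)) * (\<integral>\<^sup>+x. h x \<partial>lborel)"
proof -
  define mass where "mass = ennreal (sqrt (pi / b) ^ DIM(complex ^ 'n))"
  let ?E = "\<lambda>w z :: complex ^ 'n. ennreal (exp (- b * (norm (w - z))\<^sup>2))"
  have "(\<integral>\<^sup>+x. (\<integral>\<^sup>+z. h (z, snd x - 1/2 * (z \<bullet> rot (fst x))) * ?E (fst x) z \<partial>lborel) \<partial>lborel) =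
     (\<integral>\<^sup>+x. (\<integral>\<^sup>+z. h (z, snd x - 1/2 * (z \<bullet> rot (fst x))) * ?E (fst x) z \<partial>lborel) \<partial>(lborel \<Otimes>\<^sub>M lborel))"
    by (simp add: lborel_prod)
  also have "\<dots> = (\<integral>\<^sup>+w. \<integral>\<^sup>+s. (\<integral>\<^sup>+z. h (z, s - 1/2 * (z \<bullet> rot w)) * ?E w z \<partial>lborel) \<partial>lborel \<partial>lborel)"
    by (subst lborel.nn_integral_fst[symmetric]) (simp_all add: lborel_prod)
  also have "\<dots> = (\<integral>\<^sup>+w. \<integral>\<^sup>+z. (\<integral>\<^sup>+s. h (z, s - 1/2 * (z \<bullet> rot w)) * ?E w z \<partial>lborel) \<partial>lborel \<partial>lborel)"
    by (intro nn_integral_cong lborel_pair.Fubini') simp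
  also have "\<dots> = (\<integral>\<^sup>+w. \<integral>\<^sup>+z. (\<integral>\<^sup>+s. h (z, s) \<partial>lborel) * ?E w z \<partial>lborel \<partial>lborel)"
  proof (intro nn_integral_cong)
    fix w z :: "complex ^ 'n"
    have "(\<integral>\<^sup>+s. h (z, s + - (1/2 * (z \<bullet> rot w))) \<partial>lborel) = (\<integral>\<^sup>+s. h (z, s) \<partial>lborel)"
      by (rule lborel_nn_integral_translate) simp
    then show "(\<integral>\<^sup>+s. h (z, s - 1/2 * (z \<bullet> rot w)) * ?E w z \<partial>lborel) = (\<integral>\<^sup>+s. h (z, s) \<partial>lborel) * ?E w z"
      by (subst nn_integral_multc) simp_all
  qed
  also have "\<dots> = (\<integral>\<^sup>+z. \<integral>\<^sup>+w. (\<integral>\<^sup>+s. h (z, s) \<partial>lborel) * ?E w z \<partial>lborel \<partial>lborel)"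
    by (rule lborel_pair.Fubini') simp
  also have "\<dots> = (\<integral>\<^sup>+z. (\<integral>\<^sup>+s. h (z, s) \<partial>lborel) * mass \<partial>lborel)"
    unfolding mass_def gauss_nn_integral_cmult[OF b] ..
  also have "\<dots> = (\<integral>\<^sup>+z. (\<integral>\<^sup>+s. h (z, s) \<partial>lborel) \<partial>lborel) * mass"
    by (rule nn_integral_multc) simp
  also have "(\<integral>\<^sup>+z. (\<integral>\<^sup>+s. h (z, s) \<partial>lborel) \<partial>lborel) = (\<integral>\<^sup>+x. h x \<partial>lborel)"
    by (subst lborel.nn_integral_fst) (simp_all add: lborel_prod)
  finally show ?thesis by (simp add: mass_def mult.commute)
qed

lemma gconv_L12:
  fixes f :: "'n::finite heis \<Rightarrow> complex"
  assumes f: "f \<in> L12" and b: "b > 0"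
  shows "gconv b f \<in> L12"
proof -
  have fm [measurable]: "f \<in> borel_measurable borel" by (rule L12_measurable[OF f])
  define mass where "mass = ennreal (sqrt (pi / b) ^ DIM(complex ^ 'n))"
  let ?u = "\<lambda>x z. f (z, snd x - 1/2 * (z \<bullet> rot (fst x)))"
  let ?e = "\<lambda>x z. exp (- b * (norm (fst x - z))\<^sup>2)"
  have bound: "ennreal (norm (gconv b f x)) \<le> (\<integral>\<^sup>+z. ennreal (norm (?u x z)) * ennreal (?e x z) \<partial>lborel)" for x
    using norm_integral_le_nn_integral[of lborel "\<lambda>z. ?u x z * of_real (?e x z)"]
    by (simp add: gconv_def norm_mult ennreal_mult')
  have "(\<integral>\<^sup>+x. ennreal (norm (gconv b f x)) \<partial>lborel) \<le> (\<integral>\<^sup>+x. (\<integral>\<^sup>+z. ennreal (norm (?u x z)) * ennreal (?e x z) \<partial>lborel) \<partial>lborel)"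
    by (intro nn_integral_mono bound)
  also have "\<dots> = mass * (\<integral>\<^sup>+x. ennreal (norm (f x)) \<partial>lborel)"
    unfolding mass_def by (rule gconv_nn_integral[OF _ b]) simp
  also have "\<dots> < \<infinity>"
    using f by (simp add: L12_def integrable_iff_bounded mass_def ennreal_mult_less_top)
  finally have 1: "integrable lborel (gconv b f)"
    by (intro integrableI_bounded) simp_all
  have sq: "ennreal ((norm (gconv b f x))\<^sup>2) \<le> mass * (\<integral>\<^sup>+z. ennreal ((norm (?u x z))\<^sup>2) * ennreal (?e x z) \<partial>lborel)" for x
  proof -
    have r: "ennreal (sqrt (?e x z)) * (ennreal (norm (?u x z)) * ennreal (sqrt (?e x z))) = ennreal (norm (?u x z)) * ennreal (?e x z)" for z
      by (simp add: ennreal_mult'[symmetric] mult.left_commute[of "sqrt _"])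
    have "ennreal ((norm (gconv b f x))\<^sup>2) = (ennreal (norm (gconv b f x)))\<^sup>2"
      by (simp add: ennreal_power)
    also have "\<dots> \<le> (\<integral>\<^sup>+z. ennreal (sqrt (?e x z)) * (ennreal (norm (?u x z)) * ennreal (sqrt (?e x z))) \<partial>lborel)\<^sup>2"
      unfolding r by (intro power_mono bound) simp
    also have "\<dots> \<le> (\<integral>\<^sup>+z. (ennreal (sqrt (?e x z)))\<^sup>2 \<partial>lborel) * (\<integral>\<^sup>+z. (ennreal (norm (?u x z)) * ennreal (sqrt (?e x z)))\<^sup>2 \<partial>lborel)"
      by (rule Cauchy_Schwarz_nn_integral) simp_all
    also have "(\<integral>\<^sup>+z. (ennreal (sqrt (?e x z)))\<^sup>2 \<partial>lborel) = mass"
      unfolding mass_def gauss_nn_integral_shift(2)[OF b, of "fst x", symmetric] by (simp add: ennreal_power)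
    also have "(\<integral>\<^sup>+z. (ennreal (norm (?u x z)) * ennreal (sqrt (?e x z)))\<^sup>2 \<partial>lborel) = (\<integral>\<^sup>+z. ennreal ((norm (?u x z))\<^sup>2) * ennreal (?e x z) \<partial>lborel)"
      by (simp add: power_mult_distrib ennreal_power)
    finally show ?thesis .
  qed
  have "L2sq lborel (gconv b f) \<le> (\<integral>\<^sup>+x. mass * (\<integral>\<^sup>+z. ennreal ((norm (?u x z))\<^sup>2) * ennreal (?e x z) \<partial>lborel) \<partial>lborel)"
    unfolding L2sq_def by (intro nn_integral_mono sq)
  also have "\<dots> = mass * (\<integral>\<^sup>+x. (\<integral>\<^sup>+z. ennreal ((norm (?u x z))\<^sup>2) * ennreal (?e x z) \<partial>lborel) \<partial>lborel)"
    by (intro nn_integral_cmult) simp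
  also have "(\<integral>\<^sup>+x. (\<integral>\<^sup>+z. ennreal ((norm (?u x z))\<^sup>2) * ennreal (?e x z) \<partial>lborel) \<partial>lborel) = mass * L2sq lborel f"
    unfolding L2sq_def mass_def by (rule gconv_nn_integral[OF _ b]) simp
  also have "mass * (mass * L2sq lborel f) < \<infinity>"
    using f by (simp add: L12_def mass_def ennreal_mult_less_top)
  finally show ?thesis using 1 by (simp add: L12_def)
qed

lemma tslice_gconv:
  fixes f :: "'n::finite heis \<Rightarrow> complex"
  assumes f: "integrable lborel f" and b: "b > 0"
  shows "tslice (gconv b f) l w = (LINT z|lborel. tslice f l z * cis (- (l / 2) * (z \<bullet> rot w)) * of_real (exp (- b * (norm (w - z))\<^sup>2)))"
proof -
  have fm [measurable]: "f \<in> borel_measurable borel" using f by auto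
  let ?c = "\<lambda>z. 1/2 * (z \<bullet> rot w)" and ?E = "\<lambda>z. exp (- b * (norm (w - z))\<^sup>2)"
  define H where "H z s = f (z, s - ?c z) * of_real (?E z) * cis (- (l * s))" for z s
  have Hm [measurable]: "case_prod H \<in> borel_measurable (lborel \<Otimes>\<^sub>M lborel)"
    unfolding H_def split_beta' by measurable
  have Hint: "integrable (lborel \<Otimes>\<^sub>M lborel) (case_prod H)"
  proof (rule integrableI_bounded[OF Hm])
    have "(\<integral>\<^sup>+p. ennreal (norm (case_prod H p)) \<partial>(lborel \<Otimes>\<^sub>M lborel)) = (\<integral>\<^sup>+z. \<integral>\<^sup>+s. ennreal (norm (H z s)) \<partial>lborel \<partial>lborel)"
      by (subst lborel.nn_integral_fst[symmetric]) simp_all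
    also have "\<dots> \<le> (\<integral>\<^sup>+z. \<integral>\<^sup>+s. ennreal (norm (f (z, s + - ?c z))) \<partial>lborel \<partial>lborel)"
      using b by (intro nn_integral_mono ennreal_leI) (simp add: H_def norm_mult mult_left_le)
    also have "\<dots> = (\<integral>\<^sup>+z. \<integral>\<^sup>+s. ennreal (norm (f (z, s))) \<partial>lborel \<partial>lborel)"
      by (intro nn_integral_cong lborel_nn_integral_translate) simp
    also have "\<dots> = (\<integral>\<^sup>+x. ennreal (norm (f x)) \<partial>lborel)"
      by (subst lborel.nn_integral_fst) (simp_all add: lborel_prod)
    also have "\<dots> < \<infinity>" using f by (simp add: integrable_iff_bounded)
    finally show "(\<integral>\<^sup>+p. ennreal (norm (case_prod H p)) \<partial>(lborel \<Otimes>\<^sub>M lborel)) < \<infinity>" .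
  qed
  have "tslice (gconv b f) l w = (LINT s|lborel. LINT z|lborel. H z s)"
    unfolding tslice_def ft_def gconv_def fst_conv snd_conv H_def integral_mult_left_zero ..
  also have "\<dots> = (LINT z|lborel. LINT s|lborel. H z s)"
    by (rule lborel_pair.Fubini_integral[OF Hint])
  also have "\<dots> = (LINT z|lborel. tslice f l z * cis (- (l / 2) * (z \<bullet> rot w)) * of_real (?E z))"
  proof (intro Bochner_Integration.integral_cong refl)
    fix z
    have "(LINT s|lborel. H z s) = (LINT s|lborel. H z (s + ?c z))"
      by (rule lborel_integral_translate[symmetric]) (simp add: H_def)
    also have "\<dots> = (LINT s|lborel. f (z, s) * cis (- (l * s)) * (cis (- (l / 2) * (z \<bullet> rot w)) * of_real (?E z)))"
    proof (intro Bochner_Integration.integral_cong refl)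
      fix s
      have "cis (- (l * (s + ?c z))) = cis (- (l * s)) * cis (- (l / 2) * (z \<bullet> rot w))"
        by (simp add: cis_mult algebra_simps)
      then show "H z (s + ?c z) = f (z, s) * cis (- (l * s)) * (cis (- (l / 2) * (z \<bullet> rot w)) * of_real (?E z))"
        unfolding H_def by (simp add: mult_ac)
    qed
    finally show "(LINT s|lborel. H z s) = tslice f l z * cis (- (l / 2) * (z \<bullet> rot w)) * of_real (?E z)"
      unfolding integral_mult_left_zero tslice_def ft_def by (simp add: mult.assoc)
  qed
  finally show ?thesis .
qed

text \<open>The multiplier of \<open>gconv\<close> on the \<open>k\<close>-th ray, normalised to the value \<open>1\<close> at \<open>l = 0\<close>.\<close>

definition gconv_symbol :: "nat \<Rightarrow> real \<Rightarrow> real \<Rightarrow> nat \<Rightarrow> real" where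
  "gconv_symbol n b l k = (1 / (1 + \<bar>l\<bar> / (4 * b))) ^ n * ((1 - \<bar>l\<bar> / (4 * b)) / (1 + \<bar>l\<bar> / (4 * b))) ^ k"

lemma gauss_twist_laguerre:
  fixes w :: "complex ^ 'n::finite"
  assumes l: "l \<noteq> 0" and b: "b > 0"
  shows "(LINT z|lborel. of_real (exp (- b * (norm z)\<^sup>2)) * cis (- (l / 2) * (z \<bullet> rot w)) * of_real (laguerre_fun k l (w - z)))
    = of_real ((pi / b) ^ CARD('n) * gconv_symbol CARD('n) b l k * laguerre_fun k l w)"
proof -
  let ?n = "CARD('n)"
  define x where "x = \<bar>l\<bar> / (4 * b)"
  have x: "x > 0" "\<bar>l\<bar> = 4 * b * x" using l b by (auto simp: x_def)
  define s where "s = (1 - x) / (1 + x)"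
  have s: "\<bar>s\<bar> < 1" using x by (simp add: s_def abs_less_iff divide_simps)
  have s1: "1 - s = 2 * x / (1 + x)" "1 + s = 2 / (1 + x)" using x by (auto simp: s_def field_simps)
  have "\<bar>l\<bar> / 4 * ((1 + s) / (1 - s)) = b"
  proof -
    have e: "2 / (1 + x) = 1 / x * (2 * x / (1 + x))" and nz: "2 * x / (1 + x) \<noteq> 0" using x(1) by simp_all
    have "2 / (1 + x) / (2 * x / (1 + x)) = 1 / x" unfolding e by (rule nonzero_mult_div_cancel_right[OF nz])
    then show ?thesis unfolding s1 x(2) using x(1) by (simp only:) simp
  qed
  then have "exp (- b * (norm z)\<^sup>2) = (1 - s) ^ ?n * lag_gauss s l z" for z :: "complex ^ 'n"
    using s by (simp add: lag_gauss_def)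
  then have "(LINT z|lborel. of_real (exp (- b * (norm z)\<^sup>2)) * cis (- (l / 2) * (z \<bullet> rot w)) * of_real (laguerre_fun k l (w - z)))
    = (LINT z|lborel. of_real ((1 - s) ^ ?n) * ((of_real (lag_gauss s l z) * cis (- (l / 2) * (z \<bullet> rot w))) * of_real (laguerre_fun k l (w - z))))"
    by (simp only: of_real_mult mult.assoc)
  also have "\<dots> = of_real ((1 - s) ^ ?n) * of_real ((2 * pi / \<bar>l\<bar>) ^ ?n * s ^ k * laguerre_fun k l w)"
    unfolding integral_mult_right_zero lag_gauss_twist_laguerre[OF l s] ..
  also have "\<dots> = of_real (((1 - s) ^ ?n * (2 * pi / \<bar>l\<bar>) ^ ?n) * s ^ k * laguerre_fun k l w)"
    by (simp only: of_real_mult mult.assoc)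
  also have "(1 - s) ^ ?n * (2 * pi / \<bar>l\<bar>) ^ ?n = (pi / b) ^ ?n * (1 / (1 + x)) ^ ?n"
    unfolding power_mult_distrib[symmetric] s1 x(2) using x(1) b by (simp add: field_simps)
  finally show ?thesis unfolding gconv_symbol_def x_def[symmetric] s_def[symmetric] by (simp only: mult.assoc)
qed

lemma tw_conv_gconv:
  fixes g :: "complex ^ 'n::finite \<Rightarrow> complex"
  assumes g: "integrable lborel g" and l: "l \<noteq> 0" and b: "b > 0"
  shows "tw_conv (\<lambda>w. LINT z|lborel. g z * cis (- (l / 2) * (z \<bullet> rot w)) * of_real (exp (- b * (norm (w - z))\<^sup>2))) k l v
    = of_real ((pi / b) ^ CARD('n) * gconv_symbol CARD('n) b l k) * tw_conv g k l v"
proof -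
  have gm [measurable]: "g \<in> borel_measurable borel" using g by auto
  let ?n = "CARD('n)" and ?e = "\<lambda>z w :: complex ^ 'n. cis (- (l / 2) * (z \<bullet> rot w))"
  let ?E = "\<lambda>w z :: complex ^ 'n. exp (- b * (norm (w - z))\<^sup>2)"
  define c where "c = 1 / fan_const ?n k"
  have c: "c > 0" by (simp add: c_def fan_const_pos)
  define H where "H z w = g z * ?e z w * of_real (?E w z) * ?e w v * of_real (laguerre_fun k l (v - w))" for z w
  have Hm [measurable]: "case_prod H \<in> borel_measurable (lborel \<Otimes>\<^sub>M lborel)"
    unfolding H_def split_beta' by measurable
  have Hint: "integrable (lborel \<Otimes>\<^sub>M lborel) (case_prod H)"
  proof (rule integrableI_bounded[OF Hm])
    have "(\<integral>\<^sup>+p. ennreal (norm (case_prod H p)) \<partial>(lborel \<Otimes>\<^sub>M lborel)) = (\<integral>\<^sup>+z. \<integral>\<^sup>+w. ennreal (norm (H z w)) \<partial>lborel \<partial>lborel)"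
      by (subst lborel.nn_integral_fst[symmetric]) simp_all
    also have "\<dots> \<le> (\<integral>\<^sup>+z. \<integral>\<^sup>+w. ennreal (c * norm (g z)) * ennreal (?E w z) \<partial>lborel \<partial>lborel)"
    proof (intro nn_integral_mono)
      fix z w
      have "norm (H z w) = norm (g z) * ?E w z * \<bar>laguerre_fun k l (v - w)\<bar>" by (simp add: H_def norm_mult)
      also have "\<dots> \<le> norm (g z) * ?E w z * c"
        unfolding c_def by (intro mult_left_mono laguerre_fun_le l) simp
      finally show "ennreal (norm (H z w)) \<le> ennreal (c * norm (g z)) * ennreal (?E w z)"
        using c by (subst ennreal_mult'[symmetric]) (auto simp: mult_ac intro!: ennreal_leI)
    qed
    also have "\<dots> = (\<integral>\<^sup>+z. ennreal (c * norm (g z)) * ennreal (sqrt (pi / b) ^ DIM(complex ^ 'n)) \<partial>lborel)"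
      unfolding gauss_nn_integral_cmult[OF b] ..
    also have "\<dots> = ennreal c * (\<integral>\<^sup>+z. ennreal (norm (g z)) \<partial>lborel) * ennreal (sqrt (pi / b) ^ DIM(complex ^ 'n))"
      using c by (simp add: nn_integral_multc nn_integral_cmult ennreal_mult')
    also have "\<dots> < \<infinity>" using g by (simp add: integrable_iff_bounded ennreal_mult_less_top)
    finally show "(\<integral>\<^sup>+p. ennreal (norm (case_prod H p)) \<partial>(lborel \<Otimes>\<^sub>M lborel)) < \<infinity>" .
  qed
  have "tw_conv (\<lambda>w. LINT z|lborel. g z * ?e z w * of_real (?E w z)) k l v = (LINT w|lborel. LINT z|lborel. H z w)"
    unfolding tw_conv_def H_def integral_mult_left_zero ..
  also have "\<dots> = (LINT z|lborel. LINT w|lborel. H z w)"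
    by (rule lborel_pair.Fubini_integral[OF Hint])
  also have "\<dots> = (LINT z|lborel. of_real ((pi / b) ^ ?n * gconv_symbol ?n b l k) * (g z * ?e z v * of_real (laguerre_fun k l (v - z))))"
  proof (intro Bochner_Integration.integral_cong refl)
    fix z
    have "(LINT w|lborel. H z w) = (LINT w|lborel. H z (w + z))"
      by (rule lborel_integral_translate[symmetric]) (simp add: H_def)
    also have "\<dots> = (LINT w|lborel. g z * ?e z v * (of_real (exp (- b * (norm w)\<^sup>2)) * ?e w (v - z) * of_real (laguerre_fun k l ((v - z) - w))))"
    proof (intro Bochner_Integration.integral_cong refl)
      fix w
      have "?e z (w + z) * ?e (w + z) v = cis (- (l / 2) * (z \<bullet> rot (w + z) + (w + z) \<bullet> rot v))"
        by (simp add: cis_mult distrib_left)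
      also have "z \<bullet> rot (w + z) + (w + z) \<bullet> rot v = z \<bullet> rot v + w \<bullet> rot (v - z)"
        using inner_rot_commute[of z w] by (simp add: rot_add rot_diff inner_add_left inner_add_right inner_diff_right)
      also have "cis (- (l / 2) * (z \<bullet> rot v + w \<bullet> rot (v - z))) = ?e z v * ?e w (v - z)"
        by (simp add: cis_mult distrib_left)
      finally have e: "?e z (w + z) * ?e (w + z) v = ?e z v * ?e w (v - z)" .
      have "H z (w + z) = g z * (?e z (w + z) * ?e (w + z) v) * of_real (exp (- b * (norm w)\<^sup>2)) * of_real (laguerre_fun k l ((v - z) - w))"
        unfolding H_def by (simp add: mult_ac algebra_simps)
      then show "H z (w + z) = g z * ?e z v * (of_real (exp (- b * (norm w)\<^sup>2)) * ?e w (v - z) * of_real (laguerre_fun k l ((v - z) - w)))"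
        unfolding e by (simp only: mult_ac)
    qed
    finally show "(LINT w|lborel. H z w) = of_real ((pi / b) ^ ?n * gconv_symbol ?n b l k) * (g z * ?e z v * of_real (laguerre_fun k l (v - z)))"
      unfolding integral_mult_right_zero gauss_twist_laguerre[OF l b] of_real_mult by (simp only: mult_ac)
  qed
  finally show ?thesis unfolding integral_mult_right_zero tw_conv_def .
qed

lemma strichartz_gconv:
  fixes f :: "'n::finite heis \<Rightarrow> complex"
  assumes f: "f \<in> L12" and b: "b > 0" and a: "a \<in> fan CARD('n)" "fst a \<noteq> 0"
  shows "strichartz (gconv b f) (a, w) = of_real ((pi / b) ^ CARD('n) * gconv_symbol CARD('n) b (fst a) (fan_index CARD('n) a)) * strichartz f (a, w)"
proof -
  obtain k where k: "a \<in> fan_ray CARD('n) k" using a by (auto simp: fan_def)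
  then have i: "fan_index CARD('n) a = k" by (rule fan_index_eq)
  obtain l where l: "a = (l, (2 * real k + real CARD('n)) * \<bar>l\<bar>)" "l \<noteq> 0" using k by (auto simp: fan_ray_def)
  have fi: "integrable lborel f" "integrable lborel (gconv b f)"
    using f gconv_L12[OF f b] by (auto simp: L12_def)
  have "tslice (gconv b f) l = (\<lambda>w. LINT z|lborel. tslice f l z * cis (- (l / 2) * (z \<bullet> rot w)) * of_real (exp (- b * (norm (w - z))\<^sup>2)))"
    by (rule ext) (rule tslice_gconv[OF fi(1) b])
  then show ?thesis
    unfolding i unfolding l(1) strichartz_eq[OF fi(1) l(2)] strichartz_eq[OF fi(2) l(2)] fst_conv
    using tw_conv_gconv[OF tslice_integrable(1)[OF fi(1)] l(2) b, of l k w] by (simp only: mult_ac)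
qed

lemma strichartz_range_cong:
  fixes G :: "(real \<times> real) \<times> (complex ^ 'n::finite) \<Rightarrow> complex"
  assumes G: "G \<in> strichartz_range" and eq: "\<And>a w. a \<in> fan CARD('n) \<Longrightarrow> H (a, w) = G (a, w)"
  shows "H \<in> strichartz_range"
proof -
  let ?K = "nu2 CARD('n) \<Otimes>\<^sub>M (lborel :: (complex ^ 'n) measure)"
  have eq': "H y = G y" if "y \<in> space ?K" for y
    using that eq[of "fst y" "snd y"] by (auto simp: space_pair_measure)
  have "H \<in> borel_measurable ?K"
    using strichartz_range_measurable[OF G] measurable_cong[of ?K H G borel] eq' by simp
  moreover have "L2sq ?K (\<lambda>y. u y - H y) = L2sq ?K (\<lambda>y. u y - G y)" for u
    unfolding L2sq_def by (intro nn_integral_cong) (simp add: eq')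
  ultimately show ?thesis using G by (simp add: strichartz_range_def)
qed

lemma gconv_symbol_bound:
  assumes b: "b > 0" shows "\<bar>gconv_symbol n b l k\<bar> \<le> 1"
proof -
  define x where "x = \<bar>l\<bar> / (4 * b)"
  have x: "x \<ge> 0" using b by (simp add: x_def)
  have "\<bar>1 / (1 + x)\<bar> ^ n \<le> 1" "\<bar>(1 - x) / (1 + x)\<bar> ^ k \<le> 1"
    using x by (intro power_le_one; simp add: divide_le_eq abs_le_iff)+
  then show ?thesis
    unfolding gconv_symbol_def x_def[symmetric] abs_mult power_abs by (intro mult_le_one) auto
qed

definition gsym :: "nat \<Rightarrow> real \<Rightarrow> real \<times> real \<Rightarrow> real" where
  "gsym n b a = gconv_symbol n b (fst a) (fan_index n a)"

lemma fan_mult_gsym: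
  assumes b: "b > 0"
  shows "(\<lambda>a. of_real (gsym CARD('n) b a)) \<in> fan_mult TYPE('n::finite)"
  unfolding fan_mult_def
proof (intro CollectI conjI allI impI)
  let ?n = "CARD('n)"
  have [measurable]: "fan_index ?n \<in> measurable (nu2 ?n) (count_space UNIV)"
    by (rule measurable_fan_index) simp
  have "(\<lambda>a. gconv_symbol ?n b (fst a) (fan_index ?n a)) \<in> borel_measurable (nu2 ?n)"
    by (rule measurable_compose_countable[of "\<lambda>k a. gconv_symbol ?n b (fst a) k"]) (simp_all add: gconv_symbol_def)
  then show "(\<lambda>a. complex_of_real (gsym ?n b a)) \<in> borel_measurable (nu2 ?n)"
    by (simp add: gsym_def)
  show "bounded ((\<lambda>a. complex_of_real (gsym ?n b a)) ` fan ?n)"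
    using gconv_symbol_bound[OF b] by (auto simp: bounded_iff gsym_def intro!: exI[of _ 1])
  fix f :: "'n heis \<Rightarrow> complex" assume f: "f \<in> L12"
  have "(\<lambda>x. of_real ((b / pi) ^ ?n) * gconv b f x) \<in> L12"
    by (rule L12_cmult[OF gconv_L12[OF f b]])
  from strichartz_in_range[OF this]
  show "(\<lambda>y. of_real (gsym ?n b (fst y)) * strichartz f y) \<in> strichartz_range"
  proof (rule strichartz_range_cong)
    fix a :: "real \<times> real" and w :: "complex ^ 'n" assume a: "a \<in> fan ?n"
    show "of_real (gsym ?n b (fst (a, w))) * strichartz f (a, w) = strichartz (\<lambda>x. of_real ((b / pi) ^ ?n) * gconv b f x) (a, w)"
    proof (cases "fst a = 0")
      case True
      then show ?thesis by (simp add: strichartz_def)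
    next
      case False
      have "(b / pi) ^ ?n * (pi / b) ^ ?n = 1" using b by (simp flip: power_mult_distrib)
      then have "complex_of_real ((b / pi) ^ ?n) * (of_real ((pi / b) ^ ?n * gsym ?n b a) * X) = of_real (gsym ?n b a) * X" for X
        by (simp only: mult.assoc[symmetric] of_real_mult[symmetric]) simp
      then show ?thesis
        unfolding strichartz_cmult strichartz_gconv[OF f b a False] gsym_def[symmetric] fst_conv by simp
    qed
  qed
qed

lemma gsym_limit:
  assumes a: "a \<in> fan n" "fst a \<noteq> 0"
  shows "(\<lambda>j. 4 * (real j + 1) * (1 - gsym n (real j + 1) a)) \<longlonglongrightarrow> snd a"
proof -
  obtain k where k: "a \<in> fan_ray n k" using a by (auto simp: fan_def)
  then have i: "fan_index n a = k" by (rule fan_index_eq)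
  obtain l where l: "a = (l, (2 * real k + real n) * \<bar>l\<bar>)" "l \<noteq> 0" using k by (auto simp: fan_ray_def)
  define h where "h x = (1 / (1 + x)) ^ n * ((1 - x) / (1 + x)) ^ k" for x :: real
  have "((\<lambda>x. 1 / (1 + x)) has_real_derivative - 1) (at 0)" "((\<lambda>x. (1 - x) / (1 + x)) has_real_derivative - 2) (at 0)"
    by (auto intro!: derivative_eq_intros)
  from DERIV_mult[OF DERIV_power[OF this(1), of n] DERIV_power[OF this(2), of k]]
  have "(h has_real_derivative - (2 * real k + real n)) (at 0)"
    unfolding h_def by (rule DERIV_cong) simp
  then have "(\<lambda>x. (h x - h 0) / (x - 0)) \<midarrow>0\<rightarrow> - (2 * real k + real n)"
    unfolding has_field_derivative_iff by simp
  moreover define x where "x j = \<bar>l\<bar> / (4 * (real j + 1))" for j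
  have x0: "x j \<noteq> 0" for j using l by (simp add: x_def)
  have "x \<longlonglongrightarrow> 0"
    using tendsto_mult[OF tendsto_const inverse_real_add_tendsto_0[of 1], of "\<bar>l\<bar> / 4"] by (simp add: x_def[abs_def])
  then have "filterlim x (at 0) sequentially" using x0 by (simp add: filterlim_at)
  ultimately have "(\<lambda>j. (h (x j) - h 0) / (x j - 0)) \<longlonglongrightarrow> - (2 * real k + real n)"
    by (rule filterlim_compose)
  from tendsto_mult[OF tendsto_const this, of "- \<bar>l\<bar>"]
  have "(\<lambda>j. - \<bar>l\<bar> * ((h (x j) - h 0) / (x j - 0))) \<longlonglongrightarrow> - \<bar>l\<bar> * (- (2 * real k + real n))" .
  also have "- \<bar>l\<bar> * (- (2 * real k + real n)) = snd a" by (simp add: l algebra_simps)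
  finally have "(\<lambda>j. - \<bar>l\<bar> * ((h (x j) - h 0) / (x j - 0))) \<longlonglongrightarrow> snd a" .
  moreover have "- \<bar>l\<bar> * ((h (x j) - h 0) / (x j - 0)) = 4 * (real j + 1) * (1 - gsym n (real j + 1) a)" for j
  proof -
    have "gsym n (real j + 1) a = h (x j)" unfolding gsym_def i gconv_symbol_def h_def x_def by (simp add: l)
    moreover have "h 0 = 1" by (simp add: h_def)
    moreover have "\<bar>l\<bar> = 4 * (real j + 1) * x j" by (simp add: x_def)
    ultimately have "- \<bar>l\<bar> * ((h (x j) - h 0) / (x j - 0)) = - (4 * (real j + 1) * (gsym n (real j + 1) a - 1))"
      using x0[of j] by simp
    then show ?thesis by (simp only: mult_minus_right[symmetric] minus_diff_eq)
  qed
  ultimately show ?thesis by simp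
qed

lemma fan_mult_real_polynomial:
  assumes g: "real_polynomial_function g" and u: "(\<lambda>a. of_real (u a)) \<in> fan_mult TYPE('n::finite)"
  shows "(\<lambda>a. of_real (g (u a))) \<in> fan_mult TYPE('n)"
  using g
proof (induction rule: real_polynomial_function.induct)
  case (linear f)
  then interpret bounded_linear f .
  have "f x = x * f 1" for x using scaleR[of x 1] by simp
  then have "(\<lambda>a. complex_of_real (f (u a))) = (\<lambda>a. of_real (u a) * of_real (f 1))"
    by (metis of_real_mult)
  then show ?case by (simp only:) (intro fan_mult_mult fan_mult_const u)
next
  case (const c)
  show ?case by (rule fan_mult_const)
next
  case (add f g)
  then show ?case unfolding of_real_add by (intro fan_mult_add)
next
  case (mult f g)
  then show ?case unfolding of_real_mult by (intro fan_mult_mult)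
qed

lemma fan_mult_level_set:
  assumes u: "(\<lambda>a. of_real (u a)) \<in> fan_mult TYPE('n::finite)"
  shows "(\<lambda>a. indicator {a. c < u a} a) \<in> fan_mult TYPE('n)"
proof -
  obtain M where M: "\<And>a. a \<in> fan CARD('n) \<Longrightarrow> \<bar>u a\<bar> \<le> M"
    using u unfolding fan_mult_def bounded_iff by auto
  define g where "g j x = min 1 (max 0 (real j * (x - c)))" for j :: nat and x :: real
  have "\<exists>p. real_polynomial_function p \<and> (\<forall>x\<in>{- M..M}. \<bar>g j x - p x\<bar> < 1 / (real j + 1))" for j
    by (rule Stone_Weierstrass_real_polynomial_function[of "{- M..M}" "g j" "1 / (real j + 1)"])
       (auto simp: g_def intro!: continuous_intros)
  then obtain p where p: "\<And>j. real_polynomial_function (p j)" "\<And>j x. x \<in> {- M..M} \<Longrightarrow> \<bar>g j x - p j x\<bar> < 1 / (real j + 1)"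
    by metis
  show ?thesis
  proof (rule fan_mult_limit[of "\<lambda>j a. of_real (p j (u a))" 2])
    show "(\<lambda>a. of_real (p j (u a))) \<in> fan_mult TYPE('n)" for j
      by (rule fan_mult_real_polynomial[OF p(1) u])
    fix a assume a: "a \<in> fan CARD('n)"
    have pg: "\<bar>g j (u a) - p j (u a)\<bar> < 1 / (real j + 1)" for j
      using M[OF a] by (intro p(2)) (auto simp: abs_le_iff)
    show "norm (complex_of_real (p j (u a))) \<le> 2" for j
    proof -
      have "\<bar>g j (u a)\<bar> \<le> 1" by (auto simp: g_def)
      moreover have "1 / (real j + 1) \<le> 1" by simp
      ultimately show ?thesis using pg[of j] unfolding norm_of_real by linarith
    qed
    have "(\<lambda>j. g j (u a) - p j (u a)) \<longlonglongrightarrow> 0"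
      by (rule Lim_null_comparison[OF _ inverse_real_add_tendsto_0[of 1]]) (use pg in \<open>auto intro!: always_eventually less_imp_le\<close>)
    moreover have "(\<lambda>j. g j (u a)) \<longlonglongrightarrow> indicator {a. c < u a} a"
    proof (rule tendsto_eventually)
      obtain N :: nat where N: "c < u a \<Longrightarrow> 1 < real N * (u a - c)"
        using ex_less_of_nat_mult[of "u a - c" 1] by (cases "c < u a") auto
      show "eventually (\<lambda>j. g j (u a) = indicator {a. c < u a} a) sequentially"
        unfolding eventually_sequentially
      proof (intro exI[of _ N] allI impI)
        fix j assume j: "N \<le> j"
        show "g j (u a) = indicator {a. c < u a} a"
        proof (cases "c < u a")
          case True
          then have "real N * (u a - c) \<le> real j * (u a - c)" using j by (intro mult_right_mono) auto
          then have "1 \<le> real j * (u a - c)" using N[OF True] by linarith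
          then show ?thesis using True by (simp add: g_def)
        next
          case False
          then show ?thesis by (simp add: g_def mult_nonneg_nonpos)
        qed
      qed
    qed
    ultimately have "(\<lambda>j. g j (u a) - (g j (u a) - p j (u a))) \<longlonglongrightarrow> indicator {a. c < u a} a - 0"
      by (intro tendsto_diff)
    then have "(\<lambda>j. p j (u a)) \<longlonglongrightarrow> indicator {a. c < u a} a" by simp
    from tendsto_of_real[where 'a = complex, OF this]
    show "(\<lambda>j. complex_of_real (p j (u a))) \<longlonglongrightarrow> indicator {a. c < u a} a"
      by (cases "c < u a") (simp_all add: indicator_def)
  qed
qed

definition fan_mult_sets :: "'n::finite itself \<Rightarrow> (real \<times> real) set set" where
  "fan_mult_sets _ = {A. A \<subseteq> fan CARD('n) \<and> indicator A \<in> fan_mult TYPE('n)}"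

lemma fan_mult_indicator_cong:
  assumes "indicator A \<in> fan_mult TYPE('n::finite)" "A \<inter> fan CARD('n) = B \<inter> fan CARD('n)"
  shows "indicator B \<in> fan_mult TYPE('n)"
proof -
  have eq: "indicator B a = (indicator A a :: complex)" if "a \<in> fan CARD('n)" for a
    using assms(2) that by (auto simp: indicator_def)
  show ?thesis
  proof (rule fan_mult_cong[OF assms(1)])
    show "(indicator B :: _ \<Rightarrow> complex) \<in> borel_measurable (nu2 CARD('n))"
      using assms(1) measurable_cong[of "nu2 CARD('n)" "indicator B" "indicator A" "borel :: complex measure"] eq by (simp add: fan_mult_def)
    show "bounded ((indicator B :: _ \<Rightarrow> complex) ` fan CARD('n))"
      by (auto simp: bounded_iff indicator_def intro!: exI[of _ 1])
  qed (rule eq)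
qed

lemma sigma_algebra_fan_mult_sets: "sigma_algebra (fan CARD('n::finite)) (fan_mult_sets TYPE('n))"
  unfolding sigma_algebra_iff2
proof (intro conjI ballI allI impI)
  let ?S = "fan_mult_sets TYPE('n)" and ?X = "fan CARD('n)"
  show "?S \<subseteq> Pow ?X" by (auto simp: fan_mult_sets_def)
  have empty: "indicator {} \<in> fan_mult TYPE('n)"
    using fan_mult_const[of 0, where 'n = 'n] by (simp add: indicator_def[abs_def])
  then show "{} \<in> ?S" by (simp add: fan_mult_sets_def)
  have compl: "indicator (- A) \<in> fan_mult TYPE('n)" if "indicator A \<in> fan_mult TYPE('n)" for A
  proof -
    have "(\<lambda>a. 1 + (-1) * indicator A a) \<in> fan_mult TYPE('n)"
      by (intro fan_mult_add fan_mult_mult fan_mult_const that)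
    moreover have "(\<lambda>a. 1 + (-1) * indicator A a) = (indicator (- A) :: _ \<Rightarrow> complex)"
      by (auto simp: fun_eq_iff indicator_def)
    ultimately show ?thesis by simp
  qed
  show "?X - A \<in> ?S" if "A \<in> ?S" for A
    using fan_mult_indicator_cong[OF compl[of A], of "?X - A"] that by (auto simp: fan_mult_sets_def)
  have inter: "indicator (A \<inter> B) \<in> fan_mult TYPE('n)"
    if "indicator A \<in> fan_mult TYPE('n)" "indicator B \<in> fan_mult TYPE('n)" for A B
    using fan_mult_mult[OF that] by (simp add: indicator_inter_arith[abs_def])
  have union: "indicator (A \<union> B) \<in> fan_mult TYPE('n)"
    if "indicator A \<in> fan_mult TYPE('n)" "indicator B \<in> fan_mult TYPE('n)" for A B
    using compl[OF inter[OF compl[OF that(1)] compl[OF that(2)]]] by simp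
  fix A :: "nat \<Rightarrow> (real \<times> real) set" assume A: "range A \<subseteq> ?S"
  have fin: "indicator (\<Union>i<j. A i) \<in> fan_mult TYPE('n)" for j
  proof (induction j)
    case 0
    show ?case using empty by (simp only: lessThan_0 UN_empty)
  next
    case (Suc j)
    have "indicator (A j) \<in> fan_mult TYPE('n)" using A by (auto simp: fan_mult_sets_def)
    from union[OF this Suc] show ?case by (simp add: lessThan_Suc)
  qed
  have "indicator (\<Union>i. A i) \<in> fan_mult TYPE('n)"
  proof (rule fan_mult_limit[where mj = "\<lambda>j. indicator (\<Union>i<j. A i)" and B = 1])
    show "indicator (\<Union>i<j. A i) \<in> fan_mult TYPE('n)" for j by (rule fin)
    show "norm (indicator (\<Union>i<j. A i) a :: complex) \<le> 1" for j a by (simp add: indicator_def)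
    show "(\<lambda>j. indicator (\<Union>i<j. A i) a :: complex) \<longlonglongrightarrow> indicator (\<Union>i. A i) a" for a
      by (rule LIMSEQ_indicator_UN)
  qed
  then show "(\<Union>i. A i) \<in> ?S" using A by (auto simp: fan_mult_sets_def)
qed

lemma sets_nu2_fan_mult:
  assumes A: "A \<in> sets (nu2 CARD('n::finite))"
  shows "indicator A \<in> fan_mult TYPE('n)"
proof -
  let ?X = "fan CARD('n)"
  interpret S: sigma_algebra ?X "fan_mult_sets TYPE('n)" by (rule sigma_algebra_fan_mult_sets)
  define N where "N = sigma ?X (fan_mult_sets TYPE('n))"
  have setsN: "sets N = fan_mult_sets TYPE('n)" and spaceN: "space N = ?X"
    by (simp_all add: N_def)
  have mN: "u \<in> borel_measurable N" if u: "(\<lambda>a. of_real (u a)) \<in> fan_mult TYPE('n)" for u :: "real \<times> real \<Rightarrow> real"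
    unfolding borel_measurable_iff_greater setsN spaceN fan_mult_sets_def
  proof (intro allI CollectI conjI)
    fix c
    show "indicator {a \<in> ?X. c < u a} \<in> fan_mult TYPE('n)"
      by (rule fan_mult_indicator_cong[OF fan_mult_level_set[OF u, of c, unfolded eta_contract_eq]]) auto
  qed auto
  have l: "fst \<in> borel_measurable N"
  proof (rule borel_measurable_LIMSEQ_real)
    show "(\<lambda>a. (real j + 1) * sin (fst a * (1 / (real j + 1)))) \<in> borel_measurable N" for j
      by (intro borel_measurable_times borel_measurable_const mN fan_mult_sin)
    fix a :: "real \<times> real"
    have "((\<lambda>x. sin (fst a * x)) has_real_derivative fst a) (at 0)"
      by (auto intro!: derivative_eq_intros)
    then have "(\<lambda>x. (sin (fst a * x) - sin (fst a * 0)) / (x - 0)) \<midarrow>0\<rightarrow> fst a"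
      unfolding has_field_derivative_iff by simp
    moreover have "filterlim (\<lambda>j. 1 / (real j + 1)) (at 0) sequentially"
      using inverse_real_add_tendsto_0[of 1] by (auto simp: filterlim_at intro!: always_eventually)
    ultimately have "(\<lambda>j. (sin (fst a * (1 / (real j + 1))) - sin (fst a * 0)) / (1 / (real j + 1) - 0)) \<longlonglongrightarrow> fst a"
      by (rule filterlim_compose)
    then show "(\<lambda>j. (real j + 1) * sin (fst a * (1 / (real j + 1)))) \<longlonglongrightarrow> fst a"
      by (simp add: mult.commute)
  qed
  define s where "s a = (if fst a = 0 then 0 else snd a)" for a :: "real \<times> real"
  have [measurable]: "{a \<in> space N. fst a = 0} \<in> sets N"
    using l by measurable
  have sm: "s \<in> borel_measurable N"
  proof (rule borel_measurable_LIMSEQ_real)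
    show "(\<lambda>a. if fst a = 0 then 0 else 4 * (real j + 1) * (1 - gsym CARD('n) (real j + 1) a)) \<in> borel_measurable N" for j
      by (intro measurable_If borel_measurable_times borel_measurable_diff borel_measurable_const mN fan_mult_gsym) simp_all
    fix a assume "a \<in> space N"
    then show "(\<lambda>j. if fst a = 0 then 0 else 4 * (real j + 1) * (1 - gsym CARD('n) (real j + 1) a)) \<longlonglongrightarrow> s a"
      using gsym_limit[of a "CARD('n)"] by (simp add: s_def spaceN)
  qed
  obtain B where B: "B \<in> sets borel" "A = ?X \<inter> B"
    using A by (auto simp: sets_restrict_space)
  have "(\<lambda>a. (fst a, s a)) \<in> borel_measurable N"
    using l sm by (rule borel_measurable_Pair)
  from measurable_sets[OF this B(1)]
  have A': "(\<lambda>a. (fst a, s a)) -` B \<inter> ?X \<in> fan_mult_sets TYPE('n)" by (simp add: setsN spaceN)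
  show ?thesis
  proof (rule fan_mult_cong)
    show "indicator ((\<lambda>a. (fst a, s a)) -` B \<inter> ?X) \<in> fan_mult TYPE('n)"
      using A' by (simp add: fan_mult_sets_def)
    show "(indicator A :: _ \<Rightarrow> complex) \<in> borel_measurable (nu2 CARD('n))" using A by (rule borel_measurable_indicator)
    show "bounded ((indicator A :: _ \<Rightarrow> complex) ` ?X)"
      by (auto simp: bounded_iff indicator_def intro!: exI[of _ 1])
    fix a assume "a \<in> ?X" "fst a \<noteq> 0"
    then show "(indicator A a :: complex) = indicator ((\<lambda>a. (fst a, s a)) -` B \<inter> ?X) a"
      by (auto simp: B(2) indicator_def s_def)
  qed
qed

theorem bounded_measurable_fan_mult:
  assumes m: "m \<in> borel_measurable (nu2 CARD('n::finite))" and b: "bounded (m ` fan CARD('n))"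
  shows "m \<in> fan_mult TYPE('n)"
proof -
  obtain B where B: "\<And>a. a \<in> fan CARD('n) \<Longrightarrow> norm (m a) \<le> B" using b unfolding bounded_iff by auto
  obtain F where F: "\<And>i. simple_function (nu2 CARD('n)) (F i)" "\<And>a. a \<in> fan CARD('n) \<Longrightarrow> (\<lambda>i. F i a) \<longlonglongrightarrow> m a"
    "\<And>i a. a \<in> fan CARD('n) \<Longrightarrow> norm (F i a) \<le> 2 * norm (m a)"
    using borel_measurable_implies_sequence_metric[OF m, of 0] by (metis dist_0_norm dist_commute space_nu2)
  have sum: "(\<lambda>a. \<Sum>y\<in>Y. indicator (C y) a * y) \<in> fan_mult TYPE('n)"
    if "finite Y" "\<And>y. y \<in> Y \<Longrightarrow> C y \<in> sets (nu2 CARD('n))" for Y :: "complex set" and C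
    using that
  proof (induction Y rule: finite_induct)
    case empty
    show ?case using fan_mult_const[of 0] by simp
  next
    case (insert y Y)
    have "(\<lambda>a. indicator (C y) a * y + (\<Sum>y\<in>Y. indicator (C y) a * y)) \<in> fan_mult TYPE('n)"
      using insert by (intro fan_mult_add fan_mult_mult fan_mult_const sets_nu2_fan_mult) auto
    then show ?case by (simp only: sum.insert[OF insert(1,2)])
  qed
  show ?thesis
  proof (rule fan_mult_limit[of F "2 * B"])
    fix i
    let ?Y = "F i ` fan CARD('n)" and ?C = "\<lambda>y. F i -` {y} \<inter> fan CARD('n)"
    have fin: "finite ?Y" "\<And>y. y \<in> ?Y \<Longrightarrow> ?C y \<in> sets (nu2 CARD('n))"
      using F(1)[of i] unfolding simple_function_def space_nu2 by auto
    show "F i \<in> fan_mult TYPE('n)"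
    proof (rule fan_mult_cong[OF sum[OF fin]])
      show "F i \<in> borel_measurable (nu2 CARD('n))" by (rule borel_measurable_simple_function[OF F(1)])
      show "bounded (F i ` fan CARD('n))" using fin(1) by (rule finite_imp_bounded)
      fix a assume a: "a \<in> fan CARD('n)"
      have "(\<Sum>y\<in>?Y. indicator (?C y) a * y) = (\<Sum>y\<in>?Y. if F i a = y then y else 0)"
        using a by (intro sum.cong refl) (simp only: indicator_def, simp)
      also have "\<dots> = F i a" using a by (subst sum.delta'[OF fin(1)]) auto
      finally show "F i a = (\<Sum>y\<in>?Y. indicator (?C y) a * y)" ..
    qed
  next
    show "norm (F i a) \<le> 2 * B" if "a \<in> fan CARD('n)" for i a
      using F(3)[OF that, of i] B[OF that] by linarith
  qed (rule F(2))
qed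

subsection \<open>Lebesgue spaces: completeness and extension of operators\<close>

definition Lpow :: "real \<Rightarrow> 'a measure \<Rightarrow> ('a \<Rightarrow> complex) \<Rightarrow> ennreal" where
  "Lpow p M f = (\<integral>\<^sup>+x. ennreal (norm (f x) powr p) \<partial>M)"

lemma Lpow_2: "Lpow 2 M f = L2sq M f"
  unfolding Lpow_def L2sq_def by (intro nn_integral_cong) (simp add: powr_numeral)

lemma Lp_norm_Lpow: "Lp_norm p M f = enn_powr (Lpow p M f) (1 / p)"
  by (simp add: Lp_norm_def Lpow_def)

lemma enn_powr_less_top: "s > 0 \<Longrightarrow> enn_powr x s < \<infinity> \<longleftrightarrow> x < \<infinity>"
  by (auto simp: enn_powr_def less_top)

lemma enn_powr_ennreal: "x \<ge> 0 \<Longrightarrow> enn_powr (ennreal x) s = ennreal (x powr s)"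
  by (simp add: enn_powr_def)

lemma Lp_iff: "p > 0 \<Longrightarrow> f \<in> Lp p M \<longleftrightarrow> f \<in> borel_measurable M \<and> Lpow p M f < \<infinity>"
  by (simp add: Lp_def Lp_norm_Lpow enn_powr_less_top[simplified])

lemma Lp_1_iff: "f \<in> Lp 1 M \<longleftrightarrow> integrable M f"
  by (simp add: Lp_iff Lpow_def integrable_iff_bounded)

lemma Lp_2_iff: "f \<in> Lp 2 M \<longleftrightarrow> f \<in> borel_measurable M \<and> L2sq M f < \<infinity>"
  by (simp add: Lp_iff Lpow_2)

lemma Lp_norm_le:
  assumes p: "p > 0" and q: "q > 0" and C: "C \<ge> 0" and fin: "Lpow p M f < \<infinity>"
    and le: "Lpow q N g \<le> ennreal (C powr q * enn2real (Lpow p M f) powr (q / p))"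
  shows "Lp_norm q N g \<le> ennreal C * Lp_norm p M f"
proof -
  define X where "X = enn2real (Lpow p M f)"
  have X: "X \<ge> 0" "Lpow p M f = ennreal X" using fin by (auto simp: X_def less_top)
  define Y where "Y = enn2real (Lpow q N g)"
  have Y: "Y \<ge> 0" "Lpow q N g = ennreal Y" using le_less_trans[OF le ennreal_less_top] by (auto simp: Y_def less_top)
  have "Y \<le> C powr q * X powr (q / p)"
    using le C unfolding Y X_def[symmetric] by (simp add: ennreal_le_iff)
  then have "Y powr (1 / q) \<le> (C powr q * X powr (q / p)) powr (1 / q)"
    using Y q by (intro powr_mono2) auto
  also have "\<dots> = C * X powr (1 / p)"
    using q C X by (simp add: powr_mult powr_powr)
  finally show ?thesis
    unfolding Lp_norm_Lpow X Y using X Y C by (simp add: enn_powr_ennreal ennreal_leI flip: ennreal_mult)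
qed

lemma tendsto_enn_powr_0:
  assumes s: "s > 0" and u: "u \<longlonglongrightarrow> 0"
  shows "(\<lambda>j. enn_powr (u j) s) \<longlonglongrightarrow> 0"
proof -
  have fin: "eventually (\<lambda>j. u j < 1) sequentially" using order_tendstoD(2)[OF u, of 1] by simp
  have "(\<lambda>j. enn2real (u j)) \<longlonglongrightarrow> enn2real 0"
    by (rule tendsto_enn2real) (use u in auto)
  then have "(\<lambda>j. enn2real (u j) powr s) \<longlonglongrightarrow> 0"
    using s by (intro tendsto_zero_powrI) (auto intro!: always_eventually)
  from tendsto_ennrealI[OF this] have "(\<lambda>j. ennreal (enn2real (u j) powr s)) \<longlonglongrightarrow> 0" by simp
  moreover have "eventually (\<lambda>j. ennreal (enn2real (u j) powr s) = enn_powr (u j) s) sequentially"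
    using fin by eventually_elim (auto simp: enn_powr_def)
  ultimately show ?thesis by (rule Lim_transform_eventually)
qed

lemma Lp_norm_2_tendsto_0: "(\<lambda>j. L2sq M (F j)) \<longlonglongrightarrow> 0 \<Longrightarrow> (\<lambda>j. Lp_norm 2 M (F j)) \<longlonglongrightarrow> 0"
  unfolding Lp_norm_Lpow Lpow_2 by (rule tendsto_enn_powr_0) simp

lemma powr_add_le:
  fixes a b :: real
  assumes "0 \<le> a" "0 \<le> b" "0 < p"
  shows "(a + b) powr p \<le> 2 powr p * (a powr p + b powr p)"
proof -
  have "(a + b) powr p \<le> (2 * max a b) powr p" using assms by (intro powr_mono2) auto
  also have "\<dots> = 2 powr p * (max a b) powr p" using assms by (simp add: powr_mult)
  also have "\<dots> \<le> 2 powr p * (a powr p + b powr p)"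
    by (intro mult_left_mono) (auto simp: max_def)
  finally show ?thesis .
qed

lemma Lpow_add_le:
  assumes [measurable]: "f \<in> borel_measurable M" "g \<in> borel_measurable M" and p: "p > 0"
  shows "Lpow p M (\<lambda>x. f x + g x) \<le> ennreal (2 powr p) * (Lpow p M f + Lpow p M g)"
proof -
  have "Lpow p M (\<lambda>x. f x + g x) \<le> (\<integral>\<^sup>+x. ennreal (2 powr p) * (ennreal (norm (f x) powr p) + ennreal (norm (g x) powr p)) \<partial>M)"
    unfolding Lpow_def
  proof (intro nn_integral_mono)
    fix x
    have "norm (f x + g x) powr p \<le> (norm (f x) + norm (g x)) powr p"
      using p by (intro powr_mono2 norm_triangle_ineq) auto
    also have "\<dots> \<le> 2 powr p * (norm (f x) powr p + norm (g x) powr p)"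
      using p by (intro powr_add_le) auto
    finally show "ennreal (norm (f x + g x) powr p) \<le> ennreal (2 powr p) * (ennreal (norm (f x) powr p) + ennreal (norm (g x) powr p))"
      by (simp add: ennreal_leI flip: ennreal_mult ennreal_plus)
  qed
  also have "\<dots> = ennreal (2 powr p) * (Lpow p M f + Lpow p M g)"
    by (simp add: nn_integral_cmult nn_integral_add Lpow_def)
  finally show ?thesis .
qed

lemma Lpow_cmult:
  assumes [measurable]: "f \<in> borel_measurable M"
  shows "Lpow p M (\<lambda>x. c * f x) = ennreal (norm c powr p) * Lpow p M f"
  by (simp add: Lpow_def norm_mult powr_mult ennreal_mult' nn_integral_cmult)

lemma Lpow_minus_commute: "Lpow p M (\<lambda>x. f x - g x) = Lpow p M (\<lambda>x. g x - f x)"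
  by (simp add: Lpow_def norm_minus_commute)

lemma Lpow_triangle:
  assumes [measurable]: "f \<in> borel_measurable M" "g \<in> borel_measurable M" "h \<in> borel_measurable M" and p: "p > 0"
  shows "Lpow p M (\<lambda>x. f x - h x) \<le> ennreal (2 powr p) * (Lpow p M (\<lambda>x. f x - g x) + Lpow p M (\<lambda>x. g x - h x))"
  using Lpow_add_le[of "\<lambda>x. f x - g x" M "\<lambda>x. g x - h x" p] p by simp

lemma Lpow_liminf_le:
  assumes [measurable]: "f \<in> borel_measurable M" "\<And>k. F k \<in> borel_measurable M"
    and lim: "AE x in M. (\<lambda>k. F k x) \<longlonglongrightarrow> g x" and p: "p > 0"
    and b: "eventually (\<lambda>k. Lpow p M (\<lambda>x. f x - F k x) \<le> c) sequentially"
  shows "Lpow p M (\<lambda>x. f x - g x) \<le> c"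
proof -
  have "Lpow p M (\<lambda>x. f x - g x) = (\<integral>\<^sup>+x. liminf (\<lambda>k. ennreal (norm (f x - F k x) powr p)) \<partial>M)"
    unfolding Lpow_def
  proof (rule nn_integral_cong_AE, use lim in eventually_elim)
    case (elim x)
    have "(\<lambda>k. norm (f x - F k x) powr p) \<longlonglongrightarrow> norm (f x - g x) powr p"
      using p by (intro tendsto_powr' tendsto_intros elim) auto
    then have "(\<lambda>k. ennreal (norm (f x - F k x) powr p)) \<longlonglongrightarrow> ennreal (norm (f x - g x) powr p)" by (rule tendsto_ennrealI)
    from lim_imp_Liminf[OF trivial_limit_sequentially this]
    show "ennreal (norm (f x - g x) powr p) = liminf (\<lambda>k. ennreal (norm (f x - F k x) powr p))" ..
  qed
  also have "\<dots> \<le> liminf (\<lambda>k. Lpow p M (\<lambda>x. f x - F k x))"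
    unfolding Lpow_def by (rule nn_integral_liminf) simp
  also have "\<dots> \<le> limsup (\<lambda>k. Lpow p M (\<lambda>x. f x - F k x))" by (rule Liminf_le_Limsup) simp
  also have "\<dots> \<le> c" by (rule Limsup_bounded[OF b])
  finally show ?thesis .
qed

theorem Lp_complete:
  fixes F :: "nat \<Rightarrow> 'a \<Rightarrow> complex"
  assumes Fm [measurable]: "\<And>j. F j \<in> borel_measurable M" and p: "p > 0"
    and cauchy: "\<And>e. e > 0 \<Longrightarrow> \<exists>N. \<forall>i\<ge>N. \<forall>j\<ge>N. Lpow p M (\<lambda>x. F i x - F j x) < ennreal e"
  obtains g where "g \<in> borel_measurable M" "(\<lambda>j. Lpow p M (\<lambda>x. F j x - g x)) \<longlonglongrightarrow> 0"
proof -
  define w where "w k = 4 powr (- p * real k)" for k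
  have w: "w k > 0" for k by (simp add: w_def)
  obtain N where N: "\<And>k i j. i \<ge> N k \<Longrightarrow> j \<ge> N k \<Longrightarrow> Lpow p M (\<lambda>x. F i x - F j x) < ennreal (w k)"
    using cauchy[OF w] by metis
  define r where "r k = Max (N ` {..k})" for k
  have rN: "r j \<ge> N k" if "k \<le> j" for k j using that by (auto simp: r_def)
  have d: "Lpow p M (\<lambda>x. F (r (Suc k)) x - F (r k) x) < ennreal (w k)" for k
    by (intro N rN) auto
  define S where "S x = (\<Sum>k. ennreal (2 powr (p * real k)) * ennreal (norm (F (r (Suc k)) x - F (r k) x) powr p))" for x
  have "(\<integral>\<^sup>+x. S x \<partial>M) = (\<Sum>k. ennreal (2 powr (p * real k)) * Lpow p M (\<lambda>x. F (r (Suc k)) x - F (r k) x))"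
    unfolding S_def Lpow_def by (subst nn_integral_suminf) (simp_all add: nn_integral_cmult)
  also have "\<dots> \<le> (\<Sum>k. ennreal ((2 powr (- p)) ^ k))"
  proof (intro suminf_le)
    fix k
    have "ennreal (2 powr (p * real k)) * Lpow p M (\<lambda>x. F (r (Suc k)) x - F (r k) x) \<le> ennreal (2 powr (p * real k)) * ennreal (w k)"
      using d[of k] by (intro mult_left_mono) auto
    also have "\<dots> = ennreal ((2 powr (- p)) ^ k)"
    proof -
      have "(4::real) powr (- p * real k) = (2 powr 2) powr (- p * real k)" by simp
      also have "\<dots> = 2 powr (2 * (- p * real k))" by (rule powr_powr)
      finally have "2 powr (p * real k) * w k = 2 powr (- p * real k)"
        unfolding w_def by (simp add: algebra_simps flip: powr_add)
      also have "\<dots> = (2 powr (- p)) ^ k" by (simp add: powr_powr flip: powr_realpow)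
      finally show ?thesis using w[of k] by (subst ennreal_mult[symmetric]) simp_all
    qed
    finally show "ennreal (2 powr (p * real k)) * Lpow p M (\<lambda>x. F (r (Suc k)) x - F (r k) x) \<le> ennreal ((2 powr (- p)) ^ k)" .
  qed auto
  also have "\<dots> < \<infinity>"
  proof -
    have "2 powr (- p) < (1::real)" using p by (simp add: powr_less_one)
    then have "summable (\<lambda>k. (2 powr (- p) :: real) ^ k)" by (intro summable_geometric) auto
    then show ?thesis by (subst suminf_ennreal2) (auto simp: summable_geometric)
  qed
  finally have "AE x in M. S x \<noteq> \<infinity>"
    by (intro nn_integral_PInf_AE) (auto simp: S_def)
  then have conv: "AE x in M. convergent (\<lambda>k. F (r k) x)"
  proof eventually_elim
    case (elim x)
    define s where "s = enn2real (S x)"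
    have s: "S x = ennreal s" "s \<ge> 0" using elim by (auto simp: s_def less_top)
    have "norm (F (r (Suc k)) x - F (r k) x) \<le> s powr (1 / p) * (1 / 2) ^ k" for k
    proof -
      let ?d = "norm (F (r (Suc k)) x - F (r k) x)"
      have "(\<Sum>i\<in>{k}. ennreal (2 powr (p * real i)) * ennreal (norm (F (r (Suc i)) x - F (r i) x) powr p)) \<le> S x"
        unfolding S_def by (rule sum_le_suminf) auto
      then have "2 powr (p * real k) * ?d powr p \<le> s"
        unfolding s using s by (simp add: ennreal_le_iff flip: ennreal_mult)
      then have "(2 powr (p * real k) * ?d powr p) powr (1 / p) \<le> s powr (1 / p)"
        using p by (intro powr_mono2) auto
      moreover have "(2 powr (p * real k) * ?d powr p) powr (1 / p) = 2 ^ k * ?d"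
        using p by (simp add: powr_mult powr_powr powr_realpow)
      ultimately show ?thesis by (simp add: field_simps power_divide)
    qed
    then have "summable (\<lambda>k. F (r (Suc k)) x - F (r k) x)"
      by (intro summable_comparison_test[OF _ summable_mult[OF summable_geometric[of "1/2::real"], of "s powr (1 / p)"]]) auto
    then show ?case
      by (simp add: summable_iff_convergent sum_lessThan_telescope[of "\<lambda>k. F (r k) x"] convergent_diff_const_right_iff)
  qed
  define g where "g x = lim (\<lambda>k. F (r k) x)" for x
  have gm: "g \<in> borel_measurable M" unfolding g_def by (rule borel_measurable_lim_metric) simp
  have lim: "AE x in M. (\<lambda>k. F (r k) x) \<longlonglongrightarrow> g x"
    using conv by eventually_elim (simp add: g_def convergent_LIMSEQ_iff)
  have "(\<lambda>j. Lpow p M (\<lambda>x. F j x - g x)) \<longlonglongrightarrow> 0"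
  proof (rule tendsto_sandwich[of "\<lambda>_. 0"])
    show "eventually (\<lambda>j. Lpow p M (\<lambda>x. F j x - g x) \<le> (INF k\<in>{k. N k \<le> j}. ennreal (w k))) sequentially"
    proof (intro always_eventually allI INF_greatest)
      fix j k assume "k \<in> {k. N k \<le> j}"
      then have j: "N k \<le> j" by simp
      have "eventually (\<lambda>i. Lpow p M (\<lambda>x. F j x - F (r i) x) \<le> ennreal (w k)) sequentially"
        unfolding eventually_sequentially
        by (intro exI[of _ k] allI impI, rule less_imp_le, rule N[OF j rN])
      then show "Lpow p M (\<lambda>x. F j x - g x) \<le> ennreal (w k)"
        by (intro Lpow_liminf_le[OF _ _ lim p]) auto
    qed
    show "(\<lambda>j. INF k\<in>{k. N k \<le> j}. ennreal (w k)) \<longlonglongrightarrow> 0"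
    proof (rule order_tendstoI)
      fix a :: ennreal assume a: "0 < a"
      have "(\<lambda>k. w k) \<longlonglongrightarrow> 0"
      proof -
        have "w k = (4 powr (- p)) ^ k" for k by (simp add: w_def powr_powr flip: powr_realpow)
        moreover have "4 powr (- p) < (1::real)" using p by (simp add: powr_less_one)
        ultimately show ?thesis by (simp add: LIMSEQ_realpow_zero)
      qed
      from order_tendstoD(2)[OF tendsto_ennrealI[OF this], of a] a
      obtain k where k: "ennreal (w k) < a" using eventually_happens[of _ sequentially] by force
      show "eventually (\<lambda>j. (INF k\<in>{k. N k \<le> j}. ennreal (w k)) < a) sequentially"
        unfolding eventually_sequentially
        by (intro exI[of _ "N k"] allI impI, rule le_less_trans[OF _ k], rule INF_lower) simp
    qed simp
  qed auto
  with gm show ?thesis by (rule that)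
qed

lemma Lpow_eq_0_AE:
  assumes [measurable]: "f \<in> borel_measurable M" and "Lpow p M f = 0"
  shows "AE x in M. f x = 0"
  using assms(2) unfolding Lpow_def by (subst (asm) nn_integral_0_iff_AE) auto

theorem bounded_extension:
  fixes D :: "('a \<Rightarrow> complex) set" and R :: "('a \<Rightarrow> complex) \<Rightarrow> ('b \<Rightarrow> complex) \<Rightarrow> bool"
  assumes p: "p > 0" and q: "q > 0"
    and D: "D \<subseteq> Lp p M"
    and dense: "\<And>f e. f \<in> Lp p M \<Longrightarrow> e > 0 \<Longrightarrow> \<exists>h\<in>D. Lpow p M (\<lambda>x. f x - h x) < ennreal e"
    and RD: "\<And>f g. R f g \<Longrightarrow> f \<in> D \<and> g \<in> borel_measurable N"
    and Rex: "\<And>f. f \<in> D \<Longrightarrow> \<exists>g. R f g"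
    and Radd: "\<And>f g f' g'. R f g \<Longrightarrow> R f' g' \<Longrightarrow> R (\<lambda>x. f x + f' x) (\<lambda>x. g x + g' x)"
    and Rcmult: "\<And>c f g. R f g \<Longrightarrow> R (\<lambda>x. c * f x) (\<lambda>x. c * g x)"
    and C: "C \<ge> 0"
    and bound: "\<And>f g. R f g \<Longrightarrow> Lpow q N g \<le> ennreal (C powr q * enn2real (Lpow p M f) powr (q / p))"
  shows "\<exists>T. bounded_Lp_operator p M q N T \<and> (\<forall>f g. R f g \<longrightarrow> (AE x in N. T f x = g x))"
proof -
  define E where "E f g \<longleftrightarrow> f \<in> Lp p M \<and> g \<in> borel_measurable N \<and>
    (\<forall>e>0. \<exists>f' g'. R f' g' \<and> Lpow p M (\<lambda>x. f' x - f x) < ennreal e \<and> Lpow q N (\<lambda>x. g' x - g x) < ennreal e)" for f g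
  have Lpm: "f \<in> borel_measurable M" "Lpow p M f < \<infinity>" if "f \<in> Lp p M" for f
    using that Lp_iff[OF p] by auto
  have RM: "f \<in> Lp p M" "f \<in> borel_measurable M" "g \<in> borel_measurable N" if "R f g" for f g
    using RD[OF that] D Lpm by auto
  have Eadd: "E (\<lambda>x. f x + f' x) (\<lambda>x. g x + g' x)" if E: "E f g" "E f' g'" for f g f' g'
    unfolding E_def
  proof (intro conjI allI impI)
    have m [measurable]: "f \<in> borel_measurable M" "f' \<in> borel_measurable M" "g \<in> borel_measurable N" "g' \<in> borel_measurable N"
      using E Lpm by (auto simp: E_def)
    show "(\<lambda>x. f x + f' x) \<in> Lp p M"
    proof -
      have "Lpow p M (\<lambda>x. f x + f' x) \<le> ennreal (2 powr p) * (Lpow p M f + Lpow p M f')"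
        by (rule Lpow_add_le[OF m(1,2) p])
      also have "\<dots> < \<infinity>" using E Lpm by (auto simp: E_def ennreal_mult_less_top)
      finally show ?thesis using p by (simp add: Lp_iff)
    qed
    show "(\<lambda>x. g x + g' x) \<in> borel_measurable N" by simp
    fix e :: real assume e: "e > 0"
    define d where "d = min (e / (2 * 2 powr p)) (e / (2 * 2 powr q))"
    have d: "d > 0" "2 powr p * (2 * d) \<le> e" "2 powr q * (2 * d) \<le> e"
      using e by (auto simp: d_def min_def field_simps)
    obtain u v where u: "R u v" "Lpow p M (\<lambda>x. u x - f x) < ennreal d" "Lpow q N (\<lambda>x. v x - g x) < ennreal d"
      using E(1) d(1) unfolding E_def by blast
    obtain u' v' where u': "R u' v'" "Lpow p M (\<lambda>x. u' x - f' x) < ennreal d" "Lpow q N (\<lambda>x. v' x - g' x) < ennreal d"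
      using E(2) d(1) unfolding E_def by blast
    have um [measurable]: "u \<in> borel_measurable M" "u' \<in> borel_measurable M" "v \<in> borel_measurable N" "v' \<in> borel_measurable N"
      using RM u(1) u'(1) by auto
    have small: "ennreal (2 powr s) * (X + Y) < ennreal e" if "X < ennreal d" "Y < ennreal d" "2 powr s * (2 * d) \<le> e" for X Y s
    proof -
      have "ennreal (2 powr s) * (X + Y) < ennreal (2 powr s) * (ennreal d + ennreal d)"
        using that by (intro ennreal_mult_strict_left_mono add_strict_mono) auto
      also have "\<dots> = ennreal (2 powr s * (2 * d))" using d by (simp flip: ennreal_mult ennreal_plus)
      also have "\<dots> \<le> ennreal e" using that by (intro ennreal_leI)
      finally show ?thesis .
    qed
    have "Lpow p M (\<lambda>x. (u x - f x) + (u' x - f' x)) < ennreal e"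
      by (rule le_less_trans[OF Lpow_add_le small]) (use u u' d p in simp_all)
    moreover have "Lpow q N (\<lambda>x. (v x - g x) + (v' x - g' x)) < ennreal e"
      by (rule le_less_trans[OF Lpow_add_le small]) (use u u' d q in simp_all)
    ultimately show "\<exists>w z. R w z \<and> Lpow p M (\<lambda>x. w x - (f x + f' x)) < ennreal e \<and> Lpow q N (\<lambda>x. z x - (g x + g' x)) < ennreal e"
      using Radd[OF u(1) u'(1)] by (intro exI[of _ "\<lambda>x. u x + u' x"] exI[of _ "\<lambda>x. v x + v' x"]) (simp add: algebra_simps)
  qed
  have Ecmult: "E (\<lambda>x. c * f x) (\<lambda>x. c * g x)" if E: "E f g" for c f g
    unfolding E_def
  proof (intro conjI allI impI)
    have m [measurable]: "f \<in> borel_measurable M" "g \<in> borel_measurable N"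
      using E Lpm by (auto simp: E_def)
    show "(\<lambda>x. c * f x) \<in> Lp p M"
    proof -
      have "f \<in> Lp p M" using E by (simp add: E_def)
      from Lpm(2)[OF this] have "Lpow p M (\<lambda>x. c * f x) < \<infinity>"
        unfolding Lpow_cmult[OF m(1)] by (simp add: ennreal_mult_less_top)
      then show ?thesis using p by (simp add: Lp_iff)
    qed
    show "(\<lambda>x. c * g x) \<in> borel_measurable N" by simp
    fix e :: real assume e: "e > 0"
    define K where "K = norm c powr p + norm c powr q + 1"
    have K: "K > 0" "norm c powr p \<le> K" "norm c powr q \<le> K" by (auto simp: K_def add_pos_nonneg intro: add_nonneg_pos)
    obtain u v where u: "R u v" "Lpow p M (\<lambda>x. u x - f x) < ennreal (e / K)" "Lpow q N (\<lambda>x. v x - g x) < ennreal (e / K)"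
      using E e K unfolding E_def by (meson divide_pos_pos)
    have um [measurable]: "u \<in> borel_measurable M" "v \<in> borel_measurable N" using RM u(1) by auto
    have small: "ennreal s * X < ennreal e" if "X < ennreal (e / K)" "0 \<le> s" "s \<le> K" for X s
    proof -
      have "ennreal s * X \<le> ennreal K * X" using that by (intro mult_right_mono ennreal_leI) auto
      also have "\<dots> < ennreal K * ennreal (e / K)" using that K by (intro ennreal_mult_strict_left_mono) auto
      also have "\<dots> = ennreal e" using K e by (simp flip: ennreal_mult)
      finally show ?thesis .
    qed
    have "Lpow p M (\<lambda>x. c * (u x - f x)) < ennreal e" "Lpow q N (\<lambda>x. c * (v x - g x)) < ennreal e"
      by (subst Lpow_cmult; simp add: small u K)+
    then show "\<exists>w z. R w z \<and> Lpow p M (\<lambda>x. w x - c * f x) < ennreal e \<and> Lpow q N (\<lambda>x. z x - c * g x) < ennreal e"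
      using Rcmult[OF u(1), of c] by (intro exI[of _ "\<lambda>x. c * u x"] exI[of _ "\<lambda>x. c * v x"]) (simp add: algebra_simps)
  qed
  have Ebound: "Lpow q N g \<le> ennreal ((4 * C) powr q * enn2real (Lpow p M f) powr (q / p))" if E: "E f g" for f g
  proof -
    have m [measurable]: "f \<in> borel_measurable M" "g \<in> borel_measurable N" using E Lpm by (auto simp: E_def)
    define X where "X = enn2real (Lpow p M f)"
    have X: "X \<ge> 0" "Lpow p M f = ennreal X" using E Lpm by (auto simp: X_def E_def less_top)
    define B where "B e = 2 powr q * (e + C powr q * (2 powr p * (e + X)) powr (q / p))" for e
    have le: "Lpow q N g \<le> ennreal (B e)" if e: "e > 0" for e
    proof -
      obtain u v where u: "R u v" "Lpow p M (\<lambda>x. u x - f x) < ennreal e" "Lpow q N (\<lambda>x. v x - g x) < ennreal e"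
        using E e unfolding E_def by blast
      have um [measurable]: "u \<in> borel_measurable M" "v \<in> borel_measurable N" using RM u(1) by auto
      have "Lpow p M (\<lambda>x. (u x - f x) + f x) \<le> ennreal (2 powr p) * (Lpow p M (\<lambda>x. u x - f x) + Lpow p M f)"
        by (rule Lpow_add_le) (use p in simp_all)
      also have "\<dots> \<le> ennreal (2 powr p) * (ennreal e + ennreal X)"
        using u X by (intro mult_left_mono add_mono) auto
      also have "\<dots> = ennreal (2 powr p * (e + X))" using e X by (simp flip: ennreal_mult ennreal_plus)
      finally have U: "enn2real (Lpow p M u) \<le> 2 powr p * (e + X)"
        using e X by (intro enn2real_leI) auto
      have "Lpow q N v \<le> ennreal (C powr q * enn2real (Lpow p M u) powr (q / p))" by (rule bound[OF u(1)])
      also have "\<dots> \<le> ennreal (C powr q * (2 powr p * (e + X)) powr (q / p))"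
        using U p q by (intro ennreal_leI mult_left_mono powr_mono2) auto
      finally have V: "Lpow q N v \<le> ennreal (C powr q * (2 powr p * (e + X)) powr (q / p))" .
      have "Lpow q N (\<lambda>x. (g x - v x) + v x) \<le> ennreal (2 powr q) * (Lpow q N (\<lambda>x. g x - v x) + Lpow q N v)"
        by (rule Lpow_add_le) (use q in simp_all)
      also have "\<dots> \<le> ennreal (2 powr q) * (ennreal e + ennreal (C powr q * (2 powr p * (e + X)) powr (q / p)))"
        using u(3) V by (intro mult_left_mono add_mono) (auto simp: Lpow_minus_commute[of q N g])
      also have "\<dots> = ennreal (B e)" using e by (simp add: B_def flip: ennreal_mult ennreal_plus)
      finally show ?thesis by simp
    qed
    have Blim: "(B \<longlongrightarrow> B 0) (at_right 0)"
      unfolding B_def using p q X by (intro tendsto_intros tendsto_powr') (auto intro!: eventually_at_right_less[THEN eventually_mono] simp: eventually_at_filter)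
    have "Lpow q N g \<le> ennreal (B 0)"
      by (rule tendsto_lowerbound[OF tendsto_ennrealI[OF Blim]])
         (auto intro!: eventually_mono[OF eventually_at_right_less[of "0::real"]] le)
    also have "B 0 = (4 * C) powr q * X powr (q / p)"
    proof -
      have "(2 powr p * X) powr (q / p) = 2 powr q * X powr (q / p)" using p X by (simp add: powr_mult powr_powr)
      moreover have "(4 * C) powr q = 2 powr q * 2 powr q * C powr q"
        using C powr_mult[of 2 2 q] powr_mult[of 4 C q] by simp
      ultimately show ?thesis by (simp add: B_def mult_ac)
    qed
    finally show ?thesis by (simp add: X_def)
  qed
  have Eex: "\<exists>g. E f g" if f: "f \<in> Lp p M" for f
  proof -
    have fm [measurable]: "f \<in> borel_measurable M" by (rule Lpm(1)[OF f])
    have "\<exists>u v. R u v \<and> Lpow p M (\<lambda>x. f x - u x) < ennreal (1 / (real j + 1))" for j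
      using dense[OF f, of "1 / (real j + 1)"] Rex by fastforce
    then obtain u v where u: "\<And>j. R (u j) (v j)" "\<And>j. Lpow p M (\<lambda>x. f x - u j x) < ennreal (1 / (real j + 1))"
      by metis
    have um [measurable]: "u j \<in> borel_measurable M" "v j \<in> borel_measurable N" for j using RM u(1) by auto
    have vd: "Lpow q N (\<lambda>x. v i x - v j x) \<le> ennreal (C powr q * (2 powr p * (1 / (real i + 1) + 1 / (real j + 1))) powr (q / p))" for i j
    proof -
      have "R (\<lambda>x. u i x + (-1) * u j x) (\<lambda>x. v i x + (-1) * v j x)" by (intro Radd Rcmult u)
      from bound[OF this] have "Lpow q N (\<lambda>x. v i x - v j x) \<le> ennreal (C powr q * enn2real (Lpow p M (\<lambda>x. u i x - u j x)) powr (q / p))" by simp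
      also have "\<dots> \<le> ennreal (C powr q * (2 powr p * (1 / (real i + 1) + 1 / (real j + 1))) powr (q / p))"
      proof -
        have "Lpow p M (\<lambda>x. u i x - u j x) \<le> ennreal (2 powr p) * (Lpow p M (\<lambda>x. u i x - f x) + Lpow p M (\<lambda>x. f x - u j x))"
          by (rule Lpow_triangle) (use p in simp_all)
        also have "\<dots> \<le> ennreal (2 powr p) * (ennreal (1 / (real i + 1)) + ennreal (1 / (real j + 1)))"
          using u(2)[of i] u(2)[of j] by (intro mult_left_mono add_mono) (auto simp: Lpow_minus_commute[of p M "u i"])
        also have "\<dots> = ennreal (2 powr p * (1 / (real i + 1) + 1 / (real j + 1)))" by (simp flip: ennreal_mult ennreal_plus)
        finally have "enn2real (Lpow p M (\<lambda>x. u i x - u j x)) \<le> 2 powr p * (1 / (real i + 1) + 1 / (real j + 1))"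
          by (intro enn2real_leI) auto
        then show ?thesis using p q by (intro ennreal_leI mult_left_mono powr_mono2) auto
      qed
      finally show ?thesis .
    qed
    have "\<exists>n. \<forall>i\<ge>n. \<forall>j\<ge>n. Lpow q N (\<lambda>x. v i x - v j x) < ennreal e" if e: "e > 0" for e
    proof -
      have "(\<lambda>n. 2 powr p * (1 / (real n + 1) + 1 / (real n + 1))) \<longlonglongrightarrow> 0"
        by (intro tendsto_mult_right_zero tendsto_add_zero inverse_real_add_tendsto_0)
      from tendsto_zero_powrI[OF this tendsto_const, of "q / p"]
      have "(\<lambda>n. (2 powr p * (1 / (real n + 1) + 1 / (real n + 1))) powr (q / p)) \<longlonglongrightarrow> 0"
        using p q by simp
      from tendsto_mult[OF tendsto_const this, of "C powr q"]
      have "(\<lambda>n. C powr q * (2 powr p * (1 / (real n + 1) + 1 / (real n + 1))) powr (q / p)) \<longlonglongrightarrow> 0" by simp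
      from order_tendstoD(2)[OF this e]
      obtain n where n: "C powr q * (2 powr p * (1 / (real n + 1) + 1 / (real n + 1))) powr (q / p) < e"
        using eventually_happens[of _ sequentially] by force
      have "Lpow q N (\<lambda>x. v i x - v j x) < ennreal e" if ij: "i \<ge> n" "j \<ge> n" for i j
      proof -
        have "C powr q * (2 powr p * (1 / (real i + 1) + 1 / (real j + 1))) powr (q / p) \<le> C powr q * (2 powr p * (1 / (real n + 1) + 1 / (real n + 1))) powr (q / p)"
          using ij p q by (intro mult_left_mono powr_mono2 add_mono divide_left_mono) auto
        then show ?thesis using vd[of i j] n e by (meson ennreal_lessI le_less_trans)
      qed
      then show ?thesis by blast
    qed
    from Lp_complete[OF um(2) q this] obtain g where g: "g \<in> borel_measurable N" "(\<lambda>j. Lpow q N (\<lambda>x. v j x - g x)) \<longlonglongrightarrow> 0"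
      by blast
    have "E f g"
      unfolding E_def
    proof (intro conjI f g allI impI)
      fix e :: real assume e: "e > 0"
      have "eventually (\<lambda>j. Lpow q N (\<lambda>x. v j x - g x) < ennreal e) sequentially"
        using order_tendstoD(2)[OF g(2), of "ennreal e"] e by simp
      moreover have "eventually (\<lambda>j. 1 / (real j + 1) < e) sequentially"
        by (rule order_tendstoD(2)[OF inverse_real_add_tendsto_0 e])
      ultimately have "eventually (\<lambda>j. Lpow q N (\<lambda>x. v j x - g x) < ennreal e \<and> 1 / (real j + 1) < e) sequentially"
        by (rule eventually_conj)
      from eventually_happens[OF this] obtain j where j: "Lpow q N (\<lambda>x. v j x - g x) < ennreal e" "1 / (real j + 1) < e"
        by auto
      have "Lpow p M (\<lambda>x. u j x - f x) < ennreal (1 / (real j + 1))"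
        using u(2)[of j] by (simp add: Lpow_minus_commute[of p M "u j"])
      also have "\<dots> \<le> ennreal e" using j(2) by (intro ennreal_leI) simp
      finally show "\<exists>f' g'. R f' g' \<and> Lpow p M (\<lambda>x. f' x - f x) < ennreal e \<and> Lpow q N (\<lambda>x. g' x - g x) < ennreal e"
        using u(1) j(1) by blast
    qed
    then show ?thesis by (rule exI[of _ g])
  qed
  have Euniq: "AE x in N. g x = g' x" if E: "E f g" "E f g'" for f g g'
  proof -
    have m: "g \<in> borel_measurable N" "g' \<in> borel_measurable N" using E by (auto simp: E_def)
    have "E (\<lambda>x. f x + (-1) * f x) (\<lambda>x. g x + (-1) * g' x)" by (intro Eadd Ecmult E)
    from Ebound[OF this] have "Lpow q N (\<lambda>x. g x - g' x) \<le> ennreal ((4 * C) powr q * enn2real (Lpow p M (\<lambda>x. 0)) powr (q / p))" by simp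
    also have "\<dots> = 0" by (simp add: Lpow_def)
    finally have "Lpow q N (\<lambda>x. g x - g' x) = 0" by simp
    from Lpow_eq_0_AE[OF _ this] m show ?thesis by simp
  qed
  have ER: "E f g" if "R f g" for f g
    unfolding E_def using RM[OF that] that by (auto simp: Lpow_def intro!: exI[of _ f] exI[of _ g])
  define T where "T f = (SOME g. E f g)" for f
  have TE: "E f (T f)" if "f \<in> Lp p M" for f
    unfolding T_def by (rule someI_ex[OF Eex[OF that]])
  have Tb: "Lpow q N (T f) \<le> ennreal ((4 * C) powr q * enn2real (Lpow p M f) powr (q / p))" if "f \<in> Lp p M" for f
    by (rule Ebound[OF TE[OF that]])
  have "bounded_Lp_operator p M q N T"
    unfolding bounded_Lp_operator_def
  proof (intro conjI ballI allI exI[of _ "4 * C"])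
    fix f assume f: "f \<in> Lp p M"
    show "T f \<in> Lp q N"
      using TE[OF f] le_less_trans[OF Tb[OF f] ennreal_less_top] q by (simp add: Lp_iff E_def)
    show "Lp_norm q N (T f) \<le> ennreal (4 * C) * Lp_norm p M f"
      by (rule Lp_norm_le[OF p q _ Lpm(2)[OF f] Tb[OF f]]) (use C in simp)
    show "AE x in N. T (\<lambda>y. c * f y) x = c * T f x" for c
    proof (rule Euniq)
      show "E (\<lambda>y. c * f y) (\<lambda>x. c * T f x)" by (rule Ecmult[OF TE[OF f]])
      then show "E (\<lambda>y. c * f y) (T (\<lambda>y. c * f y))" by (intro TE) (simp add: E_def)
    qed
    fix g assume g: "g \<in> Lp p M"
    show "AE x in N. T (\<lambda>y. f y + g y) x = T f x + T g x"
    proof (rule Euniq)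
      show "E (\<lambda>y. f y + g y) (\<lambda>x. T f x + T g x)" by (rule Eadd[OF TE[OF f] TE[OF g]])
      then show "E (\<lambda>y. f y + g y) (T (\<lambda>y. f y + g y))" by (intro TE) (simp add: E_def)
    qed
  qed
  moreover have "AE x in N. T f x = g x" if "R f g" for f g
    using Euniq[OF TE ER[OF that]] RM[OF that] by blast
  ultimately show ?thesis by blast
qed

subsection \<open>Paley's inequality\<close>

lemma nn_integral_powr_tail:
  fixes A e :: real
  assumes A: "A > 0" and e: "e < - 1"
  shows "(\<integral>\<^sup>+x. ennreal (x powr e) * indicator {A<..} x \<partial>lborel) \<le> ennreal (A powr (e + 1) / (- (e + 1)))"
proof -
  have "(\<integral>\<^sup>+x. ennreal (x powr e) * indicator {A<..} x \<partial>lborel) \<le> (\<integral>\<^sup>+x. ennreal (x powr e) * indicator {A..} x \<partial>lborel)"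
    by (intro nn_integral_mono mult_left_mono) (auto simp: indicator_def)
  also have "\<dots> = ennreal (0 - A powr (e + 1) / (e + 1))"
  proof (rule nn_integral_FTC_atLeast)
    fix x assume x: "A \<le> x"
    then have "x > 0" using A by simp
    then have "((\<lambda>x. x powr (e + 1)) has_real_derivative (e + 1) * x powr (e + 1 - 1)) (at x)"
      by (rule has_real_derivative_powr)
    from DERIV_cdivide[OF this, of "e + 1"] show "DERIV (\<lambda>x. x powr (e + 1) / (e + 1)) x :> x powr e"
      using e by simp
  next
    have "((\<lambda>x. x powr (e + 1)) \<longlongrightarrow> 0) at_top"
      using e by (intro tendsto_neg_powr) (auto intro: filterlim_ident)
    from tendsto_divide[OF this tendsto_const, of "e + 1"] show "((\<lambda>x. x powr (e + 1) / (e + 1)) \<longlongrightarrow> 0) at_top"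
      using e by simp
  qed auto
  also have "0 - A powr (e + 1) / (e + 1) = A powr (e + 1) / (- (e + 1))"
    by (simp only: divide_minus_right diff_0)
  finally show ?thesis .
qed

lemma nn_integral_linear_head:
  fixes A :: real
  assumes A: "A \<ge> 0"
  shows "(\<integral>\<^sup>+x. ennreal (2 * x) * indicator {0..A} x \<partial>lborel) = ennreal (A\<^sup>2)"
proof -
  have "(\<integral>\<^sup>+x. ennreal (2 * x) * indicator {0..A} x \<partial>lborel) = ennreal (A\<^sup>2 - 0\<^sup>2)"
    by (rule nn_integral_FTC_Icc) (use A in \<open>auto intro!: derivative_eq_intros\<close>)
  then show ?thesis by simp
qed

lemma sigma_finite_nu2:
  assumes n: "n > 0"
  shows "sigma_finite_measure (nu2 n)"
proof
  define A where "A j = {a \<in> space (nu2 n). \<bar>fst a\<bar> \<le> real j \<and> snd a \<le> (2 * real j + real n) * \<bar>fst a\<bar>}" for j :: nat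
  define Z where "Z = {a \<in> space (nu2 n). fst a = 0}"
  have Am [measurable]: "A j \<in> sets (nu2 n)" for j unfolding A_def by measurable
  have Zm [measurable]: "Z \<in> sets (nu2 n)" unfolding Z_def by measurable
  have in_A: "indicator (A j) (l, (2 * real k + real n) * \<bar>l\<bar>) \<le> (indicator {- real j..real j} l * indicator {..j} k :: ennreal)" if "l \<noteq> 0" for j k l
  proof (cases "(l, (2 * real k + real n) * \<bar>l\<bar>) \<in> A j")
    case True
    then have "(2 * real k + real n) * \<bar>l\<bar> \<le> (2 * real j + real n) * \<bar>l\<bar>" "\<bar>l\<bar> \<le> real j" by (auto simp: A_def)
    then have "k \<le> j" using that by (simp add: mult_le_cancel_right)
    then show ?thesis using \<open>\<bar>l\<bar> \<le> real j\<close> by (simp add: indicator_def abs_le_iff)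
  qed simp
  have "emeasure (nu2 n) (A j) < \<infinity>" for j
  proof -
    define c where "c = (\<Sum>k\<le>j. ennreal (1 / (fan_const n k)\<^sup>2))"
    have c: "c < \<infinity>" by (simp add: c_def)
    have "emeasure (nu2 n) (A j) = (\<integral>\<^sup>+a. indicator (A j) a \<partial>nu2 n)"
      by (rule nn_integral_indicator[OF Am, symmetric])
    also have "\<dots> = ennreal (1 / (2 * pi) ^ (2 * n + 1)) * (\<integral>\<^sup>+l. (\<Sum>k. ennreal (1 / (fan_const n k)\<^sup>2) * indicator (A j) (l, (2 * real k + real n) * \<bar>l\<bar>)) * ennreal (\<bar>l\<bar> ^ (2 * n)) \<partial>lborel)"
      by (rule nn_integral_nu2) simp
    also have "(\<integral>\<^sup>+l. (\<Sum>k. ennreal (1 / (fan_const n k)\<^sup>2) * indicator (A j) (l, (2 * real k + real n) * \<bar>l\<bar>)) * ennreal (\<bar>l\<bar> ^ (2 * n)) \<partial>lborel)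
       \<le> (\<integral>\<^sup>+l. c * ennreal (real j ^ (2 * n)) * indicator {- real j..real j} l \<partial>lborel)"
    proof (rule nn_integral_mono_AE, use AE_lborel_singleton[of "0::real"] in eventually_elim)
      case (elim l)
      have "(\<Sum>k. ennreal (1 / (fan_const n k)\<^sup>2) * indicator (A j) (l, (2 * real k + real n) * \<bar>l\<bar>)) \<le> (\<Sum>k. ennreal (1 / (fan_const n k)\<^sup>2) * (indicator {- real j..real j} l * indicator {..j} k))"
        by (intro suminf_le mult_left_mono in_A elim) auto
      also have "\<dots> = (\<Sum>k\<le>j. ennreal (1 / (fan_const n k)\<^sup>2) * (indicator {- real j..real j} l * indicator {..j} k))"
        by (rule suminf_finite) auto
      also have "\<dots> = c * indicator {- real j..real j} l"
        unfolding c_def sum_distrib_right by (intro sum.cong) auto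
      finally have "(\<Sum>k. ennreal (1 / (fan_const n k)\<^sup>2) * indicator (A j) (l, (2 * real k + real n) * \<bar>l\<bar>)) * ennreal (\<bar>l\<bar> ^ (2 * n)) \<le> c * indicator {- real j..real j} l * ennreal (\<bar>l\<bar> ^ (2 * n))"
        by (rule mult_right_mono) simp
      also have "\<dots> \<le> c * ennreal (real j ^ (2 * n)) * indicator {- real j..real j} l"
        by (cases "l \<in> {- real j..real j}") (auto intro!: mult_left_mono ennreal_leI power_mono simp: abs_le_iff)
      finally show ?case .
    qed
    also have "\<dots> = c * ennreal (real j ^ (2 * n)) * emeasure lborel {- real j..real j}"
      by (rule nn_integral_cmult_indicator) simp
    finally have "emeasure (nu2 n) (A j) \<le> ennreal (1 / (2 * pi) ^ (2 * n + 1)) * (c * ennreal (real j ^ (2 * n)) * emeasure lborel {- real j..real j})"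
      by (simp add: mult_left_mono)
    also have "\<dots> < \<infinity>" using c by (simp add: ennreal_mult_less_top)
    finally show ?thesis .
  qed
  moreover have "emeasure (nu2 n) Z < \<infinity>"
  proof -
    have "emeasure (nu2 n) Z = (\<integral>\<^sup>+a. indicator Z a \<partial>nu2 n)"
      by (rule nn_integral_indicator[OF Zm, symmetric])
    also have "\<dots> = ennreal (1 / (2 * pi) ^ (2 * n + 1)) * (\<integral>\<^sup>+l. (\<Sum>k. ennreal (1 / (fan_const n k)\<^sup>2) * indicator Z (l, (2 * real k + real n) * \<bar>l\<bar>)) * ennreal (\<bar>l\<bar> ^ (2 * n)) \<partial>lborel)"
      by (rule nn_integral_nu2) simp
    also have "(\<integral>\<^sup>+l. (\<Sum>k. ennreal (1 / (fan_const n k)\<^sup>2) * indicator Z (l, (2 * real k + real n) * \<bar>l\<bar>)) * ennreal (\<bar>l\<bar> ^ (2 * n)) \<partial>lborel) = (\<integral>\<^sup>+l. 0 \<partial>(lborel :: real measure))"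
      by (rule nn_integral_cong_AE, use AE_lborel_singleton[of "0::real"] in eventually_elim) (simp add: Z_def)
    finally show ?thesis by simp
  qed
  moreover have "(\<Union>j. A j) \<union> Z = space (nu2 n)"
  proof -
    have "\<exists>j. a \<in> A j" if a: "a \<in> fan n" "fst a \<noteq> 0" for a
    proof -
      obtain k where k: "snd a = (2 * real k + real n) * \<bar>fst a\<bar>" using a by (auto simp: fan_def fan_ray_def)
      obtain j :: nat where j: "\<bar>fst a\<bar> \<le> real j" using real_arch_simple by blast
      have "snd a \<le> (2 * real (max k j) + real n) * \<bar>fst a\<bar>" unfolding k by (intro mult_right_mono) auto
      then show ?thesis using a j by (intro exI[of _ "max k j"]) (auto simp: A_def)
    qed
    then show ?thesis by (auto simp: A_def Z_def)
  qed
  ultimately show "\<exists>B. countable B \<and> B \<subseteq> sets (nu2 n) \<and> \<Union> B = space (nu2 n) \<and> (\<forall>a\<in>B. emeasure (nu2 n) a \<noteq> \<infinity>)"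
    by (intro exI[of _ "insert Z (range A)"]) (auto simp del: space_nu2 sets_nu2 simp: less_top[symmetric] simp: Am Zm Un_commute)
qed

lemma strichartz_set_L1:
  fixes f :: "'n::finite heis \<Rightarrow> complex"
  assumes f: "integrable lborel f" and A: "A \<in> sets (nu2 CARD('n))"
  shows "(\<integral>\<^sup>+y. indicator A (fst y) * ennreal ((norm (strichartz f y))\<^sup>2) \<partial>(nu2 CARD('n) \<Otimes>\<^sub>M lborel))
    \<le> ennreal ((2 * pi) ^ CARD('n) * (LINT x|lborel. norm (f x))\<^sup>2) * emeasure (mu CARD('n)) A"
proof -
  let ?n = "CARD('n)"
  define K where "K = (2 * pi) ^ ?n * (LINT x|lborel. norm (f x))\<^sup>2"
  have K: "K \<ge> 0" by (simp add: K_def)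
  have fm [measurable]: "f \<in> borel_measurable borel" using f by auto
  note [measurable] = A
  have wm [measurable]: "(\<lambda>(l, t::real). ennreal (1 / \<bar>l\<bar> ^ ?n)) \<in> borel_measurable (nu2 ?n)"
    unfolding split_beta' by measurable
  have "(\<integral>\<^sup>+y. indicator A (fst y) * ennreal ((norm (strichartz f y))\<^sup>2) \<partial>(nu2 ?n \<Otimes>\<^sub>M lborel))
    = (\<integral>\<^sup>+a. \<integral>\<^sup>+w. indicator A a * ennreal ((norm (strichartz f (a, w)))\<^sup>2) \<partial>lborel \<partial>nu2 ?n)"
    by (subst lborel.nn_integral_fst[symmetric]) simp_all
  also have "\<dots> \<le> (\<integral>\<^sup>+a. ennreal K * ((case a of (l, t) \<Rightarrow> ennreal (1 / \<bar>l\<bar> ^ ?n)) * indicator A a) \<partial>nu2 ?n)"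
  proof (rule nn_integral_mono)
    fix a assume "a \<in> space (nu2 ?n)"
    then have a: "a \<in> fan ?n" by simp
    show "(\<integral>\<^sup>+w. indicator A a * ennreal ((norm (strichartz f (a, w)))\<^sup>2) \<partial>lborel) \<le> ennreal K * ((case a of (l, t) \<Rightarrow> ennreal (1 / \<bar>l\<bar> ^ ?n)) * indicator A a)"
    proof (cases "fst a = 0")
      case True
      then show ?thesis by (simp add: strichartz_def)
    next
      case False
      then obtain l k where l: "a = (l, (2 * real k + real ?n) * \<bar>l\<bar>)" "l \<noteq> 0" using a by (auto simp: fan_def fan_ray_def)
      have am: "a \<in> space (nu2 ?n)" using a by simp
      have "(\<integral>\<^sup>+w. indicator A a * ennreal ((norm (strichartz f (a, w)))\<^sup>2) \<partial>lborel) = indicator A a * (\<integral>\<^sup>+w. ennreal ((norm (strichartz f (a, w)))\<^sup>2) \<partial>lborel)"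
        by (rule nn_integral_cmult) (use measurable_Pair2[OF measurable_strichartz[OF fm] am] in simp)
      also have "\<dots> \<le> indicator A a * ennreal (fan_const ?n k * (2 * pi / \<bar>l\<bar>) ^ ?n * (LINT x|lborel. norm (f x))\<^sup>2)"
        unfolding l(1) by (intro mult_left_mono strichartz_L1_bound f l) auto
      also have "\<dots> \<le> indicator A a * ennreal (K * (1 / \<bar>l\<bar> ^ ?n))"
      proof (intro mult_left_mono ennreal_leI)
        have "fan_const ?n k * ((2 * pi / \<bar>l\<bar>) ^ ?n * (LINT x|lborel. norm (f x))\<^sup>2) \<le> 1 * ((2 * pi / \<bar>l\<bar>) ^ ?n * (LINT x|lborel. norm (f x))\<^sup>2)"
          by (intro mult_right_mono fan_const_le_1) auto
        then show "fan_const ?n k * (2 * pi / \<bar>l\<bar>) ^ ?n * (LINT x|lborel. norm (f x))\<^sup>2 \<le> K * (1 / \<bar>l\<bar> ^ ?n)"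
          by (simp add: K_def power_divide mult_ac)
      qed simp
      also have "\<dots> = ennreal K * ((case a of (l, t) \<Rightarrow> ennreal (1 / \<bar>l\<bar> ^ ?n)) * indicator A a)"
      proof -
        have c: "(case a of (l, t) \<Rightarrow> ennreal (1 / \<bar>l\<bar> ^ ?n)) = ennreal (1 / \<bar>l\<bar> ^ ?n)" by (simp add: l(1))
        show ?thesis unfolding c by (subst ennreal_mult[OF K]) (simp, simp only: mult_ac)
      qed
      finally show ?thesis .
    qed
  qed
  also have "\<dots> = ennreal K * (\<integral>\<^sup>+a. (case a of (l, t) \<Rightarrow> ennreal (1 / \<bar>l\<bar> ^ ?n)) * indicator A a \<partial>nu2 ?n)"
    by (rule nn_integral_cmult) simp
  also have "(\<integral>\<^sup>+a. (case a of (l, t) \<Rightarrow> ennreal (1 / \<bar>l\<bar> ^ ?n)) * indicator A a \<partial>nu2 ?n) = emeasure (mu ?n) A"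
    unfolding mu_def by (rule emeasure_density[OF wm A, symmetric])
  finally show ?thesis unfolding K_def .
qed

lemma L12_indicator:
  assumes f: "f \<in> L12" and A: "A \<in> sets borel"
  shows "(\<lambda>x. indicator A x * f x) \<in> L12"
proof -
  have fm [measurable]: "f \<in> borel_measurable borel" by (rule L12_measurable[OF f])
  note [measurable] = A
  have "integrable lborel (\<lambda>x. indicator A x * f x)"
    by (rule Bochner_Integration.integrable_bound[of _ f]) (use f in \<open>auto simp: L12_def indicator_def intro!: AE_I2\<close>)
  moreover have "L2sq lborel (\<lambda>x. indicator A x * f x) \<le> L2sq lborel f"
    unfolding L2sq_def by (intro nn_integral_mono) (auto simp: indicator_def)
  ultimately show ?thesis using f by (auto simp: L12_def intro: le_less_trans)
qed

lemma layer_cake_square: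
  fixes t :: real
  assumes "t \<ge> 0"
  shows "ennreal (t\<^sup>2) = (\<integral>\<^sup>+\<alpha>. ennreal (2 * \<alpha>) * indicator {0<..} \<alpha> * indicator {\<alpha><..} t \<partial>lborel)"
proof -
  have "ennreal (t\<^sup>2) = (\<integral>\<^sup>+\<alpha>. ennreal (2 * \<alpha>) * indicator {0..t} \<alpha> \<partial>lborel)"
    by (rule nn_integral_linear_head[OF assms, symmetric])
  also have "\<dots> = (\<integral>\<^sup>+\<alpha>. ennreal (2 * \<alpha>) * indicator {0<..} \<alpha> * indicator {\<alpha><..} t \<partial>lborel)"
    by (rule nn_integral_cong_AE, use AE_lborel_singleton[of t] in eventually_elim) (auto simp: indicator_def)
  finally show ?thesis .
qed

lemma paley_normalized:
  fixes f :: "'n::finite heis \<Rightarrow> complex" and m :: "real \<times> real \<Rightarrow> complex"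
  assumes p: "1 < p" "p < 2" and B: "B \<ge> 0"
    and m: "m \<in> borel_measurable (nu2 CARD('n))"
    and weak: "\<And>\<alpha>. \<alpha> > 0 \<Longrightarrow> emeasure (mu CARD('n)) {a \<in> fan CARD('n). norm (m a) > \<alpha>} \<le> ennreal (B * \<alpha> powr (- (2 * p / (2 - p))))"
    and f: "f \<in> L12" and f1: "Lpow p lborel f = 1"
  shows "L2sq (nu2 CARD('n) \<Otimes>\<^sub>M lborel) (\<lambda>y. m (fst y) * strichartz f y)
    \<le> ennreal (2 * (2 * pi) ^ CARD('n) * B * ((2 - p) / (p - 1)) + 2)"
proof -
  let ?n = "CARD('n)" and ?K = "nu2 CARD('n) \<Otimes>\<^sub>M (lborel :: (complex ^ 'n) measure)"
  interpret N: sigma_finite_measure "nu2 ?n" by (rule sigma_finite_nu2) simp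
  interpret K: pair_sigma_finite "nu2 ?n" "lborel :: (complex ^ 'n) measure" ..
  interpret LK: pair_sigma_finite "lborel :: real measure" ?K ..
  have fm [measurable]: "f \<in> borel_measurable borel" by (rule L12_measurable[OF f])
  have Sm [measurable]: "strichartz f \<in> borel_measurable ?K" by (rule L12_strichartz_measurable[OF f])
  note [measurable] = m
  have mm [measurable]: "(\<lambda>y. m (fst y)) \<in> borel_measurable ?K" by (rule measurable_fst_mult[OF m])
  define b where "b = - 2 / (2 - p)"
  have b: "b < 0" using p by (simp add: b_def)
  define r where "r = 2 * p / (2 - p)"
  define P where "P = (2 * pi) ^ ?n"
  have P: "P > 0" by (simp add: P_def)
  define S where "S \<alpha> = {a \<in> fan ?n. norm (m a) > \<alpha>}" for \<alpha>
  have Ss [measurable]: "S \<alpha> \<in> sets (nu2 ?n)" for \<alpha>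
  proof -
    have "{a \<in> space (nu2 ?n). norm (m a) > \<alpha>} \<in> sets (nu2 ?n)" by measurable
    then show ?thesis by (simp add: S_def)
  qed
  define \<Phi> where "\<Phi> \<alpha> = (\<integral>\<^sup>+y. indicator (S \<alpha>) (fst y) * ennreal ((norm (strichartz f y))\<^sup>2) \<partial>?K)" for \<alpha>
  have "L2sq ?K (\<lambda>y. m (fst y) * strichartz f y) = (\<integral>\<^sup>+y. (\<integral>\<^sup>+\<alpha>. ennreal (2 * \<alpha>) * indicator {0<..} \<alpha> * indicator {\<alpha><..} (norm (m (fst y))) * ennreal ((norm (strichartz f y))\<^sup>2) \<partial>lborel) \<partial>?K)"
    unfolding L2sq_def
  proof (intro nn_integral_cong)
    fix y :: "(real \<times> real) \<times> (complex ^ 'n)"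
    have [measurable]: "(\<lambda>\<alpha>. indicator {\<alpha><..} (norm (m (fst y))) :: ennreal) \<in> borel_measurable lborel"
    proof -
      have "(\<lambda>\<alpha>. indicator {\<alpha><..} (norm (m (fst y)))) = (indicator {..<norm (m (fst y))} :: real \<Rightarrow> ennreal)"
        by (auto simp: indicator_def)
      then show ?thesis by simp
    qed
    have "ennreal ((norm (m (fst y) * strichartz f y))\<^sup>2) = ennreal ((norm (m (fst y)))\<^sup>2) * ennreal ((norm (strichartz f y))\<^sup>2)"
      by (simp add: norm_mult power_mult_distrib ennreal_mult')
    also have "\<dots> = (\<integral>\<^sup>+\<alpha>. ennreal (2 * \<alpha>) * indicator {0<..} \<alpha> * indicator {\<alpha><..} (norm (m (fst y))) \<partial>lborel) * ennreal ((norm (strichartz f y))\<^sup>2)"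
      by (subst layer_cake_square) simp_all
    also have "\<dots> = (\<integral>\<^sup>+\<alpha>. ennreal (2 * \<alpha>) * indicator {0<..} \<alpha> * indicator {\<alpha><..} (norm (m (fst y))) * ennreal ((norm (strichartz f y))\<^sup>2) \<partial>lborel)"
      by (rule nn_integral_multc[symmetric]) simp
    finally show "ennreal ((norm (m (fst y) * strichartz f y))\<^sup>2) = (\<integral>\<^sup>+\<alpha>. ennreal (2 * \<alpha>) * indicator {0<..} \<alpha> * indicator {\<alpha><..} (norm (m (fst y))) * ennreal ((norm (strichartz f y))\<^sup>2) \<partial>lborel)" .
  qed
  also have "\<dots> = (\<integral>\<^sup>+\<alpha>. (\<integral>\<^sup>+y. ennreal (2 * \<alpha>) * indicator {0<..} \<alpha> * indicator {\<alpha><..} (norm (m (fst y))) * ennreal ((norm (strichartz f y))\<^sup>2) \<partial>?K) \<partial>lborel)"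
    by (rule LK.Fubini') (simp add: indicator_def)
  also have "\<dots> = (\<integral>\<^sup>+\<alpha>. ennreal (2 * \<alpha>) * indicator {0<..} \<alpha> * \<Phi> \<alpha> \<partial>lborel)"
  proof (intro nn_integral_cong)
    fix \<alpha> :: real
    have "(\<integral>\<^sup>+y. ennreal (2 * \<alpha>) * indicator {0<..} \<alpha> * indicator {\<alpha><..} (norm (m (fst y))) * ennreal ((norm (strichartz f y))\<^sup>2) \<partial>?K)
      = (\<integral>\<^sup>+y. ennreal (2 * \<alpha>) * indicator {0<..} \<alpha> * (indicator (S \<alpha>) (fst y) * ennreal ((norm (strichartz f y))\<^sup>2)) \<partial>?K)"
      by (intro nn_integral_cong) (auto simp: S_def indicator_def space_pair_measure)
    also have "\<dots> = ennreal (2 * \<alpha>) * indicator {0<..} \<alpha> * \<Phi> \<alpha>"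
      unfolding \<Phi>_def by (rule nn_integral_cmult) measurable
    finally show "(\<integral>\<^sup>+y. ennreal (2 * \<alpha>) * indicator {0<..} \<alpha> * indicator {\<alpha><..} (norm (m (fst y))) * ennreal ((norm (strichartz f y))\<^sup>2) \<partial>?K) = ennreal (2 * \<alpha>) * indicator {0<..} \<alpha> * \<Phi> \<alpha>" .
  qed
  also have "\<dots> \<le> (\<integral>\<^sup>+\<alpha>. (\<integral>\<^sup>+x. ennreal (4 * P * B * norm (f x)) * (ennreal (\<alpha> powr (- p / (2 - p))) * indicator {0<..} \<alpha> * indicator {\<alpha> powr b<..} (norm (f x)))
       + ennreal (2 * (norm (f x))\<^sup>2) * (ennreal (2 * \<alpha>) * indicator {0<..} \<alpha> * indicator {..\<alpha> powr b} (norm (f x))) \<partial>lborel) \<partial>lborel)"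
  proof (intro nn_integral_mono)
    fix \<alpha> :: real
    let ?T = "\<integral>\<^sup>+x. ennreal (4 * P * B * norm (f x)) * (ennreal (\<alpha> powr (- p / (2 - p))) * indicator {0<..} \<alpha> * indicator {\<alpha> powr b<..} (norm (f x)))
       + ennreal (2 * (norm (f x))\<^sup>2) * (ennreal (2 * \<alpha>) * indicator {0<..} \<alpha> * indicator {..\<alpha> powr b} (norm (f x))) \<partial>lborel"
    show "ennreal (2 * \<alpha>) * indicator {0<..} \<alpha> * \<Phi> \<alpha> \<le> ?T"
    proof (cases "\<alpha> > 0")
      case False
      then show ?thesis by simp
    next
      case \<alpha>: True
      define h where "h = \<alpha> powr b"
      have h: "h > 0" using \<alpha> by (simp add: h_def)
      define U where "U = {x. norm (f x) > h}"
      have U [measurable]: "U \<in> sets borel" unfolding U_def by measurable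
      define f1 f2 where "f1 x = indicator U x * f x" and "f2 x = indicator (- U) x * f x" for x
      have L: "f1 \<in> L12" "f2 \<in> L12" unfolding f1_def[abs_def] f2_def[abs_def] by (intro L12_indicator f; simp)+
      have I: "integrable lborel f1" "integrable lborel f2" using L by (auto simp: L12_def)
      have [measurable]: "strichartz f1 \<in> borel_measurable ?K" "strichartz f2 \<in> borel_measurable ?K" by (intro L12_strichartz_measurable L)+
      have sum: "strichartz f y = strichartz f1 y + strichartz f2 y" for y
      proof -
        have "f = (\<lambda>x. f1 x + f2 x)" by (rule ext) (simp add: f1_def f2_def indicator_def)
        then show ?thesis using strichartz_add[OF I, of y] by simp
      qed
      have N1: "ennreal (LINT x|lborel. norm (f1 x)) = (\<integral>\<^sup>+x. ennreal (norm (f x)) * indicator {h<..} (norm (f x)) \<partial>lborel)"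
      proof -
        have "ennreal (LINT x|lborel. norm (f1 x)) = (\<integral>\<^sup>+x. ennreal (norm (f1 x)) \<partial>lborel)"
          by (rule nn_integral_eq_integral[OF integrable_norm[OF I(1)], symmetric]) simp
        also have "\<dots> = (\<integral>\<^sup>+x. ennreal (norm (f x)) * indicator {h<..} (norm (f x)) \<partial>lborel)"
          by (intro nn_integral_cong) (auto simp: f1_def U_def indicator_def)
        finally show ?thesis .
      qed
      have N1le: "ennreal (LINT x|lborel. norm (f1 x)) \<le> ennreal (h powr (1 - p))"
      proof -
        have "ennreal (LINT x|lborel. norm (f1 x)) \<le> (\<integral>\<^sup>+x. ennreal (h powr (1 - p)) * ennreal (norm (f x) powr p) \<partial>lborel)"
          unfolding N1
        proof (intro nn_integral_mono)
          fix x
          show "ennreal (norm (f x)) * indicator {h<..} (norm (f x)) \<le> ennreal (h powr (1 - p)) * ennreal (norm (f x) powr p)"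
          proof (cases "h < norm (f x)")
            case True
            then have pos: "norm (f x) > 0" using h by linarith
            have "norm (f x) powr (1 - p) \<le> h powr (1 - p)" using True h p by (intro powr_mono2') auto
            then have "norm (f x) powr (1 - p) * norm (f x) powr p \<le> h powr (1 - p) * norm (f x) powr p" by (rule mult_right_mono) simp
            moreover have "norm (f x) powr (1 - p) * norm (f x) powr p = norm (f x)" using pos by (simp flip: powr_add)
            ultimately show ?thesis using True by (simp add: ennreal_leI flip: ennreal_mult)
          qed simp
        qed
        also have "\<dots> = ennreal (h powr (1 - p))"
          using f1 by (simp add: nn_integral_cmult Lpow_def)
        finally show ?thesis .
      qed
      have "\<Phi> \<alpha> \<le> (\<integral>\<^sup>+y. 2 * (indicator (S \<alpha>) (fst y) * ennreal ((norm (strichartz f1 y))\<^sup>2)) + 2 * ennreal ((norm (strichartz f2 y))\<^sup>2) \<partial>?K)"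
        unfolding \<Phi>_def
      proof (intro nn_integral_mono)
        fix y
        have "norm (strichartz f y) \<le> norm (strichartz f1 y) + norm (strichartz f2 y)" unfolding sum by (rule norm_triangle_ineq)
        then have "(norm (strichartz f y))\<^sup>2 \<le> (norm (strichartz f1 y) + norm (strichartz f2 y))\<^sup>2" by (intro power_mono) auto
        also have "\<dots> \<le> 2 * (norm (strichartz f1 y))\<^sup>2 + 2 * (norm (strichartz f2 y))\<^sup>2"
          using sum_squares_bound[of "norm (strichartz f1 y)" "norm (strichartz f2 y)"] by (simp add: power2_sum)
        finally have "ennreal ((norm (strichartz f y))\<^sup>2) \<le> ennreal (2 * (norm (strichartz f1 y))\<^sup>2 + 2 * (norm (strichartz f2 y))\<^sup>2)"
          by (rule ennreal_leI)
        also have "\<dots> = 2 * ennreal ((norm (strichartz f1 y))\<^sup>2) + 2 * ennreal ((norm (strichartz f2 y))\<^sup>2)"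
          by (simp add: ennreal_mult')
        finally show "indicator (S \<alpha>) (fst y) * ennreal ((norm (strichartz f y))\<^sup>2) \<le> 2 * (indicator (S \<alpha>) (fst y) * ennreal ((norm (strichartz f1 y))\<^sup>2)) + 2 * ennreal ((norm (strichartz f2 y))\<^sup>2)"
          by (auto simp: indicator_def)
      qed
      also have "\<dots> = 2 * (\<integral>\<^sup>+y. indicator (S \<alpha>) (fst y) * ennreal ((norm (strichartz f1 y))\<^sup>2) \<partial>?K) + 2 * L2sq ?K (strichartz f2)"
        by (simp add: nn_integral_add nn_integral_cmult L2sq_def)
      also have "\<dots> \<le> 2 * (ennreal (P * (LINT x|lborel. norm (f1 x))\<^sup>2) * ennreal (B * \<alpha> powr (- r))) + 2 * L2sq lborel f2"
      proof (intro add_mono mult_left_mono strichartz_bessel I)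
        show "(\<integral>\<^sup>+y. indicator (S \<alpha>) (fst y) * ennreal ((norm (strichartz f1 y))\<^sup>2) \<partial>?K) \<le> ennreal (P * (LINT x|lborel. norm (f1 x))\<^sup>2) * ennreal (B * \<alpha> powr (- r))"
          unfolding P_def by (rule order_trans[OF strichartz_set_L1[OF I(1) Ss] mult_left_mono[OF weak[OF \<alpha>, folded S_def r_def]]]) simp
      qed auto
      finally have "\<Phi> \<alpha> \<le> 2 * (ennreal (P * (LINT x|lborel. norm (f1 x))\<^sup>2) * ennreal (B * \<alpha> powr (- r))) + 2 * L2sq lborel f2" .
      also have "2 * (ennreal (P * (LINT x|lborel. norm (f1 x))\<^sup>2) * ennreal (B * \<alpha> powr (- r)))
        \<le> ennreal (2 * P * B * \<alpha> powr (- r) * h powr (1 - p)) * (\<integral>\<^sup>+x. ennreal (norm (f x)) * indicator {h<..} (norm (f x)) \<partial>lborel)"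
      proof -
        define Q where "Q = (LINT x|lborel. norm (f1 x))"
        have Q: "Q \<ge> 0" "Q \<le> h powr (1 - p)" using N1le by (auto simp: Q_def ennreal_le_iff)
        have "2 * (ennreal (P * Q\<^sup>2) * ennreal (B * \<alpha> powr (- r))) = ennreal (2 * P * B * \<alpha> powr (- r) * Q * Q)"
          using P B Q by (simp add: power2_eq_square mult_ac flip: ennreal_mult ennreal_numeral)
        also have "\<dots> \<le> ennreal (2 * P * B * \<alpha> powr (- r) * h powr (1 - p) * Q)"
          using P B Q by (intro ennreal_leI mult_right_mono mult_left_mono) auto
        also have "\<dots> = ennreal (2 * P * B * \<alpha> powr (- r) * h powr (1 - p)) * ennreal Q"
          using P B Q by (intro ennreal_mult) auto
        finally show ?thesis unfolding Q_def N1 .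
      qed
      finally have "ennreal (2 * \<alpha>) * \<Phi> \<alpha> \<le> ennreal (2 * \<alpha>) * (ennreal (2 * P * B * \<alpha> powr (- r) * h powr (1 - p)) * (\<integral>\<^sup>+x. ennreal (norm (f x)) * indicator {h<..} (norm (f x)) \<partial>lborel) + 2 * L2sq lborel f2)"
        by (intro mult_left_mono) (auto simp: add_right_mono)
      also have "\<dots> = ennreal (4 * P * B * \<alpha> powr (- p / (2 - p))) * (\<integral>\<^sup>+x. ennreal (norm (f x)) * indicator {h<..} (norm (f x)) \<partial>lborel) + ennreal (4 * \<alpha>) * L2sq lborel f2"
      proof -
        have "\<alpha> * \<alpha> powr (- r) * h powr (1 - p) = \<alpha> powr 1 * \<alpha> powr (- r) * \<alpha> powr (b * (1 - p))"
          using \<alpha> by (simp add: h_def powr_powr)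
        also have "\<dots> = \<alpha> powr (1 + - r + b * (1 - p))" by (simp only: powr_add)
        also have "1 + - r + b * (1 - p) = - p / (2 - p)"
        proof -
          define d where "d = 2 - p"
          have d: "d > 0" and pd: "p = 2 - d" using p by (auto simp: d_def)
          show ?thesis unfolding r_def b_def pd using d by (simp add: field_simps)
        qed
        finally have c1: "2 * \<alpha> * (2 * P * B * \<alpha> powr (- r) * h powr (1 - p)) = 4 * P * B * \<alpha> powr (- p / (2 - p))" by (simp add: mult_ac)
        have c2: "ennreal (2 * \<alpha>) * (ennreal u * v + 2 * w) = ennreal (2 * \<alpha> * u) * v + ennreal (4 * \<alpha>) * w" for u v w
        proof -
          have "ennreal (4 * \<alpha>) = ennreal (2 * \<alpha>) * 2" using \<alpha> by (simp flip: ennreal_mult ennreal_numeral)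
          then show ?thesis using \<alpha> by (simp add: distrib_left mult.assoc ennreal_mult')
        qed
        show ?thesis unfolding c2 c1 ..
      qed
      also have "L2sq lborel f2 = (\<integral>\<^sup>+x. ennreal ((norm (f x))\<^sup>2) * indicator {..h} (norm (f x)) \<partial>lborel)"
        unfolding L2sq_def by (intro nn_integral_cong) (auto simp: f2_def U_def indicator_def)
      also have "ennreal (4 * P * B * \<alpha> powr (- p / (2 - p))) * (\<integral>\<^sup>+x. ennreal (norm (f x)) * indicator {h<..} (norm (f x)) \<partial>lborel) + ennreal (4 * \<alpha>) * (\<integral>\<^sup>+x. ennreal ((norm (f x))\<^sup>2) * indicator {..h} (norm (f x)) \<partial>lborel)
        = (\<integral>\<^sup>+x. ennreal (4 * P * B * \<alpha> powr (- p / (2 - p))) * (ennreal (norm (f x)) * indicator {h<..} (norm (f x))) + ennreal (4 * \<alpha>) * (ennreal ((norm (f x))\<^sup>2) * indicator {..h} (norm (f x))) \<partial>lborel)"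
        by (simp add: nn_integral_add nn_integral_cmult)
      also have "\<dots> = ?T"
      proof (intro nn_integral_cong arg_cong2[where f = "(+)"])
        fix x
        show "ennreal (4 * P * B * \<alpha> powr (- p / (2 - p))) * (ennreal (norm (f x)) * indicator {h<..} (norm (f x))) = ennreal (4 * P * B * norm (f x)) * (ennreal (\<alpha> powr (- p / (2 - p))) * indicator {0<..} \<alpha> * indicator {\<alpha> powr b<..} (norm (f x)))"
          using \<alpha> P B by (simp add: h_def indicator_def mult_ac flip: ennreal_mult)
        show "ennreal (4 * \<alpha>) * (ennreal ((norm (f x))\<^sup>2) * indicator {..h} (norm (f x))) = ennreal (2 * (norm (f x))\<^sup>2) * (ennreal (2 * \<alpha>) * indicator {0<..} \<alpha> * indicator {..\<alpha> powr b} (norm (f x)))"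
          using \<alpha> by (simp add: h_def indicator_def mult_ac flip: ennreal_mult)
      qed
      finally show ?thesis using \<alpha> by simp
    qed
  qed
  also have "\<dots> = (\<integral>\<^sup>+x. (\<integral>\<^sup>+\<alpha>. ennreal (4 * P * B * norm (f x)) * (ennreal (\<alpha> powr (- p / (2 - p))) * indicator {0<..} \<alpha> * indicator {\<alpha> powr b<..} (norm (f x)))
       + ennreal (2 * (norm (f x))\<^sup>2) * (ennreal (2 * \<alpha>) * indicator {0<..} \<alpha> * indicator {..\<alpha> powr b} (norm (f x))) \<partial>lborel) \<partial>lborel)"
    by (rule lborel_pair.Fubini'[symmetric]) (simp add: indicator_def)
  also have "\<dots> \<le> (\<integral>\<^sup>+x. ennreal (2 * P * B * ((2 - p) / (p - 1)) + 2) * ennreal (norm (f x) powr p) \<partial>lborel)"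
  proof (intro nn_integral_mono)
    fix x
    let ?I = "\<integral>\<^sup>+\<alpha>. ennreal (4 * P * B * norm (f x)) * (ennreal (\<alpha> powr (- p / (2 - p))) * indicator {0<..} \<alpha> * indicator {\<alpha> powr b<..} (norm (f x)))
       + ennreal (2 * (norm (f x))\<^sup>2) * (ennreal (2 * \<alpha>) * indicator {0<..} \<alpha> * indicator {..\<alpha> powr b} (norm (f x))) \<partial>lborel"
    show "?I \<le> ennreal (2 * P * B * ((2 - p) / (p - 1)) + 2) * ennreal (norm (f x) powr p)"
    proof (cases "f x = 0")
      case True
      then show ?thesis by simp
    next
      case False
      define t where "t = norm (f x)"
      have t: "t > 0" using False by (simp add: t_def)
      define A where "A = t powr (1 / b)"
      have A: "A > 0" using t by (simp add: A_def)
      have Ab: "A powr b = t" using t b by (simp add: A_def powr_powr)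
      have iff: "\<alpha> powr b < t \<longleftrightarrow> A < \<alpha>" if "\<alpha> > 0" for \<alpha>
        unfolding Ab[symmetric] using that A b powr_less_mono2_neg[of b A \<alpha>] powr_less_mono2_neg[of b \<alpha> A]
        by (cases A \<alpha> rule: linorder_cases) auto
      have e1: "- p / (2 - p) < - 1" using p by (simp add: pos_divide_less_eq)
      have "?I = (\<integral>\<^sup>+\<alpha>. ennreal (4 * P * B * t) * (ennreal (\<alpha> powr (- p / (2 - p))) * indicator {A<..} \<alpha>) + ennreal (2 * t\<^sup>2) * (ennreal (2 * \<alpha>) * indicator {0..A} \<alpha>) \<partial>lborel)"
      proof (rule nn_integral_cong)
        fix \<alpha> :: real
        have e1: "ennreal (\<alpha> powr (- p / (2 - p))) * indicator {0<..} \<alpha> * indicator {\<alpha> powr b<..} t = ennreal (\<alpha> powr (- p / (2 - p))) * indicator {A<..} \<alpha>"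
          using iff[of \<alpha>] A by (auto simp: indicator_def)
        have e2: "ennreal (2 * \<alpha>) * indicator {0<..} \<alpha> * indicator {..\<alpha> powr b} t = ennreal (2 * \<alpha>) * indicator {0..A} \<alpha>"
          using iff[of \<alpha>] A by (auto simp: indicator_def not_less ennreal_neg)
        show "ennreal (4 * P * B * norm (f x)) * (ennreal (\<alpha> powr (- p / (2 - p))) * indicator {0<..} \<alpha> * indicator {\<alpha> powr b<..} (norm (f x)))
           + ennreal (2 * (norm (f x))\<^sup>2) * (ennreal (2 * \<alpha>) * indicator {0<..} \<alpha> * indicator {..\<alpha> powr b} (norm (f x)))
           = ennreal (4 * P * B * t) * (ennreal (\<alpha> powr (- p / (2 - p))) * indicator {A<..} \<alpha>) + ennreal (2 * t\<^sup>2) * (ennreal (2 * \<alpha>) * indicator {0..A} \<alpha>)"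
          unfolding t_def[symmetric] e1 e2 ..
      qed
      also have "\<dots> = ennreal (4 * P * B * t) * (\<integral>\<^sup>+\<alpha>. ennreal (\<alpha> powr (- p / (2 - p))) * indicator {A<..} \<alpha> \<partial>lborel) + ennreal (2 * t\<^sup>2) * (\<integral>\<^sup>+\<alpha>. ennreal (2 * \<alpha>) * indicator {0..A} \<alpha> \<partial>lborel)"
        by (simp add: nn_integral_add nn_integral_cmult)
      also have "\<dots> \<le> ennreal (4 * P * B * t) * ennreal (A powr (- p / (2 - p) + 1) / (- (- p / (2 - p) + 1))) + ennreal (2 * t\<^sup>2) * ennreal (A\<^sup>2)"
        using e1 A by (intro add_mono mult_left_mono nn_integral_powr_tail) (auto simp: nn_integral_linear_head)
      also have "\<dots> = ennreal (4 * P * B * (t * A powr (- p / (2 - p) + 1)) / (- (- p / (2 - p) + 1)) + 2 * (t\<^sup>2 * A\<^sup>2))"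
      proof -
        have "0 \<le> A powr (- p / (2 - p) + 1) / (- (- p / (2 - p) + 1))" using e1 by (intro divide_nonneg_nonneg) auto
        then obtain X where X: "A powr (- p / (2 - p) + 1) / (- (- p / (2 - p) + 1)) = X" "X \<ge> 0" by blast
        have "4 * P * B * (t * A powr (- p / (2 - p) + 1)) / (- (- p / (2 - p) + 1)) = 4 * P * B * t * X"
          unfolding X(1)[symmetric] by (simp only: times_divide_eq_right mult.assoc)
        moreover have "ennreal (4 * P * B * t) * ennreal X + ennreal (2 * t\<^sup>2) * ennreal (A\<^sup>2) = ennreal (4 * P * B * t * X + 2 * (t\<^sup>2 * A\<^sup>2))"
          using P B t A X(2) by (subst ennreal_plus) (auto simp: ennreal_mult[symmetric] mult_ac)
        ultimately show ?thesis unfolding X(1) by (simp only:)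
      qed
      also have "t * A powr (- p / (2 - p) + 1) = t powr p"
      proof -
        have e: "1 / b * (- p / (2 - p) + 1) = p - 1"
        proof -
          define d where "d = 2 - p"
          have "d > 0" "p = 2 - d" using p by (auto simp: d_def)
          then show ?thesis unfolding b_def by (simp add: field_simps)
        qed
        have "A powr (- p / (2 - p) + 1) = t powr (p - 1)" unfolding A_def powr_powr e ..
        then show ?thesis using t by (simp add: powr_mult_base)
      qed
      also have "t\<^sup>2 * A\<^sup>2 = t powr p"
      proof -
        have e: "2 + 1 / b * 2 = p" using p by (simp add: b_def field_simps)
        have "A\<^sup>2 = t powr (1 / b * 2)" using A unfolding A_def by (simp add: powr_powr flip: powr_numeral)
        then have "t\<^sup>2 * A\<^sup>2 = t powr (2 + 1 / b * 2)" using t by (simp add: powr_add powr_numeral)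
        then show ?thesis unfolding e .
      qed
      also have "4 * P * B * t powr p / (- (- p / (2 - p) + 1)) + 2 * t powr p = (2 * P * B * ((2 - p) / (p - 1)) + 2) * t powr p"
      proof -
        have "- (- p / (2 - p) + 1) = 2 * (p - 1) / (2 - p)" using p by (simp add: field_simps)
        moreover have "4 * P * B * u / (2 * v / w) = 2 * P * B * (w / v) * u" if "v \<noteq> 0" "w \<noteq> 0" for u v w :: real
          using that by (simp add: field_simps)
        ultimately show ?thesis using p by (simp only: distrib_right)
      qed
      also have "ennreal ((2 * P * B * ((2 - p) / (p - 1)) + 2) * t powr p) = ennreal (2 * P * B * ((2 - p) / (p - 1)) + 2) * ennreal (norm (f x) powr p)"
        using P B p by (subst ennreal_mult) (auto simp: t_def)
      finally show ?thesis .
    qed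
  qed
  also have "\<dots> = ennreal (2 * P * B * ((2 - p) / (p - 1)) + 2)"
    using f1 by (simp add: nn_integral_cmult Lpow_def)
  finally show ?thesis unfolding P_def .
qed

lemma L12_Lpow_finite:
  assumes f: "f \<in> L12" and p: "1 \<le> p" "p \<le> 2"
  shows "Lpow p lborel f < \<infinity>"
proof -
  have [measurable]: "f \<in> borel_measurable borel" by (rule L12_measurable[OF f])
  have "Lpow p lborel f \<le> (\<integral>\<^sup>+x. ennreal (norm (f x)) + ennreal ((norm (f x))\<^sup>2) \<partial>lborel)"
    unfolding Lpow_def
  proof (intro nn_integral_mono)
    fix x
    have "norm (f x) powr p \<le> norm (f x) + (norm (f x))\<^sup>2"
    proof (cases "norm (f x) \<le> 1")
      case True
      then have "norm (f x) powr p \<le> norm (f x) powr 1" using p by (intro powr_mono') auto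
      then show ?thesis by (simp add: add_increasing2)
    next
      case False
      then have "norm (f x) powr p \<le> norm (f x) powr 2" using p by (intro powr_mono) auto
      then show ?thesis by (simp add: powr_numeral add_increasing)
    qed
    then show "ennreal (norm (f x) powr p) \<le> ennreal (norm (f x)) + ennreal ((norm (f x))\<^sup>2)"
      by (simp add: ennreal_leI flip: ennreal_plus)
  qed
  also have "\<dots> = (\<integral>\<^sup>+x. ennreal (norm (f x)) \<partial>lborel) + L2sq lborel f"
    by (simp add: nn_integral_add L2sq_def)
  also have "\<dots> < \<infinity>" using f by (auto simp: L12_def integrable_iff_bounded)
  finally show ?thesis .
qed

theorem paley:
  fixes m :: "real \<times> real \<Rightarrow> complex"
  assumes p: "1 < p" "p < 2" and B: "B \<ge> 0"
    and m: "m \<in> borel_measurable (nu2 CARD('n::finite))" and bd: "bounded (m ` fan CARD('n))"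
    and weak: "\<And>\<alpha>. \<alpha> > 0 \<Longrightarrow> emeasure (mu CARD('n)) {a \<in> fan CARD('n). norm (m a) > \<alpha>} \<le> ennreal (B * \<alpha> powr (- (2 * p / (2 - p))))"
  shows "\<exists>C\<ge>0. \<forall>f :: 'n heis \<Rightarrow> complex. f \<in> L12 \<longrightarrow>
    L2sq (nu2 CARD('n) \<Otimes>\<^sub>M lborel) (\<lambda>y. m (fst y) * strichartz f y) \<le> ennreal (C * enn2real (Lpow p lborel f) powr (2 / p))"
proof -
  define C where "C = 2 * (2 * pi) ^ CARD('n) * B * ((2 - p) / (p - 1)) + 2"
  have C: "C \<ge> 0" using p B by (simp add: C_def)
  let ?K = "nu2 CARD('n) \<Otimes>\<^sub>M (lborel :: (complex ^ 'n) measure)"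
  have "L2sq ?K (\<lambda>y. m (fst y) * strichartz f y) \<le> ennreal (C * enn2real (Lpow p lborel f) powr (2 / p))"
    if f: "f \<in> L12" for f :: "'n heis \<Rightarrow> complex"
  proof -
    have fm [measurable]: "f \<in> borel_measurable borel" by (rule L12_measurable[OF f])
    have Sm [measurable]: "strichartz f \<in> borel_measurable ?K" by (rule L12_strichartz_measurable[OF f])
    have mm [measurable]: "(\<lambda>y. m (fst y)) \<in> borel_measurable ?K" by (rule measurable_fst_mult[OF m])
    define X where "X = enn2real (Lpow p lborel f)"
    have X: "X \<ge> 0" "Lpow p lborel f = ennreal X" using L12_Lpow_finite[OF f, of p] p by (auto simp: X_def less_top)
    show ?thesis
    proof (cases "X = 0")
      case True
      then have "AE x in lborel. f x = 0" using X by (intro Lpow_eq_0_AE[of _ _ p]) auto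
      then have "L2sq lborel f = 0" unfolding L2sq_def by (subst nn_integral_0_iff_AE) auto
      then have 0: "L2sq ?K (strichartz f) = 0" using strichartz_bessel[of f] f by (simp add: L12_def)
      obtain b where b: "\<And>a. a \<in> fan CARD('n) \<Longrightarrow> norm (m a) \<le> b" using bd by (auto simp: bounded_iff)
      have "L2sq ?K (\<lambda>y. m (fst y) * strichartz f y) \<le> ennreal (b\<^sup>2) * L2sq ?K (strichartz f)"
        by (intro L2sq_mult_le b) (auto simp: space_pair_measure)
      then show ?thesis unfolding 0 by simp
    next
      case False
      then have X0: "X > 0" using X by simp
      define c where "c = X powr (- 1 / p)"
      have c: "c > 0" using X0 by (simp add: c_def)
      have "Lpow p lborel (\<lambda>x. of_real c * f x) = ennreal (c powr p) * Lpow p lborel f"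
        using c by (subst Lpow_cmult) auto
      also have "\<dots> = ennreal (c powr p * X)" using X by (simp add: ennreal_mult)
      also have "c powr p * X = 1"
      proof -
        have "c powr p = X powr (- 1)" using p by (simp add: c_def powr_powr)
        then show ?thesis using X0 by (simp add: powr_minus)
      qed
      finally have n: "Lpow p lborel (\<lambda>x. of_real c * f x) = 1" by simp
      have "L2sq ?K (\<lambda>y. m (fst y) * strichartz (\<lambda>x. of_real c * f x) y) \<le> ennreal C"
        unfolding C_def by (rule paley_normalized[OF p B m weak L12_cmult[OF f] n])
      moreover have "L2sq ?K (\<lambda>y. m (fst y) * strichartz (\<lambda>x. of_real c * f x) y) = ennreal (c\<^sup>2) * L2sq ?K (\<lambda>y. m (fst y) * strichartz f y)"
        using c L2sq_cmult[of "\<lambda>y. m (fst y) * strichartz f y" ?K "of_real c"] by (simp add: strichartz_cmult mult.left_commute)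
      ultimately have le: "ennreal (c\<^sup>2) * L2sq ?K (\<lambda>y. m (fst y) * strichartz f y) \<le> ennreal C" by simp
      have "1 / c\<^sup>2 = X powr (2 / p)"
      proof -
        have "c\<^sup>2 = X powr (- (2 / p))" using X0 unfolding c_def by (simp add: power2_eq_square flip: powr_add)
        then show ?thesis by (simp add: powr_minus field_simps)
      qed
      have "L2sq ?K (\<lambda>y. m (fst y) * strichartz f y) = ennreal (1 / c\<^sup>2) * (ennreal (c\<^sup>2) * L2sq ?K (\<lambda>y. m (fst y) * strichartz f y))"
        using c by (simp flip: mult.assoc ennreal_mult)
      also have "\<dots> \<le> ennreal (1 / c\<^sup>2) * ennreal C" by (intro mult_left_mono le) simp
      also have "\<dots> = ennreal (C * X powr (2 / p))"
        unfolding \<open>1 / c\<^sup>2 = X powr (2 / p)\<close> using C by (simp add: mult.commute flip: ennreal_mult)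
      finally show ?thesis unfolding X_def .
    qed
  qed
  then show ?thesis using C by blast
qed

text \<open>
  The tail exponent of \<open>\<bar>m\<bar>\<^bsup>\<theta>\<^esup>\<close> is \<open>1/(\<theta>t) = 2s/(2 - s)\<close>, the one in Paley's inequality.
\<close>

lemma weak_power_bound:
  fixes m :: "real \<times> real \<Rightarrow> complex"
  assumes s: "1 < s" "s \<le> 2" and \<theta>: "\<theta> \<ge> 0" and A: "A \<ge> 0"
    and m: "m \<in> borel_measurable (nu2 CARD('n::finite))" and bd: "bounded (m ` fan CARD('n))"
    and t: "s < 2 \<Longrightarrow> t > 0 \<and> \<theta> * t = 1 / s - 1 / 2"
    and tail: "\<And>\<alpha>. t > 0 \<Longrightarrow> \<alpha> > 0 \<Longrightarrow> emeasure (mu CARD('n)) {a \<in> fan CARD('n). norm (m a) > \<alpha>} \<le> ennreal (A * \<alpha> powr (- (1 / t)))"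
  shows "\<exists>C\<ge>0. \<forall>f :: 'n heis \<Rightarrow> complex. f \<in> L12 \<longrightarrow>
    L2sq (nu2 CARD('n) \<Otimes>\<^sub>M lborel) (\<lambda>y. of_real (norm (m (fst y)) powr \<theta>) * strichartz f y) \<le> ennreal (C * enn2real (Lpow s lborel f) powr (2 / s))"
proof -
  let ?K = "nu2 CARD('n) \<Otimes>\<^sub>M (lborel :: (complex ^ 'n) measure)"
  define m' where "m' a = (of_real (norm (m a) powr \<theta>) :: complex)" for a
  note [measurable] = m
  have m' [measurable]: "m' \<in> borel_measurable (nu2 CARD('n))" unfolding m'_def[abs_def] by measurable
  obtain b where b: "\<And>a. a \<in> fan CARD('n) \<Longrightarrow> norm (m a) \<le> b" using bd by (auto simp: bounded_iff)
  have b': "norm (m' a) \<le> b powr \<theta>" if "a \<in> fan CARD('n)" for a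
    using b[OF that] \<theta> by (auto simp: m'_def intro: powr_mono2)
  show ?thesis
  proof (cases "s < 2")
    case True
    then have t0: "t > 0" and tt: "\<theta> * t = 1 / s - 1 / 2" using t by auto
    have "1 / s - 1 / 2 > 0" using True s by (simp add: field_simps)
    then have \<theta>0: "\<theta> > 0" using tt t0 by (metis zero_less_mult_pos2)
    have "emeasure (mu CARD('n)) {a \<in> fan CARD('n). norm (m' a) > \<alpha>} \<le> ennreal (A * \<alpha> powr (- (2 * s / (2 - s))))" if \<alpha>: "\<alpha> > 0" for \<alpha>
    proof -
      have "{a \<in> fan CARD('n). norm (m' a) > \<alpha>} = {a \<in> fan CARD('n). norm (m a) > \<alpha> powr (1 / \<theta>)}"
      proof -
        have "x powr \<theta> > \<alpha> \<longleftrightarrow> x > \<alpha> powr (1 / \<theta>)" if x: "x \<ge> 0" for x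
        proof -
          have "(\<alpha> powr (1 / \<theta>)) powr \<theta> = \<alpha>" using \<theta>0 \<alpha> by (simp add: powr_powr)
          moreover have "(\<alpha> powr (1 / \<theta>)) powr \<theta> < x powr \<theta> \<longleftrightarrow> \<alpha> powr (1 / \<theta>) < x"
            using powr_less_mono2[of \<theta> "\<alpha> powr (1 / \<theta>)" x] powr_mono2[of \<theta> x "\<alpha> powr (1 / \<theta>)"] \<theta>0 x by (auto simp: not_le[symmetric])
          ultimately show ?thesis by simp
        qed
        then show ?thesis by (auto simp: m'_def)
      qed
      also have "emeasure (mu CARD('n)) \<dots> \<le> ennreal (A * (\<alpha> powr (1 / \<theta>)) powr (- (1 / t)))"
        using \<alpha> by (intro tail t0) simp
      also have "(\<alpha> powr (1 / \<theta>)) powr (- (1 / t)) = \<alpha> powr (- (2 * s / (2 - s)))"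
      proof -
        have "1 / (\<theta> * t) = 2 * s / (2 - s)" unfolding tt using s True by (simp add: field_simps)
        then show ?thesis by (simp add: powr_powr)
      qed
      finally show ?thesis .
    qed
    moreover have "bounded (m' ` fan CARD('n))" unfolding bounded_iff using b' by blast
    ultimately show ?thesis using paley[OF s(1) True A m'] unfolding m'_def by blast
  next
    case False
    then have s2: "s = 2" using s by simp
    have "L2sq ?K (\<lambda>y. m' (fst y) * strichartz f y) \<le> ennreal ((b powr \<theta>)\<^sup>2 * enn2real (Lpow s lborel f) powr (2 / s))"
      if f: "f \<in> L12" for f :: "'n heis \<Rightarrow> complex"
    proof -
      have "L2sq ?K (\<lambda>y. m' (fst y) * strichartz f y) \<le> ennreal ((b powr \<theta>)\<^sup>2) * L2sq ?K (strichartz f)"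
        by (intro L2sq_mult_le b' L12_strichartz_measurable f) (auto simp: space_pair_measure)
      also have "L2sq ?K (strichartz f) \<le> L2sq lborel f" using f by (intro strichartz_bessel) (auto simp: L12_def)
      also have "L2sq lborel f = ennreal (enn2real (Lpow s lborel f) powr (2 / s))"
        using f unfolding s2 Lpow_2 by (auto simp: L12_def less_top)
      finally show ?thesis by (simp add: ennreal_mult mult_left_mono)
    qed
    then show ?thesis unfolding m'_def by (intro exI[of _ "(b powr \<theta>)\<^sup>2"]) auto
  qed
qed

subsection \<open>The transform on square integrable functions\<close>

lemma enn_powr_2_half: "enn_powr (enn_powr x (1 / 2)) 2 = x"
proof (cases x)
  case (real r)
  then show ?thesis by (simp add: enn_powr_ennreal powr_powr del: powr_numeral)
next
  case top
  then show ?thesis by (simp add: enn_powr_def)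
qed

lemma L2sq_tendsto_0_iff: "(\<lambda>j. Lp_norm 2 M (F j)) \<longlonglongrightarrow> 0 \<longleftrightarrow> (\<lambda>j. L2sq M (F j)) \<longlonglongrightarrow> 0"
proof
  assume "(\<lambda>j. Lp_norm 2 M (F j)) \<longlonglongrightarrow> 0"
  then have "(\<lambda>j. enn_powr (Lp_norm 2 M (F j)) 2) \<longlonglongrightarrow> 0" by (rule tendsto_enn_powr_0[rotated]) simp
  then show "(\<lambda>j. L2sq M (F j)) \<longlonglongrightarrow> 0" unfolding Lp_norm_Lpow Lpow_2 enn_powr_2_half .
qed (rule Lp_norm_2_tendsto_0)

lemma L12_iff: "f \<in> L12 \<longleftrightarrow> f \<in> Lp 1 lborel \<inter> Lp 2 lborel"
  by (auto simp: L12_def Lp_1_iff Lp_2_iff)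

lemma strichartz_L2_iff:
  fixes g :: "'n::finite heis \<Rightarrow> complex"
  shows "strichartz_L2 g G \<longleftrightarrow>
    g \<in> borel_measurable borel \<and> L2sq lborel g < \<infinity> \<and>
    G \<in> borel_measurable (nu2 CARD('n) \<Otimes>\<^sub>M lborel) \<and> L2sq (nu2 CARD('n) \<Otimes>\<^sub>M lborel) G < \<infinity> \<and>
    (\<exists>F. (\<forall>j::nat. F j \<in> L12) \<and> (\<lambda>j. L2sq lborel (\<lambda>x. F j x - g x)) \<longlonglongrightarrow> 0 \<and>
      (\<lambda>j. L2sq (nu2 CARD('n) \<Otimes>\<^sub>M lborel) (\<lambda>y. strichartz (F j) y - G y)) \<longlonglongrightarrow> 0)"
  unfolding strichartz_L2_def L2sq_tendsto_0_iff L12_iff[symmetric] by (simp add: Lp_2_iff)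

lemma L2sq_le_of_limit:
  assumes m [measurable]: "\<And>j. F j \<in> borel_measurable M" "g \<in> borel_measurable M"
      "\<And>j. H j \<in> borel_measurable K" "G \<in> borel_measurable K"
    and eq: "\<And>j. L2sq M (F j) = L2sq K (H j)"
    and lim: "(\<lambda>j. L2sq M (\<lambda>x. F j x - g x)) \<longlonglongrightarrow> 0" "(\<lambda>j. L2sq K (\<lambda>y. H j y - G y)) \<longlonglongrightarrow> 0"
  shows "L2sq M g \<le> L2sq K G"
proof -
  define e where "e j = L2sq M (\<lambda>x. F j x - g x)" for j
  define e' where "e' j = L2sq K (\<lambda>y. H j y - G y)" for j
  have le: "L2sq M g \<le> ennreal (1 + d) * (ennreal (1 + d) * L2sq K G)" if d: "d > 0" for d :: real
  proof (rule LIMSEQ_le_const)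
    have "L2sq M g \<le> ennreal (1 + d) * (ennreal (1 + d) * L2sq K G + ennreal (1 + 1 / d) * e' j) + ennreal (1 + 1 / d) * e j" for j
    proof -
      have "L2sq M g = L2sq M (\<lambda>x. F j x + (g x - F j x))" by simp
      also have "\<dots> \<le> ennreal (1 + d) * L2sq M (F j) + ennreal (1 + 1 / d) * L2sq M (\<lambda>x. g x - F j x)"
        using d by (intro L2sq_add_le) auto
      also have "L2sq M (\<lambda>x. g x - F j x) = e j" unfolding e_def by (rule L2sq_minus_commute)
      also have "L2sq M (F j) = L2sq K (\<lambda>y. G y + (H j y - G y))" by (simp add: eq)
      also have "\<dots> \<le> ennreal (1 + d) * L2sq K G + ennreal (1 + 1 / d) * e' j"
        unfolding e'_def using d by (intro L2sq_add_le) auto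
      finally show ?thesis by (simp add: mult_left_mono add_right_mono)
    qed
    then show "\<exists>N. \<forall>j\<ge>N. L2sq M g \<le> ennreal (1 + d) * (ennreal (1 + d) * L2sq K G + ennreal (1 + 1 / d) * e' j) + ennreal (1 + 1 / d) * e j" by blast
    have "(\<lambda>j. ennreal (1 + d) * (ennreal (1 + d) * L2sq K G + ennreal (1 + 1 / d) * e' j) + ennreal (1 + 1 / d) * e j)
      \<longlonglongrightarrow> ennreal (1 + d) * (ennreal (1 + d) * L2sq K G + ennreal (1 + 1 / d) * 0) + ennreal (1 + 1 / d) * 0"
      using lim unfolding e_def[symmetric] e'_def[symmetric]
      by (intro tendsto_add ennreal_tendsto_cmult tendsto_const) auto
    then show "(\<lambda>j. ennreal (1 + d) * (ennreal (1 + d) * L2sq K G + ennreal (1 + 1 / d) * e' j) + ennreal (1 + 1 / d) * e j)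
      \<longlonglongrightarrow> ennreal (1 + d) * (ennreal (1 + d) * L2sq K G)" by simp
  qed
  show ?thesis
  proof (cases "L2sq K G")
    case (real y)
    have "L2sq M g \<le> ennreal ((1 + 1) * ((1 + 1) * y))" using le[of 1] real by (simp add: ennreal_mult)
    then obtain x where x: "L2sq M g = ennreal x" "x \<ge> 0" by (cases "L2sq M g") (auto simp: top_unique)
    have xy: "x \<le> (1 + d) * ((1 + d) * y)" if "d > 0" for d
      
    proof -
      have m: "ennreal (1 + d) * ennreal u = ennreal ((1 + d) * u)" if "u \<ge> 0" for u
        by (rule ennreal_mult[symmetric]) (use \<open>d > 0\<close> that in auto)
      have "ennreal (1 + d) * (ennreal (1 + d) * ennreal y) = ennreal ((1 + d) * ((1 + d) * y))"
        using that real(1) by (subst m, simp, subst m) auto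
      then have "ennreal x \<le> ennreal ((1 + d) * ((1 + d) * y))" using le[OF that] unfolding x(1) real(2) by (simp only:)
      then show ?thesis using that real(1) by (subst (asm) ennreal_le_iff) auto
    qed
    have "x \<le> (1 + 0) * ((1 + 0) * y)"
    proof (rule LIMSEQ_le_const)
      show "(\<lambda>j. (1 + 1 / (real j + 1)) * ((1 + 1 / (real j + 1)) * y)) \<longlonglongrightarrow> (1 + 0) * ((1 + 0) * y)"
        by (intro tendsto_mult tendsto_add tendsto_const inverse_real_add_tendsto_0)
      show "\<exists>N. \<forall>j\<ge>N. x \<le> (1 + 1 / (real j + 1)) * ((1 + 1 / (real j + 1)) * y)"
        by (intro exI allI impI xy) simp
    qed
    then show ?thesis unfolding x(1) real(2) by (simp add: ennreal_leI)
  qed simp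
qed

lemma strichartz_L2_norm:
  fixes g :: "'n::finite heis \<Rightarrow> complex"
  assumes "strichartz_L2 g G"
  shows "L2sq lborel g = L2sq (nu2 CARD('n) \<Otimes>\<^sub>M lborel) G"
proof -
  let ?K = "nu2 CARD('n) \<Otimes>\<^sub>M (lborel :: (complex ^ 'n) measure)"
  obtain F where F: "\<And>j::nat. F j \<in> L12" "(\<lambda>j. L2sq lborel (\<lambda>x. F j x - g x)) \<longlonglongrightarrow> 0"
      "(\<lambda>j. L2sq ?K (\<lambda>y. strichartz (F j) y - G y)) \<longlonglongrightarrow> 0"
    and [measurable]: "g \<in> borel_measurable borel" "G \<in> borel_measurable ?K"
    using assms unfolding strichartz_L2_iff by blast
  have [measurable]: "F j \<in> borel_measurable borel" "strichartz (F j) \<in> borel_measurable ?K" for j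
    using F(1) by (auto intro: L12_measurable L12_strichartz_measurable)
  have eq: "L2sq lborel (F j) = L2sq ?K (strichartz (F j))" for j
    using F(1)[of j] by (intro strichartz_plancherel[symmetric]) (auto simp: L12_def)
  show ?thesis
  proof (rule antisym)
    show "L2sq lborel g \<le> L2sq ?K G" by (rule L2sq_le_of_limit[OF _ _ _ _ eq F(2,3)]) auto
    show "L2sq ?K G \<le> L2sq lborel g" by (rule L2sq_le_of_limit[OF _ _ _ _ eq[symmetric] F(3,2)]) auto
  qed
qed

lemma L2sq_sum_tendsto_0:
  assumes m: "\<And>j. F j \<in> borel_measurable M" "\<And>j. F' j \<in> borel_measurable M"
    and lim: "(\<lambda>j. L2sq M (F j)) \<longlonglongrightarrow> 0" "(\<lambda>j. L2sq M (F' j)) \<longlonglongrightarrow> 0"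
  shows "(\<lambda>j. L2sq M (\<lambda>x. F j x + F' j x)) \<longlonglongrightarrow> 0"
proof (rule tendsto_sandwich[OF _ _ tendsto_const])
  show "eventually (\<lambda>j. L2sq M (\<lambda>x. F j x + F' j x) \<le> 2 * L2sq M (F j) + 2 * L2sq M (F' j)) sequentially"
    by (intro always_eventually allI L2sq_add_le2 m)
  have "(\<lambda>j. 2 * L2sq M (F j) + 2 * L2sq M (F' j)) \<longlonglongrightarrow> 2 * 0 + 2 * 0"
    using lim by (intro tendsto_add ennreal_tendsto_cmult) auto
  then show "(\<lambda>j. 2 * L2sq M (F j) + 2 * L2sq M (F' j)) \<longlonglongrightarrow> 0" by simp
qed simp

lemma strichartz_L2_add:
  fixes g g' :: "'n::finite heis \<Rightarrow> complex"
  assumes "strichartz_L2 g G" "strichartz_L2 g' G'"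
  shows "strichartz_L2 (\<lambda>x. g x + g' x) (\<lambda>y. G y + G' y)"
proof -
  let ?K = "nu2 CARD('n) \<Otimes>\<^sub>M (lborel :: (complex ^ 'n) measure)"
  obtain F F' where F: "\<And>j::nat. F j \<in> L12" "(\<lambda>j. L2sq lborel (\<lambda>x. F j x - g x)) \<longlonglongrightarrow> 0"
      "(\<lambda>j. L2sq ?K (\<lambda>y. strichartz (F j) y - G y)) \<longlonglongrightarrow> 0"
    and F': "\<And>j::nat. F' j \<in> L12" "(\<lambda>j. L2sq lborel (\<lambda>x. F' j x - g' x)) \<longlonglongrightarrow> 0"
      "(\<lambda>j. L2sq ?K (\<lambda>y. strichartz (F' j) y - G' y)) \<longlonglongrightarrow> 0"
    and [measurable]: "g \<in> borel_measurable borel" "G \<in> borel_measurable ?K" "g' \<in> borel_measurable borel" "G' \<in> borel_measurable ?K"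
    and fin: "L2sq lborel g < \<infinity>" "L2sq ?K G < \<infinity>" "L2sq lborel g' < \<infinity>" "L2sq ?K G' < \<infinity>"
    using assms unfolding strichartz_L2_iff by blast
  have [measurable]: "F j \<in> borel_measurable borel" "strichartz (F j) \<in> borel_measurable ?K"
      "F' j \<in> borel_measurable borel" "strichartz (F' j) \<in> borel_measurable ?K" for j
    using F(1) F'(1) by (auto intro: L12_measurable L12_strichartz_measurable)
  have sum: "strichartz (\<lambda>x. F j x + F' j x) y = strichartz (F j) y + strichartz (F' j) y" for j y
    using F(1)[of j] F'(1)[of j] by (intro strichartz_add) (auto simp: L12_def)
  show ?thesis unfolding strichartz_L2_iff
  proof (intro conjI exI[of _ "\<lambda>j x. F j x + F' j x"] allI)
    show "L2sq lborel (\<lambda>x. g x + g' x) < \<infinity>"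
      using L2sq_add_le2[of g lborel g'] fin by (auto intro: le_less_trans simp: ennreal_mult_less_top)
    show "L2sq ?K (\<lambda>x. G x + G' x) < \<infinity>"
      using L2sq_add_le2[of G ?K G'] fin by (auto intro: le_less_trans simp: ennreal_mult_less_top)
    show "(\<lambda>x. F j x + F' j x) \<in> L12" for j by (intro L12_add F F')
    show "(\<lambda>j. L2sq lborel (\<lambda>x. F j x + F' j x - (g x + g' x))) \<longlonglongrightarrow> 0"
      using L2sq_sum_tendsto_0[OF _ _ F(2) F'(2)] by (simp add: algebra_simps)
    show "(\<lambda>j. L2sq ?K (\<lambda>y. strichartz (\<lambda>x. F j x + F' j x) y - (G y + G' y))) \<longlonglongrightarrow> 0"
      unfolding sum using L2sq_sum_tendsto_0[OF _ _ F(3) F'(3)] by (simp add: algebra_simps)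
  qed auto
qed

lemma strichartz_L2_cmult:
  fixes g :: "'n::finite heis \<Rightarrow> complex"
  assumes "strichartz_L2 g G"
  shows "strichartz_L2 (\<lambda>x. c * g x) (\<lambda>y. c * G y)"
proof -
  let ?K = "nu2 CARD('n) \<Otimes>\<^sub>M (lborel :: (complex ^ 'n) measure)"
  obtain F where F: "\<And>j::nat. F j \<in> L12" "(\<lambda>j. L2sq lborel (\<lambda>x. F j x - g x)) \<longlonglongrightarrow> 0"
      "(\<lambda>j. L2sq ?K (\<lambda>y. strichartz (F j) y - G y)) \<longlonglongrightarrow> 0"
    and [measurable]: "g \<in> borel_measurable borel" "G \<in> borel_measurable ?K"
    and fin: "L2sq lborel g < \<infinity>" "L2sq ?K G < \<infinity>"
    using assms unfolding strichartz_L2_iff by blast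
  have [measurable]: "F j \<in> borel_measurable borel" "strichartz (F j) \<in> borel_measurable ?K" for j
    using F(1) by (auto intro: L12_measurable L12_strichartz_measurable)
  show ?thesis unfolding strichartz_L2_iff
  proof (intro conjI exI[of _ "\<lambda>j x. c * F j x"] allI)
    show "L2sq lborel (\<lambda>x. c * g x) < \<infinity>" "L2sq ?K (\<lambda>x. c * G x) < \<infinity>"
      using fin by (auto simp: L2sq_cmult ennreal_mult_less_top)
    show "(\<lambda>x. c * F j x) \<in> L12" for j by (intro L12_cmult F)
    have "(\<lambda>j. ennreal ((norm c)\<^sup>2) * L2sq lborel (\<lambda>x. F j x - g x)) \<longlonglongrightarrow> ennreal ((norm c)\<^sup>2) * 0"
      using F(2) by (intro ennreal_tendsto_cmult) auto
    then show "(\<lambda>j. L2sq lborel (\<lambda>x. c * F j x - c * g x)) \<longlonglongrightarrow> 0"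
      by (simp add: L2sq_cmult flip: right_diff_distrib)
    have "(\<lambda>j. ennreal ((norm c)\<^sup>2) * L2sq ?K (\<lambda>y. strichartz (F j) y - G y)) \<longlonglongrightarrow> ennreal ((norm c)\<^sup>2) * 0"
      using F(3) by (intro ennreal_tendsto_cmult) auto
    then show "(\<lambda>j. L2sq ?K (\<lambda>y. strichartz (\<lambda>x. c * F j x) y - c * G y)) \<longlonglongrightarrow> 0"
      by (simp add: L2sq_cmult strichartz_cmult flip: right_diff_distrib)
  qed auto
qed

lemma strichartz_L2_cong_AE:
  fixes g g' :: "'n::finite heis \<Rightarrow> complex"
  assumes g: "strichartz_L2 g G" and g' [measurable]: "g' \<in> borel_measurable borel" and ae: "AE x in lborel. g' x = g x"
  shows "strichartz_L2 g' G"
proof -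
  have "L2sq lborel (\<lambda>x. f x - g' x) = L2sq lborel (\<lambda>x. f x - g x)" for f
    unfolding L2sq_def by (rule nn_integral_cong_AE) (use ae in eventually_elim, simp)
  moreover have "L2sq lborel g' = L2sq lborel g"
    unfolding L2sq_def by (rule nn_integral_cong_AE) (use ae in eventually_elim, simp)
  ultimately show ?thesis using g g' unfolding strichartz_L2_iff by simp
qed

lemma strichartz_L2_L12:
  fixes h :: "'n::finite heis \<Rightarrow> complex"
  assumes "h \<in> L12"
  shows "strichartz_L2 h (strichartz h)"
  unfolding strichartz_L2_iff using assms
proof (intro conjI exI[of _ "\<lambda>_. h"])
  show "L2sq (nu2 CARD('n) \<Otimes>\<^sub>M lborel) (strichartz h) < \<infinity>" by (rule L12_strichartz_finite[OF assms])
qed (auto simp: L12_measurable L12_strichartz_measurable L2sq_def L12_def)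

lemma strichartz_range_L2:
  fixes G :: "(real \<times> real) \<times> (complex ^ 'n::finite) \<Rightarrow> complex"
  assumes "G \<in> strichartz_range"
  shows "\<exists>g. strichartz_L2 g G"
proof -
  let ?K = "nu2 CARD('n) \<Otimes>\<^sub>M (lborel :: (complex ^ 'n) measure)"
  have Gm [measurable]: "G \<in> borel_measurable ?K" by (rule strichartz_range_measurable[OF assms])
  have "\<exists>f. f \<in> L12 \<and> L2sq ?K (\<lambda>y. strichartz f y - G y) < ennreal (1 / (real j + 1))" for j :: nat
  proof -
    have "1 / (real j + 1) > 0" by simp
    then show ?thesis using assms unfolding strichartz_range_def by blast
  qed
  then obtain F where F: "\<And>j. F j \<in> L12" and FG: "\<And>j. L2sq ?K (\<lambda>y. strichartz (F j) y - G y) < ennreal (1 / (real j + 1))"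
    by metis
  have [measurable]: "F j \<in> borel_measurable borel" "strichartz (F j) \<in> borel_measurable ?K" for j
    using F by (auto intro: L12_measurable L12_strichartz_measurable)
  have lim: "(\<lambda>j. L2sq ?K (\<lambda>y. strichartz (F j) y - G y)) \<longlonglongrightarrow> 0"
  proof (rule tendsto_sandwich[OF _ _ tendsto_const])
    show "eventually (\<lambda>j. L2sq ?K (\<lambda>y. strichartz (F j) y - G y) \<le> ennreal (1 / (real j + 1))) sequentially"
      by (intro always_eventually allI less_imp_le FG)
    show "(\<lambda>j. ennreal (1 / (real j + 1))) \<longlonglongrightarrow> 0"
      using tendsto_ennrealI[OF inverse_real_add_tendsto_0[of 1]] by simp
  qed simp
  have dif: "L2sq lborel (\<lambda>x. F i x - F j x) \<le> 2 * L2sq ?K (\<lambda>y. strichartz (F i) y - G y) + 2 * L2sq ?K (\<lambda>y. strichartz (F j) y - G y)" for i j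
  proof -
    have "(\<lambda>x. F i x + (- 1) * F j x) \<in> L12" by (intro L12_add L12_cmult F)
    then have D: "(\<lambda>x. F i x - F j x) \<in> L12" by simp
    have "L2sq lborel (\<lambda>x. F i x - F j x) = L2sq ?K (strichartz (\<lambda>x. F i x - F j x))"
      using D by (intro strichartz_plancherel[symmetric]) (auto simp: L12_def)
    also have "strichartz (\<lambda>x. F i x - F j x) = (\<lambda>y. (strichartz (F i) y - G y) + (G y - strichartz (F j) y))"
      using F[of i] F[of j] by (intro ext) (simp add: strichartz_diff L12_def)
    also have "L2sq ?K \<dots> \<le> 2 * L2sq ?K (\<lambda>y. strichartz (F i) y - G y) + 2 * L2sq ?K (\<lambda>y. G y - strichartz (F j) y)"
      by (intro L2sq_add_le2) auto
    finally show ?thesis by (simp add: L2sq_minus_commute[of ?K G])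
  qed
  have cauchy: "\<exists>N. \<forall>i\<ge>N. \<forall>j\<ge>N. Lpow 2 lborel (\<lambda>x. F i x - F j x) < ennreal e" if e: "e > 0" for e
  proof -
    have "eventually (\<lambda>j. L2sq ?K (\<lambda>y. strichartz (F j) y - G y) < ennreal (e / 4)) sequentially"
      using e by (intro order_tendstoD(2)[OF lim]) simp
    then obtain N where N: "\<And>j. j \<ge> N \<Longrightarrow> L2sq ?K (\<lambda>y. strichartz (F j) y - G y) < ennreal (e / 4)"
      by (auto simp: eventually_sequentially)
    have "L2sq lborel (\<lambda>x. F i x - F j x) < ennreal e" if "i \<ge> N" "j \<ge> N" for i j
    proof -
      have "2 * L2sq ?K (\<lambda>y. strichartz (F i) y - G y) + 2 * L2sq ?K (\<lambda>y. strichartz (F j) y - G y) < 2 * ennreal (e / 4) + 2 * ennreal (e / 4)"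
        using N[OF that(1)] N[OF that(2)] by (intro add_strict_mono ennreal_mult_strict_left_mono) auto
      also have "\<dots> = ennreal e" using e by (simp flip: ennreal_plus ennreal_mult ennreal_numeral)
      finally show ?thesis using dif[of i j] by simp
    qed
    then show ?thesis unfolding Lpow_2 by blast
  qed
  obtain g where g [measurable]: "g \<in> borel_measurable lborel" and gl: "(\<lambda>j. Lpow 2 lborel (\<lambda>x. F j x - g x)) \<longlonglongrightarrow> 0"
  proof (rule Lp_complete[of F lborel 2])
    show "F j \<in> borel_measurable lborel" for j by simp
    show "\<exists>N. \<forall>i\<ge>N. \<forall>j\<ge>N. Lpow 2 lborel (\<lambda>x. F i x - F j x) < ennreal e" if "e > 0" for e by (rule cauchy[OF that])
  qed auto
  have gl2: "(\<lambda>j. L2sq lborel (\<lambda>x. F j x - g x)) \<longlonglongrightarrow> 0" using gl unfolding Lpow_2 .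
  have fin: "L2sq lborel g < \<infinity>"
  proof -
    obtain j where j: "L2sq lborel (\<lambda>x. F j x - g x) < 1"
      using eventually_happens'[OF _ order_tendstoD(2)[OF gl2, of 1]] by auto
    have "L2sq lborel g = L2sq lborel (\<lambda>x. F j x + (g x - F j x))" by simp
    also have "\<dots> \<le> 2 * L2sq lborel (F j) + 2 * L2sq lborel (\<lambda>x. g x - F j x)" by (intro L2sq_add_le2) auto
    also have "\<dots> < \<infinity>" using F[of j] j less_trans[OF j ennreal_one_less_top]
      by (auto simp: L12_def ennreal_mult_less_top L2sq_minus_commute[of lborel g])
    finally show ?thesis .
  qed
  have finG: "L2sq ?K G < \<infinity>"
  proof -
    have "L2sq ?K G = L2sq ?K (\<lambda>y. strichartz (F 0) y + (G y - strichartz (F 0) y))" by simp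
    also have "\<dots> \<le> 2 * L2sq ?K (strichartz (F 0)) + 2 * L2sq ?K (\<lambda>y. G y - strichartz (F 0) y)" by (intro L2sq_add_le2) auto
    also have "\<dots> < \<infinity>" using L12_strichartz_finite[OF F[of 0]] less_trans[OF FG[of 0] ennreal_less_top]
      by (auto simp: ennreal_mult_less_top L2sq_minus_commute[of ?K G])
    finally show ?thesis .
  qed
  show ?thesis unfolding strichartz_L2_iff using fin finG F gl2 lim Gm g by (intro exI[of _ g]) auto
qed

text \<open>Polarisation of the Plancherel identity for \<open>g + h\<close>.\<close>

lemma strichartz_pairing_le:
  fixes g h :: "'n::finite heis \<Rightarrow> complex"
  assumes g: "strichartz_L2 g G" and h: "h \<in> L12" and pos: "\<And>x. g x \<bullet> h x \<ge> 0"
  shows "(\<integral>\<^sup>+x. ennreal (g x \<bullet> h x) \<partial>lborel) \<le> (\<integral>\<^sup>+y. ennreal (norm (G y) * norm (strichartz h y)) \<partial>(nu2 CARD('n) \<Otimes>\<^sub>M lborel))"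
proof -
  let ?K = "nu2 CARD('n) \<Otimes>\<^sub>M (lborel :: (complex ^ 'n) measure)"
  let ?H = "strichartz h"
  have [measurable]: "g \<in> borel_measurable borel" "G \<in> borel_measurable ?K" and fin: "L2sq lborel g < \<infinity>"
    using g unfolding strichartz_L2_iff by auto
  have [measurable]: "h \<in> borel_measurable borel" "?H \<in> borel_measurable ?K"
    using h by (auto intro: L12_measurable L12_strichartz_measurable)
  have hfin: "L2sq lborel h < \<infinity>" using h by (simp add: L12_def)
  have hS: "L2sq ?K ?H = L2sq lborel h" using h by (intro strichartz_plancherel) (auto simp: L12_def)
  have gS: "L2sq ?K G = L2sq lborel g" by (rule strichartz_L2_norm[OF g, symmetric])
  let ?c = "L2sq lborel g + L2sq lborel h"
  have "?c + 2 * (\<integral>\<^sup>+x. ennreal (g x \<bullet> h x) \<partial>lborel) = (\<integral>\<^sup>+x. ennreal ((norm (g x))\<^sup>2) + ennreal ((norm (h x))\<^sup>2) + 2 * ennreal (g x \<bullet> h x) \<partial>lborel)"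
    by (simp add: nn_integral_add nn_integral_cmult L2sq_def)
  also have "\<dots> = L2sq lborel (\<lambda>x. g x + h x)"
    unfolding L2sq_def
  proof (intro nn_integral_cong)
    fix x
    have "(norm (g x + h x))\<^sup>2 = (norm (g x))\<^sup>2 + (norm (h x))\<^sup>2 + 2 * (g x \<bullet> h x)"
      by (simp add: power2_norm_eq_inner inner_add_left inner_add_right inner_commute)
    then show "ennreal ((norm (g x))\<^sup>2) + ennreal ((norm (h x))\<^sup>2) + 2 * ennreal (g x \<bullet> h x) = ennreal ((norm (g x + h x))\<^sup>2)"
      using pos[of x] by (simp add: ennreal_plus ennreal_mult')
  qed
  also have "\<dots> = L2sq ?K (\<lambda>y. G y + ?H y)"
    by (rule strichartz_L2_norm[OF strichartz_L2_add[OF g strichartz_L2_L12[OF h]]])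
  also have "\<dots> \<le> (\<integral>\<^sup>+y. ennreal ((norm (G y))\<^sup>2) + ennreal ((norm (?H y))\<^sup>2) + 2 * ennreal (norm (G y) * norm (?H y)) \<partial>?K)"
    unfolding L2sq_def
  proof (intro nn_integral_mono)
    fix y
    have "(norm (G y + ?H y))\<^sup>2 \<le> (norm (G y) + norm (?H y))\<^sup>2" by (intro power_mono norm_triangle_ineq) auto
    also have "\<dots> = (norm (G y))\<^sup>2 + (norm (?H y))\<^sup>2 + 2 * (norm (G y) * norm (?H y))" by (simp add: power2_sum)
    finally have "ennreal ((norm (G y + ?H y))\<^sup>2) \<le> ennreal \<dots>" by (rule ennreal_leI)
    then show "ennreal ((norm (G y + ?H y))\<^sup>2) \<le> ennreal ((norm (G y))\<^sup>2) + ennreal ((norm (?H y))\<^sup>2) + 2 * ennreal (norm (G y) * norm (?H y))"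
      by (simp add: ennreal_plus ennreal_mult')
  qed
  also have "\<dots> = ?c + 2 * (\<integral>\<^sup>+y. ennreal (norm (G y) * norm (?H y)) \<partial>?K)"
    using gS hS by (simp add: nn_integral_add nn_integral_cmult L2sq_def)
  finally have "2 * (\<integral>\<^sup>+x. ennreal (g x \<bullet> h x) \<partial>lborel) \<le> 2 * (\<integral>\<^sup>+y. ennreal (norm (G y) * norm (?H y)) \<partial>?K)"
    using fin hfin by (subst (asm) ennreal_add_left_cancel_le) auto
  then show ?thesis by (subst (asm) ennreal_mult_le_mult_iff) auto
qed

subsection \<open>Truncation and duality\<close>

definition trunc_set :: "('a \<Rightarrow> complex) \<Rightarrow> nat \<Rightarrow> 'a set" where
  "trunc_set f j = {x. 1 < (real j + 1) * norm (f x) \<and> norm (f x) < real j + 1}"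

lemma trunc_set_borel [measurable]:
  assumes [measurable]: "f \<in> borel_measurable borel"
  shows "trunc_set f j \<in> sets borel"
  unfolding trunc_set_def by measurable

lemma trunc_set_eventually:
  assumes "f x \<noteq> 0"
  shows "eventually (\<lambda>j. x \<in> trunc_set f j) sequentially"
proof -
  obtain N :: nat where N: "real N > max (norm (f x)) (1 / norm (f x))" using reals_Archimedean2 by blast
  have "x \<in> trunc_set f j" if "j \<ge> N" for j
  proof -
    have j: "real j \<ge> real N" using that by simp
    have "1 / norm (f x) < real j + 1" using j N by simp
    then have "1 < (real j + 1) * norm (f x)" using assms by (simp add: pos_divide_less_eq)
    moreover have "norm (f x) < real j + 1" using j N by simp
    ultimately show ?thesis by (simp add: trunc_set_def)
  qed
  then show ?thesis by (auto simp: eventually_sequentially)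
qed

lemma trunc_set_one_le:
  assumes "x \<in> trunc_set f j" "p > 0"
  shows "1 \<le> (real j + 1) powr p * norm (f x) powr p"
proof -
  have "1 \<le> ((real j + 1) * norm (f x)) powr p"
    using assms by (intro ge_one_powr_ge_zero) (auto simp: trunc_set_def)
  then show ?thesis by (simp add: powr_mult)
qed

lemma trunc_tendsto: "(\<lambda>j. indicator (trunc_set f j) x * f x) \<longlonglongrightarrow> f x"
proof (cases "f x = 0")
  case False
  have "eventually (\<lambda>j. indicator (trunc_set f j) x * f x = f x) sequentially"
    using trunc_set_eventually[of f x, OF False] by eventually_elim simp
  then show ?thesis by (rule tendsto_eventually)
qed simp

lemma L12_of_Lpow_bound:
  fixes h :: "'n::finite heis \<Rightarrow> complex"
  assumes [measurable]: "h \<in> borel_measurable borel" "f \<in> borel_measurable borel" and c: "c \<ge> 0"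
    and b: "\<And>x. norm (h x) \<le> c * norm (f x) powr p" "\<And>x. norm (h x) \<le> c" and fin: "Lpow p lborel f < \<infinity>"
  shows "h \<in> L12"
proof -
  have "(\<integral>\<^sup>+x. ennreal (norm (h x)) \<partial>lborel) \<le> (\<integral>\<^sup>+x. ennreal c * ennreal (norm (f x) powr p) \<partial>lborel)"
    by (intro nn_integral_mono) (use b c in \<open>simp add: ennreal_leI flip: ennreal_mult\<close>)
  also have "\<dots> = ennreal c * Lpow p lborel f" by (simp add: nn_integral_cmult Lpow_def)
  finally have 1: "(\<integral>\<^sup>+x. ennreal (norm (h x)) \<partial>lborel) < \<infinity>" using fin by (auto simp: ennreal_mult_less_top intro: le_less_trans)
  have "L2sq lborel h \<le> (\<integral>\<^sup>+x. ennreal c * ennreal (norm (h x)) \<partial>lborel)"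
    unfolding L2sq_def
  proof (intro nn_integral_mono)
    fix x
    have "(norm (h x))\<^sup>2 \<le> c * norm (h x)" unfolding power2_eq_square by (intro mult_right_mono b) simp
    then show "ennreal ((norm (h x))\<^sup>2) \<le> ennreal c * ennreal (norm (h x))"
      using c by (simp add: ennreal_leI flip: ennreal_mult)
  qed
  also have "\<dots> = ennreal c * (\<integral>\<^sup>+x. ennreal (norm (h x)) \<partial>lborel)" by (simp add: nn_integral_cmult)
  finally have "L2sq lborel h < \<infinity>" using 1 by (auto simp: ennreal_mult_less_top intro: le_less_trans)
  then show ?thesis using 1 by (auto simp: L12_def integrable_iff_bounded)
qed

lemma L12_dense:
  fixes f :: "'n::finite heis \<Rightarrow> complex"
  assumes f: "f \<in> Lp p lborel" and p: "p > 0" and e: "e > 0"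
  shows "\<exists>h\<in>L12. Lpow p lborel (\<lambda>x. f x - h x) < ennreal e"
proof -
  have [measurable]: "f \<in> borel_measurable borel" and fin: "Lpow p lborel f < \<infinity>" using f by (auto simp: Lp_iff[OF p])
  define h where "h j x = indicator (trunc_set f j) x * f x" for j x
  have hm [measurable]: "h j \<in> borel_measurable borel" for j unfolding h_def[abs_def] by measurable
  have L: "h j \<in> L12" for j
  proof (rule L12_of_Lpow_bound[OF hm _ _ _ _ fin])
    define c where "c = (real j + 1) * ((real j + 1) powr p + 1)"
    show "0 \<le> c" by (simp add: c_def)
    fix x
    show "norm (h j x) \<le> c"
    proof (cases "x \<in> trunc_set f j")
      case True
      then have "norm (h j x) \<le> (real j + 1) * 1" by (simp add: h_def trunc_set_def)
      also have "\<dots> \<le> c" unfolding c_def by (intro mult_left_mono) auto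
      finally show ?thesis .
    qed (simp add: h_def c_def)
    show "norm (h j x) \<le> c * norm (f x) powr p"
    proof (cases "x \<in> trunc_set f j")
      case True
      then have "norm (h j x) \<le> (real j + 1) * 1" by (simp add: h_def trunc_set_def)
      also have "\<dots> \<le> (real j + 1) * ((real j + 1) powr p * norm (f x) powr p)"
        by (intro mult_left_mono trunc_set_one_le True p) simp
      also have "\<dots> \<le> (real j + 1) * (((real j + 1) powr p + 1) * norm (f x) powr p)"
        by (intro mult_left_mono mult_right_mono) auto
      finally show ?thesis by (simp only: c_def mult.assoc)
    qed (simp add: h_def c_def)
  qed simp
  have "(\<lambda>j. \<integral>\<^sup>+x. ennreal (norm (f x - h j x) powr p) \<partial>lborel) \<longlonglongrightarrow> (\<integral>\<^sup>+x. 0 \<partial>(lborel :: 'n heis measure))"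
  proof (rule nn_integral_dominated_convergence[where w = "\<lambda>x. ennreal (norm (f x) powr p)"])
    show "AE x in lborel. ennreal (norm (f x - h j x) powr p) \<le> ennreal (norm (f x) powr p)" for j
      using p by (intro AE_I2) (auto simp: h_def indicator_def)
    show "(\<integral>\<^sup>+x. ennreal (norm (f x) powr p) \<partial>lborel) < \<infinity>" using fin by (simp add: Lpow_def)
    show "AE x in lborel. (\<lambda>j. ennreal (norm (f x - h j x) powr p)) \<longlonglongrightarrow> 0"
    proof (intro AE_I2 tendsto_eventually)
      fix x
      show "eventually (\<lambda>j. ennreal (norm (f x - h j x) powr p) = 0) sequentially"
      proof (cases "f x = 0")
        case False
        show ?thesis using trunc_set_eventually[of f x, OF False] by eventually_elim (simp add: h_def)
      qed (simp add: h_def)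
    qed
  qed auto
  then have "(\<lambda>j. Lpow p lborel (\<lambda>x. f x - h j x)) \<longlonglongrightarrow> 0" by (simp add: Lpow_def)
  then have "eventually (\<lambda>j. Lpow p lborel (\<lambda>x. f x - h j x) < ennreal e) sequentially"
    using e by (intro order_tendstoD(2)) auto
  then obtain j where "Lpow p lborel (\<lambda>x. f x - h j x) < ennreal e"
    using eventually_happens'[of sequentially] by auto
  then show ?thesis using L by blast
qed

lemma Lpow_duality:
  fixes g :: "'n::finite heis \<Rightarrow> complex"
  assumes gm [measurable]: "g \<in> borel_measurable borel" and fin: "L2sq lborel g < \<infinity>" and q: "q \<ge> 2" and D: "D \<ge> 0"
    and dual: "\<And>h. h \<in> L12 \<Longrightarrow> (\<And>x. g x \<bullet> h x \<ge> 0) \<Longrightarrow>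
      (\<integral>\<^sup>+x. ennreal (g x \<bullet> h x) \<partial>lborel)\<^sup>2 \<le> ennreal (D * enn2real (Lpow (q / (q - 1)) lborel h) powr (2 / (q / (q - 1))))"
  shows "Lpow q lborel g \<le> ennreal (D powr (q / 2))"
proof -
  have bound: "Lpow q lborel (\<lambda>x. indicator (trunc_set g j) x * g x) \<le> ennreal (D powr (q / 2))" for j
  proof -
    let ?S = "trunc_set g j"
    define h where "h x = of_real (indicator ?S x * norm (g x) powr (q - 2)) * g x" for x
    have hm [measurable]: "h \<in> borel_measurable borel" unfolding h_def[abs_def] by measurable
    have nh: "norm (h x) = indicator ?S x * norm (g x) powr (q - 1)" for x
    proof (cases "g x = 0")
      case False
      then have "norm (g x) powr (q - 2) * norm (g x) = norm (g x) powr (q - 1)"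
        using powr_add[of "norm (g x)" "q - 2" 1] by simp
      then show ?thesis by (simp add: h_def norm_mult indicator_def)
    qed (simp add: h_def)
    have gh: "g x \<bullet> h x = indicator ?S x * norm (g x) powr q" for x
    proof -
      have "g x \<bullet> h x = indicator ?S x * norm (g x) powr (q - 2) * (norm (g x))\<^sup>2"
        unfolding h_def scaleR_conv_of_real[symmetric] by (simp add: power2_norm_eq_inner)
      also have "norm (g x) powr (q - 2) * (norm (g x))\<^sup>2 = norm (g x) powr q" if "g x \<noteq> 0"
        using that powr_add[of "norm (g x)" "q - 2" 2] by (simp add: powr_numeral)
      then have "indicator ?S x * norm (g x) powr (q - 2) * (norm (g x))\<^sup>2 = indicator ?S x * norm (g x) powr q"
        by (cases "g x = 0") (simp_all add: indicator_def)
      finally show ?thesis .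
    qed
    define c where "c = (real j + 1) powr (q - 1) * ((real j + 1) powr 2 + 1)"
    have hL: "h \<in> L12"
    proof (rule L12_of_Lpow_bound[OF hm gm, where c = c and p = 2])
      show "0 \<le> c" by (simp add: c_def)
      show "Lpow 2 lborel g < \<infinity>" using fin by (simp add: Lpow_2)
      fix x
      have le: "norm (h x) \<le> (real j + 1) powr (q - 1) * 1" if "x \<in> ?S"
        using that q by (auto simp: nh trunc_set_def intro!: powr_mono2)
      show "norm (h x) \<le> c"
      proof (cases "x \<in> ?S")
        case True
        have "(real j + 1) powr (q - 1) * 1 \<le> c" unfolding c_def by (intro mult_left_mono) auto
        with le[OF True] show ?thesis by (rule order_trans)
      qed (simp add: nh c_def)
      show "norm (h x) \<le> c * norm (g x) powr 2"
      proof (cases "x \<in> ?S")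
        case True
        have "(real j + 1) powr (q - 1) * 1 \<le> (real j + 1) powr (q - 1) * ((real j + 1) powr 2 * norm (g x) powr 2)"
          by (intro mult_left_mono trunc_set_one_le True) auto
        also have "\<dots> \<le> (real j + 1) powr (q - 1) * (((real j + 1) powr 2 + 1) * norm (g x) powr 2)"
          by (intro mult_left_mono mult_right_mono) auto
        also have "\<dots> = c * norm (g x) powr 2" by (simp only: c_def mult.assoc)
        finally show ?thesis using le[OF True] by (rule order_trans[rotated])
      qed (simp add: nh c_def)
    qed
    define Z where "Z = Lpow q lborel (\<lambda>x. indicator ?S x * g x)"
    have Z_gh: "(\<integral>\<^sup>+x. ennreal (g x \<bullet> h x) \<partial>lborel) = Z"
      unfolding Z_def Lpow_def using q by (intro nn_integral_cong) (auto simp: gh indicator_def)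
    have Z_h: "Lpow (q / (q - 1)) lborel h = Z"
      unfolding Z_def Lpow_def using q by (intro nn_integral_cong) (auto simp: nh indicator_def powr_powr)
    have "Lpow (q / (q - 1)) lborel h < \<infinity>"
      using q by (intro L12_Lpow_finite hL) (auto simp: field_simps)
    then obtain z where z: "Z = ennreal z" "z \<ge> 0" unfolding Z_h by (cases Z) auto
    have "(\<integral>\<^sup>+x. ennreal (g x \<bullet> h x) \<partial>lborel)\<^sup>2 \<le> ennreal (D * enn2real (Lpow (q / (q - 1)) lborel h) powr (2 / (q / (q - 1))))"
      by (rule dual[OF hL]) (simp add: gh)
    then have "ennreal (z\<^sup>2) \<le> ennreal (D * z powr (2 / (q / (q - 1))))"
      unfolding Z_gh Z_h z(1) using z(2) by (simp add: ennreal_power)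
    then have le: "z\<^sup>2 \<le> D * z powr (2 / (q / (q - 1)))" using D z(2) by (subst (asm) ennreal_le_iff) auto
    have "z \<le> D powr (q / 2)"
    proof (cases "z = 0")
      case False
      then have z0: "z > 0" using z by simp
      have ex: "2 / (q / (q - 1)) = 2 - 2 / q" using q by (simp add: field_simps)
      have "z\<^sup>2 = z powr (2 / q) * z powr (2 / (q / (q - 1)))"
        unfolding ex using z0 by (simp add: powr_numeral flip: powr_add)
      then have "z powr (2 / q) * z powr (2 / (q / (q - 1))) \<le> D * z powr (2 / (q / (q - 1)))" using le by simp
      then have "z powr (2 / q) \<le> D" using z0 by (subst (asm) mult_le_cancel_right_pos) auto
      then have "(z powr (2 / q)) powr (q / 2) \<le> D powr (q / 2)" using q by (intro powr_mono2) auto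
      then show ?thesis using q z0 by (simp add: powr_powr)
    qed simp
    then show ?thesis unfolding Z_def[symmetric] z(1) by (rule ennreal_leI)
  qed
  have "Lpow q lborel (\<lambda>x. 0 - g x) \<le> ennreal (D powr (q / 2))"
  proof (rule Lpow_liminf_le[where F = "\<lambda>j x. indicator (trunc_set g j) x * g x"])
    show "AE x in lborel. (\<lambda>j. indicator (trunc_set g j) x * g x) \<longlonglongrightarrow> g x"
      by (intro AE_I2 trunc_tendsto)
    show "eventually (\<lambda>j. Lpow q lborel (\<lambda>x. 0 - indicator (trunc_set g j) x * g x) \<le> ennreal (D powr (q / 2))) sequentially"
      using bound by (intro always_eventually allI) (simp add: Lpow_def)
  qed (use q in auto)
  then show ?thesis by (simp add: Lpow_def)
qed

subsection \<open>Schwartz functions\<close>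

lemma nn_integral_inverse_1_plus_square: "(\<integral>\<^sup>+x. ennreal (inverse (1 + x\<^sup>2)) \<partial>(lborel :: real measure)) < \<infinity>"
proof -
  have "integrable lborel (\<lambda>x::real. inverse (1 + x\<^sup>2))"
    using integrable_inverse_1_plus_square by (simp add: set_integrable_def einterval_def)
  then show ?thesis by (simp add: integrable_iff_bounded)
qed

lemma schwartz_L12:
  fixes f :: "'n::finite heis \<Rightarrow> complex"
  assumes f: "f \<in> schwartz"
  shows "f \<in> L12"
proof -
  let ?d = "DIM('n heis)"
  have S: "\<And>x. f differentiable (at x)" "\<And>N. bounded (range (\<lambda>x. norm x ^ N *\<^sub>R f x))"
    using f unfolding schwartz_def by (force dest: spec[of _ "[]"])+
  have "continuous_on UNIV f"
    using S(1) by (intro continuous_at_imp_continuous_on ballI differentiable_imp_continuous_within) auto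
  then have fm [measurable]: "f \<in> borel_measurable borel" by (rule borel_measurable_continuous_onI)
  obtain a where a: "\<And>x. norm (f x) \<le> a" using S(2)[of 0] by (auto simp: bounded_iff)
  have a0: "a \<ge> 0" using order_trans[OF norm_ge_zero a] .
  obtain b where b: "\<And>x. norm x ^ (2 * ?d) * norm (f x) \<le> b" using S(2)[of "2 * ?d"] by (auto simp: bounded_iff)
  define c where "c = 2 ^ ?d * (a + b)"
  define w :: "'n heis \<Rightarrow> real" where "w x = (\<Prod>i\<in>Basis. inverse (1 + (x \<bullet> i)\<^sup>2))" for x
  have wpos: "w x \<ge> 0" for x unfolding w_def by (intro prod_nonneg) simp
  have [measurable]: "w \<in> borel_measurable borel" unfolding w_def[abs_def] by measurable
  have "(\<integral>\<^sup>+x. ennreal (w x) \<partial>lborel) = (\<integral>\<^sup>+x. (\<Prod>i\<in>Basis. ennreal (inverse (1 + (x \<bullet> i)\<^sup>2))) \<partial>(lborel :: 'n heis measure))"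
    unfolding w_def by (intro nn_integral_cong prod_ennreal[symmetric]) simp
  also have "\<dots> = (\<Prod>i\<in>(Basis :: 'n heis set). \<integral>\<^sup>+x. ennreal (inverse (1 + x\<^sup>2)) \<partial>(lborel :: real measure))"
    by (rule nn_integral_lborel_prod) auto
  also have "\<dots> < \<infinity>" unfolding prod_constant using nn_integral_inverse_1_plus_square by (simp only: power_less_top_ennreal infinity_ennreal_def simp_thms)
  finally have wI: "(\<integral>\<^sup>+x. ennreal (w x) \<partial>lborel) < \<infinity>" .
  have fw: "norm (f x) \<le> c * w x" for x
  proof -
    define u where "u = (norm x)\<^sup>2"
    have u: "u \<ge> 0" by (simp add: u_def)
    have "(\<Prod>i\<in>Basis. 1 + (x \<bullet> i)\<^sup>2) \<le> (\<Prod>i\<in>(Basis :: 'n heis set). 1 + u)"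
    proof (intro prod_mono conjI)
      fix i :: "'n heis" assume i: "i \<in> Basis"
      have "\<bar>x \<bullet> i\<bar> \<le> norm x" by (rule Basis_le_norm[OF i])
      then show "1 + (x \<bullet> i)\<^sup>2 \<le> 1 + u" using power_mono[of "\<bar>x \<bullet> i\<bar>" "norm x" 2] by (simp add: u_def)
    qed simp
    also have "\<dots> = (1 + u) ^ ?d" by simp
    also have "\<dots> \<le> (2 * max 1 u) ^ ?d" using u by (intro power_mono) auto
    also have "\<dots> = 2 ^ ?d * (max 1 u) ^ ?d" by (simp add: power_mult_distrib)
    also have "\<dots> \<le> 2 ^ ?d * (1 + u ^ ?d)"
      using u by (intro mult_left_mono) (auto simp: max_def)
    finally have P: "(\<Prod>i\<in>Basis. 1 + (x \<bullet> i)\<^sup>2) \<le> 2 ^ ?d * (1 + u ^ ?d)" .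
    have "norm (f x) * (\<Prod>i\<in>Basis. 1 + (x \<bullet> i)\<^sup>2) \<le> norm (f x) * (2 ^ ?d * (1 + u ^ ?d))"
      by (intro mult_left_mono P) simp
    also have "\<dots> = 2 ^ ?d * (norm (f x) + norm x ^ (2 * ?d) * norm (f x))"
      unfolding u_def power_mult by (simp only: distrib_left distrib_right mult_ac mult_1_right mult_1_left)
    also have "\<dots> \<le> c" unfolding c_def by (intro mult_left_mono add_mono a b) simp
    finally have le: "norm (f x) * (\<Prod>i\<in>Basis. 1 + (x \<bullet> i)\<^sup>2) \<le> c" .
    have pos: "(\<Prod>i\<in>Basis. 1 + (x \<bullet> i)\<^sup>2) > 0" by (intro prod_pos) (simp add: add_pos_nonneg)
    have "w x = inverse (\<Prod>i\<in>Basis. 1 + (x \<bullet> i)\<^sup>2)" unfolding w_def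
      using prod_inversef[of "\<lambda>i. 1 + (x \<bullet> i)\<^sup>2" Basis] by (simp add: o_def)
    then show ?thesis using le pos by (simp add: field_simps)
  qed
  have "integrable lborel (\<lambda>x. c * w x)"
    using wI wpos by (intro integrable_mult_right) (simp add: integrable_iff_bounded)
  then have I: "integrable lborel f"
    by (rule Bochner_Integration.integrable_bound) (use fw order_trans[OF fw abs_ge_self] in auto)
  have "L2sq lborel f \<le> (\<integral>\<^sup>+x. ennreal a * ennreal (norm (f x)) \<partial>lborel)"
    unfolding L2sq_def
  proof (intro nn_integral_mono)
    fix x
    have "(norm (f x))\<^sup>2 \<le> a * norm (f x)" unfolding power2_eq_square by (intro mult_right_mono a) simp
    then show "ennreal ((norm (f x))\<^sup>2) \<le> ennreal a * ennreal (norm (f x))"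
      using a0 by (simp add: ennreal_leI flip: ennreal_mult)
  qed
  also have "\<dots> = ennreal a * (\<integral>\<^sup>+x. ennreal (norm (f x)) \<partial>lborel)" by (simp add: nn_integral_cmult)
  also have "\<dots> < \<infinity>" using I by (simp add: integrable_iff_bounded ennreal_mult_less_top)
  finally show ?thesis using I by (simp add: L12_def)
qed

subsection \<open>The multiplier theorem\<close>

lemma weak_tail:
  assumes t: "t > 0" and \<alpha>: "\<alpha> > 0" and S: "S \<ge> 0" and le: "ennreal \<alpha> * enn_powr E t \<le> ennreal S"
  shows "E \<le> ennreal (S powr (1 / t) * \<alpha> powr (- (1 / t)))"
proof (cases E)
  case (real x)
  have "ennreal (\<alpha> * x powr t) \<le> ennreal S"
    using le real \<alpha> by (simp add: enn_powr_ennreal ennreal_mult)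
  then have "x powr t \<le> S / \<alpha>" using S \<alpha> by (simp add: ennreal_le_iff field_simps)
  then have "(x powr t) powr (1 / t) \<le> (S / \<alpha>) powr (1 / t)" using t by (intro powr_mono2) auto
  then have "x \<le> (S / \<alpha>) powr (1 / t)" using t real by (simp add: powr_powr)
  also have "\<dots> = S powr (1 / t) * \<alpha> powr (- (1 / t))"
    using S \<alpha> by (simp add: powr_divide powr_minus_divide)
  finally show ?thesis unfolding real(2) by (rule ennreal_leI)
next
  case top
  then show ?thesis using le t \<alpha> by (simp add: enn_powr_def ennreal_mult_top top_unique)
qed

theorem fan_multiplier_Lp_Lq:
  fixes m :: "real \<times> real \<Rightarrow> complex"
  assumes p: "1 < p" "p \<le> 2" and q: "2 \<le> q"
    and bd: "bounded (m ` fan CARD('n::finite))"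
    and m: "m \<in> borel_measurable (nu2 CARD('n))"
    and weak: "(SUP \<alpha>\<in>{0::real<..}. ennreal \<alpha> *
           enn_powr (emeasure (mu CARD('n)) {a \<in> fan CARD('n). norm (m a) > \<alpha>}) (1 / p - 1 / q)) < \<infinity>"
  shows "\<exists>C\<ge>0. \<forall>(f :: 'n heis \<Rightarrow> complex) g. f \<in> L12 \<longrightarrow> strichartz_L2 g (\<lambda>y. m (fst y) * strichartz f y) \<longrightarrow>
    Lpow q lborel g \<le> ennreal (C powr q * enn2real (Lpow p lborel f) powr (q / p))"
proof -
  let ?K = "nu2 CARD('n) \<Otimes>\<^sub>M (lborel :: (complex ^ 'n) measure)"
  define t where "t = 1 / p - 1 / q"
  define \<theta> where "\<theta> = (1 / p - 1 / 2) / t"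
  define q' where "q' = q / (q - 1)"
  have ip: "1 / p \<ge> 1 / 2" "p < 2 \<Longrightarrow> 1 / p > 1 / 2" using p by (auto simp: field_simps)
  have iq: "1 / q \<le> 1 / 2" "q > 2 \<Longrightarrow> 1 / q < 1 / 2" using q by (auto simp: field_simps)
  have iq': "1 / q' = 1 - 1 / q" using q by (simp add: q'_def field_simps)
  have q': "1 < q'" "q' \<le> 2" "q' < 2 \<Longrightarrow> q > 2" using q by (auto simp: q'_def field_simps)
  have \<theta>t: "\<theta> * t = 1 / p - 1 / 2" if "t > 0" using that by (simp add: \<theta>_def)
  have \<theta>: "0 \<le> \<theta>" "\<theta> \<le> 1"
  proof -
    have "0 \<le> 1 / p - 1 / 2" "1 / p - 1 / 2 \<le> t" "0 \<le> t" using ip(1) iq(1) by (auto simp: t_def)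
    then show "0 \<le> \<theta>" "\<theta> \<le> 1" by (auto simp: \<theta>_def divide_le_eq_1)
  qed
  define S where "S = enn2real (SUP \<alpha>\<in>{0::real<..}. ennreal \<alpha> *
           enn_powr (emeasure (mu CARD('n)) {a \<in> fan CARD('n). norm (m a) > \<alpha>}) t)"
  have S: "S \<ge> 0" "(SUP \<alpha>\<in>{0::real<..}. ennreal \<alpha> *
           enn_powr (emeasure (mu CARD('n)) {a \<in> fan CARD('n). norm (m a) > \<alpha>}) t) = ennreal S"
    using weak unfolding S_def t_def[symmetric] by (simp_all add: less_top)
  have tail: "emeasure (mu CARD('n)) {a \<in> fan CARD('n). norm (m a) > \<alpha>} \<le> ennreal (S powr (1 / t) * \<alpha> powr (- (1 / t)))"
    if "t > 0" "\<alpha> > 0" for \<alpha>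
  proof (rule weak_tail[OF that S(1)])
    show "ennreal \<alpha> * enn_powr (emeasure (mu CARD('n)) {a \<in> fan CARD('n). norm (m a) > \<alpha>}) t \<le> ennreal S"
      unfolding S(2)[symmetric] by (rule SUP_upper) (simp add: that)
  qed
  obtain C1 where C1: "C1 \<ge> 0" "\<And>f :: 'n heis \<Rightarrow> complex. f \<in> L12 \<Longrightarrow>
    L2sq ?K (\<lambda>y. of_real (norm (m (fst y)) powr \<theta>) * strichartz f y) \<le> ennreal (C1 * enn2real (Lpow p lborel f) powr (2 / p))"
  proof -
    have "p < 2 \<Longrightarrow> t > 0 \<and> \<theta> * t = 1 / p - 1 / 2" using ip iq \<theta>t by (auto simp: t_def)
    from weak_power_bound[OF p \<theta>(1) powr_ge_zero m bd this tail] that show thesis by blast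
  qed
  obtain C2 where C2: "C2 \<ge> 0" "\<And>f :: 'n heis \<Rightarrow> complex. f \<in> L12 \<Longrightarrow>
    L2sq ?K (\<lambda>y. of_real (norm (m (fst y)) powr (1 - \<theta>)) * strichartz f y) \<le> ennreal (C2 * enn2real (Lpow q' lborel f) powr (2 / q'))"
  proof -
    have "t > 0 \<and> (1 - \<theta>) * t = 1 / q' - 1 / 2" if "q' < 2"
    proof -
      have t: "t > 0" using ip(1) iq(2)[OF q'(3)[OF that]] unfolding t_def by linarith
      have "(1 - \<theta>) * t = t - (1 / p - 1 / 2)" using \<theta>t[OF t] by (simp add: algebra_simps)
      then show ?thesis using t iq' by (simp add: t_def)
    qed
    moreover have "1 - \<theta> \<ge> 0" using \<theta> by simp
    ultimately show thesis using weak_power_bound[OF q'(1,2) _ powr_ge_zero m bd _ tail] that by blast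
  qed
  define C where "C = (C1 * C2) powr (1 / 2)"
  have "Lpow q lborel g \<le> ennreal (C powr q * enn2real (Lpow p lborel f) powr (q / p))"
    if f: "f \<in> L12" and g: "strichartz_L2 g (\<lambda>y. m (fst y) * strichartz f y)" for f g :: "'n heis \<Rightarrow> complex"
  proof -
    define X where "X = enn2real (Lpow p lborel f)"
    define D where "D = C1 * C2 * X powr (2 / p)"
    have D: "D \<ge> 0" using C1 C2 by (simp add: D_def)
    have gm: "g \<in> borel_measurable borel" "L2sq lborel g < \<infinity>" using g unfolding strichartz_L2_iff by auto
    have [measurable]: "strichartz f \<in> borel_measurable ?K" "(\<lambda>y. m (fst y)) \<in> borel_measurable ?K"
      by (intro L12_strichartz_measurable f, intro measurable_fst_mult m)
    have "Lpow q lborel g \<le> ennreal (D powr (q / 2))"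
    proof (rule Lpow_duality[OF gm q D], fold q'_def)
      fix h :: "'n heis \<Rightarrow> complex" assume h: "h \<in> L12" and pos: "\<And>x. g x \<bullet> h x \<ge> 0"
      have [measurable]: "strichartz h \<in> borel_measurable ?K" by (intro L12_strichartz_measurable h)
      let ?u = "\<lambda>y. ennreal (norm (of_real (norm (m (fst y)) powr \<theta>) * strichartz f y))"
      let ?v = "\<lambda>y. ennreal (norm (of_real (norm (m (fst y)) powr (1 - \<theta>)) * strichartz h y))"
      have "(\<integral>\<^sup>+x. ennreal (g x \<bullet> h x) \<partial>lborel) \<le> (\<integral>\<^sup>+y. ennreal (norm (m (fst y) * strichartz f y) * norm (strichartz h y)) \<partial>?K)"
        by (rule strichartz_pairing_le[OF g h pos])
      also have "\<dots> = (\<integral>\<^sup>+y. ?u y * ?v y \<partial>?K)"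
      proof (intro nn_integral_cong)
        fix y :: "(real \<times> real) \<times> (complex ^ 'n)"
        have "norm (m (fst y)) = norm (m (fst y)) powr \<theta> * norm (m (fst y)) powr (1 - \<theta>)"
          by (simp flip: powr_add)
        then have "norm (m (fst y) * strichartz f y) * norm (strichartz h y)
           = (norm (m (fst y)) powr \<theta> * norm (strichartz f y)) * (norm (m (fst y)) powr (1 - \<theta>) * norm (strichartz h y))"
          unfolding norm_mult by (metis mult.assoc mult.left_commute)
        then show "ennreal (norm (m (fst y) * strichartz f y) * norm (strichartz h y)) = ?u y * ?v y"
          by (simp add: norm_mult flip: ennreal_mult)
      qed
      finally have "(\<integral>\<^sup>+x. ennreal (g x \<bullet> h x) \<partial>lborel)\<^sup>2 \<le> (\<integral>\<^sup>+y. ?u y * ?v y \<partial>?K)\<^sup>2"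
        by (intro power_mono) auto
      also have "\<dots> \<le> (\<integral>\<^sup>+y. (?u y)\<^sup>2 \<partial>?K) * (\<integral>\<^sup>+y. (?v y)\<^sup>2 \<partial>?K)"
        by (rule Cauchy_Schwarz_nn_integral) measurable
      also have "\<dots> = L2sq ?K (\<lambda>y. of_real (norm (m (fst y)) powr \<theta>) * strichartz f y) * L2sq ?K (\<lambda>y. of_real (norm (m (fst y)) powr (1 - \<theta>)) * strichartz h y)"
        unfolding L2sq_def by (simp add: ennreal_power)
      also have "\<dots> \<le> ennreal (C1 * X powr (2 / p)) * ennreal (C2 * enn2real (Lpow q' lborel h) powr (2 / q'))"
        unfolding X_def by (intro mult_mono C1 C2 f h) auto
      also have "\<dots> = ennreal (D * enn2real (Lpow q' lborel h) powr (2 / q'))"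
        using C1(1) C2(1) by (simp add: D_def mult_ac flip: ennreal_mult)
      finally show "(\<integral>\<^sup>+x. ennreal (g x \<bullet> h x) \<partial>lborel)\<^sup>2 \<le> ennreal (D * enn2real (Lpow q' lborel h) powr (2 / q'))" .
    qed
    also have "D powr (q / 2) = C powr q * X powr (q / p)"
      using C1(1) C2(1) by (simp add: D_def C_def powr_mult powr_powr)
    finally show ?thesis unfolding X_def .
  qed
  moreover have "C \<ge> 0" by (simp add: C_def)
  ultimately show ?thesis by blast
qed

theorem theorem3p5:
  fixes p q :: real and m :: "real \<times> real \<Rightarrow> complex"
  assumes "1 < p" "p \<le> 2" "2 \<le> q"
    and "bounded (m ` fan CARD('n::finite))"
    and "m \<in> borel_measurable (restrict_space borel (fan CARD('n)))"
    and "(SUP \<alpha>\<in>{0::real<..}. ennreal \<alpha> *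
           enn_powr (emeasure (mu CARD('n)) {a \<in> fan CARD('n). norm (m a) > \<alpha>}) (1 / p - 1 / q))
         < \<infinity>"
  shows "\<exists>T :: ('n heis \<Rightarrow> complex) \<Rightarrow> ('n heis \<Rightarrow> complex).
           bounded_Lp_operator p lborel q lborel T \<and>
           (\<forall>f\<in>schwartz. is_multiplier_image m f (T f))"
proof -
  have p0: "p > 0" and q0: "q > 0" using assms by auto
  have m: "m \<in> borel_measurable (nu2 CARD('n))" using assms(5) by simp
  define R where "R f g \<longleftrightarrow> f \<in> L12 \<and> strichartz_L2 g (\<lambda>y. m (fst y) * strichartz f y)" for f g :: "'n heis \<Rightarrow> complex"
  obtain C where C: "C \<ge> 0" and bound: "\<And>f g. R f g \<Longrightarrow> Lpow q lborel g \<le> ennreal (C powr q * enn2real (Lpow p lborel f) powr (q / p))"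
    using fan_multiplier_Lp_Lq[OF assms(1-4) m assms(6)] unfolding R_def by blast
  have fm: "m \<in> fan_mult TYPE('n)" by (rule bounded_measurable_fan_mult[OF m assms(4)])
  have Rex: "\<exists>g. R f g" if "f \<in> L12" for f
    using strichartz_range_L2[of "\<lambda>y. m (fst y) * strichartz f y"] fm that unfolding R_def fan_mult_def by blast
  have "\<exists>T. bounded_Lp_operator p lborel q lborel T \<and> (\<forall>f g. R f g \<longrightarrow> (AE x in lborel. T f x = g x))"
  proof (rule bounded_extension[OF p0 q0 _ _ _ Rex _ _ C bound])
    show "(L12 :: ('n heis \<Rightarrow> complex) set) \<subseteq> Lp p lborel"
      using assms by (auto simp: Lp_iff[OF p0] L12_measurable intro!: L12_Lpow_finite[simplified])
    show "\<exists>h\<in>L12. Lpow p lborel (\<lambda>x. f x - h x) < ennreal e" if "f \<in> Lp p lborel" "e > 0" for f :: "'n heis \<Rightarrow> complex" and e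
      by (rule L12_dense[OF that(1) p0 that(2)])
    show "f \<in> L12 \<and> g \<in> borel_measurable lborel" if "R f g" for f g
      using that unfolding R_def strichartz_L2_iff by simp
    show "R (\<lambda>x. f x + f' x) (\<lambda>x. g x + g' x)" if "R f g" "R f' g'" for f g f' g'
    proof -
      have "strichartz (\<lambda>x. f x + f' x) y = strichartz f y + strichartz f' y" for y
        using that unfolding R_def by (intro strichartz_add) (auto simp: L12_def)
      moreover have "(\<lambda>x. f x + f' x) \<in> L12" using that unfolding R_def by (intro L12_add) auto
      ultimately show ?thesis using that strichartz_L2_add[of g _ g'] unfolding R_def by (simp add: distrib_left)
    qed
    show "R (\<lambda>x. c * f x) (\<lambda>x. c * g x)" if "R f g" for c f g
    proof -
      have "(\<lambda>x. c * f x) \<in> L12" using that unfolding R_def by (intro L12_cmult) auto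
      then show ?thesis using that strichartz_L2_cmult[of g _ c] unfolding R_def by (simp add: strichartz_cmult mult.left_commute)
    qed
  qed
  then obtain T where T: "bounded_Lp_operator p lborel q lborel T" and TR: "\<And>f g. R f g \<Longrightarrow> AE x in lborel. T f x = g x"
    by blast
  have "is_multiplier_image m f (T f)" if f: "f \<in> schwartz" for f :: "'n heis \<Rightarrow> complex"
  proof -
    have fL: "f \<in> L12" by (rule schwartz_L12[OF f])
    obtain g where g: "R f g" using Rex[OF fL] by blast
    have "f \<in> Lp p lborel" using assms fL by (auto simp: Lp_iff[OF p0] L12_measurable intro!: L12_Lpow_finite[simplified])
    then have "T f \<in> Lp q lborel" using T unfolding bounded_Lp_operator_def by blast
    then have "T f \<in> borel_measurable borel" by (simp add: Lp_iff[OF q0])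
    then have "strichartz_L2 (T f) (\<lambda>y. m (fst y) * strichartz f y)"
      using g TR[OF g] unfolding R_def by (blast intro: strichartz_L2_cong_AE)
    then show ?thesis unfolding is_multiplier_image_def
      by (intro exI[of _ "\<lambda>y. m (fst y) * strichartz f y"]) (auto simp: split_beta')
  qed
  then show ?thesis using T by blast
qed

end
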